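(* Let $A=\mathbb{C}Q/\mathcal{I}$ be a finite-dimensional complex bound quiver algebra, equipped with a fixed embedding system, and let $\mathcal{R}(A)$ be its integral coefficient ring. The following statements are equivalent: (1) $\mathrm{gl.dim}\,A<\infty$; (2) $\sup_{v\in Q_0}\deg_x\Phi(P^\bullet_{S_v};x)<\infty$; (3) the embedded total projective integral profile $\Phi^{\mathrm{emb}}(P^\bullet_{\mathrm{top}(A)};x)$ lies in $\mathcal{R}(A)[x]$; (4) $\sup_{v\in Q_0}\deg_x\Phi(I_\bullet^{S_v};x)<\infty$; (5) the embedded total injective integral profile $\Phi^{\mathrm{emb}}(I_\bullet^{\mathrm{top}(A)};x)$ lies in $\mathcal{R}(A)[x]$.
   Context: $Q$ is a finite quiver, $\mathcal{I}$ an admissible ideal, $S_v$ the simple left $A$-module at the vertex $v\in Q_0$, $\mathrm{top}(A)=A/\mathrm{rad}(A)\cong\bigoplus_{v}S_v$. Fix a basis $\{a_1,\dots,a_d\}$ of $A$. For a finite-dimensional left $A$-module $M$ let $\rho_M:A\to\mathrm{End}_{\mathbb{C}}(M)$ be the structure map. For $t\in(\mathbb{R}_{\ge0})^d$, $I_A(t)=\{\sum_i\lambda_ia_i:0\le\lambda_i\le t_i\}\cong\prod_i[0,t_i]$ carries the transported $d$-dimensional Lebesgue measure $\mu_t$. The integral profile of $M$ is the map $\Phi_M:(\mathbb{R}_{\ge0})^d\to\mathrm{End}_{\mathbb{C}}(M)$, $\Phi_M(t)=\int_{I_A(t)}\rho_M(x)\,d\mu_t(x)$ (Bochner integral). Let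 $\mathcal{C}_A=\mathrm{add}(\mathrm{proj}\cup\mathrm{inj})$ be the category of finite direct sums of finite-dimensional projective and injective left $A$-modules, and $\Pi=\bigoplus_{v\in Q_0}(P(v)\oplus I(v))$ with $P(v),I(v)$ the indecomposable projective and injective modules at $v$. A fixed embedding system is a choice, for every $M\in\mathcal{C}_A$, of a left $A$-module $M'$ and an $A$-isomorphism $\sigma_M:\Pi^{\oplus\mathbb{N}}\to M\oplus M'$. For $f:(\mathbb{R}_{\ge0})^d\to\mathrm{End}_{\mathbb{C}}(M)$ put $\mathrm{Emb}_M(f)(t)=\sigma_M^{-1}\circ\iota_M\circ f(t)\circ\pi_M\circ\sigma_M$, with $\pi_M,\iota_M$ the canonical projection $M\oplus M'\to M$ and inclusion $M\to M\oplus M'$. The integral coefficient ring $\mathcal{R}(A)$ is the complex subalgebra of $\mathrm{Map}((\mathbb{R}_{\ge0})^d,\mathrm{End}_{\mathbb{C}}(\Pi^{\oplus\mathbb{N}}))$ (pointwise operations) generated by all $\mathrm{Emb}_M(\Phi_M)$, $M\in\mathcal{C}_A$. $\mathcal{R}(A)[x]\subseteq\mathcal{R}(A)[[x]]$ are the polynomials and formal power series with coefficients in $\mathcal{R}(A)$. For a finite-dimensional left module $M$ with minimal projective resolution $\cdots\to P_M^1\to P_M^0\to M\to0$ and minimal injective coresolution $0\to M\to I_0^M\to I_1^M\to\cdots$, the total profiles are the formal series $\Phi(P_M^\bullet;x)=\sum_{n\ge0}\Phi_{P_M^n}x^n$ and $\Phi(I^M_\bullet;x)=\sum_{n\ge0}\Phi_{I^M_n}x^n$,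 and the embedded total profiles are $\Phi^{\mathrm{emb}}(P_M^\bullet;x)=\sum_{n\ge0}\mathrm{Emb}_{P_M^n}(\Phi_{P_M^n})x^n$ and $\Phi^{\mathrm{emb}}(I^M_\bullet;x)=\sum_{n\ge0}\mathrm{Emb}_{I^M_n}(\Phi_{I^M_n})x^n$, in $\mathcal{R}(A)[[x]]$. The degree $\deg_x$ is the largest $n$ with nonzero coefficient of $x^n$, and $\infty$ if the series is not a polynomial. *)

theory Defs
  imports
    "HOL-Analysis.Analysis"
    "HOL-Library.Extended_Nat"
    "HOL-Algebra.QuotRing"
    "HOL-Algebra.Ideal_Product"
    "HOL-Algebra.UnivPoly"
    "Graph_Theory.Arc_Walk"
begin

section \<open>Bound quiver algebras\<close>

text \<open>
  A finite quiver is a \<^term>\<open>fin_digraph\<close> (loops and multiple arcs are allowed). A path is a pair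
  of its start vertex and its list of arcs, so \<open>(v, [])\<close> is the trivial path at \<open>v\<close>. Complex
  algebras and complex vector spaces are records of type \<open>(complex, _) module\<close>; for a vector space
  or a module the fields \<open>mult\<close> and \<open>one\<close> of the record carry no information.
\<close>

type_synonym ('v, 'e) path = "'v \<times> 'e list"

definition paths :: "('v, 'e) pre_digraph \<Rightarrow> ('v, 'e) path set" where
  "paths Q = {(u, p). \<exists>v. pre_digraph.awalk Q u p v}"

definition path_elt :: "('v, 'e) path \<Rightarrow> ('v, 'e) path \<Rightarrow> complex" where
  "path_elt p = (\<lambda>q. if q = p then 1 else 0)"

text \<open>
  The product of two paths is their concatenation, the left factor being travelled first. For the
  coefficient of \<open>f g\<close> at a path, one sums over all ways of cutting this path into two.
\<close>

definition path_algebra ::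
    "('v, 'e) pre_digraph \<Rightarrow> (complex, ('v, 'e) path \<Rightarrow> complex) module" where
  "path_algebra Q =
    \<lparr>carrier = {f. finite {p. f p \<noteq> 0} \<and> {p. f p \<noteq> 0} \<subseteq> paths Q},
     mult = (\<lambda>f g (u, p). \<Sum>i\<le>length p.
               f (u, take i p) * g (last (pre_digraph.awalk_verts Q u (take i p)), drop i p)),
     one = (\<lambda>(u, p). if u \<in> verts Q \<and> p = [] then 1 else 0),
     zero = (\<lambda>p. 0),
     add = (\<lambda>f g p. f p + g p),
     smult = (\<lambda>c f p. c * f p)\<rparr>"

definition arrow_ideal :: "('v, 'e) pre_digraph \<Rightarrow> (('v, 'e) path \<Rightarrow> complex) set" where
  "arrow_ideal Q = genideal (path_algebra Q) {path_elt (tail Q e, [e]) | e. e \<in> arcs Q}"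

primrec arrow_ideal_power :: "('v, 'e) pre_digraph \<Rightarrow> nat \<Rightarrow> (('v, 'e) path \<Rightarrow> complex) set" where
  "arrow_ideal_power Q 0 = carrier (path_algebra Q)"
| "arrow_ideal_power Q (Suc n) =
     ideal_prod (path_algebra Q) (arrow_ideal_power Q n) (arrow_ideal Q)"

definition admissible_ideal ::
    "('v, 'e) pre_digraph \<Rightarrow> (('v, 'e) path \<Rightarrow> complex) set \<Rightarrow> bool" where
  "admissible_ideal Q I \<longleftrightarrow> ideal I (path_algebra Q) \<and> I \<subseteq> arrow_ideal_power Q 2 \<and>
     (\<exists>m\<ge>2. arrow_ideal_power Q m \<subseteq> I)"

type_synonym ('v, 'e) bq_elt = "(('v, 'e) path \<Rightarrow> complex) set"

definition bound_quiver_algebra ::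
    "('v, 'e) pre_digraph \<Rightarrow> (('v, 'e) path \<Rightarrow> complex) set \<Rightarrow> (complex, ('v, 'e) bq_elt) module"
  where
  "bound_quiver_algebra Q I =
     ring.extend (path_algebra Q Quot I)
       (module.fields (\<lambda>c X. \<Union>f\<in>X. I +>\<^bsub>path_algebra Q\<^esub> (c \<odot>\<^bsub>path_algebra Q\<^esub> f)))"

definition vertex_idem ::
    "('v, 'e) pre_digraph \<Rightarrow> (('v, 'e) path \<Rightarrow> complex) set \<Rightarrow> 'v \<Rightarrow> ('v, 'e) bq_elt" where
  "vertex_idem Q I v = I +>\<^bsub>path_algebra Q\<^esub> path_elt (v, [])"

section \<open>Left modules over a (noncommutative) ring\<close>

locale left_module = R?: ring R + M?: abelian_group M
  for R :: "('a, 'r) ring_scheme" (structure) and M :: "('a, 'm) module" (structure) +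
  assumes smult_closed: "\<lbrakk>a \<in> carrier R; x \<in> carrier M\<rbrakk> \<Longrightarrow> a \<odot>\<^bsub>M\<^esub> x \<in> carrier M"
    and smult_l_distr: "\<lbrakk>a \<in> carrier R; b \<in> carrier R; x \<in> carrier M\<rbrakk> \<Longrightarrow>
      (a \<oplus>\<^bsub>R\<^esub> b) \<odot>\<^bsub>M\<^esub> x = a \<odot>\<^bsub>M\<^esub> x \<oplus>\<^bsub>M\<^esub> b \<odot>\<^bsub>M\<^esub> x"
    and smult_r_distr: "\<lbrakk>a \<in> carrier R; x \<in> carrier M; y \<in> carrier M\<rbrakk> \<Longrightarrow>
      a \<odot>\<^bsub>M\<^esub> (x \<oplus>\<^bsub>M\<^esub> y) = a \<odot>\<^bsub>M\<^esub> x \<oplus>\<^bsub>M\<^esub> a \<odot>\<^bsub>M\<^esub> y"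
    and smult_assoc: "\<lbrakk>a \<in> carrier R; b \<in> carrier R; x \<in> carrier M\<rbrakk> \<Longrightarrow>
      (a \<otimes>\<^bsub>R\<^esub> b) \<odot>\<^bsub>M\<^esub> x = a \<odot>\<^bsub>M\<^esub> (b \<odot>\<^bsub>M\<^esub> x)"
    and smult_one: "x \<in> carrier M \<Longrightarrow> \<one>\<^bsub>R\<^esub> \<odot>\<^bsub>M\<^esub> x = x"

definition lmod_hom ::
    "('a, 'r) ring_scheme \<Rightarrow> ('a, 'm) module \<Rightarrow> ('a, 'n) module \<Rightarrow> ('m \<Rightarrow> 'n) set" where
  "lmod_hom R M N = {f \<in> carrier M \<rightarrow> carrier N.
     (\<forall>x\<in>carrier M. \<forall>y\<in>carrier M. f (x \<oplus>\<^bsub>M\<^esub> y) = f x \<oplus>\<^bsub>N\<^esub> f y) \<and>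
     (\<forall>a\<in>carrier R. \<forall>x\<in>carrier M. f (a \<odot>\<^bsub>M\<^esub> x) = a \<odot>\<^bsub>N\<^esub> f x)}"

definition lmod_iso ::
    "('a, 'r) ring_scheme \<Rightarrow> ('a, 'm) module \<Rightarrow> ('a, 'n) module \<Rightarrow> ('m \<Rightarrow> 'n) set" where
  "lmod_iso R M N = {f \<in> lmod_hom R M N. bij_betw f (carrier M) (carrier N)}"

definition lmod_prod :: "('a, 'm) module \<Rightarrow> ('a, 'n) module \<Rightarrow> ('a, 'm \<times> 'n) module" where
  "lmod_prod M N =
    \<lparr>carrier = carrier M \<times> carrier N, mult = undefined, one = undefined,
     zero = (\<zero>\<^bsub>M\<^esub>, \<zero>\<^bsub>N\<^esub>),
     add = (\<lambda>(x, y) (x', y'). (x \<oplus>\<^bsub>M\<^esub> x', y \<oplus>\<^bsub>N\<^esub> y')),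
     smult = (\<lambda>a (x, y). (a \<odot>\<^bsub>M\<^esub> x, a \<odot>\<^bsub>N\<^esub> y))\<rparr>"

definition lmod_dsum :: "'i set \<Rightarrow> ('i \<Rightarrow> ('a, 'm) module) \<Rightarrow> ('a, 'i \<Rightarrow> 'm) module" where
  "lmod_dsum J N =
    \<lparr>carrier = {f \<in> (\<Pi>\<^sub>E i\<in>J. carrier (N i)). finite {i \<in> J. f i \<noteq> \<zero>\<^bsub>N i\<^esub>}},
     mult = undefined, one = undefined,
     zero = (\<lambda>i\<in>J. \<zero>\<^bsub>N i\<^esub>),
     add = (\<lambda>f g. \<lambda>i\<in>J. f i \<oplus>\<^bsub>N i\<^esub> g i),
     smult = (\<lambda>a f. \<lambda>i\<in>J. a \<odot>\<^bsub>N i\<^esub> f i)\<rparr>"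

definition regular_module :: "('a, 'r) ring_scheme \<Rightarrow> ('a, 'a) module" where
  "regular_module R =
    \<lparr>carrier = carrier R, mult = mult R, one = one R, zero = zero R, add = add R, smult = mult R\<rparr>"

definition lmod_quot :: "('a, 'm) module \<Rightarrow> 'm set \<Rightarrow> ('a, 'm set) module" where
  "lmod_quot M U =
    \<lparr>carrier = a_rcosets\<^bsub>M\<^esub> U, mult = undefined, one = undefined,
     zero = U, add = set_add M, smult = (\<lambda>a X. \<Union>x\<in>X. U +>\<^bsub>M\<^esub> (a \<odot>\<^bsub>M\<^esub> x))\<rparr>"

definition maximal_left_ideal :: "'a set \<Rightarrow> ('a, 'r) ring_scheme \<Rightarrow> bool" where
  "maximal_left_ideal J R \<longleftrightarrow> submodule J R (regular_module R) \<and> J \<noteq> carrier R \<and>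
     (\<forall>K. submodule K R (regular_module R) \<and> J \<subseteq> K \<longrightarrow> K = J \<or> K = carrier R)"

definition jacobson_radical :: "('a, 'r) ring_scheme \<Rightarrow> 'a set" where
  "jacobson_radical R = {x \<in> carrier R. \<forall>J. maximal_left_ideal J R \<longrightarrow> x \<in> J}"

definition top_module :: "('a, 'r) ring_scheme \<Rightarrow> ('a, 'a set) module" where
  "top_module R = lmod_quot (regular_module R) (jacobson_radical R)"

definition essential ::
    "('a, 'r) ring_scheme \<Rightarrow> ('a, 'm) module \<Rightarrow> 'm set \<Rightarrow> bool" where
  "essential R M U \<longleftrightarrow> submodule U R M \<and>
     (\<forall>V. submodule V R M \<and> U \<inter> V = {\<zero>\<^bsub>M\<^esub>} \<longrightarrow> V = {\<zero>\<^bsub>M\<^esub>})"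

definition superfluous ::
    "('a, 'r) ring_scheme \<Rightarrow> ('a, 'm) module \<Rightarrow> 'm set \<Rightarrow> bool" where
  "superfluous R M U \<longleftrightarrow> submodule U R M \<and>
     (\<forall>V. submodule V R M \<and> U <+>\<^bsub>M\<^esub> V = carrier M \<longrightarrow> V = carrier M)"

text \<open>
  HOL cannot quantify over modules with carriers in all types. In the following notions the test
  modules (for projectivity and injectivity), the terms of resolutions and the modules over which
  the global dimension is taken have their elements in one type \<open>'u\<close>. They agree with the usual
  notions as soon as \<open>'u\<close> is at least as large as the ring and as \<open>complex\<close>: the free modules and
  injective hulls that are needed then have copies inside \<open>'u\<close>.
\<close>

definition projective_module :: "('a, 'r) ring_scheme \<Rightarrow> ('a, 'u) module \<Rightarrow> bool" where
  "projective_module R P \<longleftrightarrow> left_module R P \<and>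
     (\<forall>(M :: ('a, 'u) module) (N :: ('a, 'u) module) p g.
        left_module R M \<and> left_module R N \<and> p \<in> lmod_hom R M N \<and> p ` carrier M = carrier N \<and>
        g \<in> lmod_hom R P N \<longrightarrow> (\<exists>h\<in>lmod_hom R P M. \<forall>x\<in>carrier P. p (h x) = g x))"

definition injective_module :: "('a, 'r) ring_scheme \<Rightarrow> ('a, 'u) module \<Rightarrow> bool" where
  "injective_module R E \<longleftrightarrow> left_module R E \<and>
     (\<forall>(M :: ('a, 'u) module) (N :: ('a, 'u) module) i g.
        left_module R M \<and> left_module R N \<and> i \<in> lmod_hom R N M \<and> inj_on i (carrier N) \<and>
        g \<in> lmod_hom R N E \<longrightarrow> (\<exists>h\<in>lmod_hom R M E. \<forall>x\<in>carrier N. h (i x) = g x))"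

text \<open>Projective resolution \<open>\<dots> \<rightarrow> P 1 \<rightarrow> P 0 \<rightarrow> M \<rightarrow> 0\<close> with differentials
  \<open>D n : P (n + 1) \<rightarrow> P n\<close> and augmentation \<open>\<epsilon>\<close>.\<close>

definition projective_resolution ::
    "('a, 'r) ring_scheme \<Rightarrow> ('a, 'm) module \<Rightarrow> (nat \<Rightarrow> ('a, 'u) module) \<Rightarrow> ('u \<Rightarrow> 'm) \<Rightarrow>
     (nat \<Rightarrow> 'u \<Rightarrow> 'u) \<Rightarrow> bool" where
  "projective_resolution R M P \<epsilon> D \<longleftrightarrow>
     (\<forall>n. projective_module R (P n)) \<and>
     \<epsilon> \<in> lmod_hom R (P 0) M \<and> (\<forall>n. D n \<in> lmod_hom R (P (Suc n)) (P n)) \<and>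
     \<epsilon> ` carrier (P 0) = carrier M \<and>
     D 0 ` carrier (P (Suc 0)) = a_kernel (P 0) M \<epsilon> \<and>
     (\<forall>n. D (Suc n) ` carrier (P (Suc (Suc n))) = a_kernel (P (Suc n)) (P n) (D n))"

definition injective_coresolution ::
    "('a, 'r) ring_scheme \<Rightarrow> ('a, 'm) module \<Rightarrow> (nat \<Rightarrow> ('a, 'u) module) \<Rightarrow> ('m \<Rightarrow> 'u) \<Rightarrow>
     (nat \<Rightarrow> 'u \<Rightarrow> 'u) \<Rightarrow> bool" where
  "injective_coresolution R M E \<eta> \<delta> \<longleftrightarrow>
     (\<forall>n. injective_module R (E n)) \<and>
     \<eta> \<in> lmod_hom R M (E 0) \<and> (\<forall>n. \<delta> n \<in> lmod_hom R (E n) (E (Suc n))) \<and>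
     inj_on \<eta> (carrier M) \<and>
     \<eta> ` carrier M = a_kernel (E 0) (E (Suc 0)) (\<delta> 0) \<and>
     (\<forall>n. \<delta> n ` carrier (E n) = a_kernel (E (Suc n)) (E (Suc (Suc n))) (\<delta> (Suc n)))"

definition proj_dim :: "('a, 'r) ring_scheme \<Rightarrow> ('a, 'u) module \<Rightarrow> enat" where
  "proj_dim R M = Inf {enat n | n. \<exists>(P :: nat \<Rightarrow> ('a, 'u) module) \<epsilon> D.
     projective_resolution R M P \<epsilon> D \<and> (\<forall>k>n. carrier (P k) = {\<zero>\<^bsub>P k\<^esub>})}"

definition gl_dim :: "'u itself \<Rightarrow> ('a, 'r) ring_scheme \<Rightarrow> enat" where
  "gl_dim U R = (SUP M\<in>{M :: ('a, 'u) module. left_module R M}. proj_dim R M)"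

section \<open>Left modules over a complex algebra\<close>

definition cscale :: "(complex, 'a) module \<Rightarrow> ('a, 'm) module \<Rightarrow> complex \<Rightarrow> 'm \<Rightarrow> 'm" where
  "cscale A M c x = (c \<odot>\<^bsub>A\<^esub> \<one>\<^bsub>A\<^esub>) \<odot>\<^bsub>M\<^esub> x"

definition finite_dim_module :: "(complex, 'a) module \<Rightarrow> ('a, 'm) module \<Rightarrow> bool" where
  "finite_dim_module A M \<longleftrightarrow> left_module A M \<and>
     (\<exists>B. finite B \<and> B \<subseteq> carrier M \<and>
       (\<forall>x\<in>carrier M. \<exists>c :: 'm \<Rightarrow> complex. x = (\<Oplus>\<^bsub>M\<^esub>b\<in>B. cscale A M (c b) b)))"

definition End_C ::
    "(complex, 'a) module \<Rightarrow> ('a, 'm) module \<Rightarrow> (complex, 'm \<Rightarrow> 'm) module" where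
  "End_C A M =
    \<lparr>carrier = {f \<in> carrier M \<rightarrow>\<^sub>E carrier M.
       (\<forall>x\<in>carrier M. \<forall>y\<in>carrier M. f (x \<oplus>\<^bsub>M\<^esub> y) = f x \<oplus>\<^bsub>M\<^esub> f y) \<and>
       (\<forall>c. \<forall>x\<in>carrier M. f (cscale A M c x) = cscale A M c (f x))},
     mult = (\<lambda>f g. \<lambda>x\<in>carrier M. f (g x)),
     one = (\<lambda>x\<in>carrier M. x),
     zero = (\<lambda>x\<in>carrier M. \<zero>\<^bsub>M\<^esub>),
     add = (\<lambda>f g. \<lambda>x\<in>carrier M. f x \<oplus>\<^bsub>M\<^esub> g x),
     smult = (\<lambda>c f. \<lambda>x\<in>carrier M. cscale A M c (f x))\<rparr>"

definition structure_map :: "('a, 'm) module \<Rightarrow> 'a \<Rightarrow> 'm \<Rightarrow> 'm" where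
  "structure_map M a = (\<lambda>x\<in>carrier M. a \<odot>\<^bsub>M\<^esub> x)"

text \<open>The minimal resolutions are taken in the category of finite-dimensional modules: each term is
  a projective cover (injective envelope) of the next syzygy (cosyzygy).\<close>

definition minimal_projective_resolution ::
    "(complex, 'a) module \<Rightarrow> ('a, 'm) module \<Rightarrow> (nat \<Rightarrow> ('a, 'u) module) \<Rightarrow> ('u \<Rightarrow> 'm) \<Rightarrow>
     (nat \<Rightarrow> 'u \<Rightarrow> 'u) \<Rightarrow> bool" where
  "minimal_projective_resolution A M P \<epsilon> D \<longleftrightarrow>
     projective_resolution A M P \<epsilon> D \<and> (\<forall>n. finite_dim_module A (P n)) \<and>
     superfluous A (P 0) (a_kernel (P 0) M \<epsilon>) \<and>
     (\<forall>n. superfluous A (P (Suc n)) (a_kernel (P (Suc n)) (P n) (D n)))"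

definition minimal_injective_coresolution ::
    "(complex, 'a) module \<Rightarrow> ('a, 'm) module \<Rightarrow> (nat \<Rightarrow> ('a, 'u) module) \<Rightarrow> ('m \<Rightarrow> 'u) \<Rightarrow>
     (nat \<Rightarrow> 'u \<Rightarrow> 'u) \<Rightarrow> bool" where
  "minimal_injective_coresolution A M E \<eta> \<delta> \<longleftrightarrow>
     injective_coresolution A M E \<eta> \<delta> \<and> (\<forall>n. finite_dim_module A (E n)) \<and>
     essential A (E 0) (\<eta> ` carrier M) \<and>
     (\<forall>n. essential A (E (Suc n)) (\<delta> n ` carrier (E n)))"

definition proj_inj_category :: "(complex, 'a) module \<Rightarrow> ('a, 'u) module set" where
  "proj_inj_category A = {M. finite_dim_module A M \<and>
     (\<exists>k (N :: nat \<Rightarrow> ('a, 'u) module).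
        (\<forall>i<k. finite_dim_module A (N i) \<and> (projective_module A (N i) \<or> injective_module A (N i))) \<and>
        lmod_iso A M (lmod_dsum {..<k} N) \<noteq> {})}"

section \<open>The standard modules of a bound quiver algebra\<close>

text \<open>The simple module at \<open>v\<close> is \<open>\<complex>\<close>, on which a residue class acts by the coefficient of the trivial
  path at \<open>v\<close>; this coefficient does not depend on the representative because an admissible ideal
  lies in the square of the arrow ideal.\<close>

definition simple_module :: "'v \<Rightarrow> (('v, 'e) bq_elt, complex) module" where
  "simple_module v =
    \<lparr>carrier = UNIV, mult = undefined, one = undefined, zero = 0, add = (+),
     smult = (\<lambda>X z. (THE c. \<forall>f\<in>X. f (v, []) = c) * z)\<rparr>"

text \<open>\<open>P(v) = A e\<^sub>v\<close> and \<open>I(v) = Hom\<^sub>\<complex>(e\<^sub>v A, \<complex>)\<close> with \<open>(a \<phi>)(x) = \<phi>(x a)\<close>.\<close>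

definition indec_projective ::
    "('v, 'e) pre_digraph \<Rightarrow> (('v, 'e) path \<Rightarrow> complex) set \<Rightarrow> 'v \<Rightarrow>
     (('v, 'e) bq_elt, ('v, 'e) bq_elt) module" where
  "indec_projective Q I v = (let A = bound_quiver_algebra Q I in
    \<lparr>carrier = {x \<otimes>\<^bsub>A\<^esub> vertex_idem Q I v | x. x \<in> carrier A}, mult = undefined, one = undefined,
     zero = \<zero>\<^bsub>A\<^esub>, add = add A, smult = mult A\<rparr>)"

definition indec_injective ::
    "('v, 'e) pre_digraph \<Rightarrow> (('v, 'e) path \<Rightarrow> complex) set \<Rightarrow> 'v \<Rightarrow>
     (('v, 'e) bq_elt, ('v, 'e) bq_elt \<Rightarrow> complex) module" where
  "indec_injective Q I v = (let A = bound_quiver_algebra Q I;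
      eA = {vertex_idem Q I v \<otimes>\<^bsub>A\<^esub> x | x. x \<in> carrier A} in
    \<lparr>carrier = {\<phi> \<in> extensional eA. (\<forall>x\<in>eA. \<forall>y\<in>eA. \<phi> (x \<oplus>\<^bsub>A\<^esub> y) = \<phi> x + \<phi> y) \<and>
        (\<forall>c. \<forall>x\<in>eA. \<phi> (c \<odot>\<^bsub>A\<^esub> x) = c * \<phi> x)},
     mult = undefined, one = undefined,
     zero = (\<lambda>x\<in>eA. 0), add = (\<lambda>\<phi> \<psi>. \<lambda>x\<in>eA. \<phi> x + \<psi> x),
     smult = (\<lambda>a \<phi>. \<lambda>x\<in>eA. \<phi> (x \<otimes>\<^bsub>A\<^esub> a))\<rparr>)"

type_synonym ('v, 'e) Pi_elt = "nat \<Rightarrow> 'v \<Rightarrow> ('v, 'e) bq_elt \<times> (('v, 'e) bq_elt \<Rightarrow> complex)"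

text \<open>The countable direct sum \<open>\<Pi>\<^bsup>\<oplus>\<nat>\<^esup>\<close> of copies of \<open>\<Pi> = \<Oplus>\<^sub>v (P(v) \<oplus> I(v))\<close>.\<close>

definition Pi_module ::
    "('v, 'e) pre_digraph \<Rightarrow> (('v, 'e) path \<Rightarrow> complex) set \<Rightarrow>
     (('v, 'e) bq_elt, 'v \<Rightarrow> ('v, 'e) bq_elt \<times> (('v, 'e) bq_elt \<Rightarrow> complex)) module" where
  "Pi_module Q I =
     lmod_dsum (verts Q) (\<lambda>v. lmod_prod (indec_projective Q I v) (indec_injective Q I v))"

definition Pi_N ::
    "('v, 'e) pre_digraph \<Rightarrow> (('v, 'e) path \<Rightarrow> complex) set \<Rightarrow>
     (('v, 'e) bq_elt, ('v, 'e) Pi_elt) module" where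
  "Pi_N Q I = lmod_dsum UNIV (\<lambda>_. Pi_module Q I)"

section \<open>Bochner integrals in complex vector spaces\<close>

text \<open>
  The library's Bochner integral takes values in a Banach type, whereas the spaces \<open>End\<^sub>\<complex>(M)\<close> are
  carrier sets depending on \<open>M\<close>. So the textbook definition is repeated for functions with values in a
  vector space \<open>V\<close> given by a carrier: approximation by integrable simple functions, almost everywhere
  and in mean. It is only used for finite-dimensional \<open>V\<close>, where all norms are equivalent, so that
  quantifying over all norms is the same as fixing one.
\<close>

definition norm_on :: "(complex, 'b) module \<Rightarrow> ('b \<Rightarrow> real) \<Rightarrow> bool" where
  "norm_on V \<nu> \<longleftrightarrow>
     (\<forall>x\<in>carrier V. 0 \<le> \<nu> x \<and> (\<nu> x = 0 \<longleftrightarrow> x = \<zero>\<^bsub>V\<^esub>)) \<and>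
     (\<forall>x\<in>carrier V. \<forall>y\<in>carrier V. \<nu> (x \<oplus>\<^bsub>V\<^esub> y) \<le> \<nu> x + \<nu> y) \<and>
     (\<forall>c. \<forall>x\<in>carrier V. \<nu> (c \<odot>\<^bsub>V\<^esub> x) = cmod c * \<nu> x)"

definition simple_integrable_in ::
    "(complex, 'b) module \<Rightarrow> 'x measure \<Rightarrow> ('x \<Rightarrow> 'b) \<Rightarrow> bool" where
  "simple_integrable_in V \<mu> s \<longleftrightarrow> s \<in> space \<mu> \<rightarrow> carrier V \<and> simple_function \<mu> s \<and>
     emeasure \<mu> {x \<in> space \<mu>. s x \<noteq> \<zero>\<^bsub>V\<^esub>} \<noteq> \<infinity>"

definition simple_integral_in :: "(complex, 'b) module \<Rightarrow> 'x measure \<Rightarrow> ('x \<Rightarrow> 'b) \<Rightarrow> 'b" where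
  "simple_integral_in V \<mu> s =
     (\<Oplus>\<^bsub>V\<^esub>y\<in>s ` space \<mu>. complex_of_real (measure \<mu> {x \<in> space \<mu>. s x = y}) \<odot>\<^bsub>V\<^esub> y)"

definition has_bochner_integral_in ::
    "(complex, 'b) module \<Rightarrow> 'x measure \<Rightarrow> ('x \<Rightarrow> 'b) \<Rightarrow> 'b \<Rightarrow> bool" where
  "has_bochner_integral_in V \<mu> f T \<longleftrightarrow> f \<in> space \<mu> \<rightarrow> carrier V \<and> T \<in> carrier V \<and>
     (\<forall>\<nu>. norm_on V \<nu> \<longrightarrow> (\<exists>s :: nat \<Rightarrow> 'x \<Rightarrow> 'b.
        (\<forall>k. simple_integrable_in V \<mu> (s k)) \<and>
        (AE x in \<mu>. (\<lambda>k. \<nu> (f x \<ominus>\<^bsub>V\<^esub> s k x)) \<longlonglongrightarrow> 0) \<and>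
        (\<lambda>k. \<integral>\<^sup>+x. ennreal (\<nu> (f x \<ominus>\<^bsub>V\<^esub> s k x)) \<partial>\<mu>) \<longlonglongrightarrow> 0 \<and>
        (\<lambda>k. \<nu> (simple_integral_in V \<mu> (s k) \<ominus>\<^bsub>V\<^esub> T)) \<longlonglongrightarrow> 0))"

definition bochner_integral_in ::
    "(complex, 'b) module \<Rightarrow> 'x measure \<Rightarrow> ('x \<Rightarrow> 'b) \<Rightarrow> 'b" where
  "bochner_integral_in V \<mu> f = (THE T. has_bochner_integral_in V \<mu> f T)"

section \<open>Integral profiles\<close>

definition is_basis :: "(complex, 'a) module \<Rightarrow> nat \<Rightarrow> (nat \<Rightarrow> 'a) \<Rightarrow> bool" where
  "is_basis A d a \<longleftrightarrow> (\<forall>i<d. a i \<in> carrier A) \<and>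
     (\<forall>x\<in>carrier A. \<exists>!c :: nat \<Rightarrow> complex.
        c \<in> extensional {..<d} \<and> x = (\<Oplus>\<^bsub>A\<^esub>i\<in>{..<d}. c i \<odot>\<^bsub>A\<^esub> a i))"

definition orthant :: "nat \<Rightarrow> (nat \<Rightarrow> real) set" where
  "orthant d = ({..<d} \<rightarrow>\<^sub>E {0..})"

text \<open>The measure \<open>\<mu>\<^sub>t\<close>; its space is the set \<open>I\<^sub>A(t)\<close>.\<close>

definition box_measure ::
    "(complex, 'a) module \<Rightarrow> nat \<Rightarrow> (nat \<Rightarrow> 'a) \<Rightarrow> (nat \<Rightarrow> real) \<Rightarrow> 'a measure" where
  "box_measure A d a t =
     embed_measure (\<Pi>\<^sub>M i\<in>{..<d}. restrict_space lborel {0..t i})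
       (\<lambda>l. \<Oplus>\<^bsub>A\<^esub>i\<in>{..<d}. complex_of_real (l i) \<odot>\<^bsub>A\<^esub> a i)"

definition integral_profile ::
    "(complex, 'a) module \<Rightarrow> nat \<Rightarrow> (nat \<Rightarrow> 'a) \<Rightarrow> ('a, 'm) module \<Rightarrow>
     (nat \<Rightarrow> real) \<Rightarrow> 'm \<Rightarrow> 'm" where
  "integral_profile A d a M = (\<lambda>t\<in>orthant d.
     bochner_integral_in (End_C A M) (box_measure A d a t) (structure_map M))"

definition map_algebra :: "'t set \<Rightarrow> (complex, 'b) module \<Rightarrow> (complex, 't \<Rightarrow> 'b) module" where
  "map_algebra T V =
    \<lparr>carrier = T \<rightarrow>\<^sub>E carrier V,
     mult = (\<lambda>f g. \<lambda>t\<in>T. f t \<otimes>\<^bsub>V\<^esub> g t), one = (\<lambda>t\<in>T. \<one>\<^bsub>V\<^esub>),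
     zero = (\<lambda>t\<in>T. \<zero>\<^bsub>V\<^esub>), add = (\<lambda>f g. \<lambda>t\<in>T. f t \<oplus>\<^bsub>V\<^esub> g t),
     smult = (\<lambda>c f. \<lambda>t\<in>T. c \<odot>\<^bsub>V\<^esub> f t)\<rparr>"

inductive_set generated_subalgebra :: "(complex, 'b) module \<Rightarrow> 'b set \<Rightarrow> 'b set"
  for B :: "(complex, 'b) module" and H :: "'b set" where
  incl: "h \<in> H \<Longrightarrow> h \<in> generated_subalgebra B H"
| one: "\<one>\<^bsub>B\<^esub> \<in> generated_subalgebra B H"
| add: "x \<in> generated_subalgebra B H \<Longrightarrow> y \<in> generated_subalgebra B H \<Longrightarrow>
    x \<oplus>\<^bsub>B\<^esub> y \<in> generated_subalgebra B H"
| mult: "x \<in> generated_subalgebra B H \<Longrightarrow> y \<in> generated_subalgebra B H \<Longrightarrow>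
    x \<otimes>\<^bsub>B\<^esub> y \<in> generated_subalgebra B H"
| scale: "x \<in> generated_subalgebra B H \<Longrightarrow> c \<odot>\<^bsub>B\<^esub> x \<in> generated_subalgebra B H"

text \<open>An embedding system assigns to \<open>M\<close> the complement \<open>C M\<close> (the module \<open>M'\<close>) and the isomorphism
  \<open>\<sigma> M\<close>.\<close>

definition embedding_system ::
    "('v, 'e) pre_digraph \<Rightarrow> (('v, 'e) path \<Rightarrow> complex) set \<Rightarrow>
     ((('v, 'e) bq_elt, 'u) module \<Rightarrow> (('v, 'e) bq_elt, 'u) module) \<Rightarrow>
     ((('v, 'e) bq_elt, 'u) module \<Rightarrow> ('v, 'e) Pi_elt \<Rightarrow> 'u \<times> 'u) \<Rightarrow> bool" where
  "embedding_system Q I C \<sigma> \<longleftrightarrow> (let A = bound_quiver_algebra Q I in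
     \<forall>M\<in>proj_inj_category A. left_module A (C M) \<and> \<sigma> M \<in> lmod_iso A (Pi_N Q I) (lmod_prod M (C M)))"

definition Emb ::
    "('v, 'e) pre_digraph \<Rightarrow> (('v, 'e) path \<Rightarrow> complex) set \<Rightarrow> nat \<Rightarrow>
     ((('v, 'e) bq_elt, 'u) module \<Rightarrow> (('v, 'e) bq_elt, 'u) module) \<Rightarrow>
     ((('v, 'e) bq_elt, 'u) module \<Rightarrow> ('v, 'e) Pi_elt \<Rightarrow> 'u \<times> 'u) \<Rightarrow>
     (('v, 'e) bq_elt, 'u) module \<Rightarrow> ((nat \<Rightarrow> real) \<Rightarrow> 'u \<Rightarrow> 'u) \<Rightarrow>
     (nat \<Rightarrow> real) \<Rightarrow> ('v, 'e) Pi_elt \<Rightarrow> ('v, 'e) Pi_elt" where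
  "Emb Q I d C \<sigma> M f = (\<lambda>t\<in>orthant d. \<lambda>x\<in>carrier (Pi_N Q I).
     inv_into (carrier (Pi_N Q I)) (\<sigma> M) (f t (fst (\<sigma> M x)), \<zero>\<^bsub>C M\<^esub>))"

definition coefficient_ring ::
    "('v, 'e) pre_digraph \<Rightarrow> (('v, 'e) path \<Rightarrow> complex) set \<Rightarrow> nat \<Rightarrow> (nat \<Rightarrow> ('v, 'e) bq_elt) \<Rightarrow>
     ((('v, 'e) bq_elt, 'u) module \<Rightarrow> (('v, 'e) bq_elt, 'u) module) \<Rightarrow>
     ((('v, 'e) bq_elt, 'u) module \<Rightarrow> ('v, 'e) Pi_elt \<Rightarrow> 'u \<times> 'u) \<Rightarrow>
     (complex, (nat \<Rightarrow> real) \<Rightarrow> ('v, 'e) Pi_elt \<Rightarrow> ('v, 'e) Pi_elt) module" where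
  "coefficient_ring Q I d a C \<sigma> = (let A = bound_quiver_algebra Q I;
      B = map_algebra (orthant d) (End_C A (Pi_N Q I)) in
    B\<lparr>carrier := generated_subalgebra B
        {Emb Q I d C \<sigma> M (integral_profile A d a M) | M. M \<in> proj_inj_category A}\<rparr>)"

text \<open>Formal series are identified with their coefficient sequences, as in \<^const>\<open>UP\<close>.\<close>

definition total_profile ::
    "(complex, 'a) module \<Rightarrow> nat \<Rightarrow> (nat \<Rightarrow> 'a) \<Rightarrow> (nat \<Rightarrow> ('a, 'm) module) \<Rightarrow>
     nat \<Rightarrow> (nat \<Rightarrow> real) \<Rightarrow> 'm \<Rightarrow> 'm" where
  "total_profile A d a X = (\<lambda>n. integral_profile A d a (X n))"

definition embedded_total_profile ::
    "('v, 'e) pre_digraph \<Rightarrow> (('v, 'e) path \<Rightarrow> complex) set \<Rightarrow> nat \<Rightarrow> (nat \<Rightarrow> ('v, 'e) bq_elt) \<Rightarrow>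
     ((('v, 'e) bq_elt, 'u) module \<Rightarrow> (('v, 'e) bq_elt, 'u) module) \<Rightarrow>
     ((('v, 'e) bq_elt, 'u) module \<Rightarrow> ('v, 'e) Pi_elt \<Rightarrow> 'u \<times> 'u) \<Rightarrow>
     (nat \<Rightarrow> (('v, 'e) bq_elt, 'u) module) \<Rightarrow>
     nat \<Rightarrow> (nat \<Rightarrow> real) \<Rightarrow> ('v, 'e) Pi_elt \<Rightarrow> ('v, 'e) Pi_elt" where
  "embedded_total_profile Q I d a C \<sigma> X =
     (\<lambda>n. Emb Q I d C \<sigma> (X n) (integral_profile (bound_quiver_algebra Q I) d a (X n)))"

text \<open>The \<open>n\<close>-th coefficient of \<open>total_profile A d a X\<close> lies in its own space of maps into
  \<open>End\<^sub>\<complex>(X n)\<close>, whose zero it is compared with. The supremum is \<open>\<infinity>\<close> for infinitely many nonzero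
  coefficients, and \<open>0\<close> for the zero series.\<close>

definition profile_degree ::
    "(complex, 'a) module \<Rightarrow> nat \<Rightarrow> (nat \<Rightarrow> 'a) \<Rightarrow> (nat \<Rightarrow> ('a, 'm) module) \<Rightarrow> enat" where
  "profile_degree A d a X =
     (SUP n\<in>{n. total_profile A d a X n \<noteq> \<zero>\<^bsub>map_algebra (orthant d) (End_C A (X n))\<^esub>}. enat n)"

end

theory Submission
  imports Defs
begin

text \<open>
  The integral profile \<open>\<Phi>\<^sub>M\<close> determines whether \<open>M\<close> vanishes: at \<open>t\<close> it is \<open>\<rho>\<^sub>M\<close> of the element
  \<open>vol \<cdot> \<Sum>\<^sub>i (t\<^sub>i / 2) a\<^sub>i\<close>, so \<open>\<Phi>\<^sub>M = 0\<close> forces every \<open>a\<^sub>i\<close>, and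
  with them \<open>1\<close>, to act as zero. Hence each of (2)--(5) says that
  the terms of the minimal resolutions in question vanish from some degree on.

  Let \<open>J\<close> be the image of the arrow ideal. It is nilpotent, it is the radical, and modulo \<open>J\<close> every module
  is semisimple. By dimension shifting, \<open>Ext\<close> from an \<open>N\<close>-th syzygy of \<open>X\<close> to \<open>Y\<close> agrees with \<open>Ext\<close> from \<open>X\<close>
  to an \<open>N\<close>-th cosyzygy of \<open>Y\<close>. If the global dimension is finite, the identity of a late syzygy of a
  minimal resolution extends to the projective term, and superfluousness makes the syzygy zero; dually for
  injectives. Conversely, if the resolutions of the simple modules (or of the top) terminate, then extension
  and lifting problems against them are solvable, and filtering an arbitrary module by powers of \<open>J\<close>
  solves them for all modules.
\<close>

section \<open>Modules and homomorphisms\<close>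

text \<open>No Ext group is ever formed. Its vanishing is expressed by two solvability conditions:
  extending a map from a submodule of a projective, and lifting a map through a quotient of an
  injective. Each makes sense for a single presentation; their equivalence makes vanishing
  independent of presentations and supplies the balance of Ext, by which statements about injective
  coresolutions meet a global dimension defined through projective resolutions. Everything has to
  take place in the one type \<open>'u\<close>, so quotients are realized on representatives, and
  free and coinduced modules are copied into \<open>'u\<close> by explicit codes. The integral sits
  in a space of endomorphisms that is only a carrier set; finitely many functionals separating its
  points reduce it to scalar integrals. The factor t_i/2 in the profile is the centre of the
  interval [0, t_i].\<close>

lemma left_moduleI:
  fixes R :: "('a, 'r) ring_scheme" and M :: "('a, 'm) module"
  assumes R: "ring R"
    and zero: "\<zero>\<^bsub>M\<^esub> \<in> carrier M"
    and add: "\<And>x y. \<lbrakk>x \<in> carrier M; y \<in> carrier M\<rbrakk> \<Longrightarrow> x \<oplus>\<^bsub>M\<^esub> y \<in> carrier M"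
    and assoc: "\<And>x y z. \<lbrakk>x \<in> carrier M; y \<in> carrier M; z \<in> carrier M\<rbrakk> \<Longrightarrow>
      (x \<oplus>\<^bsub>M\<^esub> y) \<oplus>\<^bsub>M\<^esub> z = x \<oplus>\<^bsub>M\<^esub> (y \<oplus>\<^bsub>M\<^esub> z)"
    and comm: "\<And>x y. \<lbrakk>x \<in> carrier M; y \<in> carrier M\<rbrakk> \<Longrightarrow> x \<oplus>\<^bsub>M\<^esub> y = y \<oplus>\<^bsub>M\<^esub> x"
    and l_zero: "\<And>x. x \<in> carrier M \<Longrightarrow> \<zero>\<^bsub>M\<^esub> \<oplus>\<^bsub>M\<^esub> x = x"
    and smult: "\<And>a x. \<lbrakk>a \<in> carrier R; x \<in> carrier M\<rbrakk> \<Longrightarrow> a \<odot>\<^bsub>M\<^esub> x \<in> carrier M"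
    and l_distr: "\<And>a b x. \<lbrakk>a \<in> carrier R; b \<in> carrier R; x \<in> carrier M\<rbrakk> \<Longrightarrow>
      (a \<oplus>\<^bsub>R\<^esub> b) \<odot>\<^bsub>M\<^esub> x = a \<odot>\<^bsub>M\<^esub> x \<oplus>\<^bsub>M\<^esub> b \<odot>\<^bsub>M\<^esub> x"
    and r_distr: "\<And>a x y. \<lbrakk>a \<in> carrier R; x \<in> carrier M; y \<in> carrier M\<rbrakk> \<Longrightarrow>
      a \<odot>\<^bsub>M\<^esub> (x \<oplus>\<^bsub>M\<^esub> y) = a \<odot>\<^bsub>M\<^esub> x \<oplus>\<^bsub>M\<^esub> a \<odot>\<^bsub>M\<^esub> y"
    and mult: "\<And>a b x. \<lbrakk>a \<in> carrier R; b \<in> carrier R; x \<in> carrier M\<rbrakk> \<Longrightarrow>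
      (a \<otimes>\<^bsub>R\<^esub> b) \<odot>\<^bsub>M\<^esub> x = a \<odot>\<^bsub>M\<^esub> (b \<odot>\<^bsub>M\<^esub> x)"
    and one: "\<And>x. x \<in> carrier M \<Longrightarrow> \<one>\<^bsub>R\<^esub> \<odot>\<^bsub>M\<^esub> x = x"
    and zero_smult: "\<And>x. x \<in> carrier M \<Longrightarrow> \<zero>\<^bsub>R\<^esub> \<odot>\<^bsub>M\<^esub> x = \<zero>\<^bsub>M\<^esub>"
  shows "left_module R M"
proof -
  interpret R: ring R by fact
  have "abelian_group M"
  proof (rule abelian_groupI)
    \<comment> \<open>The negative of \<open>x\<close> is (-1) x, because \<open>\<zero>\<close> is
      assumed to act as zero; hence no negatives are asked for.\<close>
    fix x assume x: "x \<in> carrier M"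
    have "(\<ominus>\<^bsub>R\<^esub> \<one>\<^bsub>R\<^esub>) \<odot>\<^bsub>M\<^esub> x \<oplus>\<^bsub>M\<^esub> x = (\<ominus>\<^bsub>R\<^esub> \<one>\<^bsub>R\<^esub> \<oplus>\<^bsub>R\<^esub> \<one>\<^bsub>R\<^esub>) \<odot>\<^bsub>M\<^esub> x"
      using x by (simp add: l_distr one)
    also have "\<dots> = \<zero>\<^bsub>M\<^esub>" using x by (simp add: R.l_neg zero_smult)
    finally show "\<exists>y\<in>carrier M. y \<oplus>\<^bsub>M\<^esub> x = \<zero>\<^bsub>M\<^esub>" using x smult[of "\<ominus>\<^bsub>R\<^esub> \<one>\<^bsub>R\<^esub>" x] by blast
  qed (use assms in auto)
  then show ?thesis
    unfolding left_module_def left_module_axioms_def using assms by blast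
qed

context abelian_group
begin

lemma minus_telescope: "\<lbrakk>x \<in> carrier G; y \<in> carrier G; z \<in> carrier G\<rbrakk> \<Longrightarrow> (x \<ominus> z) \<oplus> (z \<ominus> y) = x \<ominus> y"
  by (simp add: a_minus_def a_assoc r_neg1)

lemma uminus_minus: "\<lbrakk>x \<in> carrier G; y \<in> carrier G\<rbrakk> \<Longrightarrow> \<ominus> (x \<ominus> y) = y \<ominus> x"
  by (simp add: a_minus_def minus_add a_comm)

lemma minus_zero_right: "x \<in> carrier G \<Longrightarrow> x \<ominus> \<zero> = x"
  using minus_equality[of \<zero> \<zero>] by (simp add: a_minus_def)

lemma minus_eq_minus:
  assumes "x \<oplus> u = y \<oplus> v" "x \<in> carrier G" "u \<in> carrier G" "y \<in> carrier G" "v \<in> carrier G"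
  shows "u \<ominus> v = y \<ominus> x"
proof -
  have "u = \<ominus> x \<oplus> (y \<oplus> v)" using assms by (simp add: r_neg1 flip: assms(1))
  then show ?thesis using assms by (simp add: a_minus_def a_assoc r_neg a_comm[of "\<ominus> x" y])
qed

end

context left_module
begin

lemma smult_zero_l:
  assumes x: "x \<in> carrier M" shows "\<zero>\<^bsub>R\<^esub> \<odot>\<^bsub>M\<^esub> x = \<zero>\<^bsub>M\<^esub>"
proof -
  have "\<zero>\<^bsub>R\<^esub> \<odot>\<^bsub>M\<^esub> x \<oplus>\<^bsub>M\<^esub> \<zero>\<^bsub>R\<^esub> \<odot>\<^bsub>M\<^esub> x = \<zero>\<^bsub>R\<^esub> \<odot>\<^bsub>M\<^esub> x"
    using x smult_l_distr[of "\<zero>\<^bsub>R\<^esub>" "\<zero>\<^bsub>R\<^esub>" x] by simp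
  then show ?thesis using x smult_closed[of "\<zero>\<^bsub>R\<^esub>" x] by simp
qed

lemma smult_zero_r:
  assumes a: "a \<in> carrier R" shows "a \<odot>\<^bsub>M\<^esub> \<zero>\<^bsub>M\<^esub> = \<zero>\<^bsub>M\<^esub>"
proof -
  have "a \<odot>\<^bsub>M\<^esub> \<zero>\<^bsub>M\<^esub> \<oplus>\<^bsub>M\<^esub> a \<odot>\<^bsub>M\<^esub> \<zero>\<^bsub>M\<^esub> = a \<odot>\<^bsub>M\<^esub> \<zero>\<^bsub>M\<^esub>"
    using a smult_r_distr[of a "\<zero>\<^bsub>M\<^esub>" "\<zero>\<^bsub>M\<^esub>"] by simp
  then show ?thesis using a smult_closed[of a "\<zero>\<^bsub>M\<^esub>"] by simp
qed

lemma smult_neg_l: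
  assumes "a \<in> carrier R" "x \<in> carrier M"
  shows "(\<ominus>\<^bsub>R\<^esub> a) \<odot>\<^bsub>M\<^esub> x = \<ominus>\<^bsub>M\<^esub> (a \<odot>\<^bsub>M\<^esub> x)"
proof -
  have "(\<ominus>\<^bsub>R\<^esub> a) \<odot>\<^bsub>M\<^esub> x \<oplus>\<^bsub>M\<^esub> a \<odot>\<^bsub>M\<^esub> x = \<zero>\<^bsub>M\<^esub>"
    using assms smult_l_distr[of "\<ominus>\<^bsub>R\<^esub> a" a x] by (simp add: R.l_neg smult_zero_l)
  then show ?thesis using assms by (simp add: M.minus_equality smult_closed)
qed

lemma smult_neg_r:
  assumes "a \<in> carrier R" "x \<in> carrier M"
  shows "a \<odot>\<^bsub>M\<^esub> (\<ominus>\<^bsub>M\<^esub> x) = \<ominus>\<^bsub>M\<^esub> (a \<odot>\<^bsub>M\<^esub> x)"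
proof -
  have "a \<odot>\<^bsub>M\<^esub> (\<ominus>\<^bsub>M\<^esub> x) \<oplus>\<^bsub>M\<^esub> a \<odot>\<^bsub>M\<^esub> x = \<zero>\<^bsub>M\<^esub>"
    using assms smult_r_distr[of a "\<ominus>\<^bsub>M\<^esub> x" x] by (simp add: M.l_neg smult_zero_r)
  then show ?thesis using assms by (simp add: M.minus_equality smult_closed)
qed

lemma neg_eq_smult: "x \<in> carrier M \<Longrightarrow> \<ominus>\<^bsub>M\<^esub> x = (\<ominus>\<^bsub>R\<^esub> \<one>\<^bsub>R\<^esub>) \<odot>\<^bsub>M\<^esub> x"
  by (simp add: smult_neg_l smult_one)

lemma smult_minus_r: "a \<in> carrier R \<Longrightarrow> x \<in> carrier M \<Longrightarrow> y \<in> carrier M \<Longrightarrow>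
    a \<odot>\<^bsub>M\<^esub> (x \<ominus>\<^bsub>M\<^esub> y) = a \<odot>\<^bsub>M\<^esub> x \<ominus>\<^bsub>M\<^esub> a \<odot>\<^bsub>M\<^esub> y"
  by (simp add: a_minus_def smult_r_distr smult_neg_r)

lemma smult_finsum_r:
  assumes "finite F" "f \<in> F \<rightarrow> carrier M" "a \<in> carrier R"
  shows "a \<odot>\<^bsub>M\<^esub> (\<Oplus>\<^bsub>M\<^esub>i\<in>F. f i) = (\<Oplus>\<^bsub>M\<^esub>i\<in>F. a \<odot>\<^bsub>M\<^esub> f i)"
  using assms(1,2)
proof (induction F rule: finite_induct)
  case (insert x F)
  then show ?case using assms(3)
    by (subst M.finsum_insert; (subst M.finsum_insert)?)
       (auto simp: smult_r_distr smult_closed Pi_iff M.finsum_closed)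
qed (simp add: assms smult_zero_r)

lemma submoduleI':
  assumes "U \<subseteq> carrier M" "\<zero>\<^bsub>M\<^esub> \<in> U" "\<And>x y. x \<in> U \<Longrightarrow> y \<in> U \<Longrightarrow> x \<oplus>\<^bsub>M\<^esub> y \<in> U"
    "\<And>a x. a \<in> carrier R \<Longrightarrow> x \<in> U \<Longrightarrow> a \<odot>\<^bsub>M\<^esub> x \<in> U"
  shows "submodule U R M"
proof (intro submodule.intro subgroup.intro)
  fix x assume "x \<in> U"
  then show "inv\<^bsub>add_monoid M\<^esub> x \<in> U"
    using assms neg_eq_smult[of x] unfolding a_inv_def[symmetric] by auto
qed (use assms in \<open>auto simp: submodule_axioms_def\<close>)

lemma submoduleD:
  assumes "submodule U R M"
  shows "U \<subseteq> carrier M" "\<zero>\<^bsub>M\<^esub> \<in> U" "\<And>x y. x \<in> U \<Longrightarrow> y \<in> U \<Longrightarrow> x \<oplus>\<^bsub>M\<^esub> y \<in> U"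
    "\<And>a x. a \<in> carrier R \<Longrightarrow> x \<in> U \<Longrightarrow> a \<odot>\<^bsub>M\<^esub> x \<in> U"
    "\<And>x. x \<in> U \<Longrightarrow> \<ominus>\<^bsub>M\<^esub> x \<in> U"
    "\<And>x y. x \<in> U \<Longrightarrow> y \<in> U \<Longrightarrow> x \<ominus>\<^bsub>M\<^esub> y \<in> U"
    "\<And>x. x \<in> U \<Longrightarrow> x \<in> carrier M"
proof -
  interpret submodule U R M by fact
  show 0: "U \<subseteq> carrier M" "\<zero>\<^bsub>M\<^esub> \<in> U" "\<And>x y. x \<in> U \<Longrightarrow> y \<in> U \<Longrightarrow> x \<oplus>\<^bsub>M\<^esub> y \<in> U"
    "\<And>a x. a \<in> carrier R \<Longrightarrow> x \<in> U \<Longrightarrow> a \<odot>\<^bsub>M\<^esub> x \<in> U"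
    "\<And>x. x \<in> U \<Longrightarrow> \<ominus>\<^bsub>M\<^esub> x \<in> U"
    using subset one_closed m_closed smult_closed m_inv_closed by (auto simp: a_inv_def)
  show "\<And>x y. x \<in> U \<Longrightarrow> y \<in> U \<Longrightarrow> x \<ominus>\<^bsub>M\<^esub> y \<in> U" using 0 by (auto simp: a_minus_def)
  show "\<And>x. x \<in> U \<Longrightarrow> x \<in> carrier M" using 0 by auto
qed

lemma submodule_left_module: "submodule U R M \<Longrightarrow> left_module R (M\<lparr>carrier := U\<rparr>)"
  apply (rule left_moduleI)
  using submoduleD[of U] smult_zero_l
  by (auto simp: M.a_ac R.ring_axioms smult_l_distr smult_r_distr smult_assoc smult_one
      dest!: subsetD)

lemma submodule_carrier: "submodule (carrier M) R M"
  by (rule submoduleI') (auto simp: smult_closed)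

lemma submodule_zero: "submodule {\<zero>\<^bsub>M\<^esub>} R M"
  by (rule submoduleI') (auto simp: smult_zero_r)

lemma minus_zero_iff: "x \<in> carrier M \<Longrightarrow> y \<in> carrier M \<Longrightarrow> x \<ominus>\<^bsub>M\<^esub> y = \<zero>\<^bsub>M\<^esub> \<longleftrightarrow> x = y"
  using M.minus_equality[of x "\<ominus>\<^bsub>M\<^esub> y"] by (auto simp: a_minus_def M.r_neg)

end

lemma lmod_homD:
  assumes "f \<in> lmod_hom R M N"
  shows "\<And>x. x \<in> carrier M \<Longrightarrow> f x \<in> carrier N"
    "\<And>x y. x \<in> carrier M \<Longrightarrow> y \<in> carrier M \<Longrightarrow> f (x \<oplus>\<^bsub>M\<^esub> y) = f x \<oplus>\<^bsub>N\<^esub> f y"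
    "\<And>a x. a \<in> carrier R \<Longrightarrow> x \<in> carrier M \<Longrightarrow> f (a \<odot>\<^bsub>M\<^esub> x) = a \<odot>\<^bsub>N\<^esub> f x"
  using assms by (auto simp: lmod_hom_def)

lemma lmod_homI:
  assumes "\<And>x. x \<in> carrier M \<Longrightarrow> f x \<in> carrier N"
    "\<And>x y. x \<in> carrier M \<Longrightarrow> y \<in> carrier M \<Longrightarrow> f (x \<oplus>\<^bsub>M\<^esub> y) = f x \<oplus>\<^bsub>N\<^esub> f y"
    "\<And>a x. a \<in> carrier R \<Longrightarrow> x \<in> carrier M \<Longrightarrow> f (a \<odot>\<^bsub>M\<^esub> x) = a \<odot>\<^bsub>N\<^esub> f x"
  shows "f \<in> lmod_hom R M N"
  using assms by (auto simp: lmod_hom_def)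

lemma lmod_hom_zero:
  assumes "left_module R M" "left_module R N" "f \<in> lmod_hom R M N"
  shows "f \<zero>\<^bsub>M\<^esub> = \<zero>\<^bsub>N\<^esub>"
proof -
  interpret M: left_module R M by fact
  interpret N: left_module R N by fact
  have "f (\<zero>\<^bsub>R\<^esub> \<odot>\<^bsub>M\<^esub> \<zero>\<^bsub>M\<^esub>) = \<zero>\<^bsub>R\<^esub> \<odot>\<^bsub>N\<^esub> f \<zero>\<^bsub>M\<^esub>" using lmod_homD(3)[OF assms(3)] by simp
  then show ?thesis using lmod_homD(1)[OF assms(3)] by (simp add: M.smult_zero_r N.smult_zero_l)
qed

lemma lmod_hom_neg:
  assumes "left_module R M" "left_module R N" "f \<in> lmod_hom R M N" "x \<in> carrier M"
  shows "f (\<ominus>\<^bsub>M\<^esub> x) = \<ominus>\<^bsub>N\<^esub> f x"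
proof -
  interpret M: left_module R M by fact
  interpret N: left_module R N by fact
  show ?thesis using assms(3,4) by (simp add: M.neg_eq_smult N.neg_eq_smult lmod_homD)
qed

lemma lmod_hom_minus:
  assumes "left_module R M" "left_module R N" "f \<in> lmod_hom R M N" "x \<in> carrier M" "y \<in> carrier M"
  shows "f (x \<ominus>\<^bsub>M\<^esub> y) = f x \<ominus>\<^bsub>N\<^esub> f y"
proof -
  interpret M: left_module R M by fact
  interpret N: left_module R N by fact
  show ?thesis using assms by (simp add: a_minus_def lmod_homD lmod_hom_neg)
qed

lemma lmod_hom_comp: "f \<in> lmod_hom R M N \<Longrightarrow> g \<in> lmod_hom R N L \<Longrightarrow> (\<lambda>x. g (f x)) \<in> lmod_hom R M L"
  by (auto simp: lmod_hom_def Pi_iff)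

lemma lmod_hom_add:
  assumes "left_module R M" "left_module R N" "f \<in> lmod_hom R M N" "g \<in> lmod_hom R M N"
  shows "(\<lambda>x. f x \<oplus>\<^bsub>N\<^esub> g x) \<in> lmod_hom R M N"
proof -
  interpret N: left_module R N by fact
  show ?thesis using assms(3,4)
    by (intro lmod_homI) (auto simp: lmod_homD N.M.a_ac N.smult_r_distr)
qed

lemma lmod_hom_uminus:
  assumes "left_module R M" "left_module R N" "f \<in> lmod_hom R M N"
  shows "(\<lambda>x. \<ominus>\<^bsub>N\<^esub> f x) \<in> lmod_hom R M N"
proof -
  interpret N: left_module R N by fact
  show ?thesis using assms(3)
    by (intro lmod_homI) (auto simp: lmod_homD N.M.minus_add N.smult_neg_r)
qed

lemma lmod_hom_diff:
  assumes "left_module R M" "left_module R N" "f \<in> lmod_hom R M N" "g \<in> lmod_hom R M N"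
  shows "(\<lambda>x. f x \<ominus>\<^bsub>N\<^esub> g x) \<in> lmod_hom R M N"
  unfolding a_minus_def by (intro lmod_hom_add lmod_hom_uminus assms)

lemma lmod_hom_const_zero:
  assumes "left_module R N" shows "(\<lambda>x. \<zero>\<^bsub>N\<^esub>) \<in> lmod_hom R M N"
proof -
  interpret N: left_module R N by fact
  show ?thesis by (intro lmod_homI) (auto simp: N.smult_zero_r)
qed

lemma lmod_hom_id: "(\<lambda>x. x) \<in> lmod_hom R M M"
  by (auto simp: lmod_hom_def)

lemma lmod_hom_codomain: "f \<in> lmod_hom R M N \<Longrightarrow> f ` carrier M \<subseteq> U \<Longrightarrow> f \<in> lmod_hom R M (N\<lparr>carrier := U\<rparr>)"
  by (auto simp: lmod_hom_def Pi_iff)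

lemma lmod_hom_codomain_subset: "f \<in> lmod_hom R M (N\<lparr>carrier := U\<rparr>) \<Longrightarrow> U \<subseteq> carrier N \<Longrightarrow> f \<in> lmod_hom R M N"
  by (auto simp: lmod_hom_def Pi_iff)

lemma lmod_hom_domain: "f \<in> lmod_hom R M N \<Longrightarrow> U \<subseteq> carrier M \<Longrightarrow> f \<in> lmod_hom R (M\<lparr>carrier := U\<rparr>) N"
  unfolding lmod_hom_def Pi_iff by (simp add: subset_iff)

lemma submodule_kernel:
  assumes "left_module R M" "left_module R N" "f \<in> lmod_hom R M N"
  shows "submodule (a_kernel M N f) R M"
proof -
  interpret M: left_module R M by fact
  interpret N: left_module R N by fact
  show ?thesis using assms
    by (intro M.submoduleI') (auto simp: a_kernel_def' lmod_homD lmod_hom_zero M.smult_closed N.smult_zero_r)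
qed

lemma submodule_image:
  assumes "left_module R M" "left_module R N" "f \<in> lmod_hom R M N" "submodule U R M"
  shows "submodule (f ` U) R N"
proof -
  interpret M: left_module R M by fact
  interpret N: left_module R N by fact
  note U = M.submoduleD[OF assms(4)]
  show ?thesis
  proof (intro N.submoduleI')
    show "f ` U \<subseteq> carrier N" using U assms by (auto simp: lmod_homD)
    show "\<zero>\<^bsub>N\<^esub> \<in> f ` U" using U(2) lmod_hom_zero[OF assms(1-3)] by (metis imageI)
    show "x \<oplus>\<^bsub>N\<^esub> y \<in> f ` U" if "x \<in> f ` U" "y \<in> f ` U" for x y
      using that U lmod_homD(2)[OF assms(3), symmetric] by auto
    show "a \<odot>\<^bsub>N\<^esub> x \<in> f ` U" if "a \<in> carrier R" "x \<in> f ` U" for a x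
      using that U lmod_homD(3)[OF assms(3), symmetric] by auto
  qed
qed

lemma submodule_trans:
  assumes "left_module R M" "submodule U R M" "submodule W R (M\<lparr>carrier := U\<rparr>)"
  shows "submodule W R M"
proof -
  interpret M: left_module R M by fact
  interpret U: left_module R "M\<lparr>carrier := U\<rparr>" by (rule M.submodule_left_module[OF assms(2)])
  show ?thesis using U.submoduleD[OF assms(3)] M.submoduleD[OF assms(2)]
    by (intro M.submoduleI') auto
qed

lemma lmod_hom_inj_iff:
  assumes "left_module R M" "left_module R N" "f \<in> lmod_hom R M N"
  shows "inj_on f (carrier M) \<longleftrightarrow> (\<forall>x\<in>carrier M. f x = \<zero>\<^bsub>N\<^esub> \<longrightarrow> x = \<zero>\<^bsub>M\<^esub>)"
proof -
  interpret M: left_module R M by fact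
  interpret N: left_module R N by fact
  show ?thesis
  proof (intro iffI inj_onI ballI impI)
    fix x assume "inj_on f (carrier M)" "x \<in> carrier M" "f x = \<zero>\<^bsub>N\<^esub>"
    then show "x = \<zero>\<^bsub>M\<^esub>" using lmod_hom_zero[OF assms] inj_onD[of f "carrier M" x "\<zero>\<^bsub>M\<^esub>"] by simp
  next
    fix x y assume *: "\<forall>x\<in>carrier M. f x = \<zero>\<^bsub>N\<^esub> \<longrightarrow> x = \<zero>\<^bsub>M\<^esub>" "x \<in> carrier M" "y \<in> carrier M" "f x = f y"
    then have "f (x \<ominus>\<^bsub>M\<^esub> y) = \<zero>\<^bsub>N\<^esub>"
      using lmod_hom_minus[OF assms] assms(3) by (simp add: lmod_homD N.minus_zero_iff)
    then show "x = y" using * M.minus_zero_iff[of x y] by simp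
  qed
qed

lemma lmod_iso_inv:
  assumes "left_module R M" "left_module R N" "f \<in> lmod_iso R M N"
  shows "inv_into (carrier M) f \<in> lmod_iso R N M"
proof -
  interpret M: left_module R M by fact
  interpret N: left_module R N by fact
  have f: "f \<in> lmod_hom R M N" and b: "bij_betw f (carrier M) (carrier N)"
    using assms(3) by (auto simp: lmod_iso_def)
  let ?g = "inv_into (carrier M) f"
  have g: "?g y \<in> carrier M" "f (?g y) = y" if "y \<in> carrier N" for y
    using bij_betw_apply[OF bij_betw_inv_into[OF b] that] bij_betw_inv_into_right[OF b that] by auto
  have gf: "?g (f x) = x" if "x \<in> carrier M" for x using b that by (simp add: bij_betw_inv_into_left)
  have "?g \<in> lmod_hom R N M"
  proof (rule lmod_homI)
    fix x y assume "x \<in> carrier N" "y \<in> carrier N"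
    then show "?g (x \<oplus>\<^bsub>N\<^esub> y) = ?g x \<oplus>\<^bsub>M\<^esub> ?g y"
      using gf[of "?g x \<oplus>\<^bsub>M\<^esub> ?g y"] lmod_homD(2)[OF f] g by simp
  next
    fix a x assume "a \<in> carrier R" "x \<in> carrier N"
    then show "?g (a \<odot>\<^bsub>N\<^esub> x) = a \<odot>\<^bsub>M\<^esub> ?g x"
      using gf[of "a \<odot>\<^bsub>M\<^esub> ?g x"] lmod_homD(3)[OF f] g M.smult_closed by simp
  qed (use g in auto)
  then show ?thesis using b by (simp add: lmod_iso_def bij_betw_inv_into)
qed

text \<open>Every quotient of a module has copies in any type with enough elements, and every module can be
  transported along an injection; both are images under a map whose fibres form a congruence.\<close>

definition image_module :: "('m \<Rightarrow> 'n) \<Rightarrow> ('a, 'm) module \<Rightarrow> ('a, 'n) module" where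
  "image_module f M = (let g = inv_into (carrier M) f in
    \<lparr>carrier = f ` carrier M, mult = undefined, one = undefined, zero = f \<zero>\<^bsub>M\<^esub>,
     add = (\<lambda>x y. f (g x \<oplus>\<^bsub>M\<^esub> g y)), smult = (\<lambda>a x. f (a \<odot>\<^bsub>M\<^esub> g x))\<rparr>)"

lemma carrier_image_module [simp]: "carrier (image_module f M) = f ` carrier M"
  by (simp add: image_module_def Let_def)

text \<open>The operations of \<open>image_module\<close> pass through a preimage chosen by
  \<open>inv_into\<close>, which may differ from the given one by an element of \<open>U\<close>.
  Since \<open>U\<close> is a submodule, the difference stays in \<open>U\<close> under addition and
  scalars, and \<open>f\<close> does not see it.\<close>

lemma image_module_gen:
  assumes "left_module R M" "submodule U R M"
    and U: "\<And>x y. x \<in> carrier M \<Longrightarrow> y \<in> carrier M \<Longrightarrow> f x = f y \<longleftrightarrow> x \<ominus>\<^bsub>M\<^esub> y \<in> U"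
  shows "left_module R (image_module f M)" "f \<in> lmod_hom R M (image_module f M)"
    "a_kernel M (image_module f M) f = U"
proof -
  interpret M: left_module R M by fact
  note Um = M.submoduleD[OF assms(2)]
  let ?g = "inv_into (carrier M) f"
  let ?N = "image_module f M"
  have g: "?g (f x) \<in> carrier M" "f (?g (f x)) = f x" if "x \<in> carrier M" for x
    using that by (auto intro: inv_into_into f_inv_into_f)
  have add: "f x \<oplus>\<^bsub>?N\<^esub> f y = f (x \<oplus>\<^bsub>M\<^esub> y)" if "x \<in> carrier M" "y \<in> carrier M" for x y
  proof -
    have "(?g (f x) \<oplus>\<^bsub>M\<^esub> ?g (f y)) \<ominus>\<^bsub>M\<^esub> (x \<oplus>\<^bsub>M\<^esub> y) = (?g (f x) \<ominus>\<^bsub>M\<^esub> x) \<oplus>\<^bsub>M\<^esub> (?g (f y) \<ominus>\<^bsub>M\<^esub> y)"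
      using that g by (simp add: a_minus_def M.M.minus_add M.M.a_ac)
    also have "\<dots> \<in> U" by (rule Um(3)) (use U[of "?g (f x)" x] U[of "?g (f y)" y] g that in auto)
    finally have "(?g (f x) \<oplus>\<^bsub>M\<^esub> ?g (f y)) \<ominus>\<^bsub>M\<^esub> (x \<oplus>\<^bsub>M\<^esub> y) \<in> U" .
    then have "f (?g (f x) \<oplus>\<^bsub>M\<^esub> ?g (f y)) = f (x \<oplus>\<^bsub>M\<^esub> y)" using that g by (subst U) auto
    then show ?thesis by (simp add: image_module_def Let_def)
  qed
  have smult: "a \<odot>\<^bsub>?N\<^esub> f x = f (a \<odot>\<^bsub>M\<^esub> x)" if "x \<in> carrier M" "a \<in> carrier R" for x a
  proof -
    have "a \<odot>\<^bsub>M\<^esub> ?g (f x) \<ominus>\<^bsub>M\<^esub> a \<odot>\<^bsub>M\<^esub> x = a \<odot>\<^bsub>M\<^esub> (?g (f x) \<ominus>\<^bsub>M\<^esub> x)"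
      using that g by (simp add: M.smult_minus_r)
    also have "\<dots> \<in> U" by (rule Um(4)) (use U[of "?g (f x)" x] g that in auto)
    finally have "a \<odot>\<^bsub>M\<^esub> ?g (f x) \<ominus>\<^bsub>M\<^esub> a \<odot>\<^bsub>M\<^esub> x \<in> U" .
    then have "f (a \<odot>\<^bsub>M\<^esub> ?g (f x)) = f (a \<odot>\<^bsub>M\<^esub> x)" using that g M.smult_closed by (subst U) auto
    then show ?thesis by (simp add: image_module_def Let_def)
  qed
  have zero: "\<zero>\<^bsub>?N\<^esub> = f \<zero>\<^bsub>M\<^esub>" by (simp add: image_module_def Let_def)
  show "left_module R ?N"
    by (rule left_moduleI)
       (auto simp: add smult zero M.smult_closed M.M.a_ac M.smult_l_distr M.smult_r_distr M.smult_assoc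
          M.smult_one M.smult_zero_l M.R.ring_axioms)
  show "f \<in> lmod_hom R M ?N" by (rule lmod_homI) (auto simp: add smult)
  show "a_kernel M ?N f = U"
    using U[of _ "\<zero>\<^bsub>M\<^esub>"] Um(7) by (auto simp: a_kernel_def' zero M.M.minus_zero_right)
qed

lemma image_module_inj:
  assumes "left_module R M" "inj_on f (carrier M)"
  shows "left_module R (image_module f M)" "f \<in> lmod_iso R M (image_module f M)"
proof -
  interpret M: left_module R M by fact
  have *: "f x = f y \<longleftrightarrow> x \<ominus>\<^bsub>M\<^esub> y \<in> {\<zero>\<^bsub>M\<^esub>}" if "x \<in> carrier M" "y \<in> carrier M" for x y
    using that assms(2) M.minus_zero_iff by (auto dest: inj_onD)
  show "left_module R (image_module f M)" "f \<in> lmod_iso R M (image_module f M)"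
    using image_module_gen[OF assms(1) M.submodule_zero *] assms(2)
    by (auto simp: lmod_iso_def bij_betw_def)
qed

text \<open>The quotient is realized on coset representatives, not on cosets, so that it keeps its
  elements in the type of \<open>M\<close>; the tests for projectivity and injectivity only admit
  modules of one type.\<close>

lemma quotient_module_ex:
  fixes M :: "('a, 'm) module"
  assumes "left_module R M" "submodule U R M"
  obtains N :: "('a, 'm) module" and p where "left_module R N" "p \<in> lmod_hom R M N"
    "p ` carrier M = carrier N" "a_kernel M N p = U"
proof -
  interpret M: left_module R M by fact
  note Um = M.submoduleD[OF assms(2)]
  define p where "p x = (SOME y. y \<in> carrier M \<and> y \<ominus>\<^bsub>M\<^esub> x \<in> U)" for x
  have p: "p x \<in> carrier M \<and> p x \<ominus>\<^bsub>M\<^esub> x \<in> U" if "x \<in> carrier M" for x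
    unfolding p_def by (rule someI[of _ x]) (use that Um in \<open>auto simp: a_minus_def M.M.r_neg\<close>)
  have pp: "p x = p y \<longleftrightarrow> x \<ominus>\<^bsub>M\<^esub> y \<in> U" if xy: "x \<in> carrier M" "y \<in> carrier M" for x y
  proof
    assume eq: "p x = p y"
    have "x \<ominus>\<^bsub>M\<^esub> p x \<in> U" using p[OF xy(1)] Um(5) xy M.M.uminus_minus[of "p x" x] by metis
    moreover have "p x \<ominus>\<^bsub>M\<^esub> y \<in> U" using p[OF xy(2)] eq by simp
    ultimately show "x \<ominus>\<^bsub>M\<^esub> y \<in> U" using M.M.minus_telescope[of x y "p x"] xy p Um(3) by metis
  next
    assume *: "x \<ominus>\<^bsub>M\<^esub> y \<in> U"
    then have **: "y \<ominus>\<^bsub>M\<^esub> x \<in> U" using Um(5) xy M.M.uminus_minus[of x y] by metis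
    have "z \<ominus>\<^bsub>M\<^esub> x \<in> U \<longleftrightarrow> z \<ominus>\<^bsub>M\<^esub> y \<in> U" if z: "z \<in> carrier M" for z
      using M.M.minus_telescope[of z y x] M.M.minus_telescope[of z x y] z xy * ** Um(3) by metis
    \<comment> \<open>Equal cosets make the two choice predicates equal, and \<open>SOME\<close>
      then returns the same representative.\<close>
    then have "(\<lambda>z. z \<in> carrier M \<and> z \<ominus>\<^bsub>M\<^esub> x \<in> U) = (\<lambda>z. z \<in> carrier M \<and> z \<ominus>\<^bsub>M\<^esub> y \<in> U)"
      by blast
    then show "p x = p y" unfolding p_def by simp
  qed
  show ?thesis
    using image_module_gen[OF assms pp] that[of "image_module p M" p] by simp
qed

lemma lmod_hom_factor:
  assumes "left_module R M" "left_module R N" "left_module R X"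
    and p: "p \<in> lmod_hom R M N" "p ` carrier M = carrier N"
    and g: "g \<in> lmod_hom R M X" "\<And>x. x \<in> carrier M \<Longrightarrow> p x = \<zero>\<^bsub>N\<^esub> \<Longrightarrow> g x = \<zero>\<^bsub>X\<^esub>"
  obtains h where "h \<in> lmod_hom R N X" "\<And>x. x \<in> carrier M \<Longrightarrow> h (p x) = g x"
proof -
  interpret M: left_module R M by fact
  interpret N: left_module R N by fact
  interpret X: left_module R X by fact
  define h where "h y = g (inv_into (carrier M) p y)" for y
  have i: "inv_into (carrier M) p (p x) \<in> carrier M" "p (inv_into (carrier M) p (p x)) = p x"
      if "x \<in> carrier M" for x
    using that by (auto intro: inv_into_into f_inv_into_f)
  have eq: "g x = g y" if "x \<in> carrier M" "y \<in> carrier M" "p x = p y" for x y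
  proof -
    have "p (x \<ominus>\<^bsub>M\<^esub> y) = \<zero>\<^bsub>N\<^esub>"
      using that lmod_hom_minus[OF assms(1,2) p(1)] p(1) by (simp add: lmod_homD N.minus_zero_iff)
    then have "g (x \<ominus>\<^bsub>M\<^esub> y) = \<zero>\<^bsub>X\<^esub>" using that g(2) by simp
    then show ?thesis
      using that lmod_hom_minus[OF assms(1,3) g(1)] g(1) by (simp add: lmod_homD X.minus_zero_iff)
  qed
  have hp: "h (p x) = g x" if "x \<in> carrier M" for x unfolding h_def
    using eq[OF i(1)[OF that] that i(2)[OF that]] .
  have "h \<in> lmod_hom R N X"
  proof (rule lmod_homI; unfold p(2)[symmetric])
    fix x y assume "x \<in> p ` carrier M" "y \<in> p ` carrier M"
    then show "h (x \<oplus>\<^bsub>N\<^esub> y) = h x \<oplus>\<^bsub>X\<^esub> h y"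
      using lmod_homD(2)[OF p(1), symmetric] g(1) by (auto simp: hp lmod_homD)
  next
    fix a x assume "a \<in> carrier R" "x \<in> p ` carrier M"
    then show "h (a \<odot>\<^bsub>N\<^esub> x) = a \<odot>\<^bsub>X\<^esub> h x"
      using lmod_homD(3)[OF p(1), symmetric] g(1) by (auto simp: hp lmod_homD M.smult_closed)
  qed (use g(1) in \<open>auto simp: hp lmod_homD\<close>)
  with hp that show ?thesis by blast
qed

text \<open>The extension sends w + u to \<open>g u\<close>. Two decompositions of an element differ
  by u - u', which lies in both \<open>W\<close> and \<open>U\<close>, where \<open>g\<close>
  vanishes; so the sum may fail to be direct, as it does later for complements modulo a
  submodule.\<close>

lemma lmod_hom_extend:
  assumes "left_module R N" "left_module R X" "submodule U R N" "submodule W R N"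
    and sum: "\<And>x. x \<in> carrier N \<Longrightarrow> \<exists>w\<in>W. \<exists>u\<in>U. x = w \<oplus>\<^bsub>N\<^esub> u"
    and g: "g \<in> lmod_hom R (N\<lparr>carrier := U\<rparr>) X" "\<And>x. x \<in> W \<Longrightarrow> x \<in> U \<Longrightarrow> g x = \<zero>\<^bsub>X\<^esub>"
  obtains h where "h \<in> lmod_hom R N X" "\<And>w u. w \<in> W \<Longrightarrow> u \<in> U \<Longrightarrow> h (w \<oplus>\<^bsub>N\<^esub> u) = g u"
    "\<And>u. u \<in> U \<Longrightarrow> h u = g u" "\<And>w. w \<in> W \<Longrightarrow> h w = \<zero>\<^bsub>X\<^esub>"
proof -
  interpret N: left_module R N by fact
  interpret X: left_module R X by fact
  interpret NU: left_module R "N\<lparr>carrier := U\<rparr>" by (rule N.submodule_left_module) fact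
  note U = N.submoduleD[OF assms(3)] and W = N.submoduleD[OF assms(4)]
  note gD = lmod_homD[OF g(1), simplified]
  have gneg: "g (\<ominus>\<^bsub>N\<^esub> x) = \<ominus>\<^bsub>X\<^esub> g x" if "x \<in> U" for x
    using that U(7) gD(1,3) by (simp add: N.neg_eq_smult X.neg_eq_smult)
  have eq: "g u = g u'" if "w \<in> W" "w' \<in> W" "u \<in> U" "u' \<in> U" "w \<oplus>\<^bsub>N\<^esub> u = w' \<oplus>\<^bsub>N\<^esub> u'" for w w' u u'
  proof -
    have c: "w \<in> carrier N" "w' \<in> carrier N" "u \<in> carrier N" "u' \<in> carrier N" using that U W by auto
    have "u \<ominus>\<^bsub>N\<^esub> u' = w' \<ominus>\<^bsub>N\<^esub> w"
      using that(5) c by (intro N.M.minus_eq_minus) auto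
    then have "u \<ominus>\<^bsub>N\<^esub> u' \<in> W" using that(1,2) W(6) by simp
    then have "g (u \<ominus>\<^bsub>N\<^esub> u') = \<zero>\<^bsub>X\<^esub>" by (rule g(2)) (intro U(6) that)
    then have "g u \<ominus>\<^bsub>X\<^esub> g u' = \<zero>\<^bsub>X\<^esub>" using that(3,4) U(5) gD(2) gneg by (simp add: a_minus_def)
    then show ?thesis using gD(1) that(3,4) X.minus_zero_iff[of "g u" "g u'"] by simp
  qed
  define h where "h x = (SOME y. \<exists>w\<in>W. \<exists>u\<in>U. x = w \<oplus>\<^bsub>N\<^esub> u \<and> y = g u)" for x
  have h: "h (w \<oplus>\<^bsub>N\<^esub> u) = g u" if "w \<in> W" "u \<in> U" for w u
  proof -
    have "\<exists>w'\<in>W. \<exists>u'\<in>U. w \<oplus>\<^bsub>N\<^esub> u = w' \<oplus>\<^bsub>N\<^esub> u' \<and> h (w \<oplus>\<^bsub>N\<^esub> u) = g u'"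
      unfolding h_def by (rule someI[of _ "g u"]) (use that in blast)
    then obtain w' u' where "w' \<in> W" "u' \<in> U" "w \<oplus>\<^bsub>N\<^esub> u = w' \<oplus>\<^bsub>N\<^esub> u'" "h (w \<oplus>\<^bsub>N\<^esub> u) = g u'"
      by blast
    then show ?thesis using eq[OF that(1) \<open>w' \<in> W\<close> that(2) \<open>u' \<in> U\<close>] by simp
  qed
  have "h \<in> lmod_hom R N X"
  proof (rule lmod_homI)
    fix x assume "x \<in> carrier N" then show "h x \<in> carrier X" using sum[of x] h gD by auto
  next
    fix x y assume "x \<in> carrier N" "y \<in> carrier N"
    then obtain w u w' u' where wu: "w \<in> W" "u \<in> U" "w' \<in> W" "u' \<in> U" "x = w \<oplus>\<^bsub>N\<^esub> u" "y = w' \<oplus>\<^bsub>N\<^esub> u'"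
      using sum by meson
    then have c: "w \<in> carrier N" "u \<in> carrier N" "w' \<in> carrier N" "u' \<in> carrier N" using U(7) W(7) by auto
    have "x \<oplus>\<^bsub>N\<^esub> y = (w \<oplus>\<^bsub>N\<^esub> w') \<oplus>\<^bsub>N\<^esub> (u \<oplus>\<^bsub>N\<^esub> u')"
      unfolding wu(5,6) using c by (simp add: N.M.a_ac)
    then show "h (x \<oplus>\<^bsub>N\<^esub> y) = h x \<oplus>\<^bsub>X\<^esub> h y"
      using wu U(3) W(3) gD(2) by (simp add: h)
  next
    fix a x assume a: "a \<in> carrier R" and "x \<in> carrier N"
    then obtain w u where wu: "w \<in> W" "u \<in> U" "x = w \<oplus>\<^bsub>N\<^esub> u" using sum by meson
    then have "a \<odot>\<^bsub>N\<^esub> x = a \<odot>\<^bsub>N\<^esub> w \<oplus>\<^bsub>N\<^esub> a \<odot>\<^bsub>N\<^esub> u" using U(7) W(7) a by (simp add: N.smult_r_distr)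
    then show "h (a \<odot>\<^bsub>N\<^esub> x) = a \<odot>\<^bsub>X\<^esub> h x" using wu U(4) W(4) gD(3) a by (simp add: h)
  qed
  moreover have "h u = g u" if "u \<in> U" for u using h[OF W(2) that] U(7)[OF that] by simp
  moreover have "h w = \<zero>\<^bsub>X\<^esub>" if "w \<in> W" for w
  proof -
    have "g \<zero>\<^bsub>N\<^esub> = \<zero>\<^bsub>X\<^esub>" by (rule g(2)[OF W(2) U(2)])
    then show ?thesis using h[OF that U(2)] W(7)[OF that] by simp
  qed
  ultimately show ?thesis using that h by blast
qed

section \<open>Extension and lifting problems\<close>

text \<open>Surjectivity of the restriction Hom(P, X) -> Hom(K, X). For projective \<open>P\<close>
  its cokernel is Ext^1(P/K, X).\<close>

definition extends_hom :: "('a, 'r) ring_scheme \<Rightarrow> ('a, 'p) module \<Rightarrow> 'p set \<Rightarrow> ('a, 'x) module \<Rightarrow> bool" where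
  "extends_hom R P K X \<longleftrightarrow>
     (\<forall>g\<in>lmod_hom R (P\<lparr>carrier := K\<rparr>) X. \<exists>h\<in>lmod_hom R P X. \<forall>x\<in>K. h x = g x)"

text \<open>Surjectivity of Hom(M, E) -> Hom(M, C). When \<open>q\<close> is onto and
  \<open>E\<close> is injective, its cokernel is Ext^1(M, ker q).\<close>

definition lifts_hom ::
    "('a, 'r) ring_scheme \<Rightarrow> ('a, 'm) module \<Rightarrow> ('a, 'e) module \<Rightarrow> ('e \<Rightarrow> 'c) \<Rightarrow> ('a, 'c) module \<Rightarrow> bool" where
  "lifts_hom R M E q C \<longleftrightarrow>
     (\<forall>g\<in>lmod_hom R M C. \<exists>h\<in>lmod_hom R M E. \<forall>x\<in>carrier M. q (h x) = g x)"

lemma projective_left_module: "projective_module R P \<Longrightarrow> left_module R P"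
  by (simp add: projective_module_def)

lemma injective_left_module: "injective_module R P \<Longrightarrow> left_module R P"
  by (simp add: injective_module_def)

lemma projective_lift:
  fixes P M N :: "('a, 'u) module"
  assumes "projective_module R P" "left_module R M" "left_module R N"
    "p \<in> lmod_hom R M N" "p ` carrier M = carrier N" "g \<in> lmod_hom R P N"
  obtains h where "h \<in> lmod_hom R P M" "\<And>x. x \<in> carrier P \<Longrightarrow> p (h x) = g x"
  using assms unfolding projective_module_def by blast

lemma injective_extend:
  fixes E M N :: "('a, 'u) module"
  assumes "injective_module R E" "left_module R M" "left_module R N"
    "i \<in> lmod_hom R N M" "inj_on i (carrier N)" "g \<in> lmod_hom R N E"
  obtains h where "h \<in> lmod_hom R M E" "\<And>x. x \<in> carrier N \<Longrightarrow> h (i x) = g x"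
  using assms unfolding injective_module_def by blast

lemma injective_extend_submodule:
  fixes E M :: "('a, 'u) module"
  assumes "injective_module R E" "left_module R M" "submodule U R M"
    "g \<in> lmod_hom R (M\<lparr>carrier := U\<rparr>) E"
  obtains h where "h \<in> lmod_hom R M E" "\<And>x. x \<in> U \<Longrightarrow> h x = g x"
proof -
  interpret M: left_module R M by fact
  have "(\<lambda>x. x) \<in> lmod_hom R (M\<lparr>carrier := U\<rparr>) M"
    using M.submoduleD(1)[OF assms(3)] by (intro lmod_hom_domain lmod_hom_id)
  then show ?thesis
    using injective_extend[OF assms(1,2) M.submodule_left_module[OF assms(3)], of "\<lambda>x. x" g] assms(4) that
    by auto
qed

text \<open>Both sides say that \<open>Ext\<^sup>1(M, Y)\<close> vanishes, where \<open>Y\<close> is the kernel of \<open>q\<close>: the left one is read off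
  a projective presentation of \<open>M\<close>, the right one an injective copresentation of \<open>Y\<close>.\<close>

lemma extends_iff_lifts:
  fixes P E C :: "('a, 'u) module" and M :: "('a, 'm) module"
  assumes P: "projective_module R P" and M: "left_module R M"
    and p: "p \<in> lmod_hom R P M" "p ` carrier P = carrier M"
    and E: "injective_module R E" and C: "left_module R C"
    and q: "q \<in> lmod_hom R E C" "q ` carrier E = carrier C"
  shows "extends_hom R P (a_kernel P M p) (E\<lparr>carrier := a_kernel E C q\<rparr>) \<longleftrightarrow> lifts_hom R M E q C"
proof
  note lm = projective_left_module[OF P] M injective_left_module[OF E] C
  interpret P: left_module R P by fact
  interpret M: left_module R M by fact
  interpret E: left_module R E by fact
  interpret C: left_module R C by fact
  define K where "K = a_kernel P M p"
  define Y where "Y = a_kernel E C q"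
  have K: "submodule K R P" unfolding K_def by (intro submodule_kernel lm p)
  have Y: "submodule Y R E" unfolding Y_def by (intro submodule_kernel lm q)
  note KD = P.submoduleD[OF K] and YD = E.submoduleD[OF Y]
  have K_iff: "x \<in> K \<longleftrightarrow> x \<in> carrier P \<and> p x = \<zero>\<^bsub>M\<^esub>" for x by (auto simp: K_def a_kernel_def')
  have Y_iff: "x \<in> Y \<longleftrightarrow> x \<in> carrier E \<and> q x = \<zero>\<^bsub>C\<^esub>" for x by (auto simp: Y_def a_kernel_def')
  {
    assume ext: "extends_hom R P (a_kernel P M p) (E\<lparr>carrier := a_kernel E C q\<rparr>)"
    show "lifts_hom R M E q C"
      unfolding lifts_hom_def
    proof
      fix g assume g: "g \<in> lmod_hom R M C"
      have "(\<lambda>x. g (p x)) \<in> lmod_hom R P C" by (rule lmod_hom_comp[OF p(1) g])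
      from projective_lift[OF P lm(3,4) q this] obtain h
        where h: "h \<in> lmod_hom R P E" "\<And>x. x \<in> carrier P \<Longrightarrow> q (h x) = g (p x)" by blast
      have hK: "h ` K \<subseteq> Y"
        using lmod_homD(1)[OF h(1)] h(2) lmod_hom_zero[OF M C g] by (auto simp: K_iff Y_iff)
      then have "h \<in> lmod_hom R (P\<lparr>carrier := K\<rparr>) (E\<lparr>carrier := Y\<rparr>)"
        by (intro lmod_hom_codomain lmod_hom_domain h(1) KD(1)) auto
      then obtain h' where h': "h' \<in> lmod_hom R P (E\<lparr>carrier := Y\<rparr>)" "\<And>x. x \<in> K \<Longrightarrow> h' x = h x"
        using ext unfolding extends_hom_def K_def[symmetric] Y_def[symmetric] by blast
      have h'E: "h' \<in> lmod_hom R P E" by (rule lmod_hom_codomain_subset[OF h'(1) YD(1)])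
      \<comment> \<open>Subtracting \<open>h'\<close> leaves the composite with \<open>q\<close>
        unchanged, since \<open>h'\<close> has values in \<open>Y\<close>, and makes the lift vanish
        on \<open>K\<close>, so that it descends along \<open>p\<close>.\<close>
      have d: "(\<lambda>x. h x \<ominus>\<^bsub>E\<^esub> h' x) \<in> lmod_hom R P E" by (rule lmod_hom_diff[OF lm(1,3) h(1) h'E])
      have dz: "h x \<ominus>\<^bsub>E\<^esub> h' x = \<zero>\<^bsub>E\<^esub>" if "x \<in> carrier P" "p x = \<zero>\<^bsub>M\<^esub>" for x
      proof -
        have "h' x = h x" "h x \<in> carrier E" using that h'(2) K_iff lmod_homD(1)[OF h(1)] by auto
        then show ?thesis by (simp add: E.minus_zero_iff)
      qed
      obtain k where k: "k \<in> lmod_hom R M E" "\<And>x. x \<in> carrier P \<Longrightarrow> k (p x) = h x \<ominus>\<^bsub>E\<^esub> h' x"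
        using lmod_hom_factor[OF lm(1) M lm(3) p d dz] by blast
      have "q (k y) = g y" if y: "y \<in> carrier M" for y
      proof -
        obtain x where x: "x \<in> carrier P" "y = p x" using y p(2) by blast
        have "h' x \<in> Y" using lmod_homD(1)[OF h'(1) x(1)] by simp
        then have z: "q (h' x) = \<zero>\<^bsub>C\<^esub>" "h' x \<in> carrier E" by (auto simp: Y_iff)
        have hx: "h x \<in> carrier E" by (rule lmod_homD(1)[OF h(1) x(1)])
        have gx: "g (p x) \<in> carrier C" using lmod_homD(1)[OF g y] x by simp
        have "q (k y) = q (h x) \<ominus>\<^bsub>C\<^esub> q (h' x)"
          unfolding x(2) k(2)[OF x(1)] by (rule lmod_hom_minus[OF lm(3,4) q(1) hx z(2)])
        also have "\<dots> = g y" using z gx x h(2)[OF x(1)] by (simp add: C.M.minus_zero_right)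
        finally show ?thesis .
      qed
      then show "\<exists>h\<in>lmod_hom R M E. \<forall>x\<in>carrier M. q (h x) = g x" using k(1) by blast
    qed
  next
    assume lift: "lifts_hom R M E q C"
    show "extends_hom R P (a_kernel P M p) (E\<lparr>carrier := a_kernel E C q\<rparr>)"
      unfolding extends_hom_def K_def[symmetric] Y_def[symmetric]
    proof
      fix g assume g: "g \<in> lmod_hom R (P\<lparr>carrier := K\<rparr>) (E\<lparr>carrier := Y\<rparr>)"
      have gE: "g \<in> lmod_hom R (P\<lparr>carrier := K\<rparr>) E" by (rule lmod_hom_codomain_subset[OF g YD(1)])
      from injective_extend_submodule[OF E lm(1) K gE] obtain h
        where h: "h \<in> lmod_hom R P E" "\<And>x. x \<in> K \<Longrightarrow> h x = g x" by blast
      have qh: "(\<lambda>x. q (h x)) \<in> lmod_hom R P C" by (rule lmod_hom_comp[OF h(1) q(1)])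
      have qhz: "q (h x) = \<zero>\<^bsub>C\<^esub>" if "x \<in> carrier P" "p x = \<zero>\<^bsub>M\<^esub>" for x
      proof -
        have "x \<in> K" using that by (simp add: K_iff)
        then have "h x \<in> Y" using h(2) lmod_homD(1)[OF g, of x] by simp
        then show ?thesis by (simp add: Y_iff)
      qed
      obtain k where k: "k \<in> lmod_hom R M C" "\<And>x. x \<in> carrier P \<Longrightarrow> k (p x) = q (h x)"
        using lmod_hom_factor[OF lm(1) M C p qh qhz] by blast
      obtain l where l: "l \<in> lmod_hom R M E" "\<And>x. x \<in> carrier M \<Longrightarrow> q (l x) = k x"
        using lift k(1) unfolding lifts_hom_def by blast
      have lp: "(\<lambda>x. l (p x)) \<in> lmod_hom R P E" by (rule lmod_hom_comp[OF p(1) l(1)])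
      \<comment> \<open>After \<open>q\<close>, the maps \<open>h\<close> and \<open>l\<close>
        composed with \<open>p\<close> agree, so \<open>f\<close> has values in \<open>Y\<close>; on
        \<open>K\<close> it is still \<open>h\<close>, because \<open>p\<close> is zero
        there.\<close>
      define f where "f = (\<lambda>x. h x \<ominus>\<^bsub>E\<^esub> l (p x))"
      have f: "f \<in> lmod_hom R P E" unfolding f_def by (rule lmod_hom_diff[OF lm(1,3) h(1) lp])
      have "f x \<in> Y" if x: "x \<in> carrier P" for x
      proof -
        have c: "h x \<in> carrier E" "l (p x) \<in> carrier E" "p x \<in> carrier M" "q (h x) \<in> carrier C"
          using x lmod_homD(1)[OF h(1)] lmod_homD(1)[OF lp] lmod_homD(1)[OF p(1)] lmod_homD(1)[OF qh] by auto
        have "q (f x) = q (h x) \<ominus>\<^bsub>C\<^esub> q (l (p x))"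
          unfolding f_def by (rule lmod_hom_minus[OF lm(3,4) q(1) c(1,2)])
        also have "\<dots> = \<zero>\<^bsub>C\<^esub>" using c k(2) l(2) x C.minus_zero_iff by simp
        finally show ?thesis using lmod_homD(1)[OF f x] by (simp add: Y_iff)
      qed
      then have "f \<in> lmod_hom R P (E\<lparr>carrier := Y\<rparr>)" by (intro lmod_hom_codomain f) auto
      moreover have "f x = g x" if x: "x \<in> K" for x
      proof -
        have "p x = \<zero>\<^bsub>M\<^esub>" "x \<in> carrier P" using x by (auto simp: K_iff)
        moreover have "g x \<in> carrier E" using lmod_homD(1)[OF gE, of x] x by simp
        ultimately show ?thesis
          using lmod_hom_zero[OF M lm(3) l(1)] h(2)[OF x] by (simp add: f_def E.M.minus_zero_right)
      qed
      ultimately show "\<exists>h\<in>lmod_hom R P (E\<lparr>carrier := Y\<rparr>). \<forall>x\<in>K. h x = g x" by blast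
    qed
  }
qed

text \<open>Ext^1(P/K, C) and Ext^1(K, ker q) agree, both being Ext^2(P/K, ker q). Concretely, a map
  K -> C that extends to \<open>P\<close> lifts to \<open>E\<close> because \<open>P\<close> is
  projective, and one that lifts to \<open>E\<close> extends to \<open>P\<close> because
  \<open>E\<close> is injective.\<close>

lemma extends_iff_lifts_shift:
  fixes P E C :: "('a, 'u) module"
  assumes P: "projective_module R P" and K: "submodule K R P"
    and E: "injective_module R E" and C: "left_module R C"
    and q: "q \<in> lmod_hom R E C" "q ` carrier E = carrier C"
  shows "extends_hom R P K C \<longleftrightarrow> lifts_hom R (P\<lparr>carrier := K\<rparr>) E q C"
proof
  note lm = projective_left_module[OF P] injective_left_module[OF E] C
  interpret P: left_module R P by fact
  note KD = P.submoduleD[OF K]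
  {
    assume ext: "extends_hom R P K C"
    show "lifts_hom R (P\<lparr>carrier := K\<rparr>) E q C"
      unfolding lifts_hom_def
    proof
      fix g assume "g \<in> lmod_hom R (P\<lparr>carrier := K\<rparr>) C"
      then obtain h where h: "h \<in> lmod_hom R P C" "\<And>x. x \<in> K \<Longrightarrow> h x = g x"
        using ext unfolding extends_hom_def by blast
      from projective_lift[OF P lm(2,3) q h(1)] obtain l
        where l: "l \<in> lmod_hom R P E" "\<And>x. x \<in> carrier P \<Longrightarrow> q (l x) = h x" by blast
      have "l \<in> lmod_hom R (P\<lparr>carrier := K\<rparr>) E" by (rule lmod_hom_domain[OF l(1) KD(1)])
      moreover have "\<forall>x\<in>K. q (l x) = g x" using l(2) h(2) KD(7) by simp
      ultimately show "\<exists>h\<in>lmod_hom R (P\<lparr>carrier := K\<rparr>) E. \<forall>x\<in>carrier (P\<lparr>carrier := K\<rparr>). q (h x) = g x"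
        by auto
    qed
  next
    assume lift: "lifts_hom R (P\<lparr>carrier := K\<rparr>) E q C"
    show "extends_hom R P K C"
      unfolding extends_hom_def
    proof
      fix g assume "g \<in> lmod_hom R (P\<lparr>carrier := K\<rparr>) C"
      then obtain l where l: "l \<in> lmod_hom R (P\<lparr>carrier := K\<rparr>) E" "\<And>x. x \<in> K \<Longrightarrow> q (l x) = g x"
        using lift unfolding lifts_hom_def by auto
      from injective_extend_submodule[OF E lm(1) K l(1)] obtain h
        where h: "h \<in> lmod_hom R P E" "\<And>x. x \<in> K \<Longrightarrow> h x = l x" by blast
      have "(\<lambda>x. q (h x)) \<in> lmod_hom R P C" by (rule lmod_hom_comp[OF h(1) q(1)])
      moreover have "\<forall>x\<in>K. q (h x) = g x" using l(2) h(2) by simp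
      ultimately show "\<exists>h\<in>lmod_hom R P C. \<forall>x\<in>K. h x = g x" by (intro bexI[of _ "\<lambda>x. q (h x)"])
    qed
  }
qed

lemma extends_hom_iso:
  assumes X: "left_module R X" and Y: "left_module R Y" and f: "f \<in> lmod_iso R X Y"
    and ext: "extends_hom R P K Y"
  shows "extends_hom R P K X"
  unfolding extends_hom_def
proof
  fix g assume g: "g \<in> lmod_hom R (P\<lparr>carrier := K\<rparr>) X"
  have fh: "f \<in> lmod_hom R X Y" and b: "bij_betw f (carrier X) (carrier Y)"
    using f by (auto simp: lmod_iso_def)
  let ?i = "inv_into (carrier X) f"
  have i: "?i \<in> lmod_hom R Y X" using lmod_iso_inv[OF X Y f] by (simp add: lmod_iso_def)
  obtain h where h: "h \<in> lmod_hom R P Y" "\<And>x. x \<in> K \<Longrightarrow> h x = f (g x)"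
    using bspec[OF ext[unfolded extends_hom_def] lmod_hom_comp[OF g fh]] by blast
  have "?i (h x) = g x" if "x \<in> K" for x
    using h(2)[OF that] lmod_homD(1)[OF g, of x] that b by (simp add: bij_betw_inv_into_left)
  then show "\<exists>h\<in>lmod_hom R P X. \<forall>x\<in>K. h x = g x"
    using lmod_hom_comp[OF h(1) i] by (intro bexI[of _ "\<lambda>x. ?i (h x)"]) auto
qed

lemma extends_hom_zero:
  assumes "left_module R P" "left_module R X" "submodule K R P" "K = {\<zero>\<^bsub>P\<^esub>} \<or> carrier X = {\<zero>\<^bsub>X\<^esub>}"
  shows "extends_hom R P K X"
  unfolding extends_hom_def
proof
  fix g assume g: "g \<in> lmod_hom R (P\<lparr>carrier := K\<rparr>) X"
  interpret P: left_module R P by fact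
  have "g \<zero>\<^bsub>P\<^esub> = \<zero>\<^bsub>X\<^esub>"
    using lmod_hom_zero[OF P.submodule_left_module[OF assms(3)] assms(2) g] by simp
  then have "\<forall>x\<in>K. \<zero>\<^bsub>X\<^esub> = g x" using assms(4) lmod_homD(1)[OF g] by auto
  then show "\<exists>h\<in>lmod_hom R P X. \<forall>x\<in>K. h x = g x"
    using lmod_hom_const_zero[OF assms(2), of P] by (intro bexI[of _ "\<lambda>x. \<zero>\<^bsub>X\<^esub>"]) auto
qed

text \<open>Over rings for which the type \<open>'u\<close> contains enough projective and injective modules, the following
  says that \<open>Ext\<^sup>1(M, X)\<close> vanishes.\<close>

definition ext_zero :: "('a, 'r) ring_scheme \<Rightarrow> ('a, 'm) module \<Rightarrow> ('a, 'u) module \<Rightarrow> bool" where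
  "ext_zero R M X \<longleftrightarrow> (\<forall>(E :: ('a, 'u) module) (C :: ('a, 'u) module) q.
     injective_module R E \<and> left_module R C \<and> q \<in> lmod_hom R E C \<and> q ` carrier E = carrier C \<and>
     lmod_iso R X (E\<lparr>carrier := a_kernel E C q\<rparr>) \<noteq> {} \<longrightarrow> lifts_hom R M E q C)"

definition enough_modules :: "'u itself \<Rightarrow> ('a, 'r) ring_scheme \<Rightarrow> bool" where
  "enough_modules U R \<longleftrightarrow>
     (\<forall>X :: ('a, 'u) module. left_module R X \<longrightarrow>
        (\<exists>(P :: ('a, 'u) module) p. projective_module R P \<and> p \<in> lmod_hom R P X \<and> p ` carrier P = carrier X) \<and>
        (\<exists>(E :: ('a, 'u) module) i. injective_module R E \<and> i \<in> lmod_hom R X E \<and> inj_on i (carrier X)))"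

lemma enough_projectives:
  fixes X :: "('a, 'u) module"
  assumes "enough_modules TYPE('u) R" "left_module R X"
  obtains P :: "('a, 'u) module" and p where "projective_module R P" "p \<in> lmod_hom R P X"
      "p ` carrier P = carrier X"
  using assms unfolding enough_modules_def by blast

lemma enough_injectives:
  fixes X :: "('a, 'u) module"
  assumes "enough_modules TYPE('u) R" "left_module R X"
  obtains E C :: "('a, 'u) module" and q where "injective_module R E" "left_module R C"
    "q \<in> lmod_hom R E C" "q ` carrier E = carrier C" "lmod_iso R X (E\<lparr>carrier := a_kernel E C q\<rparr>) \<noteq> {}"
proof -
  obtain E :: "('a, 'u) module" and i where E: "injective_module R E" "i \<in> lmod_hom R X E"
      "inj_on i (carrier X)"
    using assms unfolding enough_modules_def by blast
  interpret X: left_module R X by fact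
  have lE: "left_module R E" by (rule injective_left_module[OF E(1)])
  have im: "submodule (i ` carrier X) R E" by (rule submodule_image[OF assms(2) lE E(2) X.submodule_carrier])
  obtain C :: "('a, 'u) module" and q where q: "left_module R C" "q \<in> lmod_hom R E C"
    "q ` carrier E = carrier C" "a_kernel E C q = i ` carrier X"
    using quotient_module_ex[OF lE im] by blast
  have "i \<in> lmod_iso R X (E\<lparr>carrier := a_kernel E C q\<rparr>)"
    unfolding q(4) lmod_iso_def using lmod_hom_codomain[OF E(2)] E(3) by (simp add: bij_betw_def)
  then show ?thesis using that[OF E(1) q(1-3)] by blast
qed

text \<open>\<open>ext_zero\<close> quantifies over all injective copresentations of
  \<open>X\<close>, and the right side mentions none: through \<open>extends_iff_lifts\<close> a
  single copresentation decides for all of them. \<open>M\<close> may have its elements outside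
  \<open>'u\<close>, as the simple modules and the top do.\<close>

lemma ext_zero_iff_extends:
  fixes P X :: "('a, 'u) module" and M :: "('a, 'm) module"
  assumes en: "enough_modules TYPE('u) R" and X: "left_module R X" and M: "left_module R M"
    and P: "projective_module R P" and p: "p \<in> lmod_hom R P M" "p ` carrier P = carrier M"
  shows "ext_zero R M X \<longleftrightarrow> extends_hom R P (a_kernel P M p) X"
proof
  assume V: "ext_zero R M X"
  obtain E C :: "('a, 'u) module" and q where E: "injective_module R E" "left_module R C"
    "q \<in> lmod_hom R E C" "q ` carrier E = carrier C" "lmod_iso R X (E\<lparr>carrier := a_kernel E C q\<rparr>) \<noteq> {}"
    using enough_injectives[OF en X] by blast
  interpret E: left_module R E by (rule injective_left_module[OF E(1)])
  have lY: "left_module R (E\<lparr>carrier := a_kernel E C q\<rparr>)"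
    by (rule E.submodule_left_module[OF submodule_kernel[OF E.left_module_axioms E(2,3)]])
  have "lifts_hom R M E q C" using V E unfolding ext_zero_def by blast
  then have "extends_hom R P (a_kernel P M p) (E\<lparr>carrier := a_kernel E C q\<rparr>)"
    using extends_iff_lifts[OF P M p E(1-4)] by simp
  then show "extends_hom R P (a_kernel P M p) X" using extends_hom_iso[OF X lY] E(5) by blast
next
  assume ext: "extends_hom R P (a_kernel P M p) X"
  show "ext_zero R M X"
    unfolding ext_zero_def
  proof (intro allI impI; elim conjE)
    fix E C :: "('a, 'u) module" and q
    assume E: "injective_module R E" "left_module R C" "q \<in> lmod_hom R E C" "q ` carrier E = carrier C"
      "lmod_iso R X (E\<lparr>carrier := a_kernel E C q\<rparr>) \<noteq> {}"
    interpret E: left_module R E by (rule injective_left_module[OF E(1)])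
    have lY: "left_module R (E\<lparr>carrier := a_kernel E C q\<rparr>)"
      by (rule E.submodule_left_module[OF submodule_kernel[OF E.left_module_axioms E(2,3)]])
    have "extends_hom R P (a_kernel P M p) (E\<lparr>carrier := a_kernel E C q\<rparr>)"
      using extends_hom_iso[OF lY X lmod_iso_inv[OF X lY] ext] E(5) by blast
    then show "lifts_hom R M E q C" using extends_iff_lifts[OF P M p E(1-4)] by simp
  qed
qed

text \<open>A projective presentation of \<open>M\<close> is the bridge: the extension problem on it
  is equivalent to the lifting problem for every copresentation of the same kernel, so testing the
  given one is enough.\<close>

lemma ext_zero_iff_lifts:
  fixes P E C :: "('a, 'u) module" and M :: "('a, 'm) module"
  assumes en: "enough_modules TYPE('u) R" and M: "left_module R M"
    and P: "projective_module R P" and p: "p \<in> lmod_hom R P M" "p ` carrier P = carrier M"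
    and E: "injective_module R E" "left_module R C" "q \<in> lmod_hom R E C" "q ` carrier E = carrier C"
  shows "ext_zero R M (E\<lparr>carrier := a_kernel E C q\<rparr>) \<longleftrightarrow> lifts_hom R M E q C"
proof -
  interpret E: left_module R E by (rule injective_left_module[OF E(1)])
  have "left_module R (E\<lparr>carrier := a_kernel E C q\<rparr>)"
    by (rule E.submodule_left_module[OF submodule_kernel[OF E.left_module_axioms E(2,3)]])
  from ext_zero_iff_extends[OF en this M P p] extends_iff_lifts[OF P M p E] show ?thesis by simp
qed

text \<open>Dimension shifting along a syzygy of \<open>M\<close> and a cosyzygy with cokernel \<open>C\<close>.\<close>

lemma ext_zero_shift:
  fixes P E C :: "('a, 'u) module" and M :: "('a, 'm) module"
  assumes en: "enough_modules TYPE('u) R" and M: "left_module R M"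
    and P: "projective_module R P" and p: "p \<in> lmod_hom R P M" "p ` carrier P = carrier M"
    and E: "injective_module R E" "left_module R C" "q \<in> lmod_hom R E C" "q ` carrier E = carrier C"
  shows "ext_zero R (P\<lparr>carrier := a_kernel P M p\<rparr>) (E\<lparr>carrier := a_kernel E C q\<rparr>) \<longleftrightarrow> ext_zero R M C"
proof -
  interpret P: left_module R P by (rule projective_left_module[OF P])
  have K: "submodule (a_kernel P M p) R P" by (rule submodule_kernel[OF P.left_module_axioms M p(1)])
  have PK: "left_module R (P\<lparr>carrier := a_kernel P M p\<rparr>)" by (rule P.submodule_left_module[OF K])
  \<comment> \<open>The shift ends with a lifting problem whose first argument is the syzygy, so the
    syzygy needs a projective presentation of its own.\<close>
  obtain P' :: "('a, 'u) module" and p' where P': "projective_module R P'"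
    "p' \<in> lmod_hom R P' (P\<lparr>carrier := a_kernel P M p\<rparr>)"
    "p' ` carrier P' = carrier (P\<lparr>carrier := a_kernel P M p\<rparr>)"
    using enough_projectives[OF en PK] by blast
  have "ext_zero R M C \<longleftrightarrow> extends_hom R P (a_kernel P M p) C"
    by (rule ext_zero_iff_extends[OF en E(2) M P p])
  also have "\<dots> \<longleftrightarrow> lifts_hom R (P\<lparr>carrier := a_kernel P M p\<rparr>) E q C"
    by (rule extends_iff_lifts_shift[OF P K E])
  also have "\<dots> \<longleftrightarrow> ext_zero R (P\<lparr>carrier := a_kernel P M p\<rparr>) (E\<lparr>carrier := a_kernel E C q\<rparr>)"
    by (rule ext_zero_iff_lifts[OF en PK P' E, symmetric])
  finally show ?thesis by simp
qed

lemma ext_zero_iso: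
  fixes X Y :: "('a, 'u) module" and M :: "('a, 'm) module"
  assumes X: "left_module R X" and Y: "left_module R Y" and f: "f \<in> lmod_iso R X Y"
    and V: "ext_zero R M X"
  shows "ext_zero R M Y"
  unfolding ext_zero_def
proof (intro allI impI; elim conjE)
  fix E C :: "('a, 'u) module" and q
  assume E: "injective_module R E" "left_module R C" "q \<in> lmod_hom R E C" "q ` carrier E = carrier C"
    "lmod_iso R Y (E\<lparr>carrier := a_kernel E C q\<rparr>) \<noteq> {}"
  then obtain g where g: "g \<in> lmod_iso R Y (E\<lparr>carrier := a_kernel E C q\<rparr>)" by blast
  let ?f = "inv_into (carrier X) f"
  have f': "f \<in> lmod_hom R X Y" "bij_betw f (carrier X) (carrier Y)"
    and g': "g \<in> lmod_hom R Y (E\<lparr>carrier := a_kernel E C q\<rparr>)" "bij_betw g (carrier Y) (a_kernel E C q)"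
    using f g by (auto simp: lmod_iso_def)
  have "(\<lambda>x. g (f x)) \<in> lmod_iso R X (E\<lparr>carrier := a_kernel E C q\<rparr>)"
    using lmod_hom_comp[OF f'(1) g'(1)] bij_betw_trans[OF f'(2) g'(2)]
    by (simp add: lmod_iso_def comp_def)
  then show "lifts_hom R M E q C" using V E(1-4) unfolding ext_zero_def by blast
qed

section \<open>Syzygies and global dimension\<close>

lemma projective_resolutionD:
  assumes "projective_resolution R M P \<epsilon> D"
  shows "\<And>n. projective_module R (P n)" "\<And>n. left_module R (P n)"
    "\<epsilon> \<in> lmod_hom R (P 0) M" "\<And>n. D n \<in> lmod_hom R (P (Suc n)) (P n)"
    "\<epsilon> ` carrier (P 0) = carrier M" "D 0 ` carrier (P (Suc 0)) = a_kernel (P 0) M \<epsilon>"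
    "\<And>n. D (Suc n) ` carrier (P (Suc (Suc n))) = a_kernel (P (Suc n)) (P n) (D n)"
  using assms unfolding projective_resolution_def by (simp_all add: projective_left_module)

lemma injective_coresolutionD:
  assumes "injective_coresolution R M E \<eta> \<delta>"
  shows "\<And>n. injective_module R (E n)" "\<And>n. left_module R (E n)"
    "\<eta> \<in> lmod_hom R M (E 0)" "\<And>n. \<delta> n \<in> lmod_hom R (E n) (E (Suc n))"
    "inj_on \<eta> (carrier M)" "\<eta> ` carrier M = a_kernel (E 0) (E (Suc 0)) (\<delta> 0)"
    "\<And>n. \<delta> n ` carrier (E n) = a_kernel (E (Suc n)) (E (Suc (Suc n))) (\<delta> (Suc n))"
  using assms unfolding injective_coresolution_def by (simp_all add: injective_left_module)

text \<open>Shifted by one against the usual count: index 0 is the kernel of the augmentation, so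
  index \<open>n\<close> is the (n+1)-st syzygy, a submodule of \<open>P n\<close>.\<close>

definition syzygy ::
    "('a, 'm) module \<Rightarrow> (nat \<Rightarrow> ('a, 'u) module) \<Rightarrow> ('u \<Rightarrow> 'm) \<Rightarrow> (nat \<Rightarrow> 'u \<Rightarrow> 'u) \<Rightarrow> nat \<Rightarrow> ('a, 'u) module"
  where
  "syzygy M P \<epsilon> D n = (P n)\<lparr>carrier :=
     (case n of 0 \<Rightarrow> a_kernel (P 0) M \<epsilon> | Suc k \<Rightarrow> a_kernel (P (Suc k)) (P k) (D k))\<rparr>"

lemma syzygy_presentation:
  assumes M: "left_module R M" and res: "projective_resolution R M P \<epsilon> D"
  shows "submodule (carrier (syzygy M P \<epsilon> D n)) R (P n)"
    "left_module R (syzygy M P \<epsilon> D n)"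
    "D n \<in> lmod_hom R (P (Suc n)) (syzygy M P \<epsilon> D n)"
    "D n ` carrier (P (Suc n)) = carrier (syzygy M P \<epsilon> D n)"
    "syzygy M P \<epsilon> D (Suc n) = (P (Suc n))\<lparr>carrier := a_kernel (P (Suc n)) (syzygy M P \<epsilon> D n) (D n)\<rparr>"
    "carrier (syzygy M P \<epsilon> D (Suc n)) = a_kernel (P (Suc n)) (P n) (D n)"
proof -
  note r = projective_resolutionD[OF res]
  interpret P: left_module R "P n" by (rule r)
  show sub: "submodule (carrier (syzygy M P \<epsilon> D n)) R (P n)"
    using submodule_kernel[OF r(2) M r(3)] submodule_kernel[OF r(2) r(2) r(4)]
    by (cases n) (simp_all add: syzygy_def)
  have up: "(P n)\<lparr>carrier := carrier (syzygy M P \<epsilon> D n)\<rparr> = syzygy M P \<epsilon> D n" by (simp add: syzygy_def)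
  show "left_module R (syzygy M P \<epsilon> D n)" using P.submodule_left_module[OF sub] unfolding up .
  show im: "D n ` carrier (P (Suc n)) = carrier (syzygy M P \<epsilon> D n)"
    using r(6,7) by (cases n) (simp_all add: syzygy_def)
  show "D n \<in> lmod_hom R (P (Suc n)) (syzygy M P \<epsilon> D n)"
    using lmod_hom_codomain[OF r(4)[of n], of "carrier (syzygy M P \<epsilon> D n)"] im unfolding up by simp
  show "syzygy M P \<epsilon> D (Suc n) = (P (Suc n))\<lparr>carrier := a_kernel (P (Suc n)) (syzygy M P \<epsilon> D n) (D n)\<rparr>"
    "carrier (syzygy M P \<epsilon> D (Suc n)) = a_kernel (P (Suc n)) (P n) (D n)"
    by (simp_all add: syzygy_def a_kernel_def')
qed

text \<open>\<open>C\<close> is the cokernel of an embedding of \<open>X\<close> into an injective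
  module; \<open>X\<close> is matched with the kernel up to isomorphism, as it need not be a subset
  of \<open>E\<close>.\<close>

definition is_cosyzygy :: "('a, 'r) ring_scheme \<Rightarrow> ('a, 'u) module \<Rightarrow> ('a, 'u) module \<Rightarrow> bool" where
  "is_cosyzygy R X C \<longleftrightarrow> left_module R C \<and>
     (\<exists>(E :: ('a, 'u) module) q. injective_module R E \<and> q \<in> lmod_hom R E C \<and> q ` carrier E = carrier C \<and>
        lmod_iso R X (E\<lparr>carrier := a_kernel E C q\<rparr>) \<noteq> {})"

definition cosyzygy :: "('a, 'r) ring_scheme \<Rightarrow> ('a, 'u) module \<Rightarrow> ('a, 'u) module" where
  "cosyzygy R X = (SOME C. is_cosyzygy R X C)"

lemma is_cosyzygy_cosyzygy:
  fixes X :: "('a, 'u) module"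
  assumes "enough_modules TYPE('u) R" "left_module R X"
  shows "is_cosyzygy R X (cosyzygy R X)"
proof -
  have "\<exists>C. is_cosyzygy R X C"
    unfolding is_cosyzygy_def by (rule enough_injectives[OF assms]) blast
  then show ?thesis unfolding cosyzygy_def by (rule someI_ex)
qed

lemma ext_zero_is_cosyzygy:
  fixes P X C :: "('a, 'u) module" and M :: "('a, 'm) module"
  assumes en: "enough_modules TYPE('u) R" and X: "left_module R X" and M: "left_module R M"
    and P: "projective_module R P" and p: "p \<in> lmod_hom R P M" "p ` carrier P = carrier M"
    and C: "is_cosyzygy R X C"
  shows "ext_zero R (P\<lparr>carrier := a_kernel P M p\<rparr>) X \<longleftrightarrow> ext_zero R M C"
proof -
  obtain E :: "('a, 'u) module" and q f where E: "injective_module R E" "left_module R C"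
    "q \<in> lmod_hom R E C" "q ` carrier E = carrier C" and f: "f \<in> lmod_iso R X (E\<lparr>carrier := a_kernel E C q\<rparr>)"
    using C unfolding is_cosyzygy_def by blast
  interpret E: left_module R E by (rule injective_left_module[OF E(1)])
  have lY: "left_module R (E\<lparr>carrier := a_kernel E C q\<rparr>)"
    by (rule E.submodule_left_module[OF submodule_kernel[OF E.left_module_axioms E(2,3)]])
  show ?thesis
    using ext_zero_shift[OF en M P p E] ext_zero_iso[OF X lY f]
      ext_zero_iso[OF lY X lmod_iso_inv[OF X lY f]] by blast
qed

lemma left_module_cosyzygy:
  fixes X :: "('a, 'u) module"
  assumes "enough_modules TYPE('u) R" "left_module R X"
  shows "left_module R (cosyzygy R X)" "left_module R ((cosyzygy R ^^ n) X)"
proof -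
  have *: "left_module R (cosyzygy R X)" if "left_module R X" for X :: "('a, 'u) module"
    using is_cosyzygy_cosyzygy[OF assms(1) that] by (simp add: is_cosyzygy_def)
  show "left_module R (cosyzygy R X)" by (rule *[OF assms(2)])
  show "left_module R ((cosyzygy R ^^ n) X)"
    by (induction n) (simp_all add: assms(2) *)
qed

text \<open>Each step removes one syzygy from the first argument and adds one cosyzygy to the
  second. The right side is free of \<open>P\<close>, which lets vanishing found with one resolution
  of \<open>M\<close> be carried over to any other.\<close>

lemma ext_zero_syzygy:
  fixes P :: "nat \<Rightarrow> ('a, 'u) module" and X :: "('a, 'u) module" and M :: "('a, 'm) module"
  assumes en: "enough_modules TYPE('u) R" and M: "left_module R M"
    and res: "projective_resolution R M P \<epsilon> D" and "left_module R X"
  shows "ext_zero R (syzygy M P \<epsilon> D n) X \<longleftrightarrow> ext_zero R M ((cosyzygy R ^^ Suc n) X)"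
  using assms(4)
proof (induction n arbitrary: X)
  note r = projective_resolutionD[OF res]
  {
    case 0
    have "syzygy M P \<epsilon> D 0 = (P 0)\<lparr>carrier := a_kernel (P 0) M \<epsilon>\<rparr>" by (simp add: syzygy_def)
    then show ?case
      using ext_zero_is_cosyzygy[OF en 0 M r(1) r(3) r(5) is_cosyzygy_cosyzygy[OF en 0]] by simp
  next
    case (Suc n)
    note s = syzygy_presentation[OF M res, of n]
    have "ext_zero R (syzygy M P \<epsilon> D (Suc n)) X \<longleftrightarrow> ext_zero R (syzygy M P \<epsilon> D n) (cosyzygy R X)"
      unfolding s(5)
      by (rule ext_zero_is_cosyzygy[OF en Suc.prems s(2) r(1) s(3,4) is_cosyzygy_cosyzygy[OF en Suc.prems]])
    also have "\<dots> \<longleftrightarrow> ext_zero R M ((cosyzygy R ^^ Suc n) (cosyzygy R X))"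
      by (rule Suc.IH[OF left_module_cosyzygy(1)[OF en Suc.prems]])
    also have "(cosyzygy R ^^ Suc n) (cosyzygy R X) = (cosyzygy R ^^ Suc (Suc n)) X"
      by (simp flip: funpow_swap1)
    finally show ?case .
  }
qed

text \<open>By exactness the kernel at \<open>n\<close> is the image of the preceding map: a copy of
  the resolved module for index 0, its n-th cosyzygy otherwise.\<close>

definition coresolution_kernel :: "(nat \<Rightarrow> ('a, 'u) module) \<Rightarrow> (nat \<Rightarrow> 'u \<Rightarrow> 'u) \<Rightarrow> nat \<Rightarrow> ('a, 'u) module" where
  "coresolution_kernel E \<delta> n = (E n)\<lparr>carrier := a_kernel (E n) (E (Suc n)) (\<delta> n)\<rparr>"

lemma coresolution_kernel_props:
  assumes res: "injective_coresolution R M E \<eta> \<delta>"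
  shows "submodule (carrier (coresolution_kernel E \<delta> n)) R (E n)"
    "left_module R (coresolution_kernel E \<delta> n)"
    "\<delta> n \<in> lmod_hom R (E n) (coresolution_kernel E \<delta> (Suc n))"
    "\<delta> n ` carrier (E n) = carrier (coresolution_kernel E \<delta> (Suc n))"
    "coresolution_kernel E \<delta> n = (E n)\<lparr>carrier := a_kernel (E n) (coresolution_kernel E \<delta> (Suc n)) (\<delta> n)\<rparr>"
proof -
  note r = injective_coresolutionD[OF res]
  interpret E: left_module R "E n" by (rule r)
  show sub: "submodule (carrier (coresolution_kernel E \<delta> n)) R (E n)"
    using submodule_kernel[OF r(2) r(2) r(4)] by (simp add: coresolution_kernel_def)
  show "left_module R (coresolution_kernel E \<delta> n)"
    using E.submodule_left_module[OF submodule_kernel[OF r(2) r(2) r(4)]] by (simp add: coresolution_kernel_def)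
  show im: "\<delta> n ` carrier (E n) = carrier (coresolution_kernel E \<delta> (Suc n))"
    using r(7) by (simp add: coresolution_kernel_def)
  show "\<delta> n \<in> lmod_hom R (E n) (coresolution_kernel E \<delta> (Suc n))"
    unfolding coresolution_kernel_def using r(7) by (intro lmod_hom_codomain r(4)) auto
  show "coresolution_kernel E \<delta> n = (E n)\<lparr>carrier := a_kernel (E n) (coresolution_kernel E \<delta> (Suc n)) (\<delta> n)\<rparr>"
    by (simp add: coresolution_kernel_def a_kernel_def')
qed

lemma is_cosyzygy_coresolution_kernel:
  assumes "injective_coresolution R M E \<eta> \<delta>"
  shows "is_cosyzygy R (coresolution_kernel E \<delta> n) (coresolution_kernel E \<delta> (Suc n))"
proof -
  note c = coresolution_kernel_props[OF assms]
  let ?Y = "coresolution_kernel E \<delta> n" and ?C = "coresolution_kernel E \<delta> (Suc n)"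
  have "(\<lambda>x. x) \<in> lmod_iso R ?Y ?Y" using lmod_hom_id[of R ?Y] by (simp add: lmod_iso_def bij_betw_def)
  then have "(\<lambda>x. x) \<in> lmod_iso R ?Y ((E n)\<lparr>carrier := a_kernel (E n) ?C (\<delta> n)\<rparr>)"
    using c(5)[of n] by metis
  then show ?thesis
    unfolding is_cosyzygy_def using c(2)[of "Suc n"] c(3,4)[of n] injective_coresolutionD(1)[OF assms] by blast
qed

text \<open>The same shift along a prescribed coresolution in place of chosen cosyzygies, so that
  information on the terms of \<open>E\<close> becomes usable.\<close>

lemma ext_zero_syzygy_coresolution:
  fixes P E :: "nat \<Rightarrow> ('a, 'u) module" and M :: "('a, 'm) module"
  assumes en: "enough_modules TYPE('u) R" and M: "left_module R M"
    and res: "projective_resolution R M P \<epsilon> D" and cores: "injective_coresolution R T E \<eta> \<delta>"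
  shows "ext_zero R (syzygy M P \<epsilon> D n) (coresolution_kernel E \<delta> k) \<longleftrightarrow>
    ext_zero R M (coresolution_kernel E \<delta> (k + Suc n))"
proof (induction n arbitrary: k)
  note r = projective_resolutionD[OF res]
  note c = coresolution_kernel_props[OF cores]
  note ic = is_cosyzygy_coresolution_kernel[OF cores]
  {
    case 0
    have "syzygy M P \<epsilon> D 0 = (P 0)\<lparr>carrier := a_kernel (P 0) M \<epsilon>\<rparr>" by (simp add: syzygy_def)
    then show ?case
      using ext_zero_is_cosyzygy[OF en c(2) M r(1) r(3) r(5) ic] by simp
  next
    case (Suc n)
    note s = syzygy_presentation[OF M res, of n]
    have "ext_zero R (syzygy M P \<epsilon> D (Suc n)) (coresolution_kernel E \<delta> k) \<longleftrightarrow>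
        ext_zero R (syzygy M P \<epsilon> D n) (coresolution_kernel E \<delta> (Suc k))"
      unfolding s(5)
      by (rule ext_zero_is_cosyzygy[OF en c(2) s(2) r(1) s(3,4) ic])
    also have "\<dots> \<longleftrightarrow> ext_zero R M (coresolution_kernel E \<delta> (Suc k + Suc n))"
      by (rule Suc.IH)
    finally show ?case by simp
  }
qed

lemma ext_zero_zero:
  fixes X :: "('a, 'u) module"
  assumes "left_module R M" "carrier M = {\<zero>\<^bsub>M\<^esub>}"
  shows "ext_zero R M X"
  unfolding ext_zero_def lifts_hom_def
proof (intro allI impI ballI; elim conjE)
  fix E C :: "('a, 'u) module" and q g
  assume *: "injective_module R E" "left_module R C" "q \<in> lmod_hom R E C" "g \<in> lmod_hom R M C"
  then have E: "left_module R E" by (simp add: injective_left_module)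
  have "q \<zero>\<^bsub>E\<^esub> = g \<zero>\<^bsub>M\<^esub>"
    using lmod_hom_zero[OF E *(2,3)] lmod_hom_zero[OF assms(1) *(2,4)] by simp
  then show "\<exists>h\<in>lmod_hom R M E. \<forall>x\<in>carrier M. q (h x) = g x"
    using lmod_hom_const_zero[OF E] assms(2) by (intro bexI[of _ "\<lambda>x. \<zero>\<^bsub>E\<^esub>"]) auto
qed

section \<open>Termination of minimal resolutions and coresolutions\<close>

lemma superfluous_carrier_zero:
  assumes "left_module R M" "superfluous R M (carrier M)"
  shows "carrier M = {\<zero>\<^bsub>M\<^esub>}"
proof -
  interpret M: left_module R M by fact
  have "carrier M <+>\<^bsub>M\<^esub> {\<zero>\<^bsub>M\<^esub>} = carrier M" by (auto simp: set_add_def' intro: bexI)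
  then show ?thesis using assms(2) M.submodule_zero unfolding superfluous_def by blast
qed

lemma superfluous_retract_zero:
  assumes M: "left_module R M" and sup: "superfluous R M K"
    and r: "r \<in> lmod_hom R M (M\<lparr>carrier := K\<rparr>)" "\<And>x. x \<in> K \<Longrightarrow> r x = x"
  shows "K = {\<zero>\<^bsub>M\<^esub>}"
proof -
  interpret M: left_module R M by fact
  have K: "submodule K R M" using sup by (simp add: superfluous_def)
  note KD = M.submoduleD[OF K]
  have rM: "r \<in> lmod_hom R M M" by (rule lmod_hom_codomain_subset[OF r(1) KD(1)])
  define W where "W = a_kernel M M r"
  have W: "submodule W R M" unfolding W_def by (rule submodule_kernel[OF M M rM])
  note WD = M.submoduleD[OF W]
  have "K <+>\<^bsub>M\<^esub> W = carrier M"
  proof (intro equalityI subsetI)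
    fix x assume x: "x \<in> carrier M"
    have rx: "r x \<in> K" using lmod_homD(1)[OF r(1) x] by simp
    have "r (x \<ominus>\<^bsub>M\<^esub> r x) = r x \<ominus>\<^bsub>M\<^esub> r (r x)" using lmod_hom_minus[OF M M rM x] KD(7)[OF rx] by simp
    also have "\<dots> = \<zero>\<^bsub>M\<^esub>" using r(2)[OF rx] M.minus_zero_iff KD(7)[OF rx] by simp
    finally have "x \<ominus>\<^bsub>M\<^esub> r x \<in> W" using x KD(7)[OF rx] by (simp add: W_def a_kernel_def')
    moreover have "x = r x \<oplus>\<^bsub>M\<^esub> (x \<ominus>\<^bsub>M\<^esub> r x)"
      using x KD(7)[OF rx] by (simp add: a_minus_def M.M.a_lcomm M.M.r_neg)
    ultimately show "x \<in> K <+>\<^bsub>M\<^esub> W" using rx unfolding set_add_def' by blast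
  qed (use KD(7) WD(7) in \<open>auto simp: set_add_def'\<close>)
  then have "W = carrier M" using sup W unfolding superfluous_def by blast
  then have "x \<in> W" if "x \<in> K" for x using KD(7)[OF that] by simp
  then have "x = \<zero>\<^bsub>M\<^esub>" if "x \<in> K" for x
    using r(2)[OF that] that by (simp add: W_def a_kernel_def')
  then show ?thesis using KD(2) by blast
qed

text \<open>The resolution \<open>S\<close> has a zero syzygy at index \<open>N\<close>, so at this
  index the syzygy of any resolution of \<open>M\<close> has no Ext^1 into anything. Tested on the
  next syzygy of \<open>P\<close>, this makes that syzygy a retract of
  \<open>P (Suc N)\<close>.\<close>

lemma minimal_resolution_terminates:
  fixes P S :: "nat \<Rightarrow> ('a, 'u) module" and M :: "('a, 'm) module"
  assumes en: "enough_modules TYPE('u) R" and M: "left_module R M"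
    and resS: "projective_resolution R M S \<epsilon>' D'" and S0: "\<And>k. k > N \<Longrightarrow> carrier (S k) = {\<zero>\<^bsub>S k\<^esub>}"
    and res: "projective_resolution R M P \<epsilon> D"
    and min: "\<And>n. superfluous R (P (Suc n)) (a_kernel (P (Suc n)) (P n) (D n))"
    and k: "k > Suc N"
  shows "carrier (P k) = {\<zero>\<^bsub>P k\<^esub>}"
proof -
  let ?Z = "syzygy M P \<epsilon> D"
  note s = syzygy_presentation[OF M res] and sS = syzygy_presentation[OF M resS]
  note r = projective_resolutionD[OF res] and rS = projective_resolutionD[OF resS]
  have "carrier (syzygy M S \<epsilon>' D' N) = D' N ` {\<zero>\<^bsub>S (Suc N)\<^esub>}"
    using sS(4)[of N] S0[of "Suc N"] by simp
  also have "\<dots> = {\<zero>\<^bsub>syzygy M S \<epsilon>' D' N\<^esub>}"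
    using lmod_hom_zero[OF rS(2) sS(2) sS(3), of N] by simp
  finally have "ext_zero R (syzygy M S \<epsilon>' D' N) X" for X :: "('a, 'u) module"
    by (intro ext_zero_zero sS(2))
  \<comment> \<open>Both syzygies are compared with the same iterated cosyzygy of
    \<open>X\<close>.\<close>
  then have ez: "ext_zero R (?Z N) X" if "left_module R X" for X :: "('a, 'u) module"
    using ext_zero_syzygy[OF en M res that, of N] ext_zero_syzygy[OF en M resS that, of N] \<open>ext_zero R
        (syzygy M S \<epsilon>' D' N) X\<close>
    by (simp del: funpow.simps)
  let ?K = "carrier (?Z (Suc N))"
  have "extends_hom R (P (Suc N)) (a_kernel (P (Suc N)) (?Z N) (D N)) (?Z (Suc N))"
    using ext_zero_iff_extends[OF en s(2) s(2) r(1) s(3,4)] ez[OF s(2)] by blast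
  moreover have "(P (Suc N))\<lparr>carrier := a_kernel (P (Suc N)) (?Z N) (D N)\<rparr> = ?Z (Suc N)"
    "a_kernel (P (Suc N)) (?Z N) (D N) = ?K"
    using s(5)[of N] by simp_all
  ultimately obtain h where h: "h \<in> lmod_hom R (P (Suc N)) (?Z (Suc N))" "\<And>x. x \<in> ?K \<Longrightarrow> h x = x"
    unfolding extends_hom_def using lmod_hom_id[of R "?Z (Suc N)"] by fastforce
  have "h \<in> lmod_hom R (P (Suc N)) ((P (Suc N))\<lparr>carrier := ?K\<rparr>)"
    using h(1) s(5)[of N] by simp
  moreover have "superfluous R (P (Suc N)) ?K" using min[of N] s(6)[of N] by simp
  ultimately have K0: "?K = {\<zero>\<^bsub>P (Suc N)\<^esub>}" 
    using superfluous_retract_zero[OF r(2) _ _ h(2)] by blast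
  have step: "carrier (P (Suc n)) = {\<zero>\<^bsub>P (Suc n)\<^esub>}" if "carrier (?Z n) = {\<zero>\<^bsub>P n\<^esub>}" for n
  proof -
    have "a_kernel (P (Suc n)) (P n) (D n) = carrier (P (Suc n))"
      using s(4)[of n] that by (auto simp: a_kernel_def')
    then show ?thesis using superfluous_carrier_zero[OF r(2)] min[of n] by simp
  qed
  have Z0: "carrier (?Z (Suc N + n)) = {\<zero>\<^bsub>P (Suc N + n)\<^esub>}" for n
  proof (induction n)
    case (Suc n)
    interpret P: left_module R "P (Suc N + Suc n)" by (rule r)
    show ?case using step[OF Suc] P.submoduleD(1,2)[OF s(1)] by auto
  qed (use K0 in simp)
  obtain n where "k = Suc (Suc N + n)" using k less_iff_Suc_add by auto
  then show ?thesis using step[OF Z0[of n]] by simp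
qed

text \<open>The identity of the cosyzygy \<open>?Y (Suc (Suc N))\<close> lifts to a section of the
  surjection from \<open>E (Suc N)\<close>. The image of the section meets the kernel trivially, and
  this kernel is essential. The bound on resolutions is applied to the cosyzygy, so it is assumed
  for all modules and not for \<open>M\<close> alone.\<close>

lemma minimal_coresolution_terminates:
  fixes E :: "nat \<Rightarrow> ('a, 'u) module" and M :: "('a, 'm) module"
  assumes en: "enough_modules TYPE('u) R"
    and gl: "\<And>X :: ('a, 'u) module. left_module R X \<Longrightarrow>
      \<exists>(S :: nat \<Rightarrow> ('a, 'u) module) \<epsilon> D. projective_resolution R X S \<epsilon> D \<and> (\<forall>k>N. carrier (S k) = {\<zero>\<^bsub>S k\<^esub>})"
    and res: "injective_coresolution R M E \<eta> \<delta>"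
    and min: "\<And>n. essential R (E (Suc n)) (\<delta> n ` carrier (E n))"
    and k: "k > Suc N"
  shows "carrier (E k) = {\<zero>\<^bsub>E k\<^esub>}"
proof -
  let ?Y = "coresolution_kernel E \<delta>"
  note c = coresolution_kernel_props[OF res]
  note r = injective_coresolutionD[OF res]
  let ?M = "?Y (Suc (Suc N))"
  obtain S :: "nat \<Rightarrow> ('a, 'u) module" and \<epsilon>' D' where resS: "projective_resolution R ?M S \<epsilon>' D'"
    and S0: "\<And>k. k > N \<Longrightarrow> carrier (S k) = {\<zero>\<^bsub>S k\<^esub>}"
    using gl[OF c(2)] by blast
  note rS = projective_resolutionD[OF resS] and sS = syzygy_presentation[OF c(2) resS]
  have "carrier (syzygy ?M S \<epsilon>' D' N) = D' N ` {\<zero>\<^bsub>S (Suc N)\<^esub>}"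
    using sS(4)[of N] S0[of "Suc N"] by simp
  also have "\<dots> = {\<zero>\<^bsub>syzygy ?M S \<epsilon>' D' N\<^esub>}"
    using lmod_hom_zero[OF rS(2) sS(2) sS(3), of N] by simp
  finally have "ext_zero R (syzygy ?M S \<epsilon>' D' N) (?Y 0)"
    by (intro ext_zero_zero sS(2))
  \<comment> \<open>The N + 1 syzygies of \<open>?M\<close> are traded for N + 1 cosyzygies, counted
    from index 0.\<close>
  then have "ext_zero R ?M (?Y (Suc N))"
    using ext_zero_syzygy_coresolution[OF en c(2) resS res, of N 0] by simp
  then have "lifts_hom R ?M (E (Suc N)) (\<delta> (Suc N)) ?M"
    using ext_zero_iff_lifts[OF en c(2) rS(1) rS(3) rS(5) r(1) c(2) c(3) c(4)] c(5)[of "Suc N"] by simp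
  then obtain h where h: "h \<in> lmod_hom R ?M (E (Suc N))" "\<And>x. x \<in> carrier ?M \<Longrightarrow> \<delta> (Suc N) (h x) = x"
    unfolding lifts_hom_def using lmod_hom_id[of R ?M] by fastforce
  interpret Mm: left_module R ?M by (rule c)
  have V: "submodule (h ` carrier ?M) R (E (Suc N))"
    by (rule submodule_image[OF c(2) r(2) h(1) Mm.submodule_carrier])
  have h0: "h \<zero>\<^bsub>?M\<^esub> = \<zero>\<^bsub>E (Suc N)\<^esub>" by (rule lmod_hom_zero[OF c(2) r(2) h(1)])
  have "carrier (?Y (Suc N)) \<inter> h ` carrier ?M = {\<zero>\<^bsub>E (Suc N)\<^esub>}"
  proof -
    interpret E: left_module R "E (Suc N)" by (rule r)
    have "x = \<zero>\<^bsub>?M\<^esub>" if "x \<in> carrier ?M" "h x \<in> carrier (?Y (Suc N))" for x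
    proof -
      have "\<delta> (Suc N) (h x) = \<zero>\<^bsub>E (Suc (Suc N))\<^esub>"
        using that(2) by (simp add: coresolution_kernel_def a_kernel_def')
      then show ?thesis using h(2)[OF that(1)] by (simp add: coresolution_kernel_def)
    qed
    then show ?thesis using h0 E.submoduleD(2)[OF c(1)] E.submoduleD(2)[OF V] by auto
  qed
  then have "h ` carrier ?M = {\<zero>\<^bsub>E (Suc N)\<^esub>}"
    using min[of N] V c(4)[of N] unfolding essential_def by simp
  then have "h x = \<zero>\<^bsub>E (Suc N)\<^esub>" if "x \<in> carrier ?M" for x using that by blast
  then have "carrier ?M \<subseteq> {\<zero>\<^bsub>?M\<^esub>}" using h(2) h0 Mm.zero_closed by (metis singletonI subsetI)
  moreover have "\<zero>\<^bsub>?M\<^esub> = \<zero>\<^bsub>E (Suc (Suc N))\<^esub>" by (simp add: coresolution_kernel_def)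
  ultimately have K0: "carrier (?Y (Suc (Suc N))) = {\<zero>\<^bsub>E (Suc (Suc N))\<^esub>}"
    using Mm.zero_closed by auto
  \<comment> \<open>A module in which the zero submodule is essential is zero.\<close>
  have step: "carrier (E (Suc n)) = {\<zero>\<^bsub>E (Suc n)\<^esub>}" if "carrier (?Y (Suc n)) = {\<zero>\<^bsub>E (Suc n)\<^esub>}" for n
  proof -
    interpret E: left_module R "E (Suc n)" by (rule r)
    have "{\<zero>\<^bsub>E (Suc n)\<^esub>} \<inter> carrier (E (Suc n)) = {\<zero>\<^bsub>E (Suc n)\<^esub>}" by auto
    then show ?thesis using min[of n] E.submodule_carrier that c(4)[of n] unfolding essential_def by simp
  qed
  have Y0: "carrier (?Y (Suc (Suc N + n))) = {\<zero>\<^bsub>E (Suc (Suc N + n))\<^esub>}" for n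
  proof (induction n)
    case (Suc n)
    have "carrier (?Y (Suc (Suc N + Suc n))) = {\<delta> (Suc (Suc N + n)) \<zero>\<^bsub>E (Suc (Suc N + n))\<^esub>}"
      using c(4)[of "Suc (Suc N + n)"] step[OF Suc] by simp
    then show ?case using lmod_hom_zero[OF r(2) r(2) r(4), of "Suc (Suc N + n)"] by simp
  qed (use K0 in simp)
  obtain n where "k = Suc (Suc N + n)" using k less_iff_Suc_add by auto
  then show ?thesis using step[OF Y0[of n]] by simp
qed

section \<open>Truncating projective resolutions and bounding the global dimension\<close>

lemma projective_resolution_ex:
  fixes M :: "('a, 'u) module"
  assumes en: "enough_modules TYPE('u) R" and M: "left_module R M"
  obtains P :: "nat \<Rightarrow> ('a, 'u) module" and \<epsilon> D where "projective_resolution R M P \<epsilon> D"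
proof -
  define good where "good = (\<lambda>(X :: ('a, 'u) module) (Pp :: ('a, 'u) module \<times> ('u \<Rightarrow> 'u)).
    projective_module R (fst Pp) \<and> snd Pp \<in> lmod_hom R (fst Pp) X \<and> snd Pp ` carrier (fst Pp) = carrier X)"
  define F where "F X = (SOME Pp. good X Pp)" for X
  have F: "good X (F X)" if X: "left_module R X" for X
  proof -
    obtain P :: "('a, 'u) module" and p where "projective_module R P" "p \<in> lmod_hom R P X"
        "p ` carrier P = carrier X"
      using enough_projectives[OF en X] by blast
    then have "good X (P, p)" by (simp add: good_def)
    then show ?thesis unfolding F_def by (rule someI)
  qed
  \<comment> \<open>\<open>K n\<close> is the n-th syzygy in the usual count, with
    \<open>K 0 = M\<close>; the recursion keeps \<open>M\<close> and all syzygies in the type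
    \<open>'u\<close>.\<close>
  define K where "K = rec_nat M (\<lambda>_ X. (fst (F X))\<lparr>carrier := a_kernel (fst (F X)) X (snd (F X))\<rparr>)"
  have K0: "K 0 = M"
      and KS: "K (Suc n) = (fst (F (K n)))\<lparr>carrier := a_kernel (fst (F (K n))) (K n) (snd (F (K n)))\<rparr>" for n
    by (simp_all add: K_def)
  have lK: "left_module R (K n)" for n
  proof (induction n)
    case (Suc n)
    have P: "left_module R (fst (F (K n)))" using F[OF Suc] projective_left_module by (auto simp: good_def)
    have p: "snd (F (K n)) \<in> lmod_hom R (fst (F (K n))) (K n)" using F[OF Suc] by (auto simp: good_def)
    show ?case unfolding KS
      by (rule left_module.submodule_left_module[OF P submodule_kernel[OF P Suc p]])
  qed (simp add: K0 M)
  define P where "P n = fst (F (K n))" for n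
  define p where "p n = snd (F (K n))" for n
  have g: "projective_module R (P n)" "p n \<in> lmod_hom R (P n) (K n)" "p n ` carrier (P n) = carrier (K n)" for n
    using F[OF lK[of n]] by (auto simp: good_def P_def p_def)
  have KS': "K (Suc n) = (P n)\<lparr>carrier := a_kernel (P n) (K n) (p n)\<rparr>" for n
    by (simp add: KS P_def p_def)
  have D: "p (Suc n) \<in> lmod_hom R (P (Suc n)) (P n)" for n
    using g(2)[of "Suc n"] unfolding KS' by (rule lmod_hom_codomain_subset) (auto simp: a_kernel_def')
  have "projective_resolution R M P (p 0) (\<lambda>n. p (Suc n))"
    unfolding projective_resolution_def
    using g D g(2)[of 0] g(3)[of 0] g(3)[of "Suc _"] by (auto simp: K0 KS' a_kernel_def')
  then show ?thesis by (rule that)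
qed

lemma projective_summand:
  fixes P :: "('a, 'u) module"
  assumes P: "projective_module R P" and W: "submodule W R P"
    and e: "e \<in> lmod_hom R P (P\<lparr>carrier := W\<rparr>)" "\<And>x. x \<in> W \<Longrightarrow> e x = x"
  shows "projective_module R (P\<lparr>carrier := W\<rparr>)"
proof -
  interpret P: left_module R P by (rule projective_left_module[OF P])
  note WD = P.submoduleD[OF W]
  show ?thesis
    unfolding projective_module_def
  proof (intro conjI allI impI P.submodule_left_module[OF W]; elim conjE)
    fix M N :: "('a, 'u) module" and p g
    assume *: "left_module R M" "left_module R N" "p \<in> lmod_hom R M N" "p ` carrier M = carrier N"
      "g \<in> lmod_hom R (P\<lparr>carrier := W\<rparr>) N"
    obtain h where h: "h \<in> lmod_hom R P M" "\<And>x. x \<in> carrier P \<Longrightarrow> p (h x) = g (e x)"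
      using projective_lift[OF P *(1-4) lmod_hom_comp[OF e(1) *(5)]] by blast
    have "h \<in> lmod_hom R (P\<lparr>carrier := W\<rparr>) M" by (rule lmod_hom_domain[OF h(1) WD(1)])
    then show "\<exists>h\<in>lmod_hom R (P\<lparr>carrier := W\<rparr>) M. \<forall>x\<in>carrier (P\<lparr>carrier := W\<rparr>). p (h x) = g x"
      using h(2) e(2) WD(7) by (intro bexI[of _ h]) auto
  qed
qed

text \<open>Extending the identity of the syzygy to \<open>f\<close> splits \<open>P (Suc N)\<close>
  into that syzygy and the kernel \<open>W\<close> of \<open>f\<close>. On \<open>W\<close> the
  differential is injective with unchanged image, so the resolution can stop with the projective
  summand \<open>W\<close> in degree \<open>Suc N\<close>.\<close>

lemma proj_dim_le:
  fixes M :: "('a, 'u) module" and P :: "nat \<Rightarrow> ('a, 'u) module"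
  assumes M: "left_module R M" and res: "projective_resolution R M P \<epsilon> D"
    and ext: "extends_hom R (P (Suc N)) (carrier (syzygy M P \<epsilon> D (Suc N))) (syzygy M P \<epsilon> D (Suc N))"
  shows "proj_dim R M \<le> enat (Suc N)"
proof -
  note r = projective_resolutionD[OF res]
  note s = syzygy_presentation[OF M res]
  let ?P = "P (Suc N)" and ?K = "carrier (syzygy M P \<epsilon> D (Suc N))"
  interpret P: left_module R ?P by (rule r)
  have Kup: "?P\<lparr>carrier := ?K\<rparr> = syzygy M P \<epsilon> D (Suc N)" by (simp add: syzygy_def)
  obtain f where f: "f \<in> lmod_hom R ?P (syzygy M P \<epsilon> D (Suc N))" "\<And>x. x \<in> ?K \<Longrightarrow> f x = x"
    using bspec[OF ext[unfolded extends_hom_def Kup] lmod_hom_id] by blast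
  note K = s(1)[of "Suc N"]
  note KD = P.submoduleD[OF K]
  have fK: "f x \<in> ?K" if "x \<in> carrier ?P" for x using lmod_homD(1)[OF f(1) that] .
  have fP: "f \<in> lmod_hom R ?P ?P" 
    by (rule lmod_hom_codomain_subset[OF _ KD(1)]) (simp only: Kup f(1))
  define W where "W = a_kernel ?P ?P f"
  have W: "submodule W R ?P" unfolding W_def by (rule submodule_kernel[OF r(2) r(2) fP])
  note WD = P.submoduleD[OF W]
  \<comment> \<open>The complementary projection 1 - f, onto \<open>W\<close>.\<close>
  define e where "e x = x \<ominus>\<^bsub>?P\<^esub> f x" for x
  have eh: "e \<in> lmod_hom R ?P ?P" unfolding e_def by (rule lmod_hom_diff[OF r(2) r(2) lmod_hom_id fP])
  have eW: "e x \<in> W" if x: "x \<in> carrier ?P" for x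
  proof -
    have "f (e x) = f x \<ominus>\<^bsub>?P\<^esub> f (f x)"
      unfolding e_def using lmod_hom_minus[OF r(2) r(2) fP x] KD(7)[OF fK[OF x]] by simp
    also have "\<dots> = \<zero>\<^bsub>?P\<^esub>" using f(2)[OF fK[OF x]] P.minus_zero_iff KD(7)[OF fK[OF x]] by simp
    finally show ?thesis using lmod_homD(1)[OF eh x] by (simp add: W_def a_kernel_def')
  qed
  have ee: "e x = x" if "x \<in> W" for x
    using that WD(7)[OF that] by (auto simp: e_def W_def a_kernel_def' P.M.minus_zero_right)
  have proj: "projective_module R (?P\<lparr>carrier := W\<rparr>)"
    using eW ee by (intro projective_summand[OF r(1) W, of e] lmod_hom_codomain eh) auto
  have De: "D N (e x) = D N x" if x: "x \<in> carrier ?P" for x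
  proof -
    interpret PN: left_module R "P N" by (rule r)
    have "D N (f x) = \<zero>\<^bsub>P N\<^esub>" using fK[OF x] s(6)[of N] by (auto simp: a_kernel_def')
    then show ?thesis
      unfolding e_def using lmod_hom_minus[OF r(2) r(2) r(4), of x N "f x"] x KD(7)[OF fK[OF x]]
          lmod_homD(1)[OF r(4) x]
      by (simp add: PN.M.minus_zero_right)
  qed
  have DW: "D N ` W = D N ` carrier ?P"
    using eW De WD(1) by (auto simp: image_iff) metis
  have Dinj: "x = \<zero>\<^bsub>?P\<^esub>" if "x \<in> W" "D N x = \<zero>\<^bsub>P N\<^esub>" for x
  proof -
    have "x \<in> ?K" using that WD(7) s(6)[of N] by (auto simp: a_kernel_def')
    then show ?thesis using that f(2) by (auto simp: W_def a_kernel_def')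
  qed
  have D0: "D n \<zero>\<^bsub>P (Suc n)\<^esub> = \<zero>\<^bsub>P n\<^esub>" for n by (rule lmod_hom_zero[OF r(2) r(2) r(4)])
  \<comment> \<open>The differentials are kept as functions; only the carriers change, to
    \<open>W\<close> in degree \<open>Suc N\<close> and to zero above it.\<close>
  define P' where "P' k = (if k \<le> N then P k else if k =
      Suc N then ?P\<lparr>carrier := W\<rparr> else (P k)\<lparr>carrier := {\<zero>\<^bsub>P k\<^esub>}\<rparr>)" for k
  have zp: "projective_module R ((P k)\<lparr>carrier := {\<zero>\<^bsub>P k\<^esub>}\<rparr>)" for k
  proof -
    interpret Pk: left_module R "P k" by (rule r)
    have "(\<lambda>x. \<zero>\<^bsub>P k\<^esub>) \<in> lmod_hom R (P k) ((P k)\<lparr>carrier := {\<zero>\<^bsub>P k\<^esub>}\<rparr>)"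
      by (rule lmod_hom_codomain[OF lmod_hom_const_zero[OF r(2)]]) auto
    then show ?thesis by (rule projective_summand[OF r(1) Pk.submodule_zero]) simp
  qed
  have sub: "carrier (P' k) \<subseteq> carrier (P k)" for k
  proof -
    interpret Pk: left_module R "P k" by (rule r)
    show ?thesis using WD(1) by (auto simp: P'_def)
  qed
  have Dk: "D k ` carrier (P' (Suc k)) \<subseteq> carrier (P' k)" for k
  proof -
    consider "Suc k \<le> N" | "k = N" | "k = Suc N" | "k > Suc N" by linarith
    then show ?thesis
    proof cases
      case 1 then show ?thesis using lmod_homD(1)[OF r(4), of _ k] by (auto simp: P'_def)
    next
      case 2 then show ?thesis using lmod_homD(1)[OF r(4), of _ k] WD(1) by (auto simp: P'_def)
    next
      case 3 then show ?thesis using D0[of k] WD(2) by (auto simp: P'_def)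
    next
      case 4 then show ?thesis using D0[of k] by (auto simp: P'_def)
    qed
  qed
  have same: "P' k = (P k)\<lparr>carrier := carrier (P' k)\<rparr>" for k by (simp add: P'_def)
  have Dhom: "D k \<in> lmod_hom R (P' (Suc k)) (P' k)" for k
  proof -
    have "D k \<in> lmod_hom R ((P (Suc k))\<lparr>carrier := carrier (P' (Suc k))\<rparr>) ((P k)\<lparr>carrier := carrier (P' k)\<rparr>)"
      using Dk by (intro lmod_hom_codomain lmod_hom_domain r(4) sub) simp
    then show ?thesis using same by simp
  qed
  have Dim: "D (Suc k) ` carrier (P' (Suc (Suc k))) = a_kernel (P' (Suc k)) (P' k) (D k)" for k
  proof -
    consider "Suc (Suc k) \<le> N" | "N = Suc k" | "k = N" | "k = Suc N" | "k > Suc N" by linarith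
    then show ?thesis
    proof cases
      case 1 then show ?thesis using r(7)[of k] by (auto simp: P'_def a_kernel_def')
    next
      case 2 then show ?thesis using r(7)[of k] DW by (auto simp: P'_def a_kernel_def')
    next
      case 3
      have "a_kernel (P' (Suc N)) (P' N) (D N) = {x \<in> W. D N x = \<zero>\<^bsub>P N\<^esub>}"
        by (simp add: P'_def a_kernel_def')
      also have "\<dots> = {\<zero>\<^bsub>?P\<^esub>}"
      proof (intro equalityI subsetI)
        fix x assume "x \<in> {x \<in> W. D N x = \<zero>\<^bsub>P N\<^esub>}"
        then show "x \<in> {\<zero>\<^bsub>?P\<^esub>}" using Dinj[of x] by simp
      qed (use D0[of N] WD(2) in simp)
      also have "\<dots> = D (Suc N) ` carrier (P' (Suc (Suc N)))" using D0[of "Suc N"] by (simp add: P'_def)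
      finally show ?thesis using 3 by simp
    next
      case 4 then show ?thesis using D0[of k] D0[of "Suc k"] by (auto simp: P'_def a_kernel_def')
    next
      case 5 then show ?thesis using D0[of k] D0[of "Suc k"] by (auto simp: P'_def a_kernel_def')
    qed
  qed
  have D0im: "D 0 ` carrier (P' (Suc 0)) = a_kernel (P' 0) M \<epsilon>"
    using r(6) DW by (cases N) (auto simp: P'_def a_kernel_def')
  have "projective_resolution R M P' \<epsilon> D"
    unfolding projective_resolution_def
    
  proof (intro conjI allI Dhom Dim D0im)
    show "projective_module R (P' n)" for n using r(1) proj zp by (simp add: P'_def)
    show "\<epsilon> \<in> lmod_hom R (P' 0) M" "\<epsilon> ` carrier (P' 0) = carrier M" using r(3,5) by (simp_all add: P'_def)
  qed
  moreover have "\<forall>k>Suc N. carrier (P' k) = {\<zero>\<^bsub>P' k\<^esub>}" by (simp add: P'_def)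
  ultimately show ?thesis unfolding proj_dim_def by (intro Inf_lower) blast
qed

text \<open>The target that counts is the syzygy itself; arbitrary \<open>X\<close> are allowed
  because the condition will be established by filtering the target.\<close>

lemma gl_dim_le:
  assumes en: "enough_modules TYPE('u) R"
    and ext: "\<And>(M :: ('a, 'u) module) (P :: nat \<Rightarrow> ('a, 'u) module) \<epsilon> D (X :: ('a, 'u) module).
      left_module R M \<Longrightarrow> projective_resolution R M P \<epsilon> D \<Longrightarrow> left_module R X \<Longrightarrow>
      extends_hom R (P (Suc N)) (carrier (syzygy M P \<epsilon> D (Suc N))) X"
  shows "gl_dim TYPE('u) R \<le> enat (Suc N)"
  unfolding gl_dim_def
proof (rule SUP_least)
  fix M :: "('a, 'u) module" assume "M \<in> {M. left_module R M}"
  then have M: "left_module R M" by simp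
  obtain P :: "nat \<Rightarrow> ('a, 'u) module" and \<epsilon> D where res: "projective_resolution R M P \<epsilon> D"
    using projective_resolution_ex[OF en M] by blast
  show "proj_dim R M \<le> enat (Suc N)"
    by (rule proj_dim_le[OF M res ext[OF M res syzygy_presentation(2)[OF M res]]])
qed

lemma gl_dim_finiteD:
  assumes "gl_dim TYPE('u) R < \<infinity>"
  obtains N where "\<And>M :: ('a, 'u) module. left_module R M \<Longrightarrow>
    \<exists>(S :: nat \<Rightarrow> ('a, 'u) module) \<epsilon> D. projective_resolution R M S \<epsilon> D \<and> (\<forall>k>N. carrier (S k) = {\<zero>\<^bsub>S k\<^esub>})"
proof -
  obtain N where N: "gl_dim TYPE('u) R = enat N" using assms by auto
  have "\<exists>(S :: nat \<Rightarrow> ('a, 'u) module) \<epsilon> D. projective_resolution R M S \<epsilon> D \<and> (\<forall>k>N. carrier (S k) = {\<zero>\<^bsub>S k\<^esub>})"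
    if M: "left_module R M" for M :: "('a, 'u) module"
  proof -
    let ?A = "{enat n | n. \<exists>(P :: nat \<Rightarrow> ('a, 'u) module) \<epsilon> D.
      projective_resolution R M P \<epsilon> D \<and> (\<forall>k>n. carrier (P k) = {\<zero>\<^bsub>P k\<^esub>})}"
    have le: "Inf ?A \<le> enat N"
      using N M SUP_upper[of M "{M :: ('a, 'u) module. left_module R M}" "proj_dim R"]
      unfolding gl_dim_def proj_dim_def by simp
    \<comment> \<open>Among extended naturals an infimum of at most \<open>N\<close> forces a member
      of at most \<open>N\<close>: otherwise all members would be at least
      \<open>Suc N\<close>.\<close>
    have "\<exists>y\<in>?A. y \<le> enat N"
    proof (rule ccontr)
      assume "\<not> (\<exists>y\<in>?A. y \<le> enat N)"
      then have "enat (Suc N) \<le> y" if "y \<in> ?A" for y 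
        using that unfolding Suc_ile_eq not_le[symmetric] by blast
      then have "enat (Suc N) \<le> Inf ?A" by (rule Inf_greatest)
      then have "enat (Suc N) \<le> enat N" using le by (rule order_trans)
      then show False by simp
    qed
    then obtain n and S :: "nat \<Rightarrow> ('a, 'u) module" and \<epsilon> D where "n \<le> N" "projective_resolution R M S \<epsilon> D"
      "\<forall>k>n. carrier (S k) = {\<zero>\<^bsub>S k\<^esub>}" by auto
    then show ?thesis by (meson le_less_trans)
  qed
  then show ?thesis using that by blast
qed

section \<open>Algebras that split modulo a nilpotent ideal\<close>

text \<open>A module over \<open>A\<close> carries no scalar action of its own; complex numbers act
  on it through the central elements c 1 of \<open>A\<close>, so the axioms mostly concern these
  elements.\<close>

locale complex_algebra = ring A for A :: "(complex, 'a) module" (structure) +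
  assumes csmult_closed: "a \<in> carrier A \<Longrightarrow> c \<odot> a \<in> carrier A"
    and csmult_add: "(c + c') \<odot> \<one> = c \<odot> \<one> \<oplus> c' \<odot> \<one>"
    and csmult_mult: "(c * c') \<odot> \<one> = (c \<odot> \<one>) \<otimes> (c' \<odot> \<one>)"
    and csmult_one: "1 \<odot> \<one> = \<one>"
    and csmult_eq: "a \<in> carrier A \<Longrightarrow> c \<odot> a = (c \<odot> \<one>) \<otimes> a"
    and csmult_central: "a \<in> carrier A \<Longrightarrow> (c \<odot> \<one>) \<otimes> a = a \<otimes> (c \<odot> \<one>)"
begin

definition sc :: "complex \<Rightarrow> 'a" where "sc c = c \<odot> \<one>"

lemma sc_closed [simp]: "sc c \<in> carrier A"
  by (simp add: sc_def csmult_closed)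

lemma sc_add: "sc (c + c') = sc c \<oplus> sc c'" by (simp add: sc_def csmult_add)
lemma sc_mult: "sc (c * c') = sc c \<otimes> sc c'" by (simp add: sc_def csmult_mult)
lemma sc_one [simp]: "sc 1 = \<one>" by (simp add: sc_def csmult_one)
lemma sc_comm: "a \<in> carrier A \<Longrightarrow> sc c \<otimes> a = a \<otimes> sc c" by (simp add: sc_def csmult_central)

lemma sc_zero [simp]: "sc 0 = \<zero>"
proof -
  have "sc 0 \<oplus> sc 0 = sc 0" using sc_add[of 0 0] by simp
  then show ?thesis by simp
qed

lemma cscale_sc: "cscale A M c x = sc c \<odot>\<^bsub>M\<^esub> x"
  by (simp add: cscale_def sc_def)

lemma smult_sc_comm:
  assumes "left_module A M" "a \<in> carrier A" "x \<in> carrier M"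
  shows "a \<odot>\<^bsub>M\<^esub> (sc c \<odot>\<^bsub>M\<^esub> x) = sc c \<odot>\<^bsub>M\<^esub> (a \<odot>\<^bsub>M\<^esub> x)"
proof -
  interpret M: left_module A M by fact
  show ?thesis using assms by (simp add: M.smult_assoc[symmetric] sc_comm)
qed

end

text \<open>The elements killed by every product of \<open>k\<close> members of \<open>J\<close>,
  described without forming powers of \<open>J\<close>. If \<open>J\<close> is the radical of a
  finite-dimensional algebra, this is the socle series of \<open>M\<close>.\<close>

primrec socle :: "'a set \<Rightarrow> ('a, 'm) module \<Rightarrow> nat \<Rightarrow> 'm set" where
  "socle J M 0 = {\<zero>\<^bsub>M\<^esub>}"
| "socle J M (Suc k) = {x \<in> carrier M. \<forall>j\<in>J. j \<odot>\<^bsub>M\<^esub> x \<in> socle J M k}"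

text \<open>The characters \<open>ch v\<close> identify A/J with a product of copies of the complex
  numbers indexed by \<open>V\<close>. The \<open>e v\<close> lift the standard idempotents of that
  product and are required to be orthogonal idempotents only modulo \<open>J\<close>. The last axiom
  says that products of \<open>m\<close> elements of \<open>J\<close> vanish, tested on
  \<open>\<one>\<close>.\<close>

locale split_algebra = complex_algebra A for A :: "(complex, 'a) module" (structure) +
  fixes V :: "'v set" and e :: "'v \<Rightarrow> 'a" and ch :: "'v \<Rightarrow> 'a \<Rightarrow> complex" and J :: "'a set" and m :: nat
  assumes finite_V: "finite V"
    and e_closed: "v \<in> V \<Longrightarrow> e v \<in> carrier A"
    and ch_add: "v \<in> V \<Longrightarrow> a \<in> carrier A \<Longrightarrow> b \<in> carrier A \<Longrightarrow> ch v (a \<oplus> b) = ch v a + ch v b"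
    and ch_mult: "v \<in> V \<Longrightarrow> a \<in> carrier A \<Longrightarrow> b \<in> carrier A \<Longrightarrow> ch v (a \<otimes> b) = ch v a * ch v b"
    and ch_sc: "v \<in> V \<Longrightarrow> ch v (c \<odot> \<one>) = c"
    and ch_e: "v \<in> V \<Longrightarrow> w \<in> V \<Longrightarrow> ch v (e w) = (if v = w then 1 else 0)"
    and J_def: "J = {a \<in> carrier A. \<forall>v\<in>V. ch v a = 0}"
    and nilpotent: "\<one> \<in> socle J (regular_module A) m"
begin

lemma ch_sc' [simp]: "v \<in> V \<Longrightarrow> ch v (sc c) = c" by (simp add: sc_def ch_sc)

lemma ch_one [simp]: "v \<in> V \<Longrightarrow> ch v \<one> = 1" using ch_sc'[of v 1] by simp

lemma ch_zero [simp]: "v \<in> V \<Longrightarrow> ch v \<zero> = 0" using ch_sc'[of v 0] by simp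

lemma ch_minus: "v \<in> V \<Longrightarrow> a \<in> carrier A \<Longrightarrow> b \<in> carrier A \<Longrightarrow> ch v (a \<ominus> b) = ch v a - ch v b"
proof -
  assume v: "v \<in> V" and a: "a \<in> carrier A" and b: "b \<in> carrier A"
  have "ch v (a \<ominus> b) + ch v b = ch v ((a \<ominus> b) \<oplus> b)" using v a b by (simp add: ch_add)
  also have "(a \<ominus> b) \<oplus> b = a" using a b by (simp add: a_minus_def a_assoc l_neg)
  finally show ?thesis by (simp add: algebra_simps)
qed

lemma J_closed: "j \<in> J \<Longrightarrow> j \<in> carrier A" by (simp add: J_def)

lemma J_mult: "j \<in> J \<Longrightarrow> a \<in> carrier A \<Longrightarrow> j \<otimes> a \<in> J" "j \<in> J \<Longrightarrow> a \<in> carrier A \<Longrightarrow> a \<otimes> j \<in> J"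
  by (auto simp: J_def ch_mult)

text \<open>The difference lies in \<open>J\<close> because all characters kill it: at
  \<open>w\<close> other than \<open>v\<close> since \<open>ch w (e v) = 0\<close>, at
  \<open>v\<close> since \<open>ch v (e v) = 1\<close>. Modulo \<open>J\<close>, the element
  \<open>e v\<close> thus spans a one-dimensional left ideal.\<close>

lemma e_action:
  assumes "v \<in> V" "a \<in> carrier A"
  shows "\<exists>j\<in>J. a \<otimes> e v = sc (ch v a) \<otimes> e v \<oplus> j"
proof (intro bexI)
  let ?j = "a \<otimes> e v \<ominus> sc (ch v a) \<otimes> e v"
  show "?j \<in> J" using assms by (auto simp: J_def ch_minus ch_mult e_closed ch_e)
  have c: "a \<otimes> e v \<in> carrier A" "sc (ch v a) \<otimes> e v \<in> carrier A" using assms e_closed by auto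
  then show "a \<otimes> e v = sc (ch v a) \<otimes> e v \<oplus> ?j"
    by (simp add: a_minus_def a_lcomm[of "sc (ch v a) \<otimes> e v"] r_neg)
qed

lemma e_action_module:
  assumes M: "left_module A M" and v: "v \<in> V" and a: "a \<in> carrier A" and x: "x \<in> carrier M"
  obtains j where "j \<in> J" "a \<odot>\<^bsub>M\<^esub> (e v \<odot>\<^bsub>M\<^esub> x) = sc (ch v a) \<odot>\<^bsub>M\<^esub> (e v \<odot>\<^bsub>M\<^esub> x) \<oplus>\<^bsub>M\<^esub> j \<odot>\<^bsub>M\<^esub> x"
proof -
  interpret M: left_module A M by fact
  obtain j where j: "j \<in> J" "a \<otimes> e v = sc (ch v a) \<otimes> e v \<oplus> j" using e_action[OF v a] by blast
  have "a \<odot>\<^bsub>M\<^esub> (e v \<odot>\<^bsub>M\<^esub> x) = (sc (ch v a) \<otimes> e v \<oplus> j) \<odot>\<^bsub>M\<^esub> x"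
    using a x e_closed[OF v] j(2)[symmetric] by (simp add: M.smult_assoc)
  also have "\<dots> = sc (ch v a) \<odot>\<^bsub>M\<^esub> (e v \<odot>\<^bsub>M\<^esub> x) \<oplus>\<^bsub>M\<^esub> j \<odot>\<^bsub>M\<^esub> x"
    using a x e_closed[OF v] J_closed[OF j(1)] by (simp add: M.smult_assoc M.smult_l_distr)
  finally show ?thesis using that j(1) by blast
qed

text \<open>All characters take the value 1 on the sum of the \<open>e v\<close>, so this sum is
  congruent to \<open>\<one>\<close> modulo \<open>J\<close>.\<close>

lemma e_sum_action:
  assumes M: "left_module A M" and S: "submodule S A M" and x: "x \<in> carrier M"
    and e: "\<And>v. v \<in> V \<Longrightarrow> e v \<odot>\<^bsub>M\<^esub> x \<in> S" and J: "\<And>j. j \<in> J \<Longrightarrow> j \<odot>\<^bsub>M\<^esub> x \<in> S"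
  shows "x \<in> S"
proof -
  interpret M: left_module A M by fact
  note SD = M.submoduleD[OF S]
  have F: "(\<Oplus>v\<in>F. e v) \<in> carrier A \<and> (\<Oplus>v\<in>F. e v) \<odot>\<^bsub>M\<^esub> x \<in> S \<and>
      (\<forall>w\<in>V. ch w (\<Oplus>v\<in>F. e v) = (if w \<in> F then 1 else 0))" if "finite F" "F \<subseteq> V" for F
    using that
  proof (induction F rule: finite_induct)
    case empty
    then show ?case using x SD(2) by (simp add: M.smult_zero_l)
  next
    case (insert v F)
    have c: "e v \<in> carrier A" "(\<Oplus>v\<in>F. e v) \<in> carrier A" using insert e_closed by auto
    have eq: "(\<Oplus>v\<in>insert v F. e v) = e v \<oplus> (\<Oplus>v\<in>F. e v)"
      using insert e_closed by (intro finsum_insert) auto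
    have "(e v \<oplus> (\<Oplus>v\<in>F. e v)) \<odot>\<^bsub>M\<^esub> x \<in> S"
      using insert c x e SD(3) by (simp add: M.smult_l_distr)
    moreover have "\<forall>w\<in>V. ch w (e v \<oplus> (\<Oplus>v\<in>F. e v)) = (if w \<in> insert v F then 1 else 0)"
      using insert c by (auto simp: ch_add ch_e)
    ultimately show ?case unfolding eq using c by simp
  qed
  let ?E = "\<Oplus>v\<in>V. e v"
  have E: "?E \<in> carrier A" "?E \<odot>\<^bsub>M\<^esub> x \<in> S" "\<And>w. w \<in> V \<Longrightarrow> ch w ?E = 1" using F[OF finite_V] by auto
  have "\<one> \<ominus> ?E \<in> J" using E by (simp add: J_def ch_minus)
  then have "(\<one> \<ominus> ?E) \<odot>\<^bsub>M\<^esub> x \<oplus>\<^bsub>M\<^esub> ?E \<odot>\<^bsub>M\<^esub> x \<in> S" using E J SD(3) by blast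
  moreover have "(\<one> \<ominus> ?E) \<odot>\<^bsub>M\<^esub> x \<oplus>\<^bsub>M\<^esub> ?E \<odot>\<^bsub>M\<^esub> x = ((\<one> \<ominus> ?E) \<oplus> ?E) \<odot>\<^bsub>M\<^esub> x"
    using E x by (simp add: M.smult_l_distr)
  moreover have "(\<one> \<ominus> ?E) \<oplus> ?E = \<one>" using E by (simp add: a_minus_def a_assoc l_neg)
  ultimately show ?thesis using x by (simp add: M.smult_one)
qed

text \<open>Every module is semisimple modulo \<open>J\<close>: a maximal \<open>W\<close> meeting \<open>U\<close> inside \<open>B\<close> is a complement,
  since otherwise it could be enlarged by some line spanned by \<open>e v x\<close>.\<close>

lemma complement_ex:
  assumes N: "left_module A N" and U: "submodule U A N" and B: "submodule B A N"
    and JB: "\<And>j x. j \<in> J \<Longrightarrow> x \<in> carrier N \<Longrightarrow> j \<odot>\<^bsub>N\<^esub> x \<in> B"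
  obtains W where "submodule W A N" "B \<subseteq> W" "\<forall>x\<in>carrier N. \<exists>w\<in>W. \<exists>u\<in>U. x = w \<oplus>\<^bsub>N\<^esub> u"
    "W \<inter> U \<subseteq> B"
proof -
  interpret N: left_module A N by fact
  note UD = N.submoduleD[OF U] and BD = N.submoduleD[OF B]
  define \<A> where "\<A> = {W. submodule W A N \<and> B \<subseteq> W \<and> W \<inter> U \<subseteq> B}"
  have ex: "\<exists>W\<in>\<A>. \<forall>X\<in>\<A>. W \<subseteq> X \<longrightarrow> X = W"
  proof (rule subset_Zorn_nonempty)
    show "\<A> \<noteq> {}" using B by (auto simp: \<A>_def)
  next
    fix \<C> assume ne: "\<C> \<noteq> {}" and chain: "subset.chain \<A> \<C>"
    have mem: "submodule W A N" "B \<subseteq> W" "W \<inter> U \<subseteq> B" if "W \<in> \<C>" for W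
      using chain that by (auto simp: \<A>_def subset.chain_def)
    have "submodule (\<Union>\<C>) A N"
    proof (rule N.submoduleI')
      show "\<Union>\<C> \<subseteq> carrier N" using mem(1) N.submoduleD(1) by blast
      show "\<zero>\<^bsub>N\<^esub> \<in> \<Union>\<C>" using ne mem(2) BD(2) by blast
      fix x y assume "x \<in> \<Union>\<C>" "y \<in> \<Union>\<C>"
      then obtain X Y where XY: "X \<in> \<C>" "Y \<in> \<C>" "x \<in> X" "y \<in> Y" by blast
      then have "X \<subseteq> Y \<or> Y \<subseteq> X" using chain by (auto simp: subset.chain_def)
      then obtain Z where "Z \<in> \<C>" "x \<in> Z" "y \<in> Z" using XY by blast
      then show "x \<oplus>\<^bsub>N\<^esub> y \<in> \<Union>\<C>" using N.submoduleD(3)[OF mem(1)] by blast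
    next
      fix a x assume "a \<in> carrier A" "x \<in> \<Union>\<C>"
      then show "a \<odot>\<^bsub>N\<^esub> x \<in> \<Union>\<C>" using N.submoduleD(4)[OF mem(1)] by blast
    qed
    moreover have "B \<subseteq> \<Union>\<C>" using ne mem(2) by blast
    moreover have "\<Union>\<C> \<inter> U \<subseteq> B" using mem(3) by blast
    ultimately show "\<Union>\<C> \<in> \<A>" by (simp add: \<A>_def)
  qed
  then obtain W where W\<A>: "W \<in> \<A>" and max: "\<And>X. X \<in> \<A> \<Longrightarrow> W \<subseteq> X \<Longrightarrow> X = W" by blast
  have W: "submodule W A N" "B \<subseteq> W" "W \<inter> U \<subseteq> B" using W\<A> by (auto simp: \<A>_def)
  note WD = N.submoduleD[OF W(1)]
  define S where "S = {w \<oplus>\<^bsub>N\<^esub> u | w u. w \<in> W \<and> u \<in> U}"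
  have S: "submodule S A N"
  proof (rule N.submoduleI')
    show "S \<subseteq> carrier N" using WD(7) UD(7) by (auto simp: S_def)
    have "\<zero>\<^bsub>N\<^esub> = \<zero>\<^bsub>N\<^esub> \<oplus>\<^bsub>N\<^esub> \<zero>\<^bsub>N\<^esub>" by simp
    then show "\<zero>\<^bsub>N\<^esub> \<in> S" unfolding S_def using WD(2) UD(2) by blast
  next
    fix x y assume "x \<in> S" "y \<in> S"
    then obtain w u w' u' where *: "w \<in> W" "u \<in> U" "w' \<in> W" "u' \<in> U" "x = w \<oplus>\<^bsub>N\<^esub> u" "y = w' \<oplus>\<^bsub>N\<^esub> u'"
      by (auto simp: S_def)
    then have c: "w \<in> carrier N" "u \<in> carrier N" "w' \<in> carrier N" "u' \<in> carrier N" using WD(7) UD(7) by auto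
    have "x \<oplus>\<^bsub>N\<^esub> y = (w \<oplus>\<^bsub>N\<^esub> w') \<oplus>\<^bsub>N\<^esub> (u \<oplus>\<^bsub>N\<^esub> u')" unfolding *(5,6) using c by (simp add: N.M.a_ac)
    then show "x \<oplus>\<^bsub>N\<^esub> y \<in> S" unfolding S_def using * WD(3) UD(3) by blast
  next
    fix a x assume a: "a \<in> carrier A" and "x \<in> S"
    then obtain w u where *: "w \<in> W" "u \<in> U" "x = w \<oplus>\<^bsub>N\<^esub> u" by (auto simp: S_def)
    then have "a \<odot>\<^bsub>N\<^esub> x = a \<odot>\<^bsub>N\<^esub> w \<oplus>\<^bsub>N\<^esub> a \<odot>\<^bsub>N\<^esub> u" using a WD(7) UD(7) by (simp add: N.smult_r_distr)
    then show "a \<odot>\<^bsub>N\<^esub> x \<in> S" unfolding S_def using * a WD(4) UD(4) by blast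
  qed
  note SD = N.submoduleD[OF S]
  have WS: "W \<subseteq> S"
  proof
    fix w assume w: "w \<in> W"
    then have "w = w \<oplus>\<^bsub>N\<^esub> \<zero>\<^bsub>N\<^esub>" using WD(7) by simp
    then show "w \<in> S" unfolding S_def using w UD(2) by blast
  qed
  have US: "U \<subseteq> S"
  proof
    fix u assume u: "u \<in> U"
    then have "u = \<zero>\<^bsub>N\<^esub> \<oplus>\<^bsub>N\<^esub> u" using UD(7) by simp
    then show "u \<in> S" unfolding S_def using u WD(2) by blast
  qed
  have "carrier N \<subseteq> S"
  proof
    fix x assume x: "x \<in> carrier N"
    show "x \<in> S"
    proof (rule e_sum_action[OF N S x])
      show "j \<odot>\<^bsub>N\<^esub> x \<in> S" if "j \<in> J" for j using JB[OF that x] W(2) WS by blast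
    next
      fix v assume v: "v \<in> V"
      define y where "y = e v \<odot>\<^bsub>N\<^esub> x"
      have y: "y \<in> carrier N" using x e_closed[OF v] by (simp add: y_def N.smult_closed)
      show "e v \<odot>\<^bsub>N\<^esub> x \<in> S"
      proof (rule ccontr)
        assume "e v \<odot>\<^bsub>N\<^esub> x \<notin> S"
        then have yS: "y \<notin> S" by (simp add: y_def)
        \<comment> \<open>The line through \<open>y\<close> may be added to \<open>W\<close>:
          \<open>a\<close> times \<open>y\<close> differs from a multiple of \<open>y\<close> by
          some \<open>j\<close> times \<open>x\<close>, which lies in \<open>B\<close> and so in
          \<open>W\<close>.\<close>
        define W' where "W' = {w \<oplus>\<^bsub>N\<^esub> sc c \<odot>\<^bsub>N\<^esub> y | w c. w \<in> W}"
        have cy: "sc c \<odot>\<^bsub>N\<^esub> y \<in> carrier N" for c using y by (simp add: N.smult_closed)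
        have "submodule W' A N"
        proof (rule N.submoduleI')
          show "W' \<subseteq> carrier N" using WD(7) cy by (auto simp: W'_def)
          have "\<zero>\<^bsub>N\<^esub> = \<zero>\<^bsub>N\<^esub> \<oplus>\<^bsub>N\<^esub> sc 0 \<odot>\<^bsub>N\<^esub> y" using y by (simp add: N.smult_zero_l)
          then show "\<zero>\<^bsub>N\<^esub> \<in> W'" unfolding W'_def using WD(2) by blast
        next
          fix p q assume "p \<in> W'" "q \<in> W'"
          then obtain w c w' c' where *: "w \<in> W" "w' \<in> W" "p = w \<oplus>\<^bsub>N\<^esub> sc c \<odot>\<^bsub>N\<^esub> y" "q = w' \<oplus>\<^bsub>N\<^esub> sc c' \<odot>\<^bsub>N\<^esub> y"
            by (auto simp: W'_def)
          have "p \<oplus>\<^bsub>N\<^esub> q = (w \<oplus>\<^bsub>N\<^esub> w') \<oplus>\<^bsub>N\<^esub> (sc c \<odot>\<^bsub>N\<^esub> y \<oplus>\<^bsub>N\<^esub> sc c' \<odot>\<^bsub>N\<^esub> y)"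
            unfolding *(3,4) using WD(7)[OF *(1)] WD(7)[OF *(2)] cy by (simp add: N.M.a_ac)
          also have "\<dots> = (w \<oplus>\<^bsub>N\<^esub> w') \<oplus>\<^bsub>N\<^esub> sc (c + c') \<odot>\<^bsub>N\<^esub> y"
            using y by (simp add: sc_add N.smult_l_distr)
          finally show "p \<oplus>\<^bsub>N\<^esub> q \<in> W'" unfolding W'_def using WD(3)[OF *(1,2)] by blast
        next
          fix a p assume a: "a \<in> carrier A" and "p \<in> W'"
          then obtain w c where *: "w \<in> W" "p = w \<oplus>\<^bsub>N\<^esub> sc c \<odot>\<^bsub>N\<^esub> y" by (auto simp: W'_def)
          obtain j where j: "j \<in> J" "a \<odot>\<^bsub>N\<^esub> y = sc (ch v a) \<odot>\<^bsub>N\<^esub> y \<oplus>\<^bsub>N\<^esub> j \<odot>\<^bsub>N\<^esub> x"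
            using e_action_module[OF N v a x] unfolding y_def by blast
          have jx: "j \<odot>\<^bsub>N\<^esub> x \<in> W" using JB[OF j(1) x] W(2) by blast
          have "a \<odot>\<^bsub>N\<^esub> p = a \<odot>\<^bsub>N\<^esub> w \<oplus>\<^bsub>N\<^esub> a \<odot>\<^bsub>N\<^esub> (sc c \<odot>\<^bsub>N\<^esub> y)"
            unfolding *(2) using a WD(7)[OF *(1)] cy by (simp add: N.smult_r_distr)
          also have "a \<odot>\<^bsub>N\<^esub> (sc c \<odot>\<^bsub>N\<^esub> y) = sc c \<odot>\<^bsub>N\<^esub> (a \<odot>\<^bsub>N\<^esub> y)" by (rule smult_sc_comm[OF N a y])
          also have "\<dots> = sc (c * ch v a) \<odot>\<^bsub>N\<^esub> y \<oplus>\<^bsub>N\<^esub> sc c \<odot>\<^bsub>N\<^esub> (j \<odot>\<^bsub>N\<^esub> x)"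
            unfolding j(2) sc_mult using y cy WD(7)[OF jx] by (simp add: N.smult_r_distr N.smult_assoc)
          also have "a \<odot>\<^bsub>N\<^esub> w \<oplus>\<^bsub>N\<^esub> (sc (c * ch v a) \<odot>\<^bsub>N\<^esub> y \<oplus>\<^bsub>N\<^esub> sc c \<odot>\<^bsub>N\<^esub> (j \<odot>\<^bsub>N\<^esub> x)) =
              (a \<odot>\<^bsub>N\<^esub> w \<oplus>\<^bsub>N\<^esub> sc c \<odot>\<^bsub>N\<^esub> (j \<odot>\<^bsub>N\<^esub> x)) \<oplus>\<^bsub>N\<^esub> sc (c * ch v a) \<odot>\<^bsub>N\<^esub> y"
            using a WD(7)[OF *(1)] cy WD(7)[OF jx] by (simp add: N.M.a_ac N.smult_closed)
          finally show "a \<odot>\<^bsub>N\<^esub> p \<in> W'"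
            unfolding W'_def using WD(3)[OF WD(4)[OF a *(1)] WD(4)[OF sc_closed jx]] by blast
        qed
        moreover have WW': "W \<subseteq> W'"
        proof
          fix w assume w: "w \<in> W"
          then have "w = w \<oplus>\<^bsub>N\<^esub> sc 0 \<odot>\<^bsub>N\<^esub> y" using y WD(7)[OF w] by (simp add: N.smult_zero_l)
          then show "w \<in> W'" unfolding W'_def using w by blast
        qed
        moreover have "W' \<inter> U \<subseteq> B"
        proof
          fix p assume p: "p \<in> W' \<inter> U"
          then obtain w c where *: "w \<in> W" "p = w \<oplus>\<^bsub>N\<^esub> sc c \<odot>\<^bsub>N\<^esub> y" by (auto simp: W'_def)
          have wN: "w \<in> carrier N" by (rule WD(7)[OF *(1)])
          \<comment> \<open>Otherwise \<open>y\<close> would be a multiple of p - w and lie in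
            \<open>S\<close>, contrary to \<open>yS\<close>.\<close>
          have "c = 0"
          proof (rule ccontr)
            assume c: "c \<noteq> 0"
            have "sc c \<odot>\<^bsub>N\<^esub> y = p \<ominus>\<^bsub>N\<^esub> w" unfolding *(2) using wN cy
              by (simp add: a_minus_def N.M.a_comm[of w] N.M.a_assoc N.M.r_neg)
            also have "\<dots> \<in> S" using p US WS *(1) by (intro SD(6)) auto
            finally have "sc (inverse c) \<odot>\<^bsub>N\<^esub> (sc c \<odot>\<^bsub>N\<^esub> y) \<in> S" by (rule SD(4)[OF sc_closed])
            moreover have "sc (inverse c) \<odot>\<^bsub>N\<^esub> (sc c \<odot>\<^bsub>N\<^esub> y) = y"
              using y c by (simp add: N.smult_assoc[symmetric] sc_mult[symmetric] N.smult_one)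
            ultimately show False using yS by simp
          qed
          then have "p = w" using * wN y by (simp add: N.smult_zero_l)
          then show "p \<in> B" using * p W(3) by blast
        qed
        ultimately have "W' = W" using max W(2) by (auto simp: \<A>_def)
        moreover have "y \<in> W'"
        proof -
          have "y = \<zero>\<^bsub>N\<^esub> \<oplus>\<^bsub>N\<^esub> sc 1 \<odot>\<^bsub>N\<^esub> y" using y by (simp add: N.smult_one)
          then show ?thesis unfolding W'_def using WD(2) by blast
        qed
        ultimately show False using yS WS by blast
      qed
    qed
  qed
  then have "\<forall>x\<in>carrier N. \<exists>w\<in>W. \<exists>u\<in>U. x = w \<oplus>\<^bsub>N\<^esub> u"
    unfolding S_def by blast
  then show ?thesis by (rule that[OF W(1,2) _ W(3)])
qed

lemma submodule_socle:
  assumes "left_module A M" shows "submodule (socle J M k) A M"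
proof -
  interpret M: left_module A M by fact
  show ?thesis
  proof (induction k)
    case 0 then show ?case by (simp add: M.submodule_zero)
  next
    case (Suc k)
    note D = M.submoduleD[OF Suc]
    show ?case
    proof (rule M.submoduleI')
      show "\<zero>\<^bsub>M\<^esub> \<in> socle J M (Suc k)" using D(2) J_closed by (simp add: M.smult_zero_r)
      show "x \<oplus>\<^bsub>M\<^esub> y \<in> socle J M (Suc k)" if "x \<in> socle J M (Suc k)" "y \<in> socle J M (Suc k)" for x y
        using that D(3) J_closed by (simp add: M.smult_r_distr)
      show "a \<odot>\<^bsub>M\<^esub> x \<in> socle J M (Suc k)" if "a \<in> carrier A" "x \<in> socle J M (Suc k)" for a x
        using that J_mult(1) J_closed by (simp add: M.smult_closed M.smult_assoc[symmetric])
    qed simp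
  qed
qed

lemma socle_hom:
  assumes "left_module A M" "left_module A N" "f \<in> lmod_hom A M N"
  shows "x \<in> socle J M k \<Longrightarrow> f x \<in> socle J N k"
proof (induction k arbitrary: x)
  case 0 then show ?case using lmod_hom_zero[OF assms] by simp
next
  case (Suc k)
  then show ?case using lmod_homD(1,3)[OF assms(3)] J_closed by (simp flip: lmod_homD(3)[OF assms(3)])
qed

lemma left_module_regular: "left_module A (regular_module A)"
  by (rule left_moduleI) (simp_all add: regular_module_def ring_axioms a_ac m_assoc l_distr r_distr)

lemma hom_from_regular:
  assumes "left_module A M" "x \<in> carrier M"
  shows "(\<lambda>a. a \<odot>\<^bsub>M\<^esub> x) \<in> lmod_hom A (regular_module A) M"
proof -
  interpret M: left_module A M by fact
  show ?thesis using assms(2)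
    by (intro lmod_homI) (simp_all add: regular_module_def M.smult_closed M.smult_l_distr M.smult_assoc)
qed

text \<open>Every \<open>x\<close> is the image of \<open>\<one>\<close> under the homomorphism a ->
  a x from the regular module, and homomorphisms respect the socle filtration.\<close>

lemma socle_top:
  assumes M: "left_module A M" shows "socle J M m = carrier M"
proof
  interpret M: left_module A M by fact
  show "socle J M m \<subseteq> carrier M" by (rule M.submoduleD(1)[OF submodule_socle[OF M]])
  show "carrier M \<subseteq> socle J M m"
  proof
    fix x assume x: "x \<in> carrier M"
    show "x \<in> socle J M m"
      using socle_hom[OF left_module_regular M hom_from_regular[OF M x] nilpotent] x
      by (simp add: M.smult_one)
  qed
qed

section \<open>Reduction of extension and lifting problems to modules killed by
  \<open>J\<close>\<close>

lemma socle_restrict: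
  assumes "left_module A M" "submodule U A M"
  shows "socle J (M\<lparr>carrier := U\<rparr>) k = socle J M k \<inter> U"
proof -
  interpret M: left_module A M by fact
  note UD = M.submoduleD[OF assms(2)]
  show ?thesis
  proof (induction k)
    case (Suc k) then show ?case using UD(4,7) J_closed by auto
  qed (use UD(2) in auto)
qed

text \<open>A map from \<open>K\<close> into a module killed by \<open>J\<close> can extend only if
  it vanishes on the part of \<open>K\<close> inside the submodule generated by J P. Maps from
  \<open>K\<close> to the \<open>T i\<close> extend, hence vanish there, and maps to the
  \<open>T i\<close> separate the points of \<open>X\<close>; so \<open>g\<close> vanishes there too
  and extends by zero on a complement of \<open>K\<close> modulo that submodule.\<close>

lemma extends_hom_semisimple:
  fixes T :: "'i \<Rightarrow> ('a, 't) module"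
  assumes P: "left_module A P" and K: "submodule K A P" and X: "left_module A X"
    and JX: "\<And>j x. j \<in> J \<Longrightarrow> x \<in> carrier X \<Longrightarrow> j \<odot>\<^bsub>X\<^esub> x = \<zero>\<^bsub>X\<^esub>"
    and T: "\<And>i. i \<in> Ind \<Longrightarrow> left_module A (T i)"
      "\<And>i j t. i \<in> Ind \<Longrightarrow> j \<in> J \<Longrightarrow> t \<in> carrier (T i) \<Longrightarrow> j \<odot>\<^bsub>T i\<^esub> t = \<zero>\<^bsub>T i\<^esub>"
    and sep: "\<And>x. x \<in> carrier X \<Longrightarrow> x \<noteq> \<zero>\<^bsub>X\<^esub> \<Longrightarrow> \<exists>i\<in>Ind. \<exists>f\<in>lmod_hom A X (T i). f x \<noteq> \<zero>\<^bsub>T i\<^esub>"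
    and ext: "\<And>i. i \<in> Ind \<Longrightarrow> extends_hom A P K (T i)"
  shows "extends_hom A P K X"
  unfolding extends_hom_def
proof
  interpret P: left_module A P by fact
  interpret X: left_module A X by fact
  fix g assume g: "g \<in> lmod_hom A (P\<lparr>carrier := K\<rparr>) X"
  note KD = P.submoduleD[OF K]
  \<comment> \<open>Its intersection \<open>B\<close> is the submodule generated by J P.\<close>
  define \<U> where "\<U> = {U. submodule U A P \<and> (\<forall>j\<in>J. \<forall>x\<in>carrier P. j \<odot>\<^bsub>P\<^esub> x \<in> U)}"
  define B where "B = \<Inter>\<U>"
  have PU: "carrier P \<in> \<U>" using P.submodule_carrier J_closed by (auto simp: \<U>_def P.smult_closed)
  have B: "submodule B A P"
  proof (rule P.submoduleI')
    show "B \<subseteq> carrier P" using PU by (auto simp: B_def)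
    show "\<zero>\<^bsub>P\<^esub> \<in> B" using P.submoduleD(2) by (auto simp: B_def \<U>_def)
    show "x \<oplus>\<^bsub>P\<^esub> y \<in> B" if "x \<in> B" "y \<in> B" for x y
      using that P.submoduleD(3) unfolding B_def \<U>_def by blast
    show "a \<odot>\<^bsub>P\<^esub> x \<in> B" if "a \<in> carrier A" "x \<in> B" for a x
      using that P.submoduleD(4) unfolding B_def \<U>_def by blast
  qed
  have JB: "j \<odot>\<^bsub>P\<^esub> x \<in> B" if "j \<in> J" "x \<in> carrier P" for j x
    using that by (auto simp: B_def \<U>_def)
  have gB: "g x = \<zero>\<^bsub>X\<^esub>" if x: "x \<in> B" "x \<in> K" for x
  proof (rule ccontr)
    have gx: "g x \<in> carrier X" using lmod_homD(1)[OF g] x(2) by simp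
    assume "g x \<noteq> \<zero>\<^bsub>X\<^esub>"
    then obtain i f where i: "i \<in> Ind" and f: "f \<in> lmod_hom A X (T i)" "f (g x) \<noteq> \<zero>\<^bsub>T i\<^esub>"
      using sep[OF gx] by blast
    obtain h where h: "h \<in> lmod_hom A P (T i)" "\<And>y. y \<in> K \<Longrightarrow> h y = f (g y)"
      using bspec[OF ext[OF i, unfolded extends_hom_def] lmod_hom_comp[OF g f(1)]] by blast
    have "a_kernel P (T i) h \<in> \<U>"
      using submodule_kernel[OF P T(1)[OF i] h(1)] T(2)[OF i] lmod_homD(1,3)[OF h(1)] J_closed
      by (auto simp: \<U>_def a_kernel_def' P.smult_closed)
    then have "h x = \<zero>\<^bsub>T i\<^esub>" using x(1) by (auto simp: B_def a_kernel_def')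
    then show False using h(2)[OF x(2)] f(2) by simp
  qed
  obtain W where W: "submodule W A P" "B \<subseteq> W"
    "\<forall>x\<in>carrier P. \<exists>w\<in>W. \<exists>u\<in>K. x = w \<oplus>\<^bsub>P\<^esub> u" "W \<inter> K \<subseteq> B"
    by (rule complement_ex[OF P K B JB])
  have gW: "g x = \<zero>\<^bsub>X\<^esub>" if "x \<in> W" "x \<in> K" for x using gB W(4) that by blast
  show "\<exists>h\<in>lmod_hom A P X. \<forall>x\<in>K. h x = g x"
  proof (rule lmod_hom_extend[OF P X K W(1) _ g gW])
    fix h assume "h \<in> lmod_hom A P X" "\<And>u. u \<in> K \<Longrightarrow> h u = g u"
    then show ?thesis by blast
  qed (use W(3) in auto)
qed

text \<open>Induction on the socle length, an instance of the exactness of Ext^1 in the middle. The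
  quotient of \<open>X\<close> by its k-th socle is killed by \<open>J\<close>; the extension into
  this quotient is lifted to \<open>X\<close> by projectivity of \<open>P\<close>, and the error on
  \<open>K\<close> falls into the k-th socle, where the induction hypothesis corrects it.\<close>

lemma extends_hom_all:
  fixes P X :: "('a, 'u) module"
  assumes P: "projective_module A P" and K: "submodule K A P"
    and ss: "\<And>Y :: ('a, 'u) module. left_module A Y \<Longrightarrow>
      (\<And>j x. j \<in> J \<Longrightarrow> x \<in> carrier Y \<Longrightarrow> j \<odot>\<^bsub>Y\<^esub> x = \<zero>\<^bsub>Y\<^esub>) \<Longrightarrow> extends_hom A P K Y"
    and X: "left_module A X"
  shows "extends_hom A P K X"
proof -
  have lP: "left_module A P" by (rule projective_left_module[OF P])
  interpret P: left_module A P by fact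
  note KD = P.submoduleD[OF K]
  have "extends_hom A P K X" if "left_module A X" "socle J X k = carrier X" for X :: "('a, 'u) module" and k
    using that
  proof (induction k arbitrary: X)
    case 0
    then show ?case using extends_hom_zero[OF lP 0(1) K] by simp
  next
    case (Suc k)
    interpret X: left_module A X by fact
    let ?S = "socle J X k"
    have S: "submodule ?S A X" by (rule submodule_socle[OF Suc.prems(1)])
    note SD = X.submoduleD[OF S]
    obtain Y :: "('a, 'u) module" and p where Y: "left_module A Y"
        and p: "p \<in> lmod_hom A X Y" "p ` carrier X = carrier Y"
      and ker: "a_kernel X Y p = ?S" using quotient_module_ex[OF Suc.prems(1) S] by blast
    have ker_iff: "x \<in> ?S \<longleftrightarrow> x \<in> carrier X \<and> p x = \<zero>\<^bsub>Y\<^esub>" for x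
      unfolding ker[symmetric] by (simp add: a_kernel_def')
    have JY: "j \<odot>\<^bsub>Y\<^esub> y = \<zero>\<^bsub>Y\<^esub>" if j: "j \<in> J" and y: "y \<in> carrier Y" for j y
    proof -
      obtain x where x: "x \<in> carrier X" "y = p x" using y p(2) by blast
      have "x \<in> socle J X (Suc k)" using x(1) unfolding Suc.prems(2) .
      then have "j \<odot>\<^bsub>X\<^esub> x \<in> ?S" using j by simp
      then show ?thesis using x lmod_homD(3)[OF p(1) J_closed[OF j] x(1)] ker_iff by simp
    qed
    have XS: "left_module A (X\<lparr>carrier := ?S\<rparr>)" by (rule X.submodule_left_module[OF S])
    have "socle J (X\<lparr>carrier := ?S\<rparr>) k = carrier (X\<lparr>carrier := ?S\<rparr>)"
      using socle_restrict[OF Suc.prems(1) S] by simp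
    from Suc.IH[OF XS this] have IH: "extends_hom A P K (X\<lparr>carrier := ?S\<rparr>)" .
    show ?case
      unfolding extends_hom_def
    proof
      fix g assume g: "g \<in> lmod_hom A (P\<lparr>carrier := K\<rparr>) X"
      have PK: "left_module A (P\<lparr>carrier := K\<rparr>)" by (rule P.submodule_left_module[OF K])
      obtain h where h: "h \<in> lmod_hom A P Y" "\<And>x. x \<in> K \<Longrightarrow> h x = p (g x)"
        using bspec[OF ss[OF Y JY, unfolded extends_hom_def] lmod_hom_comp[OF g p(1)]] by blast
      obtain l where l: "l \<in> lmod_hom A P X" "\<And>x. x \<in> carrier P \<Longrightarrow> p (l x) = h x"
        using projective_lift[OF P Suc.prems(1) Y p h(1)] by blast
      let ?d = "\<lambda>x. g x \<ominus>\<^bsub>X\<^esub> l x"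
      have lK: "l \<in> lmod_hom A (P\<lparr>carrier := K\<rparr>) X" by (rule lmod_hom_domain[OF l(1) KD(1)])
      have d: "?d \<in> lmod_hom A (P\<lparr>carrier := K\<rparr>) X" by (rule lmod_hom_diff[OF PK Suc.prems(1) g lK])
      have c: "g x \<in> carrier X" "l x \<in> carrier X" if "x \<in> K" for x
        using lmod_homD(1)[OF g] lmod_homD(1)[OF lK] that by auto
      have "?d x \<in> ?S" if x: "x \<in> K" for x
      proof -
        interpret Y: left_module A Y by fact
        have "p (?d x) = p (g x) \<ominus>\<^bsub>Y\<^esub> p (l x)" by (rule lmod_hom_minus[OF Suc.prems(1) Y p(1) c[OF x]])
        also have "\<dots> = \<zero>\<^bsub>Y\<^esub>" using l(2)[OF KD(7)[OF x]] h(2)[OF x] lmod_homD(1)[OF p(1) c(1)[OF x]]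
          by (simp add: Y.minus_zero_iff)
        finally show ?thesis using c[OF x] by (simp add: ker_iff)
      qed
      then have "?d \<in> lmod_hom A (P\<lparr>carrier := K\<rparr>) (X\<lparr>carrier := ?S\<rparr>)" by (intro lmod_hom_codomain d) auto
      then obtain f where f: "f \<in> lmod_hom A P (X\<lparr>carrier := ?S\<rparr>)" "\<And>x. x \<in> K \<Longrightarrow> f x = ?d x"
        using bspec[OF IH[unfolded extends_hom_def]] by blast
      have "f \<in> lmod_hom A P X" by (rule lmod_hom_codomain_subset[OF f(1) SD(1)])
      then have "(\<lambda>x. f x \<oplus>\<^bsub>X\<^esub> l x) \<in> lmod_hom A P X" by (rule lmod_hom_add[OF lP Suc.prems(1) _ l(1)])
      moreover have "f x \<oplus>\<^bsub>X\<^esub> l x = g x" if x: "x \<in> K" for x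
        using f(2)[OF x] c[OF x] by (simp add: a_minus_def X.M.a_assoc X.M.l_neg)
      ultimately show "\<exists>h\<in>lmod_hom A P X. \<forall>x\<in>K. h x = g x"
        by (intro bexI[of _ "\<lambda>x. f x \<oplus>\<^bsub>X\<^esub> l x"] ballI)
    qed
  qed
  then show ?thesis using X socle_top by blast
qed

text \<open>The image of \<open>g\<close> consists of elements killed by \<open>J\<close>. By
  hypothesis their components under the \<open>e v\<close> come from the part of \<open>E\<close>
  killed by \<open>J\<close>; in that part the kernel of \<open>q\<close> has a complement
  \<open>W\<close>, on which \<open>q\<close> can be inverted.\<close>

lemma lifts_hom_semisimple:
  assumes M: "left_module A M" and E: "left_module A E" and C: "left_module A C" and q: "q \<in> lmod_hom A E C"
    and JM: "\<And>j x. j \<in> J \<Longrightarrow> x \<in> carrier M \<Longrightarrow> j \<odot>\<^bsub>M\<^esub> x = \<zero>\<^bsub>M\<^esub>"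
    and lift: "\<And>v c. v \<in> V \<Longrightarrow> c \<in> carrier C \<Longrightarrow> (\<And>j. j \<in> J \<Longrightarrow> j \<odot>\<^bsub>C\<^esub> c = \<zero>\<^bsub>C\<^esub>) \<Longrightarrow> e v \<odot>\<^bsub>C\<^esub> c = c \<Longrightarrow>
      \<exists>x\<in>carrier E. q x = c \<and> (\<forall>j\<in>J. j \<odot>\<^bsub>E\<^esub> x = \<zero>\<^bsub>E\<^esub>)"
  shows "lifts_hom A M E q C"
  unfolding lifts_hom_def
proof
  interpret M: left_module A M by fact
  interpret E: left_module A E by fact
  interpret C: left_module A C by fact
  fix g assume g: "g \<in> lmod_hom A M C"
  let ?S = "socle J E (Suc 0)"
  let ?N = "E\<lparr>carrier := ?S\<rparr>"
  have S: "submodule ?S A E" by (rule submodule_socle[OF E])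
  note SD = E.submoduleD[OF S]
  interpret N: left_module A ?N by (rule E.submodule_left_module[OF S])
  have qN: "q \<in> lmod_hom A ?N C" by (rule lmod_hom_domain[OF q SD(1)])
  let ?U = "a_kernel ?N C q"
  have U: "submodule ?U A ?N" by (rule submodule_kernel[OF N.left_module_axioms C qN])
  \<comment> \<open>\<open>J\<close> kills all of \<open>?N\<close>, so \<open>B\<close> can be
    taken zero and the complement of the kernel is direct.\<close>
  have JN: "j \<odot>\<^bsub>?N\<^esub> x \<in> {\<zero>\<^bsub>?N\<^esub>}" if "j \<in> J" "x \<in> carrier ?N" for j x using that by simp
  obtain W where W: "submodule W A ?N" "{\<zero>\<^bsub>?N\<^esub>} \<subseteq> W"
    "\<forall>x\<in>carrier ?N. \<exists>w\<in>W. \<exists>u\<in>?U. x = w \<oplus>\<^bsub>?N\<^esub> u" "W \<inter> ?U \<subseteq> {\<zero>\<^bsub>?N\<^esub>}"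
    by (rule complement_ex[OF N.left_module_axioms U N.submodule_zero JN])
  have WE: "submodule W A E" by (rule submodule_trans[OF E S W(1)])
  note WD = E.submoduleD[OF WE]
  have WS: "W \<subseteq> ?S" using N.submoduleD(1)[OF W(1)] by simp
  have qW: "submodule (q ` W) A C" by (rule submodule_image[OF E C q WE])
  note qWD = C.submoduleD[OF qW]
  have gW: "g x \<in> q ` W" if x: "x \<in> carrier M" for x
  proof (rule e_sum_action[OF C qW])
    show gx: "g x \<in> carrier C" by (rule lmod_homD(1)[OF g x])
    have Jg: "j \<odot>\<^bsub>C\<^esub> g x = \<zero>\<^bsub>C\<^esub>" if "j \<in> J" for j
      using lmod_homD(3)[OF g J_closed[OF that] x] JM[OF that x] lmod_hom_zero[OF M C g] by simp
    show "j \<odot>\<^bsub>C\<^esub> g x \<in> q ` W" if "j \<in> J" for j using Jg[OF that] qWD(2) by simp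
    fix v assume v: "v \<in> V"
    let ?c = "e v \<odot>\<^bsub>C\<^esub> g x"
    note ev = e_closed[OF v]
    have c: "?c \<in> carrier C" using ev gx by (simp add: C.smult_closed)
    have Jc: "j \<odot>\<^bsub>C\<^esub> ?c = \<zero>\<^bsub>C\<^esub>" if "j \<in> J" for j
      using Jg[OF J_mult(1)[OF that ev]] ev gx J_closed[OF that] by (simp add: C.smult_assoc)
    have ec: "e v \<odot>\<^bsub>C\<^esub> ?c = ?c"
    proof -
      obtain j where "j \<in> J" "e v \<odot>\<^bsub>C\<^esub> ?c = sc (ch v (e v)) \<odot>\<^bsub>C\<^esub> ?c \<oplus>\<^bsub>C\<^esub> j \<odot>\<^bsub>C\<^esub> g x"
        using e_action_module[OF C v ev gx] by blast
      then show ?thesis using Jg c v by (simp add: ch_e C.smult_one)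
    qed
    obtain y where y: "y \<in> carrier E" "q y = ?c" "\<forall>j\<in>J. j \<odot>\<^bsub>E\<^esub> y = \<zero>\<^bsub>E\<^esub>"
      using lift[OF v c Jc ec] by blast
    then have "y \<in> carrier ?N" by simp
    from bspec[OF W(3) this] obtain w u where wu: "w \<in> W" "u \<in> ?U" "y = w \<oplus>\<^bsub>E\<^esub> u" by auto
    then have "q y = q w \<oplus>\<^bsub>C\<^esub> \<zero>\<^bsub>C\<^esub>"
      using lmod_homD(2)[OF q WD(7)[OF wu(1)], of u] by (simp add: a_kernel_def')
    also have "\<dots> = q w" using lmod_homD(1)[OF q WD(7)[OF wu(1)]] by simp
    finally show "?c \<in> q ` W" using y(2) imageI[OF wu(1), of q] by simp
  qed
  have inj: "w = w'" if w: "w \<in> W" "w' \<in> W" "q w = q w'" for w w'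
  proof -
    have "q (w \<ominus>\<^bsub>E\<^esub> w') = q w \<ominus>\<^bsub>C\<^esub> q w'" by (rule lmod_hom_minus[OF E C q WD(7)[OF w(1)] WD(7)[OF w(2)]])
    also have "\<dots> = \<zero>\<^bsub>C\<^esub>" using w(3) lmod_homD(1)[OF q WD(7)[OF w(2)]] by (simp add: C.minus_zero_iff)
    finally have "w \<ominus>\<^bsub>E\<^esub> w' \<in> W \<inter> ?U" using WD(6)[OF w(1,2)] WS by (auto simp: a_kernel_def')
    then have "w \<ominus>\<^bsub>E\<^esub> w' = \<zero>\<^bsub>E\<^esub>" using W(4) by auto
    then show ?thesis using E.minus_zero_iff WD(7) w(1,2) by blast
  qed
  define h where "h x = (SOME w. w \<in> W \<and> q w = g x)" for x
  have h: "h x \<in> W" "q (h x) = g x" if "x \<in> carrier M" for x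
  proof -
    have "\<exists>w. w \<in> W \<and> q w = g x" using gW[OF that] by force
    then have "h x \<in> W \<and> q (h x) = g x" unfolding h_def by (rule someI_ex)
    then show "h x \<in> W" "q (h x) = g x" by auto
  qed
  have "h \<in> lmod_hom A M E"
  proof (rule lmod_homI)
    fix x y assume xy: "x \<in> carrier M" "y \<in> carrier M"
    show "h (x \<oplus>\<^bsub>M\<^esub> y) = h x \<oplus>\<^bsub>E\<^esub> h y"
    proof (rule inj)
      show "q (h (x \<oplus>\<^bsub>M\<^esub> y)) = q (h x \<oplus>\<^bsub>E\<^esub> h y)"
        using xy h lmod_homD(2)[OF g xy] lmod_homD(2)[OF q WD(7) WD(7), OF h(1) h(1), OF xy] by simp
    qed (use xy h WD(3) in auto)
  next
    fix a x assume ax: "a \<in> carrier A" "x \<in> carrier M"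
    show "h (a \<odot>\<^bsub>M\<^esub> x) = a \<odot>\<^bsub>E\<^esub> h x"
    proof (rule inj)
      show "q (h (a \<odot>\<^bsub>M\<^esub> x)) = q (a \<odot>\<^bsub>E\<^esub> h x)"
        using ax h lmod_homD(3)[OF g ax] lmod_homD(3)[OF q ax(1) WD(7)[OF h(1)[OF ax(2)]]]
        by (simp add: M.smult_closed)
    qed (use ax h WD(4) M.smult_closed in auto)
  qed (use h(1) WD(7) in auto)
  then show "\<exists>h\<in>lmod_hom A M E. \<forall>x\<in>carrier M. q (h x) = g x" using h(2) by blast
qed

text \<open>Dual induction, on the socle length of the source: a lift on the k-th socle extends to
  all of \<open>M\<close> because \<open>E\<close> is injective, and the remaining error factors
  through the quotient, which is killed by \<open>J\<close>.\<close>

lemma lifts_hom_all: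
  fixes E M :: "('a, 'u) module"
  assumes E: "injective_module A E" and C: "left_module A C" and q: "q \<in> lmod_hom A E C"
    and ss: "\<And>Y :: ('a, 'u) module. left_module A Y \<Longrightarrow>
      (\<And>j x. j \<in> J \<Longrightarrow> x \<in> carrier Y \<Longrightarrow> j \<odot>\<^bsub>Y\<^esub> x = \<zero>\<^bsub>Y\<^esub>) \<Longrightarrow> lifts_hom A Y E q C"
    and M: "left_module A M"
  shows "lifts_hom A M E q C"
proof -
  have lE: "left_module A E" by (rule injective_left_module[OF E])
  interpret E: left_module A E by fact
  interpret C: left_module A C by fact
  have "lifts_hom A M E q C" if "left_module A M" "socle J M k = carrier M" for M :: "('a, 'u) module" and k
    using that
  proof (induction k arbitrary: M)
    case 0
    interpret M: left_module A M by fact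
    show ?case
      unfolding lifts_hom_def
    proof
      fix g assume g: "g \<in> lmod_hom A M C"
      have "q \<zero>\<^bsub>E\<^esub> = g \<zero>\<^bsub>M\<^esub>" using lmod_hom_zero[OF lE C q] lmod_hom_zero[OF 0(1) C g] by simp
      moreover have "x = \<zero>\<^bsub>M\<^esub>" if "x \<in> carrier M" for x using that 0(2) by auto
      ultimately have "\<forall>x\<in>carrier M. q \<zero>\<^bsub>E\<^esub> = g x" by metis
      then show "\<exists>h\<in>lmod_hom A M E. \<forall>x\<in>carrier M. q (h x) = g x"
        by (intro bexI[of _ "\<lambda>x. \<zero>\<^bsub>E\<^esub>"] lmod_hom_const_zero[OF lE])
    qed
  next
    case (Suc k)
    note lM = Suc.prems(1)
    interpret M: left_module A M by fact
    let ?S = "socle J M k"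
    have S: "submodule ?S A M" by (rule submodule_socle[OF lM])
    note SD = M.submoduleD[OF S]
    obtain Y :: "('a, 'u) module" and p where Y: "left_module A Y"
        and p: "p \<in> lmod_hom A M Y" "p ` carrier M = carrier Y"
      and ker: "a_kernel M Y p = ?S" using quotient_module_ex[OF lM S] by blast
    have ker_iff: "x \<in> ?S \<longleftrightarrow> x \<in> carrier M \<and> p x = \<zero>\<^bsub>Y\<^esub>" for x
      unfolding ker[symmetric] by (simp add: a_kernel_def')
    have JY: "j \<odot>\<^bsub>Y\<^esub> y = \<zero>\<^bsub>Y\<^esub>" if j: "j \<in> J" and y: "y \<in> carrier Y" for j y
    proof -
      obtain x where x: "x \<in> carrier M" "y = p x" using y p(2) by blast
      have "x \<in> socle J M (Suc k)" using x(1) unfolding Suc.prems(2) .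
      then have "j \<odot>\<^bsub>M\<^esub> x \<in> ?S" using j by simp
      then show ?thesis using x lmod_homD(3)[OF p(1) J_closed[OF j] x(1)] ker_iff by simp
    qed
    have MS: "left_module A (M\<lparr>carrier := ?S\<rparr>)" by (rule M.submodule_left_module[OF S])
    have "socle J (M\<lparr>carrier := ?S\<rparr>) k = carrier (M\<lparr>carrier := ?S\<rparr>)"
      using socle_restrict[OF lM S] by simp
    from Suc.IH[OF MS this] have IH: "lifts_hom A (M\<lparr>carrier := ?S\<rparr>) E q C" .
    show ?case
      unfolding lifts_hom_def
    proof
      fix g assume g: "g \<in> lmod_hom A M C"
      have gS: "g \<in> lmod_hom A (M\<lparr>carrier := ?S\<rparr>) C" by (rule lmod_hom_domain[OF g SD(1)])
      obtain h where h: "h \<in> lmod_hom A (M\<lparr>carrier := ?S\<rparr>) E" "\<And>x. x \<in> ?S \<Longrightarrow> q (h x) = g x"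
        using bspec[OF IH[unfolded lifts_hom_def] gS] by auto
      obtain h' where h': "h' \<in> lmod_hom A M E" "\<And>x. x \<in> ?S \<Longrightarrow> h' x = h x"
        using injective_extend_submodule[OF E lM S h(1)] by blast
      have qh: "(\<lambda>x. q (h' x)) \<in> lmod_hom A M C" by (rule lmod_hom_comp[OF h'(1) q])
      let ?d = "\<lambda>x. g x \<ominus>\<^bsub>C\<^esub> q (h' x)"
      have d: "?d \<in> lmod_hom A M C" by (rule lmod_hom_diff[OF lM C g qh])
      have c: "g x \<in> carrier C" "q (h' x) \<in> carrier C" if "x \<in> carrier M" for x
        using lmod_homD(1)[OF g that] lmod_homD(1)[OF qh that] by auto
      have "?d x = \<zero>\<^bsub>C\<^esub>" if "x \<in> carrier M" "p x = \<zero>\<^bsub>Y\<^esub>" for x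
      proof -
        have "x \<in> ?S" using that ker_iff by simp
        then show ?thesis using h(2) h'(2) c[OF that(1)] by (simp add: C.minus_zero_iff)
      qed
      then obtain f where f: "f \<in> lmod_hom A Y C" "\<And>x. x \<in> carrier M \<Longrightarrow> f (p x) = ?d x"
        using lmod_hom_factor[OF lM Y C p d] by blast
      obtain l where l: "l \<in> lmod_hom A Y E" "\<And>y. y \<in> carrier Y \<Longrightarrow> q (l y) = f y"
        using bspec[OF ss[OF Y JY, unfolded lifts_hom_def] f(1)] by blast
      have lp: "(\<lambda>x. l (p x)) \<in> lmod_hom A M E" by (rule lmod_hom_comp[OF p(1) l(1)])
      have "(\<lambda>x. l (p x) \<oplus>\<^bsub>E\<^esub> h' x) \<in> lmod_hom A M E" by (rule lmod_hom_add[OF lM lE lp h'(1)])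
      moreover have "q (l (p x) \<oplus>\<^bsub>E\<^esub> h' x) = g x" if x: "x \<in> carrier M" for x
      proof -
        have "q (l (p x) \<oplus>\<^bsub>E\<^esub> h' x) = ?d x \<oplus>\<^bsub>C\<^esub> q (h' x)"
          using lmod_homD(2)[OF q lmod_homD(1)[OF lp x] lmod_homD(1)[OF h'(1) x]]
            l(2)[OF lmod_homD(1)[OF p(1) x]] f(2)[OF x] by simp
        then show ?thesis using c[OF x] by (simp add: a_minus_def C.M.a_assoc C.M.l_neg)
      qed
      ultimately show "\<exists>h\<in>lmod_hom A M E. \<forall>x\<in>carrier M. q (h x) = g x"
        by (intro bexI[of _ "\<lambda>x. l (p x) \<oplus>\<^bsub>E\<^esub> h' x"] ballI)
    qed
  qed
  then show ?thesis using M socle_top by blast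
qed

end

section \<open>Global dimension and the resolutions of a family of test modules\<close>

lemma projective_resolution_iso:
  assumes M: "left_module R M" and N: "left_module R N"
    and res: "projective_resolution R M P \<epsilon> D" and f: "f \<in> lmod_iso R M N"
  shows "projective_resolution R N P (\<lambda>x. f (\<epsilon> x)) D"
proof -
  note r = projective_resolutionD[OF res]
  have fh: "f \<in> lmod_hom R M N" and b: "inj_on f (carrier M)" "f ` carrier M = carrier N"
    using f by (auto simp: lmod_iso_def bij_betw_def)
  have inj: "\<forall>x\<in>carrier M. f x = \<zero>\<^bsub>N\<^esub> \<longrightarrow> x = \<zero>\<^bsub>M\<^esub>" using b(1) lmod_hom_inj_iff[OF M N fh] by blast
  have ker: "a_kernel (P 0) N (\<lambda>x. f (\<epsilon> x)) = a_kernel (P 0) M \<epsilon>"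
    using inj lmod_homD(1)[OF r(3)] lmod_hom_zero[OF M N fh] unfolding a_kernel_def' by fastforce
  have im: "(\<lambda>x. f (\<epsilon> x)) ` carrier (P 0) = carrier N" using r(5) b(2) by (simp flip: image_image)
  show ?thesis
    using res lmod_hom_comp[OF r(3) fh] im unfolding projective_resolution_def ker by simp
qed

context split_algebra
begin

text \<open>A coresolution of \<open>T i\<close> that stops has a zero cosyzygy, and shifting back
  yields Ext^1 = 0 from every (N+1)-st syzygy to \<open>T i\<close>. As the \<open>T i\<close>
  separate the points of modules killed by \<open>J\<close>, all targets follow.\<close>

lemma gl_dim_le_of_coresolutions:
  fixes T :: "'i \<Rightarrow> ('a, 't) module" and E :: "'i \<Rightarrow> nat \<Rightarrow> ('a, 'u) module"
  assumes en: "enough_modules TYPE('u) A"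
    and T: "\<And>i. i \<in> Ind \<Longrightarrow> left_module A (T i)"
      "\<And>i j t. i \<in> Ind \<Longrightarrow> j \<in> J \<Longrightarrow> t \<in> carrier (T i) \<Longrightarrow> j \<odot>\<^bsub>T i\<^esub> t = \<zero>\<^bsub>T i\<^esub>"
    and sep: "\<And>(X :: ('a, 'u) module) x. left_module A X \<Longrightarrow>
      (\<And>j y. j \<in> J \<Longrightarrow> y \<in> carrier X \<Longrightarrow> j \<odot>\<^bsub>X\<^esub> y = \<zero>\<^bsub>X\<^esub>) \<Longrightarrow> x \<in> carrier X \<Longrightarrow> x \<noteq> \<zero>\<^bsub>X\<^esub> \<Longrightarrow>
      \<exists>i\<in>Ind. \<exists>f\<in>lmod_hom A X (T i). f x \<noteq> \<zero>\<^bsub>T i\<^esub>"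
    and res: "\<And>i. i \<in> Ind \<Longrightarrow> injective_coresolution A (T i) (E i) (\<eta> i) (\<delta> i)"
    and zero: "\<And>i k. i \<in> Ind \<Longrightarrow> k > N \<Longrightarrow> carrier (E i k) = {\<zero>\<^bsub>E i k\<^esub>}"
  shows "gl_dim TYPE('u) A \<le> enat (Suc N)"
proof (rule gl_dim_le[OF en])
  fix M :: "('a, 'u) module" and P :: "nat \<Rightarrow> ('a, 'u) module" and \<epsilon> D and X :: "('a, 'u) module"
  assume M: "left_module A M" and resP: "projective_resolution A M P \<epsilon> D" and X: "left_module A X"
  note r = projective_resolutionD[OF resP]
  note s = syzygy_presentation[OF M resP]
  let ?K = "carrier (syzygy M P \<epsilon> D (Suc N))"
  have Keq: "a_kernel (P (Suc N)) (syzygy M P \<epsilon> D N) (D N) = ?K" using s(5)[of N] by simp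
  have extT: "extends_hom A (P (Suc N)) ?K (T i)" if i: "i \<in> Ind" for i
  proof -
    let ?Y = "coresolution_kernel (E i) (\<delta> i)"
    note ir = injective_coresolutionD[OF res[OF i]] and c = coresolution_kernel_props[OF res[OF i]]
    interpret EN: left_module A "E i (Suc N)" by (rule ir)
    have "\<zero>\<^bsub>?Y (Suc N)\<^esub> = \<zero>\<^bsub>E i (Suc N)\<^esub>" by (simp add: coresolution_kernel_def)
    moreover have "carrier (?Y (Suc N)) = {\<zero>\<^bsub>E i (Suc N)\<^esub>}"
      using EN.submoduleD(1,2)[OF c(1)] zero[OF i, of "Suc N"] by auto
    ultimately have "carrier (?Y (Suc N)) = {\<zero>\<^bsub>?Y (Suc N)\<^esub>}" by simp
    then have "extends_hom A (P 0) (a_kernel (P 0) M \<epsilon>) (?Y (Suc N))"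
      using extends_hom_zero[OF r(2) c(2) submodule_kernel[OF r(2) M r(3)]] by blast
    then have "ext_zero A M (?Y (Suc N))"
      using ext_zero_iff_extends[OF en c(2) M r(1) r(3) r(5)] by blast
    then have "ext_zero A (syzygy M P \<epsilon> D N) (?Y 0)"
      using ext_zero_syzygy_coresolution[OF en M resP res[OF i], of N 0] by simp
    then have ext: "extends_hom A (P (Suc N)) ?K (?Y 0)"
      using ext_zero_iff_extends[OF en c(2) s(2) r(1) s(3,4), of N 0] unfolding Keq by blast
    have "\<eta> i \<in> lmod_hom A (T i) (?Y 0)"
      unfolding coresolution_kernel_def using ir(6) by (intro lmod_hom_codomain ir(3)) simp
    then have "\<eta> i \<in> lmod_iso A (T i) (?Y 0)"
      using ir(5,6) by (simp add: lmod_iso_def bij_betw_def coresolution_kernel_def)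
    then show ?thesis by (rule extends_hom_iso[OF T(1)[OF i] c(2) _ ext])
  qed
  have ss: "extends_hom A (P (Suc N)) ?K Y" if Y: "left_module A Y"
    and JY: "\<And>j x. j \<in> J \<Longrightarrow> x \<in> carrier Y \<Longrightarrow> j \<odot>\<^bsub>Y\<^esub> x = \<zero>\<^bsub>Y\<^esub>" for Y :: "('a, 'u) module"
    by (rule extends_hom_semisimple[OF r(2) s(1) Y JY T sep[OF Y JY] extT])
  show "extends_hom A (P (Suc N)) ?K X"
    by (rule extends_hom_all[OF r(1) s(1) ss X])
qed

text \<open>The target \<open>X\<close> is replaced by its iterated cosyzygy \<open>C'\<close>:
  resolutions that stop give Ext^1(T i, C') = 0. The maps T i -> C that hit elements killed by
  \<open>J\<close> then lift, and the lifts supply the preimages that the semisimple case asks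
  for.\<close>

lemma gl_dim_le_of_resolutions:
  fixes T :: "'i \<Rightarrow> ('a, 't) module" and P :: "'i \<Rightarrow> nat \<Rightarrow> ('a, 'u) module"
  assumes en: "enough_modules TYPE('u) A"
    and T: "\<And>i. i \<in> Ind \<Longrightarrow> left_module A (T i)"
      "\<And>i j t. i \<in> Ind \<Longrightarrow> j \<in> J \<Longrightarrow> t \<in> carrier (T i) \<Longrightarrow> j \<odot>\<^bsub>T i\<^esub> t = \<zero>\<^bsub>T i\<^esub>"
    and gen: "\<And>(C :: ('a, 'u) module) v c. left_module A C \<Longrightarrow> v \<in> V \<Longrightarrow> c \<in> carrier C \<Longrightarrow>
      (\<And>j. j \<in> J \<Longrightarrow> j \<odot>\<^bsub>C\<^esub> c = \<zero>\<^bsub>C\<^esub>) \<Longrightarrow> e v \<odot>\<^bsub>C\<^esub> c = c \<Longrightarrow>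
      \<exists>i\<in>Ind. \<exists>f\<in>lmod_hom A (T i) C. \<exists>t\<in>carrier (T i). f t = c"
    and res: "\<And>i. i \<in> Ind \<Longrightarrow> projective_resolution A (T i) (P i) (\<epsilon> i) (D i)"
    and zero: "\<And>i k. i \<in> Ind \<Longrightarrow> k > N \<Longrightarrow> carrier (P i k) = {\<zero>\<^bsub>P i k\<^esub>}"
  shows "gl_dim TYPE('u) A \<le> enat (Suc N)"
proof (rule gl_dim_le[OF en])
  fix M :: "('a, 'u) module" and S :: "nat \<Rightarrow> ('a, 'u) module" and \<epsilon>' D' and X :: "('a, 'u) module"
  assume M: "left_module A M" and resS: "projective_resolution A M S \<epsilon>' D'" and X: "left_module A X"
  note r = projective_resolutionD[OF resS]
  note s = syzygy_presentation[OF M resS]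
  let ?K = "carrier (syzygy M S \<epsilon>' D' (Suc N))"
  have Keq: "a_kernel (S (Suc N)) (syzygy M S \<epsilon>' D' N) (D' N) = ?K" using s(5)[of N] by simp
  define C' where "C' = (cosyzygy A ^^ Suc N) X"
  have C': "left_module A C'" unfolding C'_def by (rule left_module_cosyzygy(2)[OF en X])
  have extT: "ext_zero A (T i) C'" if i: "i \<in> Ind" for i
  proof -
    note ri = projective_resolutionD[OF res[OF i]] and si = syzygy_presentation[OF T(1)[OF i] res[OF i]]
    have "carrier (syzygy (T i) (P i) (\<epsilon> i) (D i) N) = D i N ` {\<zero>\<^bsub>P i (Suc N)\<^esub>}"
      using si(4)[of N] zero[OF i, of "Suc N"] by simp
    also have "\<dots> = {\<zero>\<^bsub>syzygy (T i) (P i) (\<epsilon> i) (D i) N\<^esub>}"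
      using lmod_hom_zero[OF ri(2) si(2) si(3), of N] by simp
    finally have "ext_zero A (syzygy (T i) (P i) (\<epsilon> i) (D i) N) X"
      by (intro ext_zero_zero si(2))
    then show ?thesis
      unfolding C'_def using ext_zero_syzygy[OF en T(1)[OF i] res[OF i] X, of N] by (simp del: funpow.simps)
  qed
  obtain E C :: "('a, 'u) module" and q where E: "injective_module A E" "left_module A C"
    "q \<in> lmod_hom A E C" "q ` carrier E = carrier C" "lmod_iso A C' (E\<lparr>carrier := a_kernel E C q\<rparr>) \<noteq> {}"
    by (rule enough_injectives[OF en C'])
  then obtain f where f: "f \<in> lmod_iso A C' (E\<lparr>carrier := a_kernel E C q\<rparr>)" by blast
  have lE: "left_module A E" by (rule injective_left_module[OF E(1)])
  interpret E: left_module A E by fact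
  interpret C: left_module A C by (rule E(2))
  have liftT: "lifts_hom A (T i) E q C" if "i \<in> Ind" for i
    using extT[OF that] E unfolding ext_zero_def by blast
  have lift: "\<exists>x\<in>carrier E. q x = c \<and> (\<forall>j\<in>J. j \<odot>\<^bsub>E\<^esub> x = \<zero>\<^bsub>E\<^esub>)"
    if vc: "v \<in> V" "c \<in> carrier C" "\<And>j. j \<in> J \<Longrightarrow> j \<odot>\<^bsub>C\<^esub> c = \<zero>\<^bsub>C\<^esub>" "e v \<odot>\<^bsub>C\<^esub> c = c" for v c
  proof -
    obtain i g t where i: "i \<in> Ind" and g: "g \<in> lmod_hom A (T i) C" and t: "t \<in> carrier (T i)" "g t = c"
      using gen[OF E(2) vc] by blast
    obtain h where h: "h \<in> lmod_hom A (T i) E" "\<forall>x\<in>carrier (T i). q (h x) = g x"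
      using bspec[OF liftT[OF i, unfolded lifts_hom_def] g] by blast
    \<comment> \<open>The lift of \<open>t\<close> is killed by \<open>J\<close> because
      \<open>t\<close> is.\<close>
    have "j \<odot>\<^bsub>E\<^esub> h t = \<zero>\<^bsub>E\<^esub>" if "j \<in> J" for j
      using lmod_homD(3)[OF h(1) J_closed[OF that] t(1)] T(2)[OF i that t(1)] lmod_hom_zero[OF T(1)[OF
          i] lE h(1)]
      by simp
    then show ?thesis using h t lmod_homD(1)[OF h(1) t(1)] by (intro bexI[of _ "h t"]) auto
  qed
  have ss: "lifts_hom A Y E q C" if Y: "left_module A Y"
    and JY: "\<And>j x. j \<in> J \<Longrightarrow> x \<in> carrier Y \<Longrightarrow> j \<odot>\<^bsub>Y\<^esub> x = \<zero>\<^bsub>Y\<^esub>" for Y :: "('a, 'u) module"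
    by (rule lifts_hom_semisimple[OF Y lE E(2,3) JY lift])
  have "lifts_hom A M E q C" by (rule lifts_hom_all[OF E(1-3) ss M])
  then have "ext_zero A M (E\<lparr>carrier := a_kernel E C q\<rparr>)"
    using ext_zero_iff_lifts[OF en M r(1) r(3) r(5) E(1-4)] by blast
  moreover have lY: "left_module A (E\<lparr>carrier := a_kernel E C q\<rparr>)"
    by (rule E.submodule_left_module[OF submodule_kernel[OF lE E(2,3)]])
  ultimately have "ext_zero A M C'"
    using ext_zero_iso[OF lY C' lmod_iso_inv[OF C' lY f]] by blast
  then have "ext_zero A (syzygy M S \<epsilon>' D' N) X"
    unfolding C'_def using ext_zero_syzygy[OF en M resS X, of N] by (simp del: funpow.simps)
  then show "extends_hom A (S (Suc N)) ?K X"
    using ext_zero_iff_extends[OF en X s(2) r(1) s(3,4), of N] unfolding Keq by blast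
qed

text \<open>Stated for a family so that it covers both the simple modules, indexed by the vertices,
  and the top, indexed by a single point. \<open>gen\<close> says that the family reaches enough
  elements killed by \<open>J\<close> and serves projective resolutions; \<open>sep\<close> is the
  dual condition for injective coresolutions.\<close>

theorem gl_dim_finite_iff:
  fixes T :: "'i \<Rightarrow> ('a, 't) module" and P E :: "'i \<Rightarrow> nat \<Rightarrow> ('a, 'u) module"
  assumes en: "enough_modules TYPE('u) A"
    and T: "\<And>i. i \<in> Ind \<Longrightarrow> left_module A (T i)"
      "\<And>i j t. i \<in> Ind \<Longrightarrow> j \<in> J \<Longrightarrow> t \<in> carrier (T i) \<Longrightarrow> j \<odot>\<^bsub>T i\<^esub> t = \<zero>\<^bsub>T i\<^esub>"
    and gen: "\<And>(C :: ('a, 'u) module) v c. left_module A C \<Longrightarrow> v \<in> V \<Longrightarrow> c \<in> carrier C \<Longrightarrow>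
      (\<And>j. j \<in> J \<Longrightarrow> j \<odot>\<^bsub>C\<^esub> c = \<zero>\<^bsub>C\<^esub>) \<Longrightarrow> e v \<odot>\<^bsub>C\<^esub> c = c \<Longrightarrow>
      \<exists>i\<in>Ind. \<exists>f\<in>lmod_hom A (T i) C. \<exists>t\<in>carrier (T i). f t = c"
    and sep: "\<And>(X :: ('a, 'u) module) x. left_module A X \<Longrightarrow>
      (\<And>j y. j \<in> J \<Longrightarrow> y \<in> carrier X \<Longrightarrow> j \<odot>\<^bsub>X\<^esub> y = \<zero>\<^bsub>X\<^esub>) \<Longrightarrow> x \<in> carrier X \<Longrightarrow> x \<noteq> \<zero>\<^bsub>X\<^esub> \<Longrightarrow>
      \<exists>i\<in>Ind. \<exists>f\<in>lmod_hom A X (T i). f x \<noteq> \<zero>\<^bsub>T i\<^esub>"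
    and P: "\<And>i. i \<in> Ind \<Longrightarrow> minimal_projective_resolution A (T i) (P i) (\<epsilon> i) (D i)"
    and E: "\<And>i. i \<in> Ind \<Longrightarrow> minimal_injective_coresolution A (T i) (E i) (\<eta> i) (\<delta> i)"
  shows "gl_dim TYPE('u) A < \<infinity> \<longleftrightarrow> (\<exists>N. \<forall>i\<in>Ind. \<forall>k>N. carrier (P i k) = {\<zero>\<^bsub>P i k\<^esub>})" (is "?G \<longleftrightarrow> ?P")
    and "gl_dim TYPE('u) A < \<infinity> \<longleftrightarrow> (\<exists>N. \<forall>i\<in>Ind. \<forall>k>N. carrier (E i k) = {\<zero>\<^bsub>E i k\<^esub>})" (is "?G \<longleftrightarrow> ?E")
proof -
  have resP: "projective_resolution A (T i) (P i) (\<epsilon> i) (D i)"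
    and minP: "superfluous A (P i (Suc n)) (a_kernel (P i (Suc n)) (P i n) (D i n))" if "i \<in> Ind" for i n
    using P[OF that] by (auto simp: minimal_projective_resolution_def)
  have resE: "injective_coresolution A (T i) (E i) (\<eta> i) (\<delta> i)"
    and minE: "essential A (E i (Suc n)) (\<delta> i n ` carrier (E i n))" if "i \<in> Ind" for i n
    using E[OF that] by (auto simp: minimal_injective_coresolution_def)
  have "?P \<and> ?E" if g: ?G
  proof -
    have "\<exists>N. \<forall>M :: ('a, 'u) module. left_module A M \<longrightarrow>
      (\<exists>(S :: nat \<Rightarrow> ('a, 'u) module) \<epsilon> D. projective_resolution A M S \<epsilon> D \<and> (\<forall>k>N. carrier (S k) = {\<zero>\<^bsub>S k\<^esub>}))"
      by (rule gl_dim_finiteD[OF g]) blast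
    then obtain N where N: "\<And>M :: ('a, 'u) module. left_module A M \<Longrightarrow>
      \<exists>(S :: nat \<Rightarrow> ('a, 'u) module) \<epsilon> D. projective_resolution A M S \<epsilon> D \<and> (\<forall>k>N. carrier (S k) = {\<zero>\<^bsub>S k\<^esub>})"
      by blast
    have "carrier (P i k) = {\<zero>\<^bsub>P i k\<^esub>}" if i: "i \<in> Ind" and k: "k > Suc N" for i k
    proof -
      note r = projective_resolutionD[OF resP[OF i]]
      \<comment> \<open>\<open>gl_dim\<close> ranges over modules with elements in
        \<open>'u\<close>, while \<open>T i\<close> may live elsewhere; a section of the
        augmentation embeds it into \<open>'u\<close>.\<close>
      let ?f = "inv_into (carrier (P i 0)) (\<epsilon> i)"
      have inj: "inj_on ?f (carrier (T i))" using r(5) inj_on_inv_into[of "carrier (T i)" "\<epsilon> i"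
          "carrier (P i 0)"] by simp
      let ?M = "image_module ?f (T i)"
      note im = image_module_inj[OF T(1)[OF i] inj]
      obtain S :: "nat \<Rightarrow> ('a, 'u) module" and \<epsilon>' D' where S: "projective_resolution A ?M S \<epsilon>' D'"
        "\<forall>k>N. carrier (S k) = {\<zero>\<^bsub>S k\<^esub>}" using N[OF im(1)] by blast
      note S' = projective_resolution_iso[OF im(1) T(1)[OF i] S(1) lmod_iso_inv[OF T(1)[OF i] im]]
      show ?thesis
        by (rule minimal_resolution_terminates[OF en T(1)[OF i] S' _ resP[OF i] minP[OF i] k]) (use S(2)
            in blast)
    qed
    moreover have "carrier (E i k) = {\<zero>\<^bsub>E i k\<^esub>}" if i: "i \<in> Ind" and k: "k > Suc N" for i k
      by (rule minimal_coresolution_terminates[OF en N resE[OF i] minE[OF i] k])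
    ultimately show ?thesis by blast
  qed
  moreover have ?G if ?P
  proof -
    obtain N where "\<And>i k. i \<in> Ind \<Longrightarrow> k > N \<Longrightarrow> carrier (P i k) = {\<zero>\<^bsub>P i k\<^esub>}" using \<open>?P\<close> by blast
    then have "gl_dim TYPE('u) A \<le> enat (Suc N)"
      by (intro gl_dim_le_of_resolutions[OF en T gen resP]) auto
    then show ?G by (metis enat_ord_code(4) leD order_le_less_trans)
  qed
  moreover have ?G if ?E
  proof -
    obtain N where "\<And>i k. i \<in> Ind \<Longrightarrow> k > N \<Longrightarrow> carrier (E i k) = {\<zero>\<^bsub>E i k\<^esub>}" using \<open>?E\<close> by blast
    then have "gl_dim TYPE('u) A \<le> enat (Suc N)"
      by (intro gl_dim_le_of_coresolutions[OF en T sep resE]) auto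
    then show ?G by (metis enat_ord_code(4) leD order_le_less_trans)
  qed
  ultimately show "?G \<longleftrightarrow> ?P" "?G \<longleftrightarrow> ?E" by blast+
qed

end

section \<open>Enough projective and injective modules in one type\<close>

lemma inj_pair_ex:
  assumes "infinite (UNIV :: 'u set)"
  obtains pr :: "'u \<times> 'u \<Rightarrow> 'u" where "inj pr"
proof -
  have "(card_of (UNIV \<times> UNIV :: ('u \<times> 'u) set), card_of (UNIV :: 'u set)) \<in> ordIso"
    by (rule card_of_Times_same_infinite[OF assms])
  then obtain f where "bij_betw f (UNIV \<times> UNIV :: ('u \<times> 'u) set) (UNIV :: 'u set)"
    using card_of_ordIso by blast
  then show ?thesis using that by (auto simp: bij_betw_def)
qed

text \<open>Later this codes elements of \<open>A\<close> by their coordinates and linear maps on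
  \<open>A\<close> by their values at a basis.\<close>

lemma inj_tuple_ex:
  assumes "infinite (UNIV :: 'u set)"
  shows "\<exists>c :: (nat \<Rightarrow> 'u) \<Rightarrow> 'u. inj_on c (extensional {..<d})"
proof (induction d)
  case 0
  have "inj_on (\<lambda>_. undefined) (extensional {..<0 :: nat} :: (nat \<Rightarrow> 'u) set)"
    by (auto simp: inj_on_def extensional_def)
  then show ?case by blast
next
  case (Suc d)
  then obtain c :: "(nat \<Rightarrow> 'u) \<Rightarrow> 'u" where c: "inj_on c (extensional {..<d})" by blast
  obtain pr :: "'u \<times> 'u \<Rightarrow> 'u" where pr: "inj pr" by (rule inj_pair_ex[OF assms])
  have "inj_on (\<lambda>f. pr (c (restrict f {..<d}), f d)) (extensional {..<Suc d})"
  proof (rule inj_onI)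
    fix f g :: "nat \<Rightarrow> 'u"
    assume f: "f \<in> extensional {..<Suc d}" and g: "g \<in> extensional {..<Suc d}"
      and eq: "pr (c (restrict f {..<d}), f d) = pr (c (restrict g {..<d}), g d)"
    then have "c (restrict f {..<d}) = c (restrict g {..<d})" and d: "f d = g d"
      using injD[OF pr] by blast+
    then have r: "restrict f {..<d} = restrict g {..<d}" using inj_onD[OF c] by auto
    have "f i = g i" for i
    proof -
      consider "i < d" | "i = d" | "i > d" by linarith
      then show ?thesis
      proof cases
        case 1 then show ?thesis using fun_cong[OF r, of i] by simp
      next
        case 2 then show ?thesis using d by simp
      next
        case 3
        then have "i \<notin> {..<Suc d}" by auto
        then show ?thesis using f g by (simp add: extensional_def)
      qed
    qed
    then show "f = g" by blast
  qed
  then show ?case by blast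
qed

lemma inj_finite_set_ex:
  assumes "infinite (UNIV :: 'u set)"
  obtains c :: "('u \<times> 'u) set \<Rightarrow> 'u" where "inj_on c (Collect finite)"
proof -
  obtain pr :: "'u \<times> 'u \<Rightarrow> 'u" where pr: "inj pr" by (rule inj_pair_ex[OF assms])
  obtain nu :: "nat \<Rightarrow> 'u" where nu: "inj nu" using infinite_countable_subset[OF assms] by blast
  define k where "k = rec_list undefined (\<lambda>x _ r. pr (pr x, r))"
  have k: "k [] = undefined" "k (x # xs) = pr (pr x, k xs)" for x xs by (simp_all add: k_def)
  have kinj: "length xs = length ys \<Longrightarrow> k xs = k ys \<Longrightarrow> xs = ys" for xs ys
  proof (induction xs arbitrary: ys)
    case (Cons x xs)
    then obtain y zs where ys: "ys = y # zs" "length zs = length xs" by (cases ys) auto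
    have "(pr x, k xs) = (pr y, k zs)" using Cons.prems(2) injD[OF pr] unfolding ys k by blast
    then have "x = y" "k xs = k zs" using injD[OF pr] by auto
    then show ?case using Cons.IH[of zs] ys by simp
  qed simp
  define l where "l S = (SOME xs. set xs = S)" for S :: "('u \<times> 'u) set"
  have l: "set (l S) = S" if "finite S" for S
    unfolding l_def by (rule someI_ex) (use that finite_list in auto)
  \<comment> \<open>The length is recorded because \<open>k []\<close> may coincide with the code of
    a nonempty list.\<close>
  have "inj_on (\<lambda>S. pr (nu (length (l S)), k (l S))) (Collect finite)"
  proof (rule inj_onI)
    fix S T :: "('u \<times> 'u) set" assume *: "S \<in> Collect finite" "T \<in> Collect finite"
      and eq: "pr (nu (length (l S)), k (l S)) = pr (nu (length (l T)), k (l T))"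
    then have "nu (length (l S)) = nu (length (l T))" "k (l S) = k (l T)" using injD[OF pr] by blast+
    then have "l S = l T" using kinj injD[OF nu] by blast
    then have "set (l S) = set (l T)" by simp
    then show "S = T" using l * by blast
  qed
  then show ?thesis by (rule that)
qed

section \<open>Free modules and their copies in \<open>'u\<close>\<close>

definition free_module :: "('a, 'r) ring_scheme \<Rightarrow> 'x set \<Rightarrow> ('a, 'x \<Rightarrow> 'a) module" where
  "free_module R B =
    \<lparr>carrier = {f. (\<forall>b. f b \<in> carrier R) \<and> finite {b. f b \<noteq> \<zero>\<^bsub>R\<^esub>} \<and> {b. f b \<noteq> \<zero>\<^bsub>R\<^esub>} \<subseteq> B},
     mult = undefined, one = undefined, zero = (\<lambda>b. \<zero>\<^bsub>R\<^esub>),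
     add = (\<lambda>f g b. f b \<oplus>\<^bsub>R\<^esub> g b), smult = (\<lambda>a f b. a \<otimes>\<^bsub>R\<^esub> f b)\<rparr>"

definition free_gen :: "('a, 'r) ring_scheme \<Rightarrow> 'x \<Rightarrow> 'x \<Rightarrow> 'a" where
  "free_gen R b = (\<lambda>c. if c = b then \<one>\<^bsub>R\<^esub> else \<zero>\<^bsub>R\<^esub>)"

context ring
begin

lemma left_module_free: "left_module R (free_module R B)"
proof (rule left_moduleI)
  fix f g assume "f \<in> carrier (free_module R B)" "g \<in> carrier (free_module R B)"
  moreover from this have "{b. f b \<oplus> g b \<noteq> \<zero>} \<subseteq> {b. f b \<noteq> \<zero>} \<union> {b. g b \<noteq> \<zero>}"
    by (auto simp: free_module_def)
  ultimately show "f \<oplus>\<^bsub>free_module R B\<^esub> g \<in> carrier (free_module R B)"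
    using finite_subset[of "{b. f b \<oplus> g b \<noteq> \<zero>}" "{b. f b \<noteq> \<zero>} \<union> {b. g b \<noteq> \<zero>}"]
    by (auto simp: free_module_def)
next
  fix a f assume a: "a \<in> carrier R" and f: "f \<in> carrier (free_module R B)"
  have "{b. a \<otimes> f b \<noteq> \<zero>} \<subseteq> {b. f b \<noteq> \<zero>}" using a by auto
  then show "a \<odot>\<^bsub>free_module R B\<^esub> f \<in> carrier (free_module R B)"
    using a f finite_subset[of "{b. a \<otimes> f b \<noteq> \<zero>}" "{b. f b \<noteq> \<zero>}"] by (auto simp: free_module_def)
qed (auto simp: free_module_def ring_axioms a_ac m_assoc l_distr r_distr)

lemma free_gen_closed: "b \<in> B \<Longrightarrow> free_gen R b \<in> carrier (free_module R B)"
  by (auto simp: free_module_def free_gen_def intro: finite_subset[of _ "{b}"])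

text \<open>Induction on a finite set containing the support, splitting off one generator at a
  time.\<close>

lemma free_hom_eq:
  assumes N: "left_module R N" and h: "h \<in> lmod_hom R (free_module R B) N"
    and g: "g \<in> lmod_hom R (free_module R B) N"
    and eq: "\<And>b. b \<in> B \<Longrightarrow> h (free_gen R b) = g (free_gen R b)" and f: "f \<in> carrier (free_module R B)"
  shows "h f = g f"
proof -
  let ?F = "free_module R B"
  have "\<forall>f\<in>carrier ?F. {b. f b \<noteq> \<zero>} \<subseteq> S \<longrightarrow> h f = g f" if "finite S" for S
    using that
  proof (induction S rule: finite_induct)
    case empty
    have "f = \<zero>\<^bsub>?F\<^esub>" if "{b. f b \<noteq> \<zero>} \<subseteq> {}" for f using that by (auto simp: free_module_def)
    then show ?case
      using lmod_hom_zero[OF left_module_free N h] lmod_hom_zero[OF left_module_free N g] by metis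
  next
    case (insert b S)
    show ?case
    proof (intro ballI impI)
      fix f assume f: "f \<in> carrier ?F" and S: "{b. f b \<noteq> \<zero>} \<subseteq> insert b S"
      show "h f = g f"
      proof (cases "f b = \<zero>")
        case True then show ?thesis using insert.IH f S by blast
      next
        case False
        then have b: "b \<in> B" and fb: "f b \<in> carrier R" using f by (auto simp: free_module_def)
        let ?f' = "\<lambda>c. if c = b then \<zero> else f c"
        have sup: "{b. ?f' b \<noteq> \<zero>} \<subseteq> {b. f b \<noteq> \<zero>}" by auto
        then have f': "?f' \<in> carrier ?F"
          using f finite_subset[OF sup] by (auto simp: free_module_def)
        have eqf: "f = f b \<odot>\<^bsub>?F\<^esub> free_gen R b \<oplus>\<^bsub>?F\<^esub> ?f'"
          using f fb by (auto simp: free_module_def free_gen_def)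
        have gen: "free_gen R b \<in> carrier ?F" by (rule free_gen_closed[OF b])
        interpret F: left_module R ?F by (rule left_module_free)
        have c: "f b \<odot>\<^bsub>?F\<^esub> free_gen R b \<in> carrier ?F" by (rule F.smult_closed[OF fb gen])
        have "{b. ?f' b \<noteq> \<zero>} \<subseteq> S" using S by auto
        then have "h ?f' = g ?f'" by (rule mp[OF bspec[OF insert.IH f']])
        then have "h (f b \<odot>\<^bsub>?F\<^esub> free_gen R b \<oplus>\<^bsub>?F\<^esub> ?f') = g (f b \<odot>\<^bsub>?F\<^esub> free_gen R b \<oplus>\<^bsub>?F\<^esub> ?f')"
          unfolding lmod_homD(2)[OF h c f'] lmod_homD(2)[OF g c f'] lmod_homD(3)[OF h fb gen]
            lmod_homD(3)[OF g fb gen] eq[OF b] by simp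
        then show ?thesis using eqf by simp
      qed
    qed
  qed
  moreover have "finite {b. f b \<noteq> \<zero>}" using f by (simp add: free_module_def)
  ultimately show ?thesis using f by blast
qed

lemma free_hom_ex:
  assumes N: "left_module R N" and y: "\<And>b. b \<in> B \<Longrightarrow> y b \<in> carrier N"
  obtains h where "h \<in> lmod_hom R (free_module R B) N" "\<And>b. b \<in> B \<Longrightarrow> h (free_gen R b) = y b"
proof -
  interpret N: left_module R N by fact
  let ?F = "free_module R B"
  define h where "h f = (\<Oplus>\<^bsub>N\<^esub>b\<in>{b. f b \<noteq> \<zero>}. f b \<odot>\<^bsub>N\<^esub> y b)" for f
  have cl: "f b \<odot>\<^bsub>N\<^esub> y b \<in> carrier N" if "f \<in> carrier ?F" "b \<in> B" for f b
    using that y by (auto simp: free_module_def intro: N.smult_closed)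
  \<comment> \<open>The sum may run over any finite part of \<open>B\<close> containing the support,
    so that two functions can be summed over a common set.\<close>
  have h: "h f = (\<Oplus>\<^bsub>N\<^esub>b\<in>S. f b \<odot>\<^bsub>N\<^esub> y b)"
    if "f \<in> carrier ?F" "finite S" "{b. f b \<noteq> \<zero>} \<subseteq> S" "S \<subseteq> B" for f S
    unfolding h_def
  proof (rule N.M.add.finprod_mono_neutral_cong_left)
    show "f i \<odot>\<^bsub>N\<^esub> y i = \<zero>\<^bsub>N\<^esub>" if "i \<in> S - {b. f b \<noteq> \<zero>}" for i
      using that \<open>S \<subseteq> B\<close> y N.smult_zero_l by auto
    show "(\<lambda>b. f b \<odot>\<^bsub>N\<^esub> y b) \<in> S \<rightarrow> carrier N" using cl that by auto
  qed (use that in auto)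
  have "h \<in> lmod_hom R ?F N"
  proof (rule lmod_homI)
    fix f assume f: "f \<in> carrier ?F"
    then have "{b. f b \<noteq> \<zero>} \<subseteq> B" by (simp add: free_module_def)
    then show "h f \<in> carrier N" unfolding h_def using cl[OF f] by (intro N.M.finsum_closed) auto
  next
    fix f g assume fg: "f \<in> carrier ?F" "g \<in> carrier ?F"
    interpret F: left_module R ?F by (rule left_module_free)
    have s: "f \<oplus>\<^bsub>?F\<^esub> g \<in> carrier ?F" using fg by simp
    let ?S = "{b. f b \<noteq> \<zero>} \<union> {b. g b \<noteq> \<zero>}"
    have S: "finite ?S" "?S \<subseteq> B" "{b. f b \<noteq> \<zero>} \<subseteq> ?S" "{b. g b \<noteq> \<zero>} \<subseteq> ?S" using fg
        by (auto simp: free_module_def)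
    have S3: "{b. (f \<oplus>\<^bsub>?F\<^esub> g) b \<noteq> \<zero>} \<subseteq> ?S" using fg by (auto simp: free_module_def)
    have "h (f \<oplus>\<^bsub>?F\<^esub> g) = (\<Oplus>\<^bsub>N\<^esub>b\<in>?S. (f \<oplus>\<^bsub>?F\<^esub> g) b \<odot>\<^bsub>N\<^esub> y b)" by (rule h[OF s S(1) S3 S(2)])
    also have "\<dots> = (\<Oplus>\<^bsub>N\<^esub>b\<in>?S. f b \<odot>\<^bsub>N\<^esub> y b \<oplus>\<^bsub>N\<^esub> g b \<odot>\<^bsub>N\<^esub> y b)"
    proof (rule N.M.finsum_cong')
      fix b assume "b \<in> ?S"
      then have "b \<in> B" using S(2) by blast
      then show "(f \<oplus>\<^bsub>?F\<^esub> g) b \<odot>\<^bsub>N\<^esub> y b = f b \<odot>\<^bsub>N\<^esub> y b \<oplus>\<^bsub>N\<^esub> g b \<odot>\<^bsub>N\<^esub> y b"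
        using fg y by (simp add: free_module_def N.smult_l_distr)
    qed (use cl[OF fg(1)] cl[OF fg(2)] S(2) in auto)
    also have "\<dots> = (\<Oplus>\<^bsub>N\<^esub>b\<in>?S. f b \<odot>\<^bsub>N\<^esub> y b) \<oplus>\<^bsub>N\<^esub> (\<Oplus>\<^bsub>N\<^esub>b\<in>?S. g b \<odot>\<^bsub>N\<^esub> y b)"
      using cl[OF fg(1)] cl[OF fg(2)] S(2) by (intro N.M.finsum_addf) auto
    also have "\<dots> = h f \<oplus>\<^bsub>N\<^esub> h g" using h[OF fg(1) S(1,3,2)] h[OF fg(2) S(1,4,2)] by simp
    finally show "h (f \<oplus>\<^bsub>?F\<^esub> g) = h f \<oplus>\<^bsub>N\<^esub> h g" .
  next
    fix a f assume a: "a \<in> carrier R" and f: "f \<in> carrier ?F"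
    interpret F: left_module R ?F by (rule left_module_free)
    have s: "a \<odot>\<^bsub>?F\<^esub> f \<in> carrier ?F" by (rule F.smult_closed[OF a f])
    let ?S = "{b. f b \<noteq> \<zero>}"
    have S: "finite ?S" "?S \<subseteq> B" using f by (auto simp: free_module_def)
    have S3: "{b. (a \<odot>\<^bsub>?F\<^esub> f) b \<noteq> \<zero>} \<subseteq> ?S" using a by (auto simp: free_module_def)
    have "h (a \<odot>\<^bsub>?F\<^esub> f) = (\<Oplus>\<^bsub>N\<^esub>b\<in>?S. (a \<odot>\<^bsub>?F\<^esub> f) b \<odot>\<^bsub>N\<^esub> y b)" by (rule h[OF s S(1) S3 S(2)])
    also have "\<dots> = (\<Oplus>\<^bsub>N\<^esub>b\<in>?S. a \<odot>\<^bsub>N\<^esub> (f b \<odot>\<^bsub>N\<^esub> y b))"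
    proof (rule N.M.finsum_cong')
      fix b assume "b \<in> ?S"
      then have "b \<in> B" using S(2) by blast
      then show "(a \<odot>\<^bsub>?F\<^esub> f) b \<odot>\<^bsub>N\<^esub> y b = a \<odot>\<^bsub>N\<^esub> (f b \<odot>\<^bsub>N\<^esub> y b)"
        using f a y by (simp add: free_module_def N.smult_assoc)
    qed (use cl[OF f] S(2) a N.smult_closed in auto)
    also have "\<dots> = a \<odot>\<^bsub>N\<^esub> h f"
      unfolding h_def using cl[OF f] S a by (intro N.smult_finsum_r[symmetric]) auto
    finally show "h (a \<odot>\<^bsub>?F\<^esub> f) = a \<odot>\<^bsub>N\<^esub> h f" .
  qed
  moreover have "h (free_gen R b) = y b" if b: "b \<in> B" for b
  proof -
    have "{c. free_gen R b c \<noteq> \<zero>} \<subseteq> {b}" by (auto simp: free_gen_def)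
    then have "h (free_gen R b) = (\<Oplus>\<^bsub>N\<^esub>c\<in>{b}. free_gen R b c \<odot>\<^bsub>N\<^esub> y c)"
      using h[OF free_gen_closed[OF b], of "{b}"] b by simp
    also have "\<dots> = \<zero>\<^bsub>N\<^esub> \<oplus>\<^bsub>N\<^esub> y b"
      using y[OF b] N.M.finsum_insert[of "{}" b "\<lambda>c. free_gen R b c \<odot>\<^bsub>N\<^esub> y c"]
      by (simp add: free_gen_def N.smult_one)
    finally show ?thesis using y[OF b] by simp
  qed
  ultimately show ?thesis by (rule that)
qed

lemma free_module_image_projective:
  fixes c :: "('x \<Rightarrow> 'a) \<Rightarrow> 'u"
  assumes inj: "inj_on c (carrier (free_module R B))"
  shows "projective_module R (image_module c (free_module R B))"
  unfolding projective_module_def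
proof (intro conjI allI impI; (elim conjE)?)
  let ?F = "free_module R B" and ?P = "image_module c (free_module R B)"
  note im = image_module_inj[OF left_module_free inj]
  show "left_module R ?P" by (rule im(1))
  have c: "c \<in> lmod_hom R ?F ?P" and i: "inv_into (carrier ?F) c \<in> lmod_hom R ?P ?F"
    using im(2) lmod_iso_inv[OF left_module_free im] by (simp_all add: lmod_iso_def)
  fix M N :: "('a, 'u) module" and p g
  assume MN: "left_module R M" "left_module R N" "p \<in> lmod_hom R M N" "p ` carrier M = carrier N"
    "g \<in> lmod_hom R ?P N"
  \<comment> \<open>Preimages need to be chosen for the generators only, as these determine the
    homomorphism.\<close>
  define y where "y b = (SOME z. z \<in> carrier M \<and> p z = g (c (free_gen R b)))" for b
  have gc: "(\<lambda>x. g (c x)) \<in> lmod_hom R ?F N" by (rule lmod_hom_comp[OF c MN(5)])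
  have y: "y b \<in> carrier M \<and> p (y b) = g (c (free_gen R b))" if b: "b \<in> B" for b
  proof -
    have "g (c (free_gen R b)) \<in> p ` carrier M"
      using lmod_homD(1)[OF gc free_gen_closed[OF b]] MN(4) by simp
    then have "\<exists>z. z \<in> carrier M \<and> p z = g (c (free_gen R b))" by auto
    then show ?thesis unfolding y_def by (rule someI_ex)
  qed
  obtain h where h: "h \<in> lmod_hom R ?F M" "\<And>b. b \<in> B \<Longrightarrow> h (free_gen R b) = y b"
    using free_hom_ex[OF MN(1), of B y] y by blast
  have ph: "(\<lambda>x. p (h x)) \<in> lmod_hom R ?F N" by (rule lmod_hom_comp[OF h(1) MN(3)])
  have eq: "p (h f) = g (c f)" if f: "f \<in> carrier ?F" for f
    by (rule free_hom_eq[OF MN(2) ph gc _ f]) (use h(2) y in simp)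
  have "(\<lambda>x. h (inv_into (carrier ?F) c x)) \<in> lmod_hom R ?P M" by (rule lmod_hom_comp[OF i h(1)])
  moreover have "\<forall>x\<in>carrier ?P. p (h (inv_into (carrier ?F) c x)) = g x"
    using eq inj by (auto simp: inv_into_f_f)
  ultimately show "\<exists>h\<in>lmod_hom R ?P M. \<forall>x\<in>carrier ?P. p (h x) = g x"
    by (intro bexI[of _ "\<lambda>x. h (inv_into (carrier ?F) c x)"])
qed

text \<open>The free module on the elements of \<open>X\<close> maps onto \<open>X\<close>; no
  minimality is claimed. It is copied into \<open>'u\<close> by coding each finitely supported
  function by its graph.\<close>

lemma projective_cover_ex:
  fixes X :: "('a, 'u) module" and j :: "'a \<Rightarrow> 'u"
  assumes inf: "infinite (UNIV :: 'u set)" and j: "inj_on j (carrier R)" and X: "left_module R X"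
  obtains P :: "('a, 'u) module" and p where "projective_module R P" "p \<in> lmod_hom R P X"
    "p ` carrier P = carrier X"
proof -
  let ?F = "free_module R (carrier X)"
  obtain s :: "('u \<times> 'u) set \<Rightarrow> 'u" where s: "inj_on s (Collect finite)" by (rule inj_finite_set_ex[OF inf])
  \<comment> \<open>The graph is taken over the support only, so it is finite; coefficients enter
    through their codes under \<open>j\<close>.\<close>
  define G where "G f = (\<lambda>b. (b, j (f b))) ` {b. f b \<noteq> \<zero>}" for f :: "'u \<Rightarrow> 'a"
  have G: "finite (G f)" if "f \<in> carrier ?F" for f using that by (simp add: G_def free_module_def)
  have "inj_on (\<lambda>f. s (G f)) (carrier ?F)"
  proof (rule inj_onI)
    fix f g assume fg: "f \<in> carrier ?F" "g \<in> carrier ?F" "s (G f) = s (G g)"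
    then have GG: "G f = G g" using inj_onD[OF s] G by simp
    have sub: "f b = g b" if "f b \<noteq> \<zero>" "G f = G g" "f \<in> carrier ?F" "g \<in> carrier ?F" for f g b
    proof -
      have "(b, j (f b)) \<in> G g" using that(1,2) by (auto simp: G_def)
      then have "j (f b) = j (g b)" by (auto simp: G_def)
      then show ?thesis using inj_onD[OF j, of "f b" "g b"] that(3,4) by (auto simp: free_module_def)
    qed
    show "f = g"
    proof
      fix b
      consider "f b \<noteq> \<zero>" | "g b \<noteq> \<zero>" | "f b = \<zero>" "g b = \<zero>" by blast
      then show "f b = g b"
      proof cases
        case 1 then show ?thesis by (rule sub[OF _ GG fg(1,2)])
      next
        case 2 then show ?thesis by (rule sub[OF _ GG[symmetric] fg(2,1), symmetric])
      qed simp
    qed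
  qed
  then have inj: "inj_on (\<lambda>f. s (G f)) (carrier ?F)" .
  let ?c = "\<lambda>f. s (G f)"
  note im = image_module_inj[OF left_module_free inj]
  note inv = lmod_iso_inv[OF left_module_free im]
  obtain h where h: "h \<in> lmod_hom R ?F X" "\<And>b. b \<in> carrier X \<Longrightarrow> h (free_gen R b) = b"
    using free_hom_ex[OF X, of "carrier X" "\<lambda>b. b"] by blast
  have ic: "inv_into (carrier ?F) ?c (s (G f)) = f" if "f \<in> carrier ?F" for f
    using inv_into_f_f[OF inj that] .
  let ?p = "\<lambda>x. h (inv_into (carrier ?F) ?c x)"
  have "?p \<in> lmod_hom R (image_module ?c ?F) X"
    using inv by (intro lmod_hom_comp[OF _ h(1)]) (simp add: lmod_iso_def)
  moreover have "?p ` carrier (image_module ?c ?F) = carrier X"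
  proof
    show "?p ` carrier (image_module ?c ?F) \<subseteq> carrier X"
      using lmod_homD(1)[OF h(1)] by (auto simp: ic)
    show "carrier X \<subseteq> ?p ` carrier (image_module ?c ?F)"
    proof
      fix x assume x: "x \<in> carrier X"
      then have "x = ?p (?c (free_gen R x))" using h(2) free_gen_closed[OF x] by (simp add: ic)
      then show "x \<in> ?p ` carrier (image_module ?c ?F)" using free_gen_closed[OF x] by auto
    qed
  qed
  ultimately show ?thesis by (rule that[OF free_module_image_projective[OF inj]])
qed

end

subsection \<open>Complex vector spaces\<close>

definition complex_ring :: "(complex, complex) module" where
  "complex_ring = \<lparr>carrier = UNIV, mult = (*), one = 1, zero = 0, add = (+), smult = (*)\<rparr>"

lemma ring_complex_ring: "ring complex_ring"
proof (rule ringI)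
  show "abelian_group complex_ring"
  proof (rule abelian_groupI)
    fix x :: complex
    show "\<exists>y\<in>carrier complex_ring. y \<oplus>\<^bsub>complex_ring\<^esub> x = \<zero>\<^bsub>complex_ring\<^esub>"
      by (rule bexI[of _ "- x"]) (simp_all add: complex_ring_def)
  qed (simp_all add: complex_ring_def)
  show "Group.monoid complex_ring" by (unfold_locales) (simp_all add: complex_ring_def)
qed (simp_all add: complex_ring_def algebra_simps)

text \<open>The field itself: one vertex, the identity as character, and zero radical, so that
  already J^1 = 0. The complement lemma then yields complements of subspaces in vector spaces of any
  dimension, and with them the extension of linear maps.\<close>

interpretation CC: split_algebra complex_ring "{()}" "\<lambda>_. 1" "\<lambda>_ z. z" "{0}" "Suc 0"
proof -
  interpret ring complex_ring by (rule ring_complex_ring)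
  show "split_algebra complex_ring {()} (\<lambda>_. 1) (\<lambda>_ z. z) {0} (Suc 0)"
    by unfold_locales (auto simp: complex_ring_def regular_module_def algebra_simps)
qed

lemma carrier_complex_ring [simp]: "carrier complex_ring = UNIV"
  by (simp add: complex_ring_def)

lemma linear_extend_ex:
  assumes L: "left_module complex_ring L" and X: "left_module complex_ring X"
    and U: "submodule U complex_ring L" and g: "g \<in> lmod_hom complex_ring (L\<lparr>carrier := U\<rparr>) X"
  shows "\<exists>h\<in>lmod_hom complex_ring L X. \<forall>x\<in>U. h x = g x"
proof -
  interpret L: left_module complex_ring L by fact
  have J: "j \<odot>\<^bsub>L\<^esub> x \<in> {\<zero>\<^bsub>L\<^esub>}" if "j \<in> {0}" "x \<in> carrier L" for j x
    using that L.smult_zero_l[of x] by (simp add: complex_ring_def)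
  obtain W where W: "submodule W complex_ring L" "{\<zero>\<^bsub>L\<^esub>} \<subseteq> W"
    "\<forall>x\<in>carrier L. \<exists>w\<in>W. \<exists>u\<in>U. x = w \<oplus>\<^bsub>L\<^esub> u" "W \<inter> U \<subseteq> {\<zero>\<^bsub>L\<^esub>}"
    by (rule CC.complement_ex[OF L U L.submodule_zero J])
  have "g \<zero>\<^bsub>L\<^esub> = \<zero>\<^bsub>X\<^esub>" using lmod_hom_zero[OF L.submodule_left_module[OF U] X g] by simp
  then have gW: "g x = \<zero>\<^bsub>X\<^esub>" if "x \<in> W" "x \<in> U" for x using that W(4) by blast
  show ?thesis
  proof (rule lmod_hom_extend[OF L X U W(1) _ g gW])
    fix h assume "h \<in> lmod_hom complex_ring L X" "\<And>u. u \<in> U \<Longrightarrow> h u = g u"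
    then show ?thesis by blast
  qed (use W(3) in auto)
qed

lemma linear_functional_ex:
  assumes L: "left_module complex_ring L" and x: "x \<in> carrier L" "x \<noteq> \<zero>\<^bsub>L\<^esub>"
  shows "\<exists>f\<in>lmod_hom complex_ring L (regular_module complex_ring). f x \<noteq> 0"
proof -
  interpret L: left_module complex_ring L by fact
  define U where "U = (\<lambda>c. c \<odot>\<^bsub>L\<^esub> x) ` UNIV"
  have sm: "c \<odot>\<^bsub>L\<^esub> x \<in> carrier L" for c using x by (simp add: L.smult_closed)
  have add: "(c + c') \<odot>\<^bsub>L\<^esub> x = c \<odot>\<^bsub>L\<^esub> x \<oplus>\<^bsub>L\<^esub> c' \<odot>\<^bsub>L\<^esub> x" for c c'
    using L.smult_l_distr[of c c' x] x by (simp add: complex_ring_def)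
  have mul: "(c * c') \<odot>\<^bsub>L\<^esub> x = c \<odot>\<^bsub>L\<^esub> (c' \<odot>\<^bsub>L\<^esub> x)" for c c'
    using L.smult_assoc[of c c' x] x by (simp add: complex_ring_def)
  have zero: "0 \<odot>\<^bsub>L\<^esub> x = \<zero>\<^bsub>L\<^esub>" using L.smult_zero_l[of x] x by (simp add: complex_ring_def)
  have one: "1 \<odot>\<^bsub>L\<^esub> x = x" using L.smult_one[of x] x by (simp add: complex_ring_def)
  have U: "submodule U complex_ring L"
  proof (rule L.submoduleI')
    show "U \<subseteq> carrier L" using sm by (auto simp: U_def)
    show "\<zero>\<^bsub>L\<^esub> \<in> U" unfolding U_def using zero by (metis rangeI)
    show "y \<oplus>\<^bsub>L\<^esub> z \<in> U" if "y \<in> U" "z \<in> U" for y z using that by (auto simp: U_def simp flip: add)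
    show "a \<odot>\<^bsub>L\<^esub> y \<in> U" if "a \<in> carrier complex_ring" "y \<in> U" for a y
      using that by (auto simp: U_def simp flip: mul)
  qed
  have inj: "c = c'" if "c \<odot>\<^bsub>L\<^esub> x = c' \<odot>\<^bsub>L\<^esub> x" for c c'
  proof (rule ccontr)
    assume "c \<noteq> c'"
    have "(c - c') \<odot>\<^bsub>L\<^esub> x \<oplus>\<^bsub>L\<^esub> c' \<odot>\<^bsub>L\<^esub> x = c' \<odot>\<^bsub>L\<^esub> x"
      using that by (simp flip: add)
    then have "(c - c') \<odot>\<^bsub>L\<^esub> x = \<zero>\<^bsub>L\<^esub>" using sm by simp
    then have "inverse (c - c') \<odot>\<^bsub>L\<^esub> ((c - c') \<odot>\<^bsub>L\<^esub> x) = \<zero>\<^bsub>L\<^esub>" by (simp add: L.smult_zero_r)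
    then have "(inverse (c - c') * (c - c')) \<odot>\<^bsub>L\<^esub> x = \<zero>\<^bsub>L\<^esub>" by (simp add: mul)
    then show False using \<open>c \<noteq> c'\<close> x one by simp
  qed
  \<comment> \<open>The coordinate on the line through \<open>x\<close>, to be extended linearly to
    all of \<open>L\<close>.\<close>
  define g where "g y = (THE c. y = c \<odot>\<^bsub>L\<^esub> x)" for y
  have g: "g (c \<odot>\<^bsub>L\<^esub> x) = c" for c unfolding g_def using inj by blast
  have "g \<in> lmod_hom complex_ring (L\<lparr>carrier := U\<rparr>) (regular_module complex_ring)"
  proof (rule lmod_homI)
    show "g y \<in> carrier (regular_module complex_ring)" for y by (simp add: regular_module_def)
    show "g (y \<oplus>\<^bsub>L\<lparr>carrier := U\<rparr>\<^esub> z) = g y \<oplus>\<^bsub>regular_module complex_ring\<^esub> g z"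
      if yz: "y \<in> carrier (L\<lparr>carrier := U\<rparr>)" "z \<in> carrier (L\<lparr>carrier := U\<rparr>)" for y z
    proof -
      obtain c c' where "y = c \<odot>\<^bsub>L\<^esub> x" "z = c' \<odot>\<^bsub>L\<^esub> x" using yz by (auto simp: U_def)
      then show ?thesis using g[of "c + c'"] by (simp add: g add regular_module_def complex_ring_def)
    qed
    show "g (a \<odot>\<^bsub>L\<lparr>carrier := U\<rparr>\<^esub> y) = a \<odot>\<^bsub>regular_module complex_ring\<^esub> g y"
      if y: "y \<in> carrier (L\<lparr>carrier := U\<rparr>)" for a y
    proof -
      obtain c where "y = c \<odot>\<^bsub>L\<^esub> x" using y by (auto simp: U_def)
      then show ?thesis using g[of "a * c"] by (simp add: g mul regular_module_def complex_ring_def)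
    qed
  qed
  then obtain h where h: "h \<in> lmod_hom complex_ring L (regular_module complex_ring)" "\<forall>y\<in>U. h y = g y"
    using linear_extend_ex[OF L CC.left_module_regular U] by blast
  have "x \<in> U" unfolding U_def using one by (metis rangeI)
  then have "h x = g (1 \<odot>\<^bsub>L\<^esub> x)" using h(2) one by simp
  then have "h x = 1" using g by simp
  then show ?thesis using h(1) by (intro bexI[of _ h]) auto
qed

section \<open>Injectivity of coinduced modules\<close>

context complex_algebra
begin

definition vector_space_of :: "('a, 'm) module \<Rightarrow> (complex, 'm) module" where
  "vector_space_of M = \<lparr>carrier = carrier M, mult = undefined, one = undefined, zero = \<zero>\<^bsub>M\<^esub>,
     add = add M, smult = cscale A M\<rparr>"

lemma vector_space_of_simps [simp]:
  "carrier (vector_space_of M) = carrier M" "\<zero>\<^bsub>vector_space_of M\<^esub> = \<zero>\<^bsub>M\<^esub>"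
  "x \<oplus>\<^bsub>vector_space_of M\<^esub> y = x \<oplus>\<^bsub>M\<^esub> y" "c \<odot>\<^bsub>vector_space_of M\<^esub> x = sc c \<odot>\<^bsub>M\<^esub> x"
  by (simp_all add: vector_space_of_def cscale_sc)

lemma left_module_vector_space_of:
  assumes "left_module A M" shows "left_module complex_ring (vector_space_of M)"
proof -
  interpret M: left_module A M by fact
  show ?thesis
  proof (rule left_moduleI[OF ring_complex_ring])
    show "\<zero>\<^bsub>complex_ring\<^esub> \<odot>\<^bsub>vector_space_of M\<^esub> x = \<zero>\<^bsub>vector_space_of M\<^esub>"
        if "x \<in> carrier (vector_space_of M)" for x
      using that by (simp add: complex_ring_def M.smult_zero_l)
  qed (simp_all add: M.M.a_ac M.smult_closed M.smult_r_distr complex_ring_def sc_add sc_mult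
      M.smult_l_distr M.smult_assoc M.smult_one)
qed

text \<open>The module of linear maps from \<open>A\<close> to \<open>X\<close>, with (a f)(x) = f(x
  a): the right adjoint of passing from modules to vector spaces, so only the linear structure of
  \<open>X\<close> enters. Functions are extensional, hence determined by their values on
  \<open>A\<close>.\<close>

definition coinduced :: "('a, 'm) module \<Rightarrow> ('a, 'a \<Rightarrow> 'm) module" where
  "coinduced X =
    \<lparr>carrier = {f \<in> carrier A \<rightarrow>\<^sub>E carrier X.
       f \<in> lmod_hom complex_ring (vector_space_of (regular_module A)) (vector_space_of X)},
     mult = undefined, one = undefined, zero = (\<lambda>x\<in>carrier A. \<zero>\<^bsub>X\<^esub>),
     add = (\<lambda>f g. \<lambda>x\<in>carrier A. f x \<oplus>\<^bsub>X\<^esub> g x),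
     smult = (\<lambda>a f. \<lambda>x\<in>carrier A. f (x \<otimes> a))\<rparr>"

lemma carrier_coinduced:
  "f \<in> carrier (coinduced X) \<longleftrightarrow> f \<in> carrier A \<rightarrow>\<^sub>E carrier X \<and>
     (\<forall>x\<in>carrier A. \<forall>y\<in>carrier A. f (x \<oplus> y) = f x \<oplus>\<^bsub>X\<^esub> f y) \<and>
     (\<forall>c. \<forall>x\<in>carrier A. f (sc c \<otimes> x) = sc c \<odot>\<^bsub>X\<^esub> f x)"
  by (auto simp: coinduced_def lmod_hom_def regular_module_def)

lemma left_module_coinduced:
  assumes "left_module A X" shows "left_module A (coinduced X)"
proof -
  interpret X: left_module A X by fact
  let ?H = "coinduced X"
  have H: "f x \<in> carrier X" if "f \<in> carrier ?H" "x \<in> carrier A" for f x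
    using that unfolding carrier_coinduced by auto
  have Hadd: "f (x \<oplus> y) = f x \<oplus>\<^bsub>X\<^esub> f y" if "f \<in> carrier ?H" "x \<in> carrier A" "y \<in> carrier A" for f x y
    using that unfolding carrier_coinduced by auto
  have Hsc: "f (sc c \<otimes> x) = sc c \<odot>\<^bsub>X\<^esub> f x" if "f \<in> carrier ?H" "x \<in> carrier A" for f c x
    using that unfolding carrier_coinduced by auto
  have Hext: "f \<in> extensional (carrier A)" if "f \<in> carrier ?H" for f
    using that unfolding carrier_coinduced by (auto simp: PiE_def)
  have f0: "f \<zero> = \<zero>\<^bsub>X\<^esub>" if f: "f \<in> carrier ?H" for f
    using Hsc[OF f one_closed, of 0] X.smult_zero_l[OF H[OF f one_closed]] by simp
  have ext: "f = g" if f: "f \<in> carrier ?H" and g: "g \<in> carrier ?H"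
      and eq: "\<And>x. x \<in> carrier A \<Longrightarrow> f x = g x" for f g
    using Hext[OF f] Hext[OF g] eq by (rule extensionalityI)
  have add: "f \<oplus>\<^bsub>?H\<^esub> g = (\<lambda>x\<in>carrier A. f x \<oplus>\<^bsub>X\<^esub> g x)" for f g by (simp add: coinduced_def)
  have smult: "a \<odot>\<^bsub>?H\<^esub> f = (\<lambda>x\<in>carrier A. f (x \<otimes> a))" for a f by (simp add: coinduced_def)
  have zero: "\<zero>\<^bsub>?H\<^esub> = (\<lambda>x\<in>carrier A. \<zero>\<^bsub>X\<^esub>)" by (simp add: coinduced_def)
  have addc: "f \<oplus>\<^bsub>?H\<^esub> g \<in> carrier ?H" if "f \<in> carrier ?H" "g \<in> carrier ?H" for f g
    unfolding carrier_coinduced add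
    using that by (auto simp: H Hadd Hsc X.M.a_ac X.smult_r_distr)
  have smc: "a \<odot>\<^bsub>?H\<^esub> f \<in> carrier ?H" if "a \<in> carrier A" "f \<in> carrier ?H" for a f
    unfolding carrier_coinduced smult
    using that by (auto simp: H Hadd Hsc l_distr m_assoc)
  have zc: "\<zero>\<^bsub>?H\<^esub> \<in> carrier ?H" 
    unfolding carrier_coinduced zero by (auto simp: X.smult_zero_r)
  show ?thesis
  proof (rule left_moduleI[OF ring_axioms zc addc])
    fix f assume f: "f \<in> carrier ?H"
    show "\<zero>\<^bsub>?H\<^esub> \<oplus>\<^bsub>?H\<^esub> f = f" by (rule ext[OF addc[OF zc f] f]) (simp add: add zero H[OF f])
    show "\<one> \<odot>\<^bsub>?H\<^esub> f = f" by (rule ext[OF smc[OF one_closed f] f]) (simp add: smult)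
    show "\<zero> \<odot>\<^bsub>?H\<^esub> f = \<zero>\<^bsub>?H\<^esub>" by (rule ext[OF smc[OF zero_closed f] zc]) (simp add: smult zero f0[OF f])
    fix g assume g: "g \<in> carrier ?H"
    show "f \<oplus>\<^bsub>?H\<^esub> g = g \<oplus>\<^bsub>?H\<^esub> f"
      by (rule ext[OF addc[OF f g] addc[OF g f]]) (simp add: add H[OF f] H[OF g] X.M.a_comm)
    fix k assume k: "k \<in> carrier ?H"
    show "f \<oplus>\<^bsub>?H\<^esub> g \<oplus>\<^bsub>?H\<^esub> k = f \<oplus>\<^bsub>?H\<^esub> (g \<oplus>\<^bsub>?H\<^esub> k)"
      by (rule ext[OF addc[OF addc[OF f g] k] addc[OF f addc[OF g k]]])
        (simp add: add H[OF f] H[OF g] H[OF k] X.M.a_assoc)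
  next
    fix a f assume a: "a \<in> carrier A" and f: "f \<in> carrier ?H"
    show "a \<odot>\<^bsub>?H\<^esub> f \<in> carrier ?H" by (rule smc[OF a f])
    { fix g assume g: "g \<in> carrier ?H"
      show "a \<odot>\<^bsub>?H\<^esub> (f \<oplus>\<^bsub>?H\<^esub> g) = a \<odot>\<^bsub>?H\<^esub> f \<oplus>\<^bsub>?H\<^esub> a \<odot>\<^bsub>?H\<^esub> g"
        by (rule ext[OF smc[OF a addc[OF f g]] addc[OF smc[OF a f] smc[OF a g]]]) (simp add: add smult a) }
    fix b assume b: "b \<in> carrier A"
    show "(a \<oplus> b) \<odot>\<^bsub>?H\<^esub> f = a \<odot>\<^bsub>?H\<^esub> f \<oplus>\<^bsub>?H\<^esub> b \<odot>\<^bsub>?H\<^esub> f"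
      by (rule ext[OF smc[OF a_closed[OF a b] f] addc[OF smc[OF a f] smc[OF b f]]])
        (simp add: add smult a b Hadd[OF f] r_distr)
    show "(a \<otimes> b) \<odot>\<^bsub>?H\<^esub> f = a \<odot>\<^bsub>?H\<^esub> (b \<odot>\<^bsub>?H\<^esub> f)"
      by (rule ext[OF smc[OF m_closed[OF a b] f] smc[OF a smc[OF b f]]]) (simp add: smult a b m_assoc)
  qed
qed

text \<open>By adjunction, extending a homomorphism into \<open>coinduced X\<close> amounts to extending a linear map into
  \<open>X\<close>.\<close>

lemma coinduced_extend:
  fixes N L :: "('a, 'n) module" and X :: "('a, 'm) module"
  assumes X: "left_module A X" and L: "left_module A L" and N: "left_module A N"
    and i: "i \<in> lmod_hom A N L" "inj_on i (carrier N)" and g: "g \<in> lmod_hom A N (coinduced X)"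
  shows "\<exists>h\<in>lmod_hom A L (coinduced X). \<forall>x\<in>carrier N. h (i x) = g x"
proof -
  interpret X: left_module A X by fact
  interpret L: left_module A L by fact
  interpret N: left_module A N by fact
  let ?v = vector_space_of
  note lv = left_module_vector_space_of
  let ?U = "i ` carrier N"
  have iv: "i \<in> lmod_hom complex_ring (?v N) (?v L)"
    using i(1) by (intro lmod_homI) (auto simp: lmod_homD)
  have U: "submodule ?U complex_ring (?v L)"
    using submodule_image[OF lv[OF N] lv[OF L] iv left_module.submodule_carrier[OF lv[OF N]]] by simp
  have gc: "g x \<in> carrier (coinduced X)" if "x \<in> carrier N" for x by (rule lmod_homD(1)[OF g that])
  have gX: "g x b \<in> carrier X" if "x \<in> carrier N" "b \<in> carrier A" for x b
    using gc[OF that(1)] that(2) unfolding carrier_coinduced by auto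
  have gadd: "g (x \<oplus>\<^bsub>N\<^esub> y) b = g x b \<oplus>\<^bsub>X\<^esub> g y b" if "x \<in> carrier N" "y \<in> carrier N" "b \<in> carrier A" for x y b
    using lmod_homD(2)[OF g that(1,2)] that(3) by (simp add: coinduced_def)
  have gsm: "g (a \<odot>\<^bsub>N\<^esub> x) b = g x (b \<otimes> a)" if "a \<in> carrier A" "x \<in> carrier N" "b \<in> carrier A" for a x b
    using lmod_homD(3)[OF g that(1,2)] that(3) by (simp add: coinduced_def)
  \<comment> \<open>The linear map adjoint to \<open>g\<close>: evaluation at \<open>\<one>\<close>,
    the counit, transported to the image of \<open>i\<close>.\<close>
  let ?k = "\<lambda>y. g (inv_into (carrier N) i y) \<one>"
  have ki: "?k (i x) = g x \<one>" if "x \<in> carrier N" for x using i(2) that by (simp add: inv_into_f_f)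
  have gsc: "g (sc c \<odot>\<^bsub>N\<^esub> x) \<one> = sc c \<odot>\<^bsub>X\<^esub> g x \<one>" if x: "x \<in> carrier N" for c x
  proof -
    have "g x (sc c \<otimes> \<one>) = sc c \<odot>\<^bsub>X\<^esub> g x \<one>" using gc[OF x] unfolding carrier_coinduced by blast
    then show ?thesis using gsm[OF sc_closed x one_closed] by simp
  qed
  have k: "?k \<in> lmod_hom complex_ring ((?v L)\<lparr>carrier := ?U\<rparr>) (?v X)"
  proof (rule lmod_homI)
    fix y assume "y \<in> carrier ((?v L)\<lparr>carrier := ?U\<rparr>)"
    then show "?k y \<in> carrier (?v X)" using gX ki by auto
  next
    fix y z assume "y \<in> carrier ((?v L)\<lparr>carrier := ?U\<rparr>)" "z \<in> carrier ((?v L)\<lparr>carrier := ?U\<rparr>)"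
    then obtain p q where pq: "p \<in> carrier N" "q \<in> carrier N" "y = i p" "z = i q" by auto
    have s: "p \<oplus>\<^bsub>N\<^esub> q \<in> carrier N" using pq by simp
    have "?k (i (p \<oplus>\<^bsub>N\<^esub> q)) = ?k (i p) \<oplus>\<^bsub>X\<^esub> ?k (i q)"
      unfolding ki[OF s] ki[OF pq(1)] ki[OF pq(2)] by (rule gadd[OF pq(1,2) one_closed])
    then show "?k (y \<oplus>\<^bsub>(?v L)\<lparr>carrier := ?U\<rparr>\<^esub> z) = ?k y \<oplus>\<^bsub>?v X\<^esub> ?k z"
      using pq lmod_homD(2)[OF i(1) pq(1,2)] by simp
  next
    fix c y assume "y \<in> carrier ((?v L)\<lparr>carrier := ?U\<rparr>)"
    then obtain p where p: "p \<in> carrier N" "y = i p" by auto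
    have s: "sc c \<odot>\<^bsub>N\<^esub> p \<in> carrier N" using p by (simp add: N.smult_closed)
    have "?k (i (sc c \<odot>\<^bsub>N\<^esub> p)) = sc c \<odot>\<^bsub>X\<^esub> ?k (i p)"
      unfolding ki[OF s] ki[OF p(1)] by (rule gsc[OF p(1)])
    then show "?k (c \<odot>\<^bsub>(?v L)\<lparr>carrier := ?U\<rparr>\<^esub> y) = c \<odot>\<^bsub>?v X\<^esub> ?k y"
      using p lmod_homD(3)[OF i(1) sc_closed p(1)] by simp
  qed
  obtain G where G: "G \<in> lmod_hom complex_ring (?v L) (?v X)" "\<forall>x\<in>?U. G x = ?k x"
    using linear_extend_ex[OF lv[OF L] lv[OF X] U k] by blast
  have GX: "G x \<in> carrier X" "G (x \<oplus>\<^bsub>L\<^esub> y) = G x \<oplus>\<^bsub>X\<^esub> G y" "G (sc c \<odot>\<^bsub>L\<^esub> x) = sc c \<odot>\<^bsub>X\<^esub> G x"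
    if "x \<in> carrier L" "y \<in> carrier L" for x y c
    using lmod_homD[OF G(1)] that by auto
  \<comment> \<open>The homomorphism adjoint to the linear extension \<open>G\<close>.\<close>
  define h where "h l = (\<lambda>b\<in>carrier A. G (b \<odot>\<^bsub>L\<^esub> l))" for l
  have hc: "h l \<in> carrier (coinduced X)" if l: "l \<in> carrier L" for l
    unfolding carrier_coinduced h_def using l GX
    by (auto simp: L.smult_closed L.smult_l_distr L.smult_assoc)
  have "h \<in> lmod_hom A L (coinduced X)"
  proof (rule lmod_homI[OF hc])
    show "h (x \<oplus>\<^bsub>L\<^esub> y) = h x \<oplus>\<^bsub>coinduced X\<^esub> h y" if "x \<in> carrier L" "y \<in> carrier L" for x y
      using that GX(2) by (auto simp: h_def coinduced_def L.smult_r_distr L.smult_closed)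
    show "h (a \<odot>\<^bsub>L\<^esub> x) = a \<odot>\<^bsub>coinduced X\<^esub> h x" if "a \<in> carrier A" "x \<in> carrier L" for a x
      using that by (auto simp: h_def coinduced_def L.smult_assoc)
  qed
  moreover have "h (i x) = g x" if x: "x \<in> carrier N" for x
  proof (rule extensionalityI[of _ "carrier A"])
    show "h (i x) \<in> extensional (carrier A)" by (simp add: h_def)
    show "g x \<in> extensional (carrier A)" using gc[OF x] unfolding carrier_coinduced by (auto simp: PiE_def)
    fix b assume b: "b \<in> carrier A"
    have bx: "b \<odot>\<^bsub>N\<^esub> x \<in> carrier N" by (rule N.smult_closed[OF b x])
    have "G (b \<odot>\<^bsub>L\<^esub> i x) = G (i (b \<odot>\<^bsub>N\<^esub> x))" using lmod_homD(3)[OF i(1) b x] by simp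
    also have "\<dots> = ?k (i (b \<odot>\<^bsub>N\<^esub> x))" using G(2) bx by blast
    also have "\<dots> = g x b" unfolding ki[OF bx] using gsm[OF b x one_closed] b by simp
    finally show "h (i x) b = g x b" using b by (simp add: h_def)
  qed
  ultimately show ?thesis by blast
qed

text \<open>\<open>X\<close> embeds by sending \<open>x\<close> to the map b -> b x, from which
  \<open>x\<close> is recovered at \<open>\<one>\<close>. The module found is injective, but
  \<open>X\<close> need not be essential in it.\<close>

lemma injective_hull_ex:
  fixes X :: "('a, 'u) module" and c :: "('a \<Rightarrow> 'u) \<Rightarrow> 'u"
  assumes X: "left_module A X" and inj: "inj_on c (carrier (coinduced X))"
  obtains E :: "('a, 'u) module" and i where "injective_module A E" "i \<in> lmod_hom A X E" "inj_on i (carrier X)"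
proof -
  interpret X: left_module A X by fact
  let ?H = "coinduced X" and ?E = "image_module c (coinduced X)"
  note H = left_module_coinduced[OF X]
  note im = image_module_inj[OF H inj]
  have ch: "c \<in> lmod_hom A ?H ?E" using im(2) by (simp add: lmod_iso_def)
  let ?d = "inv_into (carrier ?H) c"
  have d: "?d \<in> lmod_hom A ?E ?H" using lmod_iso_inv[OF H im] by (simp add: lmod_iso_def)
  have "injective_module A ?E"
    unfolding injective_module_def
  proof (intro conjI im(1) allI impI; elim conjE)
    fix M N :: "('a, 'u) module" and i g
    assume *: "left_module A M" "left_module A N" "i \<in> lmod_hom A N M" "inj_on i (carrier N)"
        "g \<in> lmod_hom A N ?E"
    obtain h where h: "h \<in> lmod_hom A M ?H" "\<forall>x\<in>carrier N. h (i x) = ?d (g x)"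
      using coinduced_extend[OF X *(1-4) lmod_hom_comp[OF *(5) d]] by blast
    have "c (h (i x)) = g x" if "x \<in> carrier N" for x
      using h(2) that lmod_homD(1)[OF *(5) that] by (simp add: f_inv_into_f)
    then show "\<exists>h\<in>lmod_hom A M ?E. \<forall>x\<in>carrier N. h (i x) = g x"
      using lmod_hom_comp[OF h(1) ch] by (intro bexI[of _ "\<lambda>x. c (h x)"]) auto
  qed
  moreover define u where "u x = (\<lambda>b\<in>carrier A. b \<odot>\<^bsub>X\<^esub> x)" for x
  have u: "u \<in> lmod_hom A X ?H"
  proof (rule lmod_homI)
    show "u x \<in> carrier ?H" if "x \<in> carrier X" for x
      using that unfolding carrier_coinduced u_def by (auto simp: X.smult_closed X.smult_l_distr X.smult_assoc)
    show "u (x \<oplus>\<^bsub>X\<^esub> y) = u x \<oplus>\<^bsub>?H\<^esub> u y" if "x \<in> carrier X" "y \<in> carrier X" for x y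
      using that by (auto simp: u_def coinduced_def X.smult_r_distr)
    show "u (a \<odot>\<^bsub>X\<^esub> x) = a \<odot>\<^bsub>?H\<^esub> u x" if "a \<in> carrier A" "x \<in> carrier X" for a x
      using that by (auto simp: u_def coinduced_def X.smult_assoc)
  qed
  have uinj: "inj_on u (carrier X)"
  proof (rule inj_onI)
    fix x y assume "x \<in> carrier X" "y \<in> carrier X" "u x = u y"
    then have "u x \<one> = u y \<one>" by simp
    moreover have "u x \<one> = x" "u y \<one> = y"
      using \<open>x \<in> carrier X\<close> \<open>y \<in> carrier X\<close> by (simp_all add: u_def X.smult_one)
    ultimately show "x = y" by simp
  qed
  have "inj_on (\<lambda>x. c (u x)) (carrier X)"
    using comp_inj_on[OF uinj inj_on_subset[OF inj]] lmod_homD(1)[OF u] by (force simp: comp_def)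
  ultimately show ?thesis using that lmod_hom_comp[OF u ch] by blast
qed

text \<open>The sizes fit: an element of \<open>A\<close> is coded by its \<open>d\<close>
  coordinates, and an element of \<open>coinduced X\<close>, being linear, by its \<open>d\<close>
  values at the basis. An injection of the complex numbers into \<open>'u\<close> therefore suffices
  to make room for all modules involved.\<close>

lemma enough_modules:
  fixes a :: "nat \<Rightarrow> 'a" and j :: "complex \<Rightarrow> 'u"
  assumes j: "inj j" and basis: "is_basis A d a"
  shows "enough_modules TYPE('u) A"
proof -
  have inf: "infinite (UNIV :: 'u set)"
    using finite_imageD[of j UNIV] j infinite_UNIV_char_0[where 'a =
        complex] finite_subset[OF subset_UNIV, of "range j"]
    by blast
  obtain t :: "(nat \<Rightarrow> 'u) \<Rightarrow> 'u" where t: "inj_on t (extensional {..<d})" using inj_tuple_ex[OF inf] by blast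
  have ac: "a i \<in> carrier A" if "i < d" for i using basis that by (simp add: is_basis_def)
  have span: "\<exists>c :: nat \<Rightarrow> complex. c \<in> extensional {..<d} \<and> x = (\<Oplus>i\<in>{..<d}. c i \<odot> a i)" if "x \<in> carrier A" for x
    using basis that unfolding is_basis_def by blast
  have "\<exists>k :: 'a \<Rightarrow> 'u. inj_on k (carrier A)"
  proof -
    define co where "co x = (SOME c :: nat \<Rightarrow> complex. c \<in> extensional {..<d} \<and> x =
        (\<Oplus>i\<in>{..<d}. c i \<odot> a i))" for x
    have co: "co x \<in> extensional {..<d} \<and> x = (\<Oplus>i\<in>{..<d}. co x i \<odot> a i)" if "x \<in> carrier A" for x
      using someI_ex[OF span[OF that]] unfolding co_def .
    have "inj_on (\<lambda>x. t (\<lambda>i\<in>{..<d}. j (co x i))) (carrier A)"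
    proof (rule inj_onI)
      fix x y assume xy: "x \<in> carrier A" "y \<in> carrier A"
        and "t (\<lambda>i\<in>{..<d}. j (co x i)) = t (\<lambda>i\<in>{..<d}. j (co y i))"
      then have eq: "(\<lambda>i\<in>{..<d}. j (co x i)) = (\<lambda>i\<in>{..<d}. j (co y i))" using inj_onD[OF t] by simp
      have "co x i = co y i" if "i < d" for i
        using fun_cong[OF eq, of i] that injD[OF j] by simp
      then have "co x = co y" using co[OF xy(1)] co[OF xy(2)] by (intro extensionalityI[of _ "{..<d}"]) auto
      then show "x = y" using co[OF xy(1)] co[OF xy(2)] by metis
    qed
    then show ?thesis by blast
  qed
  then obtain k :: "'a \<Rightarrow> 'u" where k: "inj_on k (carrier A)" by blast
  have cinj: "inj_on (\<lambda>f. t (\<lambda>i\<in>{..<d}. f (a i))) (carrier (coinduced X))" if X: "left_module A X"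
      for X :: "('a, 'u) module"
  proof (rule inj_onI)
    interpret X: left_module A X by fact
    fix f g assume f: "f \<in> carrier (coinduced X)" and g: "g \<in> carrier (coinduced X)"
      and "t (\<lambda>i\<in>{..<d}. f (a i)) = t (\<lambda>i\<in>{..<d}. g (a i))"
    then have eq: "(\<lambda>i\<in>{..<d}. f (a i)) = (\<lambda>i\<in>{..<d}. g (a i))" using inj_onD[OF t] by simp
    have fin: "f (\<Oplus>i\<in>F. c i \<odot> a i) = g (\<Oplus>i\<in>F. c i \<odot> a i)" if "finite F" "F \<subseteq> {..<d}" for F
        and c :: "nat \<Rightarrow> complex"
      using that
    proof (induction F rule: finite_induct)
      case empty
      have *: "h \<zero> = \<zero>\<^bsub>X\<^esub>" if h: "h \<in> carrier (coinduced X)" for h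
      proof -
        have "h (sc 0 \<otimes> \<one>) = sc 0 \<odot>\<^bsub>X\<^esub> h \<one>" "h \<one> \<in> carrier X" using h one_closed
            unfolding carrier_coinduced by blast+
        then show ?thesis using X.smult_zero_l[of "h \<one>"] by simp
      qed
      show ?case using *[OF f] *[OF g] by simp
    next
      case (insert i F)
      have cl: "c i \<odot> a i \<in> carrier A" if "i < d" for i using ac[OF that] by (simp add: csmult_closed)
      have S: "(\<Oplus>i\<in>F. c i \<odot> a i) \<in> carrier A" using insert cl by (intro finsum_closed) auto
      have eq1: "(\<Oplus>i\<in>insert i F. c i \<odot> a i) = c i \<odot> a i \<oplus> (\<Oplus>i\<in>F. c i \<odot> a i)"
        using insert cl by (intro finsum_insert) auto
      have i: "i < d" using insert by auto
      have h: "h (\<Oplus>i\<in>insert i F. c i \<odot> a i) = sc (c i) \<odot>\<^bsub>X\<^esub> h (a i) \<oplus>\<^bsub>X\<^esub> h (\<Oplus>i\<in>F. c i \<odot> a i)"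
        if h: "h \<in> carrier (coinduced X)" for h
      proof -
        have "h (c i \<odot> a i) = sc (c i) \<odot>\<^bsub>X\<^esub> h (a i)"
          using h ac[OF i] csmult_eq[OF ac[OF i], of "c i"]
              unfolding carrier_coinduced sc_def[symmetric] by simp
        then show ?thesis unfolding eq1 using h cl[OF i] S unfolding carrier_coinduced by simp
      qed
      have "f (a i) = g (a i)" using fun_cong[OF eq, of i] i by simp
      then show ?case unfolding h[OF f] h[OF g] using insert by simp
    qed
    show "f = g"
    proof (rule extensionalityI[of _ "carrier A"])
      show "f \<in> extensional (carrier A)" "g \<in> extensional (carrier A)"
        using f g unfolding carrier_coinduced by (auto simp: PiE_def)
      fix x assume "x \<in> carrier A"
      then obtain c :: "nat \<Rightarrow> complex" where "x = (\<Oplus>i\<in>{..<d}. c i \<odot> a i)" using span by blast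
      then show "f x = g x" using fin[of "{..<d}" c] by simp
    qed
  qed
  show ?thesis
    unfolding enough_modules_def
  proof (intro allI impI conjI)
    fix X :: "('a, 'u) module" assume X: "left_module A X"
    obtain P :: "('a, 'u) module" and p where "projective_module A P" "p \<in> lmod_hom A P X"
        "p ` carrier P = carrier X"
      by (rule projective_cover_ex[OF inf k X])
    then show "\<exists>(P :: ('a, 'u) module) p. projective_module A P \<and> p \<in> lmod_hom A P X \<and> p ` carrier P =
        carrier X"
      by blast
    obtain E :: "('a, 'u) module" and i where "injective_module A E" "i \<in> lmod_hom A X E" "inj_on i (carrier X)"
      by (rule injective_hull_ex[OF X cinj[OF X]])
    then show "\<exists>(E :: ('a, 'u) module) i. injective_module A E \<and> i \<in> lmod_hom A X E \<and> inj_on i (carrier X)"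
      by blast
  qed
qed

end

section \<open>Bochner integrals of linear combinations\<close>

text \<open>Finitely many functionals separating points stand in for finite dimension: they yield a
  norm and reduce equations between vector integrals to equations between scalar ones.\<close>

locale functional_space = left_module complex_ring V for V :: "(complex, 'b) module" (structure) +
  fixes \<Phi> :: "('b \<Rightarrow> complex) set"
  assumes finite_functionals: "finite \<Phi>"
    and functionals: "\<Phi> \<subseteq> lmod_hom complex_ring V (regular_module complex_ring)"
    and separating: "x \<in> carrier V \<Longrightarrow> (\<And>\<phi>. \<phi> \<in> \<Phi> \<Longrightarrow> \<phi> x = 0) \<Longrightarrow> x = \<zero>\<^bsub>V\<^esub>"
begin

lemma scale_closed: "x \<in> carrier V \<Longrightarrow> c \<odot>\<^bsub>V\<^esub> x \<in> carrier V"
  by (simp add: smult_closed)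

lemma scale_zero: "x \<in> carrier V \<Longrightarrow> 0 \<odot>\<^bsub>V\<^esub> x = \<zero>\<^bsub>V\<^esub>"
  using smult_zero_l[of x] by (simp add: complex_ring_def)

lemma functional_add: "\<phi> \<in> \<Phi> \<Longrightarrow> x \<in> carrier V \<Longrightarrow> y \<in> carrier V \<Longrightarrow> \<phi> (x \<oplus>\<^bsub>V\<^esub> y) = \<phi> x + \<phi> y"
  using functionals lmod_homD(2)[of \<phi> complex_ring V "regular_module complex_ring" x y]
  by (auto simp: regular_module_def complex_ring_def)

lemma functional_scale: "\<phi> \<in> \<Phi> \<Longrightarrow> x \<in> carrier V \<Longrightarrow> \<phi> (c \<odot>\<^bsub>V\<^esub> x) = c * \<phi> x"
  using functionals lmod_homD(3)[of \<phi> complex_ring V "regular_module complex_ring" c x]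
  by (auto simp: regular_module_def complex_ring_def)

lemma functional_zero: "\<phi> \<in> \<Phi> \<Longrightarrow> \<phi> \<zero>\<^bsub>V\<^esub> = 0"
  using functional_scale[of \<phi> "\<zero>\<^bsub>V\<^esub>" 0] scale_zero[of "\<zero>\<^bsub>V\<^esub>"] by simp

lemma functional_minus:
  assumes "\<phi> \<in> \<Phi>" "x \<in> carrier V" "y \<in> carrier V" shows "\<phi> (x \<ominus>\<^bsub>V\<^esub> y) = \<phi> x - \<phi> y"
proof -
  have "\<phi> (x \<ominus>\<^bsub>V\<^esub> y) + \<phi> y = \<phi> ((x \<ominus>\<^bsub>V\<^esub> y) \<oplus>\<^bsub>V\<^esub> y)" using assms by (simp add: functional_add)
  also have "(x \<ominus>\<^bsub>V\<^esub> y) \<oplus>\<^bsub>V\<^esub> y = x" using assms by (simp add: a_minus_def M.a_assoc M.l_neg)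
  finally show ?thesis by (simp add: algebra_simps)
qed

lemma functional_finsum:
  assumes "\<phi> \<in> \<Phi>" "finite F" "f \<in> F \<rightarrow> carrier V"
  shows "\<phi> (\<Oplus>\<^bsub>V\<^esub>i\<in>F. f i) = (\<Sum>i\<in>F. \<phi> (f i))"
  using assms(2,3)
proof (induction F rule: finite_induct)
  case empty then show ?case using functional_zero[OF assms(1)] by simp
next
  case (insert i F)
  have "(\<Oplus>\<^bsub>V\<^esub>i\<in>insert i F. f i) = f i \<oplus>\<^bsub>V\<^esub> (\<Oplus>\<^bsub>V\<^esub>i\<in>F. f i)"
    using insert by (intro M.finsum_insert) auto
  then show ?case using insert by (simp add: functional_add[OF assms(1)] Pi_iff M.finsum_closed)
qed

lemma separating_eq:
  assumes "x \<in> carrier V" "y \<in> carrier V" "\<And>\<phi>. \<phi> \<in> \<Phi> \<Longrightarrow> \<phi> x = \<phi> y" shows "x = y"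
proof -
  have "x \<ominus>\<^bsub>V\<^esub> y = \<zero>\<^bsub>V\<^esub>" using assms by (intro separating) (auto simp: functional_minus)
  then show ?thesis using assms minus_zero_iff by blast
qed

definition fnorm :: "'b \<Rightarrow> real" where "fnorm x = (\<Sum>\<phi>\<in>\<Phi>. cmod (\<phi> x))"

lemma fnorm_bound: "\<phi> \<in> \<Phi> \<Longrightarrow> cmod (\<phi> x) \<le> fnorm x"
  unfolding fnorm_def using finite_functionals by (intro member_le_sum) auto

lemma norm_on_fnorm: "norm_on V fnorm"
  unfolding norm_on_def
proof (intro conjI ballI allI)
  fix x assume x: "x \<in> carrier V"
  show "0 \<le> fnorm x" by (simp add: fnorm_def sum_nonneg)
  show "fnorm x = 0 \<longleftrightarrow> x = \<zero>\<^bsub>V\<^esub>"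
  proof
    assume "fnorm x = 0"
    then have "\<phi> x = 0" if "\<phi> \<in> \<Phi>" for \<phi> using fnorm_bound[OF that, of x] by simp
    then show "x = \<zero>\<^bsub>V\<^esub>" using separating x by blast
  qed (simp add: fnorm_def functional_zero)
  show "fnorm (c \<odot>\<^bsub>V\<^esub> x) = cmod c * fnorm x" for c
    using x by (simp add: fnorm_def functional_scale norm_mult sum_distrib_left)
  fix y assume "y \<in> carrier V"
  then show "fnorm (x \<oplus>\<^bsub>V\<^esub> y) \<le> fnorm x + fnorm y"
    using x by (simp add: fnorm_def functional_add sum.distrib[symmetric] sum_mono norm_triangle_ineq)
qed

definition lincomb :: "nat \<Rightarrow> (nat \<Rightarrow> complex) \<Rightarrow> (nat \<Rightarrow> 'b) \<Rightarrow> 'b" where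
  "lincomb d c \<rho> = (\<Oplus>\<^bsub>V\<^esub>i\<in>{..<d}. c i \<odot>\<^bsub>V\<^esub> \<rho> i)"

lemma lincomb_closed: "(\<And>i. i < d \<Longrightarrow> \<rho> i \<in> carrier V) \<Longrightarrow> lincomb d c \<rho> \<in> carrier V"
  unfolding lincomb_def by (intro M.finsum_closed) (auto simp: scale_closed)

lemma functional_lincomb:
  "\<phi> \<in> \<Phi> \<Longrightarrow> (\<And>i. i < d \<Longrightarrow> \<rho> i \<in> carrier V) \<Longrightarrow> \<phi> (lincomb d c \<rho>) = (\<Sum>i<d. c i * \<phi> (\<rho> i))"
  unfolding lincomb_def by (subst functional_finsum) (auto simp: scale_closed functional_scale intro!: sum.cong)

lemma lincomb_minus:
  assumes "\<And>i. i < d \<Longrightarrow> \<rho> i \<in> carrier V"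
  shows "lincomb d c \<rho> \<ominus>\<^bsub>V\<^esub> lincomb d c' \<rho> = lincomb d (\<lambda>i. c i - c' i) \<rho>"
  using assms
  by (intro separating_eq)
     (auto simp: functional_minus functional_lincomb lincomb_closed sum_subtractf left_diff_distrib)

lemma norm_lincomb_le:
  assumes \<nu>: "norm_on V \<nu>" and \<rho>: "\<And>i. i < d \<Longrightarrow> \<rho> i \<in> carrier V"
  shows "\<nu> (lincomb d c \<rho>) \<le> (\<Sum>i<d. cmod (c i) * \<nu> (\<rho> i))"
proof -
  have "\<nu> (\<Oplus>\<^bsub>V\<^esub>i\<in>F. c i \<odot>\<^bsub>V\<^esub> \<rho> i) \<le> (\<Sum>i\<in>F. cmod (c i) * \<nu> (\<rho> i))" if "finite F" "F \<subseteq> {..<d}" for F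
    using that
  proof (induction F rule: finite_induct)
    case empty
    have "\<nu> \<zero>\<^bsub>V\<^esub> = 0" using \<nu> M.zero_closed unfolding norm_on_def by blast
    then show ?case by simp
  next
    case (insert i F)
    have cl: "c i \<odot>\<^bsub>V\<^esub> \<rho> i \<in> carrier V" if "i < d" for i using \<rho>[OF that] by (simp add: scale_closed)
    have F: "(\<Oplus>\<^bsub>V\<^esub>i\<in>F. c i \<odot>\<^bsub>V\<^esub> \<rho> i) \<in> carrier V" using insert cl by (intro M.finsum_closed) auto
    have i: "c i \<odot>\<^bsub>V\<^esub> \<rho> i \<in> carrier V" "\<rho> i \<in> carrier V" using insert cl \<rho> by auto
    have "(\<Oplus>\<^bsub>V\<^esub>i\<in>insert i F. c i \<odot>\<^bsub>V\<^esub> \<rho> i) = c i \<odot>\<^bsub>V\<^esub> \<rho> i \<oplus>\<^bsub>V\<^esub> (\<Oplus>\<^bsub>V\<^esub>i\<in>F. c i \<odot>\<^bsub>V\<^esub> \<rho> i)"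
      using insert cl by (intro M.finsum_insert) auto
    moreover have "\<nu> (c i \<odot>\<^bsub>V\<^esub> \<rho> i \<oplus>\<^bsub>V\<^esub> (\<Oplus>\<^bsub>V\<^esub>i\<in>F. c i \<odot>\<^bsub>V\<^esub> \<rho> i)) \<le>
        \<nu> (c i \<odot>\<^bsub>V\<^esub> \<rho> i) + \<nu> (\<Oplus>\<^bsub>V\<^esub>i\<in>F. c i \<odot>\<^bsub>V\<^esub> \<rho> i)"
      using \<nu> i(1) F unfolding norm_on_def by blast
    moreover have "\<nu> (c i \<odot>\<^bsub>V\<^esub> \<rho> i) = cmod (c i) * \<nu> (\<rho> i)" using \<nu> i(2) unfolding norm_on_def by blast
    ultimately show ?case using insert by simp
  qed
  then show ?thesis unfolding lincomb_def by simp
qed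

text \<open>A simple function is the finite sum of its values weighted by the indicators of its
  fibres, so a functional can be applied termwise.\<close>

lemma simple_integral_functional:
  assumes \<mu>: "finite_measure \<mu>" and s: "simple_integrable_in V \<mu> s" and \<phi>: "\<phi> \<in> \<Phi>"
  shows "integrable \<mu> (\<lambda>x. \<phi> (s x))" "\<phi> (simple_integral_in V \<mu> s) = (\<integral>x. \<phi> (s x) \<partial>\<mu>)"
    "simple_integral_in V \<mu> s \<in> carrier V"
proof -
  interpret finite_measure \<mu> by fact
  have sV: "s \<in> space \<mu> \<rightarrow> carrier V" and sf: "simple_function \<mu> s"
    using s by (auto simp: simple_integrable_in_def)
  let ?F = "s ` space \<mu>"
  have fin: "finite ?F" and ms: "\<And>y. y \<in> ?F \<Longrightarrow> {x \<in> space \<mu>. s x = y} \<in> sets \<mu>"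
    using sf unfolding simple_function_def by (auto simp: vimage_def Int_def conj_commute)
  let ?g = "\<lambda>x. \<Sum>y\<in>?F. indicator {x \<in> space \<mu>. s x = y} x *\<^sub>R \<phi> y"
  have eq: "\<phi> (s x) = ?g x" if x: "x \<in> space \<mu>" for x
  proof -
    have "?g x = (\<Sum>y\<in>?F. if y = s x then \<phi> y else 0)"
      using x by (intro sum.cong) (auto simp: indicator_def)
    then show ?thesis using fin x by simp
  qed
  have int: "integrable \<mu> (\<lambda>x. indicator {x \<in> space \<mu>. s x = y} x *\<^sub>R \<phi> y)" if "y \<in> ?F" for y
    using ms[OF that] by (intro integrable_scaleR_left) (auto intro!: integrable_real_indicator simp:
        emeasure_finite less_top[symmetric])
  have ig: "integrable \<mu> ?g" by (intro Bochner_Integration.integrable_sum int)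
  show "integrable \<mu> (\<lambda>x. \<phi> (s x))"
    by (rule iffD2[OF Bochner_Integration.integrable_cong[OF refl] ig]) (rule eq)
  have "(\<integral>x. \<phi> (s x) \<partial>\<mu>) = integral\<^sup>L \<mu> ?g" by (rule Bochner_Integration.integral_cong[OF refl eq])
  also have "\<dots> = (\<Sum>y\<in>?F. \<integral>x. indicator {x \<in> space \<mu>. s x = y} x *\<^sub>R \<phi> y \<partial>\<mu>)"
    by (intro Bochner_Integration.integral_sum int)
  also have "\<dots> = (\<Sum>y\<in>?F. complex_of_real (measure \<mu> {x \<in> space \<mu>. s x = y}) * \<phi> y)"
  proof (intro sum.cong refl)
    fix y assume y: "y \<in> ?F"
    have "(\<integral>x. indicator {x \<in> space \<mu>. s x = y} x *\<^sub>R \<phi> y \<partial>\<mu>) =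
        (\<integral>x. indicator {x \<in> space \<mu>. s x = y} x \<partial>\<mu>) *\<^sub>R \<phi> y"
      using ms[OF y] by (intro integral_scaleR_left) (auto intro!: integrable_real_indicator simp:
          emeasure_finite less_top[symmetric])
    also have "(\<integral>x. indicator {x \<in> space \<mu>. s x = y} x \<partial>\<mu>) = measure \<mu> {x \<in> space \<mu>. s x = y}"
      using ms[OF y] by (simp add: emeasure_finite less_top[symmetric] Int_absorb1)
    finally show "(\<integral>x. indicator {x \<in> space \<mu>. s x = y} x *\<^sub>R \<phi> y \<partial>\<mu>) =
        complex_of_real (measure \<mu> {x \<in> space \<mu>. s x = y}) * \<phi> y" by (simp add: scaleR_conv_of_real)
  qed
  also have "\<dots> = \<phi> (simple_integral_in V \<mu> s)"
    unfolding simple_integral_in_def using sV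
    by (subst functional_finsum[OF \<phi> fin]) (auto simp: Pi_iff scale_closed functional_scale[OF \<phi>]
        intro!: sum.cong)
  finally show "\<phi> (simple_integral_in V \<mu> s) = (\<integral>x. \<phi> (s x) \<partial>\<mu>)" by simp
  show "simple_integral_in V \<mu> s \<in> carrier V"
    unfolding simple_integral_in_def using sV by (intro M.finsum_closed) (auto simp: Pi_iff scale_closed)
qed

text \<open>\<open>fnorm\<close> is among the norms over which the definition quantifies, and it
  bounds each functional of the family; mean convergence of the simple functions in this norm
  therefore passes to their images under \<open>\<phi>\<close>, where scalar limits are
  unique.\<close>

lemma bochner_integral_functional:
  assumes \<mu>: "finite_measure \<mu>" and T: "has_bochner_integral_in V \<mu> f T" and \<phi>: "\<phi> \<in> \<Phi>"
    and int: "integrable \<mu> (\<lambda>x. \<phi> (f x))"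
  shows "\<phi> T = (\<integral>x. \<phi> (f x) \<partial>\<mu>)"
proof -
  have fV: "f \<in> space \<mu> \<rightarrow> carrier V" and TV: "T \<in> carrier V"
    using T by (auto simp: has_bochner_integral_in_def)
  obtain s where s: "\<And>k. simple_integrable_in V \<mu> (s k)"
    and l1: "(\<lambda>k. \<integral>\<^sup>+x. ennreal (fnorm (f x \<ominus>\<^bsub>V\<^esub> s k x)) \<partial>\<mu>) \<longlonglongrightarrow> 0"
    and lT: "(\<lambda>k. fnorm (simple_integral_in V \<mu> (s k) \<ominus>\<^bsub>V\<^esub> T)) \<longlonglongrightarrow> 0"
    using T norm_on_fnorm unfolding has_bochner_integral_in_def by blast
  note si = simple_integral_functional[OF \<mu> s \<phi>]
  have sV: "s k x \<in> carrier V" if "x \<in> space \<mu>" for k x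
    using s[of k] that by (auto simp: simple_integrable_in_def)
  have "(\<lambda>k. \<phi> (simple_integral_in V \<mu> (s k)) - \<phi> T) \<longlonglongrightarrow> 0"
  proof (rule Lim_null_comparison[OF _ lT], rule always_eventually, rule allI)
    fix k
    show "cmod (\<phi> (simple_integral_in V \<mu> (s k)) - \<phi> T) \<le> fnorm (simple_integral_in V \<mu> (s k) \<ominus>\<^bsub>V\<^esub> T)"
      using fnorm_bound[OF \<phi>] functional_minus[OF \<phi> si(3) TV] by metis
  qed
  then have 1: "(\<lambda>k. \<phi> (simple_integral_in V \<mu> (s k))) \<longlonglongrightarrow> \<phi> T" by (rule LIM_zero_cancel)
  have le: "ennreal (cmod ((\<integral>x. \<phi> (f x) \<partial>\<mu>) - \<phi> (simple_integral_in V \<mu> (s k)))) \<le>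
      (\<integral>\<^sup>+x. ennreal (fnorm (f x \<ominus>\<^bsub>V\<^esub> s k x)) \<partial>\<mu>)" for k
  proof -
    have "(\<integral>x. \<phi> (f x) \<partial>\<mu>) - \<phi> (simple_integral_in V \<mu> (s k)) = (\<integral>x. \<phi> (f x) - \<phi> (s k x) \<partial>\<mu>)"
      unfolding si(2) by (rule Bochner_Integration.integral_diff[OF int si(1), symmetric])
    then have "ennreal (cmod ((\<integral>x. \<phi> (f x) \<partial>\<mu>) - \<phi> (simple_integral_in V \<mu> (s k)))) \<le>
        (\<integral>\<^sup>+x. ennreal (cmod (\<phi> (f x) - \<phi> (s k x))) \<partial>\<mu>)"
      using integral_norm_bound_ennreal[OF Bochner_Integration.integrable_diff[OF int si(1)]] by simp
    also have "\<dots> \<le> (\<integral>\<^sup>+x. ennreal (fnorm (f x \<ominus>\<^bsub>V\<^esub> s k x)) \<partial>\<mu>)"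
    proof (intro nn_integral_mono ennreal_leI)
      fix x assume x: "x \<in> space \<mu>"
      then have fx: "f x \<in> carrier V" using fV by blast
      show "cmod (\<phi> (f x) - \<phi> (s k x)) \<le> fnorm (f x \<ominus>\<^bsub>V\<^esub> s k x)"
        using fnorm_bound[OF \<phi>, of "f x \<ominus>\<^bsub>V\<^esub> s k x"] functional_minus[OF \<phi> fx sV[OF x]] by simp
    qed
    finally show ?thesis .
  qed
  have "(\<lambda>k. ennreal (cmod ((\<integral>x. \<phi> (f x) \<partial>\<mu>) - \<phi> (simple_integral_in V \<mu> (s k))))) \<longlonglongrightarrow> ennreal 0"
    unfolding ennreal_0
    by (rule tendsto_sandwich[OF _ _ tendsto_const l1]) (auto intro!: always_eventually le)
  then have "(\<lambda>k. cmod ((\<integral>x. \<phi> (f x) \<partial>\<mu>) - \<phi> (simple_integral_in V \<mu> (s k)))) \<longlonglongrightarrow> 0"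
    by (subst (asm) tendsto_ennreal_iff) (auto intro!: always_eventually)
  then have "(\<lambda>k. (\<integral>x. \<phi> (f x) \<partial>\<mu>) - \<phi> (simple_integral_in V \<mu> (s k))) \<longlonglongrightarrow> 0"
    by (rule tendsto_norm_zero_cancel)
  from tendsto_diff[OF tendsto_const[of "\<integral>x. \<phi> (f x) \<partial>\<mu>"] this]
  have "(\<lambda>k. \<phi> (simple_integral_in V \<mu> (s k))) \<longlonglongrightarrow> (\<integral>x. \<phi> (f x) \<partial>\<mu>)" by simp
  then show ?thesis using 1 LIMSEQ_unique by blast
qed

text \<open>The coordinates are rounded down to multiples of 1/(k+1). Being bounded, the rounded
  function takes finitely many values, and the error is at most 1/(k+1) in each coordinate,
  uniformly on the space, which controls every norm at once.\<close>

lemma bochner_integral_lincomb: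
  fixes l :: "nat \<Rightarrow> 'x \<Rightarrow> real"
  assumes \<mu>: "finite_measure \<mu>" and \<rho>: "\<And>i. i < d \<Longrightarrow> \<rho> i \<in> carrier V"
    and l: "\<And>i. i < d \<Longrightarrow> l i \<in> borel_measurable \<mu>"
    and B: "\<And>i x. i < d \<Longrightarrow> x \<in> space \<mu> \<Longrightarrow> \<bar>l i x\<bar> \<le> B"
    and f: "\<And>x. x \<in> space \<mu> \<Longrightarrow> f x = lincomb d (\<lambda>i. complex_of_real (l i x)) \<rho>"
  shows "bochner_integral_in V \<mu> f = lincomb d (\<lambda>i. complex_of_real (\<integral>x. l i x \<partial>\<mu>)) \<rho>"
proof -
  interpret finite_measure \<mu> by fact
  let ?T = "lincomb d (\<lambda>i. complex_of_real (\<integral>x. l i x \<partial>\<mu>)) \<rho>"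
  define u where "u k i x = real_of_int \<lfloor>real (Suc k) * l i x\<rfloor> / real (Suc k)" for k i x
  define s where "s k x = lincomb d (\<lambda>i. complex_of_real (u k i x)) \<rho>" for k x
  have fV: "f \<in> space \<mu> \<rightarrow> carrier V" using f lincomb_closed[OF \<rho>] by auto
  have il: "integrable \<mu> (l i)" if "i < d" for i
    using B[OF that] by (intro integrable_const_bound[of _ B] l that) (auto intro!: AE_I2)
  have um: "u k i \<in> borel_measurable \<mu>" if "i < d" for k i
    unfolding u_def using l[OF that] by measurable
  have ub: "\<bar>l i x - u k i x\<bar> \<le> 1 / real (Suc k)" for k i x
  proof -
    let ?n = "real (Suc k)"
    have "\<bar>?n * l i x - real_of_int \<lfloor>?n * l i x\<rfloor>\<bar> \<le> 1" by linarith
    moreover have "l i x - u k i x = (?n * l i x - real_of_int \<lfloor>?n * l i x\<rfloor>) / ?n"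
      by (simp add: u_def field_simps)
    ultimately show ?thesis by (simp add: abs_divide divide_right_mono del: of_nat_Suc)
  qed
  have iu: "integrable \<mu> (u k i)" if i: "i < d" for k i
  proof (rule integrable_const_bound[of _ "B + 1", OF _ um[OF i]], rule AE_I2)
    fix x assume "x \<in> space \<mu>"
    then have "\<bar>l i x\<bar> \<le> B" by (rule B[OF i])
    moreover have "1 / real (Suc k) \<le> 1" by simp
    ultimately show "norm (u k i x) \<le> B + 1" using ub[of i x k] unfolding real_norm_def by linarith
  qed
  \<comment> \<open>The floors are collected in an integer vector; its fibres are measurable, and
    \<open>s k\<close> is a function of it.\<close>
  have simple: "simple_function \<mu> (\<lambda>x. \<lambda>i\<in>{..<d}. \<lfloor>real (Suc k) * l i x\<rfloor>)" for k
    unfolding simple_function_def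
  proof (intro conjI ballI)
    let ?q = "\<lambda>x. \<lambda>i\<in>{..<d}. \<lfloor>real (Suc k) * l i x\<rfloor>"
    have "?q ` space \<mu> \<subseteq> {..<d} \<rightarrow>\<^sub>E {\<lfloor>- (real (Suc k) * B)\<rfloor>..\<lfloor>real (Suc k) * B\<rfloor>}"
    proof
      fix y assume "y \<in> ?q ` space \<mu>"
      then obtain x where x: "x \<in> space \<mu>" "y = ?q x" by blast
      have "\<lfloor>real (Suc k) * l i x\<rfloor> \<in> {\<lfloor>- (real (Suc k) * B)\<rfloor>..\<lfloor>real (Suc k) * B\<rfloor>}" if i: "i < d" for i
      proof -
        have "- B \<le> l i x" "l i x \<le> B" using B[OF i x(1)] by auto
        then have "- (real (Suc k) * B) \<le> real (Suc k) * l i x" "real (Suc k) * l i x \<le> real (Suc k) * B"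
          using mult_left_mono[of "- B" "l i x" "real (Suc k)"] mult_left_mono[of "l i x" B "real (Suc k)"]
          by (auto simp del: of_nat_Suc)
        then show ?thesis unfolding atLeastAtMost_iff by (intro conjI floor_mono)
      qed
      then show "y \<in> {..<d} \<rightarrow>\<^sub>E {\<lfloor>- (real (Suc k) * B)\<rfloor>..\<lfloor>real (Suc k) * B\<rfloor>}" using x by auto
    qed
    then show "finite (?q ` space \<mu>)" by (rule finite_subset) (intro finite_PiE; simp)
    fix y assume "y \<in> ?q ` space \<mu>"
    then have ext: "y \<in> extensional {..<d}" by auto
    have "?q -` {y} \<inter> space \<mu> = {x \<in> space \<mu>. \<forall>i\<in>{..<d}. \<lfloor>real (Suc k) * l i x\<rfloor> = y i}"
    proof (intro equalityI subsetI)
      fix x assume "x \<in> ?q -` {y} \<inter> space \<mu>"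
      then have "x \<in> space \<mu>" "?q x = y" by auto
      then show "x \<in> {x \<in> space \<mu>. \<forall>i\<in>{..<d}. \<lfloor>real (Suc k) * l i x\<rfloor> = y i}" by auto
    next
      fix x assume x: "x \<in> {x \<in> space \<mu>. \<forall>i\<in>{..<d}. \<lfloor>real (Suc k) * l i x\<rfloor> = y i}"
      then have "?q x = y" using ext by (intro extensionalityI[of _ "{..<d}"]) auto
      then show "x \<in> ?q -` {y} \<inter> space \<mu>" using x by simp
    qed
    also have "\<dots> \<in> sets \<mu>"
    proof (rule sets.sets_Collect_finite_All)
      fix i assume "i \<in> {..<d}"
      then have li[measurable]: "l i \<in> borel_measurable \<mu>" using l by simp
      show "{x \<in> space \<mu>. \<lfloor>real (Suc k) * l i x\<rfloor> = y i} \<in> sets \<mu>"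
        unfolding floor_eq_iff by measurable
    qed simp
    finally show "?q -` {y} \<inter> space \<mu> \<in> sets \<mu>" .
  qed
  have sint: "simple_integrable_in V \<mu> (s k)" for k
    unfolding simple_integrable_in_def
  proof (intro conjI)
    show "s k \<in> space \<mu> \<rightarrow> carrier V" using lincomb_closed[OF \<rho>] by (auto simp: s_def)
    have "s k = (\<lambda>y. lincomb d (\<lambda>i. complex_of_real (real_of_int (y i) / real (Suc k))) \<rho>) \<circ>
        (\<lambda>x. \<lambda>i\<in>{..<d}. \<lfloor>real (Suc k) * l i x\<rfloor>)"
    proof
      fix x
      show "s k x = ((\<lambda>y. lincomb d (\<lambda>i. complex_of_real (real_of_int (y i) / real (Suc k))) \<rho>) \<circ>
        (\<lambda>x. \<lambda>i\<in>{..<d}. \<lfloor>real (Suc k) * l i x\<rfloor>)) x"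
        unfolding s_def comp_def lincomb_def u_def
        by (rule M.finsum_cong') (auto simp: scale_closed \<rho>)
    qed
    then show "simple_function \<mu> (s k)" using simple_function_compose[OF simple] by simp
  qed simp
  have si: "simple_integral_in V \<mu> (s k) = lincomb d (\<lambda>i. complex_of_real (\<integral>x. u k i x \<partial>\<mu>)) \<rho>" for k
  \<comment> \<open>Without functionals \<open>V\<close> is zero and both sides coincide; otherwise
    some functional is at hand for \<open>simple_integral_functional\<close>, whose third part puts
    the integral into \<open>V\<close>.\<close>
  proof (cases "\<Phi> = {}")
    case True
    have z: "x = \<zero>\<^bsub>V\<^esub>" if "x \<in> carrier V" for x using separating[OF that] True by blast
    have "simple_integral_in V \<mu> (s k) \<in> carrier V"
      unfolding simple_integral_in_def using sint[of k]
      by (intro M.finsum_closed) (auto simp: Pi_iff scale_closed simple_integrable_in_def)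
    from z[OF this] z[OF lincomb_closed[OF \<rho>]] show ?thesis by simp
  next
    case False
    then obtain \<phi>0 where \<phi>0: "\<phi>0 \<in> \<Phi>" by blast
    show ?thesis
    proof (rule separating_eq)
      show "simple_integral_in V \<mu> (s k) \<in> carrier V" by (rule simple_integral_functional(3)[OF \<mu> sint \<phi>0])
      show "lincomb d (\<lambda>i. complex_of_real (\<integral>x. u k i x \<partial>\<mu>)) \<rho> \<in> carrier V" by (rule lincomb_closed[OF \<rho>])
      fix \<phi> assume \<phi>: "\<phi> \<in> \<Phi>"
      have "\<phi> (simple_integral_in V \<mu> (s k)) = (\<integral>x. (\<Sum>i<d. complex_of_real (u k i x) * \<phi> (\<rho> i)) \<partial>\<mu>)"
        by (simp add: simple_integral_functional(2)[OF \<mu> sint \<phi>] s_def functional_lincomb[OF \<phi>] \<rho>)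
      also have "\<dots> = (\<Sum>i<d. \<integral>x. complex_of_real (u k i x) * \<phi> (\<rho> i) \<partial>\<mu>)"
        by (intro Bochner_Integration.integral_sum integrable_mult_left integrable_of_real iu) auto
      also have "\<dots> = (\<Sum>i<d. complex_of_real (\<integral>x. u k i x \<partial>\<mu>) * \<phi> (\<rho> i))"
        by (intro sum.cong refl) simp
      finally show "\<phi> (simple_integral_in V \<mu> (s k)) = \<phi> (lincomb d (\<lambda>i. complex_of_real (\<integral>x. u k i x \<partial>\<mu>)) \<rho>)"
        by (simp add: functional_lincomb[OF \<phi>] \<rho>)
    qed
  qed
  have inv0: "(\<lambda>k. c / real (Suc k)) \<longlonglongrightarrow> 0" for c :: real
    using tendsto_mult_right_zero[OF LIMSEQ_inverse_real_of_nat, of c] by (simp add: field_simps)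
  have has: "has_bochner_integral_in V \<mu> f ?T"
    unfolding has_bochner_integral_in_def
  proof (intro conjI allI impI fV lincomb_closed \<rho>)
    fix \<nu> assume \<nu>: "norm_on V \<nu>"
    \<comment> \<open>The constant that bounds \<open>\<nu>\<close> of a combination in terms of its
      largest coefficient.\<close>
    define S where "S = (\<Sum>i<d. \<nu> (\<rho> i))"
    have \<nu>0: "0 \<le> \<nu> (\<rho> i)" if "i < d" for i using \<nu> \<rho>[OF that] by (simp add: norm_on_def)
    have S0: "0 \<le> S" unfolding S_def using \<nu>0 by (intro sum_nonneg) auto
    have \<nu>LC: "\<nu> (lincomb d c \<rho>) \<le> b * S" if "\<And>i. i < d \<Longrightarrow> cmod (c i) \<le> b" for c b
    proof -
      have "\<nu> (lincomb d c \<rho>) \<le> (\<Sum>i<d. cmod (c i) * \<nu> (\<rho> i))" by (rule norm_lincomb_le[OF \<nu> \<rho>])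
      also have "\<dots> \<le> (\<Sum>i<d. b * \<nu> (\<rho> i))" using that \<nu>0 by (intro sum_mono mult_right_mono) auto
      finally show ?thesis by (simp add: S_def sum_distrib_left)
    qed
    have \<nu>nn: "0 \<le> \<nu> (lincomb d c \<rho>)" for c using \<nu> lincomb_closed[OF \<rho>] by (simp add: norm_on_def)
    have d: "f x \<ominus>\<^bsub>V\<^esub> s k x = lincomb d (\<lambda>i. complex_of_real (l i x) - complex_of_real (u k i x)) \<rho>"
        if "x \<in> space \<mu>" for k x
      unfolding f[OF that] s_def by (rule lincomb_minus[OF \<rho>])
    have bd: "\<nu> (f x \<ominus>\<^bsub>V\<^esub> s k x) \<le> S / real (Suc k)" and nn: "0 \<le> \<nu> (f x \<ominus>\<^bsub>V\<^esub> s k x)"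
        if x: "x \<in> space \<mu>" for x k
    proof -
      have "\<nu> (f x \<ominus>\<^bsub>V\<^esub> s k x) \<le> 1 / real (Suc k) * S"
        unfolding d[OF x] using ub by (intro \<nu>LC) (simp flip: of_real_diff del: of_nat_Suc)
      then show "\<nu> (f x \<ominus>\<^bsub>V\<^esub> s k x) \<le> S / real (Suc k)" by simp
      show "0 \<le> \<nu> (f x \<ominus>\<^bsub>V\<^esub> s k x)" unfolding d[OF x] by (rule \<nu>nn)
    qed
    show "\<exists>s. (\<forall>k. simple_integrable_in V \<mu> (s k)) \<and>
        (AE x in \<mu>. (\<lambda>k. \<nu> (f x \<ominus>\<^bsub>V\<^esub> s k x)) \<longlonglongrightarrow> 0) \<and>
        (\<lambda>k. \<integral>\<^sup>+x. ennreal (\<nu> (f x \<ominus>\<^bsub>V\<^esub> s k x)) \<partial>\<mu>) \<longlonglongrightarrow> 0 \<and>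
        (\<lambda>k. \<nu> (simple_integral_in V \<mu> (s k) \<ominus>\<^bsub>V\<^esub> ?T)) \<longlonglongrightarrow> 0"
    proof (intro exI[of _ s] conjI allI sint AE_I2)
      fix x assume x: "x \<in> space \<mu>"
      show "(\<lambda>k. \<nu> (f x \<ominus>\<^bsub>V\<^esub> s k x)) \<longlonglongrightarrow> 0"
        by (rule tendsto_sandwich[OF _ _ tendsto_const inv0[of S]]) (auto intro!: always_eventually bd
            nn x simp del: of_nat_Suc)
    next
      let ?m = "measure \<mu> (space \<mu>)"
      have le: "(\<integral>\<^sup>+x. ennreal (\<nu> (f x \<ominus>\<^bsub>V\<^esub> s k x)) \<partial>\<mu>) \<le> ennreal (S * ?m / real (Suc k))" for k
      proof -
        have "(\<integral>\<^sup>+x. ennreal (\<nu> (f x \<ominus>\<^bsub>V\<^esub> s k x)) \<partial>\<mu>) \<le> (\<integral>\<^sup>+x. ennreal (S / real (Suc k)) \<partial>\<mu>)"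
          by (intro nn_integral_mono ennreal_leI bd)
        also have "\<dots> = ennreal (S / real (Suc k)) * ennreal ?m" by (simp add: emeasure_eq_measure)
        also have "\<dots> = ennreal (S * ?m / real (Suc k))" using S0 by (simp flip: ennreal_mult del: of_nat_Suc)
        finally show ?thesis .
      qed
      have lim: "(\<lambda>k. ennreal (S * ?m / real (Suc k))) \<longlonglongrightarrow> ennreal 0"
        by (intro tendsto_ennrealI inv0)
      show "(\<lambda>k. \<integral>\<^sup>+x. ennreal (\<nu> (f x \<ominus>\<^bsub>V\<^esub> s k x)) \<partial>\<mu>) \<longlonglongrightarrow> 0"
        by (rule tendsto_sandwich[OF _ _ tendsto_const lim[unfolded ennreal_0]])
          (auto intro!: always_eventually le simp del: of_nat_Suc)
    next
      let ?m = "measure \<mu> (space \<mu>)"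
      have eq: "simple_integral_in V \<mu> (s k) \<ominus>\<^bsub>V\<^esub> ?T =
          lincomb d (\<lambda>i. complex_of_real (\<integral>x. u k i x \<partial>\<mu>) - complex_of_real (\<integral>x. l i x \<partial>\<mu>)) \<rho>" for k
        unfolding si by (rule lincomb_minus[OF \<rho>])
      have le: "\<nu> (simple_integral_in V \<mu> (s k) \<ominus>\<^bsub>V\<^esub> ?T) \<le> ?m * S / real (Suc k)" for k
      proof -
        have "cmod (complex_of_real (\<integral>x. u k i x \<partial>\<mu>) - complex_of_real (\<integral>x. l i x \<partial>\<mu>)) \<le> ?m / real (Suc
            k)" if i: "i < d" for i
        proof -
          have "cmod (complex_of_real (\<integral>x. u k i x \<partial>\<mu>) - complex_of_real (\<integral>x. l i x \<partial>\<mu>)) =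
              \<bar>(\<integral>x. u k i x \<partial>\<mu>) - (\<integral>x. l i x \<partial>\<mu>)\<bar>"
            by (simp flip: of_real_diff)
          also have "\<dots> = \<bar>\<integral>x. u k i x - l i x \<partial>\<mu>\<bar>" using iu[OF i] il[OF i] by simp
          also have "\<dots> \<le> (\<integral>x. \<bar>u k i x - l i x\<bar> \<partial>\<mu>)" by (rule integral_abs_bound)
          also have "\<dots> \<le> (\<integral>x. 1 / real (Suc k) \<partial>\<mu>)"
            using ub iu[OF i] il[OF i] by (intro integral_mono) (auto simp: abs_minus_commute)
          finally show ?thesis by simp
        qed
        then have "\<nu> (simple_integral_in V \<mu> (s k) \<ominus>\<^bsub>V\<^esub> ?T) \<le> ?m / real (Suc k) * S"
          unfolding eq by (rule \<nu>LC)
        then show ?thesis by simp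
      qed
      have nn': "0 \<le> \<nu> (simple_integral_in V \<mu> (s k) \<ominus>\<^bsub>V\<^esub> ?T)" for k unfolding eq by (rule \<nu>nn)
      show "(\<lambda>k. \<nu> (simple_integral_in V \<mu> (s k) \<ominus>\<^bsub>V\<^esub> ?T)) \<longlonglongrightarrow> 0"
        by (rule tendsto_sandwich[OF _ _ tendsto_const inv0[of "?m * S"]])
          (auto intro!: always_eventually le nn' simp del: of_nat_Suc)
    qed
  qed
  show ?thesis
    unfolding bochner_integral_in_def
  proof (rule the_equality, rule has)
    fix T assume T: "has_bochner_integral_in V \<mu> f T"
    show "T = ?T"
    proof (rule separating_eq)
      show "T \<in> carrier V" using T by (simp add: has_bochner_integral_in_def)
      show "?T \<in> carrier V" by (rule lincomb_closed[OF \<rho>])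
      fix \<phi> assume \<phi>: "\<phi> \<in> \<Phi>"
      have "integrable \<mu> (\<lambda>x. \<Sum>i<d. complex_of_real (l i x) * \<phi> (\<rho> i))"
        by (intro Bochner_Integration.integrable_sum integrable_mult_left integrable_of_real il) auto
      then have "integrable \<mu> (\<lambda>x. \<phi> (f x))"
        by (rule Bochner_Integration.integrable_cong[THEN iffD1, rotated 2])
          (auto simp: f functional_lincomb[OF \<phi> \<rho>])
      then show "\<phi> T = \<phi> ?T"
        using bochner_integral_functional[OF \<mu> T \<phi>] bochner_integral_functional[OF \<mu> has \<phi>] by simp
    qed
  qed
qed

end

section \<open>Vanishing of integral profiles\<close>

lemma prod_if_split:
  fixes a b :: "nat \<Rightarrow> real"
  assumes "i < d"
  shows "(\<Prod>j<d. if j = i then a j else b j) = a i * (\<Prod>j\<in>{..<d} - {i}. b j)"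
proof -
  have "(\<Prod>j<d. if j = i then a j else b j) = a i * (\<Prod>j\<in>{..<d} - {i}. if j = i then a j else b j)"
    using assms by (subst prod.remove[of _ i]) auto
  moreover have "(\<Prod>j\<in>{..<d} - {i}. if j = i then a j else b j) = (\<Prod>j\<in>{..<d} - {i}. b j)"
    by (rule prod.cong) auto
  ultimately show ?thesis by simp
qed

text \<open>The integrand is a product of functions of one variable, all of them the constant 1
  except the i-th; so the integral is the product of the lengths \<open>t j\<close> for the other
  indices and the integral of y over the i-th interval.\<close>

lemma box_integral:
  fixes t :: "nat \<Rightarrow> real"
  assumes t: "\<And>i. i < d \<Longrightarrow> 0 \<le> t i" and i: "i < d"
  defines "N \<equiv> \<Pi>\<^sub>M i\<in>{..<d}. restrict_space lborel {0..t i}"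
  shows "(\<integral>x. x i \<partial>N) = (t i)\<^sup>2 / 2 * (\<Prod>j\<in>{..<d} - {i}. t j)"
    and "finite_measure N"
proof -
  interpret P: product_sigma_finite "\<lambda>i. restrict_space lborel {0..t i}"
  proof (rule product_sigma_finite.intro)
    show "sigma_finite_measure (restrict_space lborel {0..t i})" for i
      by (rule sigma_finite_measure_restrict_space[OF lborel.sigma_finite_measure_axioms]) simp
  qed
  have i1: "integrable (restrict_space lborel {0..t j}) (\<lambda>_. 1 :: real)"
    and v1: "(\<integral>x. 1 \<partial>restrict_space lborel {0..t j}) = t j" if "j < d" for j
  proof -
    show "integrable (restrict_space lborel {0..t j}) (\<lambda>_. 1 :: real)"
      using borel_integrable_atLeastAtMost[of 0 "t j" "\<lambda>_. 1"]
      by (subst integrable_restrict_space) (simp_all add: mult.commute)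
    show "(\<integral>x. 1 \<partial>restrict_space lborel {0..t j}) = t j"
      using integral_power[of 0 "t j" 0] t[OF that]
          by (subst integral_restrict_space) (simp_all add: mult.commute)
  qed
  have i2: "integrable (restrict_space lborel {0..t i}) (\<lambda>x. x :: real)"
    using borel_integrable_atLeastAtMost[of 0 "t i" "\<lambda>x. x"]
    by (subst integrable_restrict_space) (simp_all add: mult.commute)
  have v2: "(\<integral>x. x \<partial>restrict_space lborel {0..t i}) = (t i)\<^sup>2 / 2"
    using integral_power[of 0 "t i" 1] t[OF i]
    by (subst integral_restrict_space) (simp_all add: mult.commute power2_eq_square)
  have "(\<integral>x. x i \<partial>N) = (\<integral>x. (\<Prod>j<d. if j = i then x j else 1) \<partial>N)"
    using prod_if_split[OF i, of _ "\<lambda>_. 1"] by simp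
  also have "\<dots> = (\<Prod>j<d. \<integral>y. (if j = i then y else 1) \<partial>restrict_space lborel {0..t j})"
    unfolding N_def
  proof (rule P.product_integral_prod)
    fix j assume "j \<in> {..<d}"
    then show "integrable (restrict_space lborel {0..t j}) (\<lambda>y. if j = i then y else 1)"
      using i1[of j] i2 by (cases "j = i") auto
  qed simp
  also have "\<dots> = (\<Prod>j<d. if j = i then (t j)\<^sup>2 / 2 else t j)"
    using v1 v2 by (intro prod.cong) auto
  also have "\<dots> = (t i)\<^sup>2 / 2 * (\<Prod>j\<in>{..<d} - {i}. t j)" by (rule prod_if_split[OF i])
  finally show "(\<integral>x. x i \<partial>N) = (t i)\<^sup>2 / 2 * (\<Prod>j\<in>{..<d} - {i}. t j)" .
  have "emeasure N (space N) = (\<Prod>j<d. emeasure (restrict_space lborel {0..t j}) (space (restrict_space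
      lborel {0..t j})))"
    unfolding N_def space_PiM by (rule P.emeasure_PiM) (simp_all only: finite_lessThan sets.top)
  also have "\<dots> = (\<Prod>j<d. ennreal (t j))"
    using t by (intro prod.cong) (auto simp: space_restrict_space emeasure_restrict_space)
  also have "\<dots> \<noteq> \<infinity>" by (simp add: ennreal_prod_eq_top)
  finally show "finite_measure N" by (rule finite_measureI)
qed

text \<open>Dimension 0 is separate, since \<open>box_integral\<close> speaks of a coordinate; the
  space is then a single point.\<close>

lemma box_finite_measure:
  fixes t :: "nat \<Rightarrow> real"
  assumes t: "\<And>i. i < d \<Longrightarrow> 0 \<le> t i"
  shows "finite_measure (\<Pi>\<^sub>M i\<in>{..<d}. restrict_space lborel {0..t i})"
proof (cases d)
  case 0
  show ?thesis unfolding 0 by (intro finite_measureI) (simp add: space_PiM)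
next
  case (Suc n)
  then show ?thesis using box_integral(2)[of d t n] t by simp
qed

context complex_algebra
begin

text \<open>Through this injectivity the \<open>embed_measure\<close> in \<open>box_measure\<close>
  becomes an image measure, and integrals can be pulled back to the box of coordinates.\<close>

lemma basis_inj:
  assumes basis: "is_basis A d a"
  shows "inj_on (\<lambda>l. \<Oplus>i\<in>{..<d}. complex_of_real (l i) \<odot> a i) (extensional {..<d} :: (nat \<Rightarrow> real) set)"
proof (rule inj_onI)
  fix l l' :: "nat \<Rightarrow> real"
  assume l: "l \<in> extensional {..<d}" and l': "l' \<in> extensional {..<d}"
    and eq: "(\<Oplus>i\<in>{..<d}. complex_of_real (l i) \<odot> a i) = (\<Oplus>i\<in>{..<d}. complex_of_real (l' i) \<odot> a i)"
  have ac: "a i \<in> carrier A" if "i < d" for i using basis that by (simp add: is_basis_def)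
  let ?c = "\<lambda>l. \<lambda>i\<in>{..<d}. complex_of_real (l i :: real)"
  have s: "(\<Oplus>i\<in>{..<d}. ?c l i \<odot> a i) = (\<Oplus>i\<in>{..<d}. complex_of_real (l i) \<odot> a i)" for l
    by (rule finsum_cong') (auto simp: ac csmult_closed)
  have "(\<Oplus>i\<in>{..<d}. ?c l i \<odot> a i) \<in> carrier A" by (intro finsum_closed) (auto simp: ac csmult_closed)
  then have ex1: "\<exists>!c. c \<in> extensional {..<d} \<and> (\<Oplus>i\<in>{..<d}. ?c l i \<odot> a i) = (\<Oplus>i\<in>{..<d}. c i \<odot> a i)"
    using basis unfolding is_basis_def by blast
  have eq': "(\<Oplus>i\<in>{..<d}. ?c l i \<odot> a i) = (\<Oplus>i\<in>{..<d}. ?c l' i \<odot> a i)" using eq unfolding s .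
  have uniq: "x = y" if "\<exists>!x. P x" "P x" "P y" for P and x y :: "nat \<Rightarrow> complex" using that by blast
  have "?c l = ?c l'" by (rule uniq[OF ex1]) (use eq' in \<open>simp_all add: restrict_extensional\<close>)
  from fun_cong[OF this] have "l i = l' i" if "i < d" for i using that
      by (metis (no_types, lifting) lessThan_iff of_real_eq_iff restrict_apply')
  then show "l = l'" using l l' by (intro extensionalityI[of _ "{..<d}"]) auto
qed

section \<open>Endomorphism spaces and separating functionals\<close>

lemma End_C_carrier:
  "f \<in> carrier (End_C A M) \<longleftrightarrow> f \<in> carrier M \<rightarrow>\<^sub>E carrier M \<and>
     (\<forall>x\<in>carrier M. \<forall>y\<in>carrier M. f (x \<oplus>\<^bsub>M\<^esub> y) = f x \<oplus>\<^bsub>M\<^esub> f y) \<and>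
     (\<forall>c. \<forall>x\<in>carrier M. f (sc c \<odot>\<^bsub>M\<^esub> x) = sc c \<odot>\<^bsub>M\<^esub> f x)"
  by (simp add: End_C_def cscale_sc)

lemma End_C_simps:
  "\<zero>\<^bsub>End_C A M\<^esub> = (\<lambda>x\<in>carrier M. \<zero>\<^bsub>M\<^esub>)" "f \<oplus>\<^bsub>End_C A M\<^esub> g = (\<lambda>x\<in>carrier M. f x \<oplus>\<^bsub>M\<^esub> g x)"
  "c \<odot>\<^bsub>End_C A M\<^esub> f = (\<lambda>x\<in>carrier M. sc c \<odot>\<^bsub>M\<^esub> f x)"
  by (simp_all add: End_C_def cscale_sc)

lemma left_module_End_C:
  assumes M: "left_module A M"
  shows "left_module complex_ring (End_C A M)"
proof -
  interpret M: left_module A M by fact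
  let ?E = "End_C A M"
  have H: "f x \<in> carrier M" if "f \<in> carrier ?E" "x \<in> carrier M" for f x
    using that unfolding End_C_carrier by auto
  have Hadd: "f (x \<oplus>\<^bsub>M\<^esub> y) = f x \<oplus>\<^bsub>M\<^esub> f y" if "f \<in> carrier ?E" "x \<in> carrier M" "y \<in> carrier M" for f x y
    using that unfolding End_C_carrier by auto
  have Hsc: "f (sc c \<odot>\<^bsub>M\<^esub> x) = sc c \<odot>\<^bsub>M\<^esub> f x" if "f \<in> carrier ?E" "x \<in> carrier M" for f c x
    using that unfolding End_C_carrier by auto
  have Hext: "f \<in> extensional (carrier M)" if "f \<in> carrier ?E" for f
    using that unfolding End_C_carrier by (auto simp: PiE_def)
  have ext: "f = g" if f: "f \<in> carrier ?E" and g: "g \<in> carrier ?E"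
      and eq: "\<And>x. x \<in> carrier M \<Longrightarrow> f x = g x" for f g
    using Hext[OF f] Hext[OF g] eq by (rule extensionalityI)
  have addc: "f \<oplus>\<^bsub>?E\<^esub> g \<in> carrier ?E" if "f \<in> carrier ?E" "g \<in> carrier ?E" for f g
    unfolding End_C_carrier End_C_simps
    using that by (auto simp: H Hadd Hsc M.M.a_ac M.smult_r_distr M.smult_closed)
  have smc: "c \<odot>\<^bsub>?E\<^esub> f \<in> carrier ?E" if "f \<in> carrier ?E" for c f
    unfolding End_C_carrier End_C_simps
    using that by (auto simp: H Hadd Hsc M.smult_r_distr M.smult_closed smult_sc_comm[OF M sc_closed])
  have zc: "\<zero>\<^bsub>?E\<^esub> \<in> carrier ?E"
    unfolding End_C_carrier End_C_simps by (auto simp: M.smult_zero_r M.smult_closed)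
  show ?thesis
  proof (rule left_moduleI[OF ring_complex_ring zc addc])
    fix f assume f: "f \<in> carrier ?E"
    show "\<zero>\<^bsub>?E\<^esub> \<oplus>\<^bsub>?E\<^esub> f = f" by (rule ext[OF addc[OF zc f] f]) (simp add: End_C_simps H[OF f])
    show "\<one>\<^bsub>complex_ring\<^esub> \<odot>\<^bsub>?E\<^esub> f = f"
      by (rule ext[OF smc[OF f] f]) (simp add: End_C_simps complex_ring_def H[OF f] M.smult_one)
    show "\<zero>\<^bsub>complex_ring\<^esub> \<odot>\<^bsub>?E\<^esub> f = \<zero>\<^bsub>?E\<^esub>"
      by (rule ext[OF smc[OF f] zc]) (simp add: End_C_simps complex_ring_def H[OF f] M.smult_zero_l)
    fix g assume g: "g \<in> carrier ?E"
    show "f \<oplus>\<^bsub>?E\<^esub> g = g \<oplus>\<^bsub>?E\<^esub> f"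
      by (rule ext[OF addc[OF f g] addc[OF g f]]) (simp add: End_C_simps H[OF f] H[OF g] M.M.a_comm)
    fix k assume k: "k \<in> carrier ?E"
    show "f \<oplus>\<^bsub>?E\<^esub> g \<oplus>\<^bsub>?E\<^esub> k = f \<oplus>\<^bsub>?E\<^esub> (g \<oplus>\<^bsub>?E\<^esub> k)"
      by (rule ext[OF addc[OF addc[OF f g] k] addc[OF f addc[OF g k]]])
        (simp add: End_C_simps H[OF f] H[OF g] H[OF k] M.M.a_assoc)
  next
    fix c f assume f: "f \<in> carrier ?E"
    show "c \<odot>\<^bsub>?E\<^esub> f \<in> carrier ?E" by (rule smc[OF f])
    { fix g assume g: "g \<in> carrier ?E"
      show "c \<odot>\<^bsub>?E\<^esub> (f \<oplus>\<^bsub>?E\<^esub> g) = c \<odot>\<^bsub>?E\<^esub> f \<oplus>\<^bsub>?E\<^esub> c \<odot>\<^bsub>?E\<^esub> g"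
        by (rule ext[OF smc[OF addc[OF f g]] addc[OF smc[OF f] smc[OF g]]])
          (simp add: End_C_simps H[OF f] H[OF g] M.smult_r_distr) }
    fix c'
    show "(c \<oplus>\<^bsub>complex_ring\<^esub> c') \<odot>\<^bsub>?E\<^esub> f = c \<odot>\<^bsub>?E\<^esub> f \<oplus>\<^bsub>?E\<^esub> c' \<odot>\<^bsub>?E\<^esub> f"
      by (rule ext[OF smc[OF f] addc[OF smc[OF f] smc[OF f]]])
        (simp add: End_C_simps complex_ring_def sc_add H[OF f] M.smult_l_distr)
    show "(c \<otimes>\<^bsub>complex_ring\<^esub> c') \<odot>\<^bsub>?E\<^esub> f = c \<odot>\<^bsub>?E\<^esub> (c' \<odot>\<^bsub>?E\<^esub> f)"
      by (rule ext[OF smc[OF f] smc[OF smc[OF f]]])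
        (simp add: End_C_simps complex_ring_def sc_mult H[OF f] M.smult_assoc)
  qed
qed

lemma structure_map_End_C:
  assumes M: "left_module A M" and b: "b \<in> carrier A"
  shows "structure_map M b \<in> carrier (End_C A M)"
proof -
  interpret M: left_module A M by fact
  show ?thesis
    unfolding End_C_carrier structure_map_def using b
    by (auto simp: M.smult_closed M.smult_r_distr smult_sc_comm[OF M b])
qed

text \<open>A finite set of functionals on a space spanned by \<open>B\<close> that separates its points is built up along
  \<open>B\<close>: the vectors of \<open>span (insert b B)\<close> on which the functionals for \<open>B\<close> vanish form at most a line.\<close>

lemma finite_separating_functionals:
  assumes M: "finite_dim_module A M"
  obtains \<Phi> where "finite \<Phi>" "\<Phi> \<subseteq> lmod_hom complex_ring (vector_space_of M) (regular_module complex_ring)"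
    "\<And>x. x \<in> carrier M \<Longrightarrow> (\<And>\<phi>. \<phi> \<in> \<Phi> \<Longrightarrow> \<phi> x = 0) \<Longrightarrow> x = \<zero>\<^bsub>M\<^esub>"
proof -
  have lM: "left_module A M" using M by (simp add: finite_dim_module_def)
  interpret M: left_module A M by fact
  let ?H = "lmod_hom complex_ring (vector_space_of M) (regular_module complex_ring)"
  define span where "span B = {\<Oplus>\<^bsub>M\<^esub>b\<in>B. sc (c b) \<odot>\<^bsub>M\<^esub> b | c :: 'b \<Rightarrow> complex. True}" for B
  have \<phi>: "\<phi> (x \<oplus>\<^bsub>M\<^esub> y) = \<phi> x + \<phi> y" "\<phi> (sc c \<odot>\<^bsub>M\<^esub> x) = c * \<phi> x"
    if "\<phi> \<in> ?H" "x \<in> carrier M" "y \<in> carrier M" for \<phi> x y c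
    using lmod_homD(2)[OF that(1), of x y] lmod_homD(3)[OF that(1), of c x] that(2,3)
    by (auto simp: regular_module_def complex_ring_def)
  have cl: "(\<Oplus>\<^bsub>M\<^esub>b\<in>B. sc (c b) \<odot>\<^bsub>M\<^esub> b) \<in> carrier M" if "B \<subseteq> carrier M" for B c
    using that by (intro M.M.finsum_closed) (auto intro: M.smult_closed)
  have ex: "\<exists>\<Phi>. finite \<Phi> \<and> \<Phi> \<subseteq> ?H \<and> (\<forall>x\<in>span B. (\<forall>\<phi>\<in>\<Phi>. \<phi> x = 0) \<longrightarrow> x = \<zero>\<^bsub>M\<^esub>)"
    if "finite B" "B \<subseteq> carrier M" for B
    using that
  proof (induction B rule: finite_induct)
    case empty
    show ?case by (intro exI[of _ "{}"]) (auto simp: span_def)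
  next
    case (insert b B)
    then obtain \<Phi> where \<Phi>: "finite \<Phi>" "\<Phi> \<subseteq> ?H" "\<forall>x\<in>span B. (\<forall>\<phi>\<in>\<Phi>. \<phi> x = 0) \<longrightarrow> x = \<zero>\<^bsub>M\<^esub>" by auto
    have b: "b \<in> carrier M" and B: "B \<subseteq> carrier M" using insert by auto
    have dec: "\<exists>u\<in>span B. \<exists>z. x = sc z \<odot>\<^bsub>M\<^esub> b \<oplus>\<^bsub>M\<^esub> u" if "x \<in> span (insert b B)" for x
    proof -
      obtain c where "x = (\<Oplus>\<^bsub>M\<^esub>b\<in>insert b B. sc (c b) \<odot>\<^bsub>M\<^esub> b)" using \<open>x \<in> span (insert b B)\<close>
          by (auto simp: span_def)
      also have "\<dots> = sc (c b) \<odot>\<^bsub>M\<^esub> b \<oplus>\<^bsub>M\<^esub> (\<Oplus>\<^bsub>M\<^esub>b\<in>B. sc (c b) \<odot>\<^bsub>M\<^esub> b)"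
        using insert B b by (intro M.M.finsum_insert) (auto intro: M.smult_closed)
      finally show ?thesis by (auto simp: span_def)
    qed
    have spc: "u \<in> carrier M" if "u \<in> span B" for u using that cl[OF B] by (auto simp: span_def)
    have sum: "u \<oplus>\<^bsub>M\<^esub> sc z \<odot>\<^bsub>M\<^esub> u' \<in> span B" if "u \<in> span B" "u' \<in> span B" for u u' z
    proof -
      obtain c c' where c: "u = (\<Oplus>\<^bsub>M\<^esub>b\<in>B. sc (c b) \<odot>\<^bsub>M\<^esub> b)" "u' = (\<Oplus>\<^bsub>M\<^esub>b\<in>B. sc (c' b) \<odot>\<^bsub>M\<^esub> b)"
        using \<open>u \<in> span B\<close> \<open>u' \<in> span B\<close> by (auto simp: span_def)
      have t: "sc (k b) \<odot>\<^bsub>M\<^esub> b \<in> carrier M" if "b \<in> B" for k b using B that by (auto intro: M.smult_closed)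
      have "sc z \<odot>\<^bsub>M\<^esub> u' = (\<Oplus>\<^bsub>M\<^esub>b\<in>B. sc z \<odot>\<^bsub>M\<^esub> (sc (c' b) \<odot>\<^bsub>M\<^esub> b))"
        unfolding c(2) using insert(1) t by (intro M.smult_finsum_r) auto
      then have "u \<oplus>\<^bsub>M\<^esub> sc z \<odot>\<^bsub>M\<^esub> u' = (\<Oplus>\<^bsub>M\<^esub>b\<in>B. sc (c b) \<odot>\<^bsub>M\<^esub> b \<oplus>\<^bsub>M\<^esub> sc z \<odot>\<^bsub>M\<^esub> (sc (c' b) \<odot>\<^bsub>M\<^esub> b))"
        unfolding c(1) using t by (subst M.M.finsum_addf) (auto intro: M.smult_closed)
      also have "\<dots> = (\<Oplus>\<^bsub>M\<^esub>b\<in>B. sc (c b + z * c' b) \<odot>\<^bsub>M\<^esub> b)"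
        using B by (intro M.M.finsum_cong') (auto simp: sc_add sc_mult M.smult_l_distr M.smult_assoc
            subset_iff intro: M.smult_closed)
      finally show ?thesis
        unfolding span_def by (intro CollectI exI[of _ "\<lambda>b. c b + z * c' b"] conjI TrueI)
    qed
    show ?case
    proof (cases "\<exists>k\<in>span (insert b B). (\<forall>\<phi>\<in>\<Phi>. \<phi> k = 0) \<and> k \<noteq> \<zero>\<^bsub>M\<^esub>")
      case False
      then show ?thesis using \<Phi> by blast
    next
      case True
      then obtain k where k: "k \<in> span (insert b B)" "\<forall>\<phi>\<in>\<Phi>. \<phi> k = 0" "k \<noteq> \<zero>\<^bsub>M\<^esub>" by blast
      obtain u0 z0 where u0: "u0 \<in> span B" "k = sc z0 \<odot>\<^bsub>M\<^esub> b \<oplus>\<^bsub>M\<^esub> u0" using dec[OF k(1)] by blast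
      have zb: "sc z \<odot>\<^bsub>M\<^esub> b \<in> carrier M" for z using b by (simp add: M.smult_closed)
      have kc: "k \<in> carrier M" unfolding u0(2) using spc[OF u0(1)] zb by simp
      have z0: "z0 \<noteq> 0"
      proof
        assume "z0 = 0"
        then have "k = u0" using u0 spc[OF u0(1)] b by (simp add: M.smult_zero_l)
        then show False using \<Phi>(3) u0(1) k(2,3) by blast
      qed
      obtain \<psi> where \<psi>: "\<psi> \<in> ?H" "\<psi> k \<noteq> 0"
        using linear_functional_ex[OF left_module_vector_space_of[OF lM], of k] kc k(3) by auto
      have "x = \<zero>\<^bsub>M\<^esub>" if x: "x \<in> span (insert b B)" "\<forall>\<phi>\<in>insert \<psi> \<Phi>. \<phi> x = 0" for x
      proof -
        obtain u z where u: "u \<in> span B" "x = sc z \<odot>\<^bsub>M\<^esub> b \<oplus>\<^bsub>M\<^esub> u" using dec[OF x(1)] by blast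
        \<comment> \<open>Chosen so that the coefficients of \<open>b\<close> cancel in x + w k.
          That vector lies in \<open>span B\<close> and is killed by \<open>\<Phi>\<close>, hence
          zero, and the new functional \<open>\<psi>\<close> then forces
          \<open>w = 0\<close>.\<close>
        define w where "w = - (z / z0)"
        have xc: "x \<in> carrier M" unfolding u(2) using spc[OF u(1)] zb by simp
        have wk: "sc w \<odot>\<^bsub>M\<^esub> k \<in> carrier M" using kc by (simp add: M.smult_closed)
        have wu: "sc w \<odot>\<^bsub>M\<^esub> u0 \<in> carrier M" using spc[OF u0(1)] by (simp add: M.smult_closed)
        have "sc w \<odot>\<^bsub>M\<^esub> k = sc (w * z0) \<odot>\<^bsub>M\<^esub> b \<oplus>\<^bsub>M\<^esub> sc w \<odot>\<^bsub>M\<^esub> u0"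
          unfolding u0(2) using zb b spc[OF u0(1)] by (simp add: M.smult_r_distr sc_mult M.smult_assoc)
        then have "x \<oplus>\<^bsub>M\<^esub> sc w \<odot>\<^bsub>M\<^esub> k = (sc z \<odot>\<^bsub>M\<^esub> b \<oplus>\<^bsub>M\<^esub> sc (w * z0) \<odot>\<^bsub>M\<^esub> b) \<oplus>\<^bsub>M\<^esub> (u \<oplus>\<^bsub>M\<^esub> sc w \<odot>\<^bsub>M\<^esub> u0)"
          unfolding u(2) using zb spc[OF u(1)] wu by (simp add: M.M.a_ac)
        also have "sc z \<odot>\<^bsub>M\<^esub> b \<oplus>\<^bsub>M\<^esub> sc (w * z0) \<odot>\<^bsub>M\<^esub> b = sc (z + w * z0) \<odot>\<^bsub>M\<^esub> b"
          using b by (simp add: sc_add M.smult_l_distr)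
        also have "z + w * z0 = 0" using z0 by (simp add: w_def)
        finally have eq: "x \<oplus>\<^bsub>M\<^esub> sc w \<odot>\<^bsub>M\<^esub> k = u \<oplus>\<^bsub>M\<^esub> sc w \<odot>\<^bsub>M\<^esub> u0"
          using b spc[OF u(1)] wu by (simp add: M.smult_zero_l)
        have "x \<oplus>\<^bsub>M\<^esub> sc w \<odot>\<^bsub>M\<^esub> k \<in> span B" unfolding eq by (rule sum[OF u(1) u0(1)])
        moreover have "\<phi> (x \<oplus>\<^bsub>M\<^esub> sc w \<odot>\<^bsub>M\<^esub> k) = 0" if \<phi>\<Phi>: "\<phi> \<in> \<Phi>" for \<phi>
        proof -
          have "\<phi> x = 0" "\<phi> k = 0" using x(2) k(2) \<phi>\<Phi> by auto
          then show ?thesis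
            using \<phi>(1)[OF subsetD[OF \<Phi>(2) \<phi>\<Phi>] xc wk] \<phi>(2)[OF subsetD[OF \<Phi>(2) \<phi>\<Phi>] kc kc, of w] by simp
        qed
        ultimately have z: "x \<oplus>\<^bsub>M\<^esub> sc w \<odot>\<^bsub>M\<^esub> k = \<zero>\<^bsub>M\<^esub>" using \<Phi>(3) by blast
        have "\<psi> \<zero>\<^bsub>M\<^esub> = 0" using \<phi>(1)[OF \<psi>(1) M.M.zero_closed M.M.zero_closed] by simp
        then have "\<psi> x + w * \<psi> k = 0"
          using \<phi>(1)[OF \<psi>(1) xc wk] \<phi>(2)[OF \<psi>(1) kc kc, of w] z by simp
        then have "w = 0" using x(2) \<psi>(2) by simp
        then show ?thesis using z xc kc by (simp add: M.smult_zero_l)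
      qed
      then show ?thesis using \<Phi>(1,2) \<psi>(1) by (intro exI[of _ "insert \<psi> \<Phi>"]) auto
    qed
  qed
  obtain B where B: "finite B" "B \<subseteq> carrier M" "\<forall>x\<in>carrier M. \<exists>c. x = (\<Oplus>\<^bsub>M\<^esub>b\<in>B. cscale A M (c b) b)"
    using M unfolding finite_dim_module_def by blast
  have sp: "x \<in> span B" if "x \<in> carrier M" for x using B(3) that unfolding span_def cscale_sc by blast
  obtain \<Phi> where \<Phi>: "finite \<Phi>" "\<Phi> \<subseteq> ?H" "\<forall>x\<in>span B. (\<forall>\<phi>\<in>\<Phi>. \<phi> x = 0) \<longrightarrow> x = \<zero>\<^bsub>M\<^esub>"
    using ex[OF B(1,2)] by blast
  show ?thesis
  proof (rule that[OF \<Phi>(1,2)])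
    fix x assume "x \<in> carrier M" "\<And>\<phi>. \<phi> \<in> \<Phi> \<Longrightarrow> \<phi> x = 0"
    then show "x = \<zero>\<^bsub>M\<^esub>" using \<Phi>(3) sp by blast
  qed
qed

text \<open>Functionals on \<open>M\<close> composed with evaluation at the generators separate
  endomorphisms, as these are determined by their values at the generators.\<close>

lemma End_C_functionals:
  assumes M: "finite_dim_module A M"
  obtains \<Psi> where "functional_space (End_C A M) \<Psi>"
proof -
  have lM: "left_module A M" using M by (simp add: finite_dim_module_def)
  interpret M: left_module A M by fact
  let ?H = "lmod_hom complex_ring (vector_space_of M) (regular_module complex_ring)"
  obtain \<Phi> where \<Phi>: "finite \<Phi>" "\<Phi> \<subseteq> ?H"
    "\<And>x. x \<in> carrier M \<Longrightarrow> (\<And>\<phi>. \<phi> \<in> \<Phi> \<Longrightarrow> \<phi> x = 0) \<Longrightarrow> x = \<zero>\<^bsub>M\<^esub>"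
    by (rule finite_separating_functionals[OF M]) blast
  obtain B where B: "finite B" "B \<subseteq> carrier M" "\<forall>x\<in>carrier M. \<exists>c. x = (\<Oplus>\<^bsub>M\<^esub>b\<in>B. cscale A M (c b) b)"
    using M unfolding finite_dim_module_def by blast
  define \<Psi> where "\<Psi> = (\<lambda>(\<phi>, b) f. \<phi> (f b)) ` (\<Phi> \<times> B)"
  have "functional_space (End_C A M) \<Psi>"
  proof (rule functional_space.intro[OF left_module_End_C[OF lM]], unfold_locales)
    show "finite \<Psi>" using \<Phi>(1) B(1) by (simp add: \<Psi>_def)
    show "\<Psi> \<subseteq> lmod_hom complex_ring (End_C A M) (regular_module complex_ring)"
    proof
      fix \<psi> assume "\<psi> \<in> \<Psi>"
      then obtain \<phi> b where \<psi>: "\<psi> = (\<lambda>f. \<phi> (f b))" "\<phi> \<in> ?H" "b \<in> carrier M"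
        using \<Phi>(2) B(2) by (auto simp: \<Psi>_def)
      have fb: "f b \<in> carrier M" if "f \<in> carrier (End_C A M)" for f
        using that \<psi>(3) unfolding End_C_carrier by auto
      show "\<psi> \<in> lmod_hom complex_ring (End_C A M) (regular_module complex_ring)"
      proof (rule lmod_homI)
        show "\<psi> (f \<oplus>\<^bsub>End_C A M\<^esub> g) = \<psi> f \<oplus>\<^bsub>regular_module complex_ring\<^esub> \<psi> g"
          if "f \<in> carrier (End_C A M)" "g \<in> carrier (End_C A M)" for f g
          using lmod_homD(2)[OF \<psi>(2), of "f b" "g b"] fb[OF that(1)] fb[OF that(2)] \<psi>(3)
          by (simp add: \<psi>(1) End_C_simps)
        show "\<psi> (c \<odot>\<^bsub>End_C A M\<^esub> f) = c \<odot>\<^bsub>regular_module complex_ring\<^esub> \<psi> f"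
          if "f \<in> carrier (End_C A M)" for c f
          using lmod_homD(3)[OF \<psi>(2), of c "f b"] fb[OF that] \<psi>(3) by (simp add: \<psi>(1) End_C_simps)
      qed (simp add: regular_module_def)
    qed
  next
    fix f assume f: "f \<in> carrier (End_C A M)" and z: "\<And>\<phi>. \<phi> \<in> \<Psi> \<Longrightarrow> \<phi> f = 0"
    have fx: "f x \<in> carrier M" if "x \<in> carrier M" for x using f that unfolding End_C_carrier by auto
    have fb: "f b = \<zero>\<^bsub>M\<^esub>" if b: "b \<in> B" for b
    proof (rule \<Phi>(3))
      show "f b \<in> carrier M" using fx B(2) b by blast
      fix \<phi> assume "\<phi> \<in> \<Phi>"
      then have "(\<lambda>f. \<phi> (f b)) \<in> \<Psi>" using b by (auto simp: \<Psi>_def)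
      from z[OF this] show "\<phi> (f b) = 0" .
    qed
    have fH: "f \<in> lmod_hom complex_ring (vector_space_of M) (vector_space_of M)"
      using f unfolding End_C_carrier by (intro lmod_homI) auto
    note lv = left_module_vector_space_of[OF lM]
    have "f x = \<zero>\<^bsub>M\<^esub>" if x: "x \<in> carrier M" for x
    proof -
      obtain c where c: "x = (\<Oplus>\<^bsub>M\<^esub>b\<in>B. cscale A M (c b) b)" using B(3) x by blast
      have "f (\<Oplus>\<^bsub>M\<^esub>b\<in>F. cscale A M (c b) b) = \<zero>\<^bsub>M\<^esub>" if "finite F" "F \<subseteq> B" for F
        using that
      proof (induction F rule: finite_induct)
        case empty
        show ?case using lmod_hom_zero[OF lv lv fH] by simp
      next
        case (insert b F)
        have cc: "cscale A M (c b) b \<in> carrier M" if "b \<in> B" for b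
          using that B(2) by (auto simp: cscale_sc intro: M.smult_closed)
        have S: "(\<Oplus>\<^bsub>M\<^esub>b\<in>F. cscale A M (c b) b) \<in> carrier M" using insert cc by (intro M.M.finsum_closed) auto
        have b: "b \<in> B" "b \<in> carrier M" using insert B(2) by auto
        have "(\<Oplus>\<^bsub>M\<^esub>b\<in>insert b F. cscale A M (c b) b) = cscale A M (c b) b \<oplus>\<^bsub>M\<^esub> (\<Oplus>\<^bsub>M\<^esub>b\<in>F. cscale A M (c b) b)"
          using insert cc by (intro M.M.finsum_insert) auto
        moreover have "f (cscale A M (c b) b) = \<zero>\<^bsub>M\<^esub>"
          using f b fb[OF b(1)] unfolding End_C_carrier by (simp add: cscale_sc M.smult_zero_r)
        moreover have "f (cscale A M (c b) b \<oplus>\<^bsub>M\<^esub> (\<Oplus>\<^bsub>M\<^esub>b\<in>F. cscale A M (c b) b)) =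
            f (cscale A M (c b) b) \<oplus>\<^bsub>M\<^esub> f (\<Oplus>\<^bsub>M\<^esub>b\<in>F. cscale A M (c b) b)"
          using f cc[OF b(1)] S unfolding End_C_carrier by blast
        ultimately show ?case using insert by simp
      qed
      then show ?thesis using B(1) c by blast
    qed
    then show "f = \<zero>\<^bsub>End_C A M\<^esub>"
      using f unfolding End_C_carrier End_C_simps
          by (intro extensionalityI[of _ "carrier M"]) (auto simp: PiE_def)
  qed
  then show ?thesis by (rule that)
qed

text \<open>On the box the structure map is a combination of the endomorphisms given by the
  \<open>a i\<close>, with the coordinate functions as coefficients; so only the integrals of the
  coordinates are needed, and these are computed on the standard box.\<close>

lemma integral_profile_eq:
  assumes M: "finite_dim_module A M" and basis: "is_basis A d a" and t: "t \<in> orthant d"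
  shows "integral_profile A d a M t \<in> carrier (End_C A M)"
    and "x \<in> carrier M \<Longrightarrow> integral_profile A d a M t x =
      (\<Oplus>\<^bsub>M\<^esub>i\<in>{..<d}. sc (complex_of_real ((t i)\<^sup>2 / 2 * (\<Prod>j\<in>{..<d} - {i}. t j))) \<odot>\<^bsub>M\<^esub> (a i \<odot>\<^bsub>M\<^esub> x))"
proof -
  have lM: "left_module A M" using M by (simp add: finite_dim_module_def)
  interpret M: left_module A M by fact
  obtain \<Psi> where "functional_space (End_C A M) \<Psi>" by (rule End_C_functionals[OF M])
  then interpret E: functional_space "End_C A M" \<Psi> .
  have ac: "a i \<in> carrier A" if "i < d" for i using basis that by (simp add: is_basis_def)
  have t0: "0 \<le> t i" if "i < d" for i using t that by (auto simp: orthant_def)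
  define N where "N = (\<Pi>\<^sub>M i\<in>{..<d}. restrict_space lborel {0..t i})"
  define L where "L = (\<lambda>l. \<Oplus>i\<in>{..<d}. complex_of_real (l i :: real) \<odot> a i)"
  let ?\<mu> = "box_measure A d a t"
  have \<mu>: "?\<mu> = embed_measure N L" by (simp add: box_measure_def N_def L_def)
  have spN: "space N \<subseteq> extensional {..<d}" by (auto simp: N_def space_PiM PiE_def)
  have injL: "inj_on L (space N)" unfolding L_def by (rule inj_on_subset[OF basis_inj[OF basis] spN])
  \<comment> \<open>The i-th coordinate as a function on the box inside \<open>A\<close>, where the
    measure lives.\<close>
  define l where "l i y = the_inv_into (space N) L y i" for i y
  have lL: "l i (L w) = w i" if "w \<in> space N" for w i unfolding l_def the_inv_into_f_f[OF injL that] ..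
  have fN: "finite_measure N" unfolding N_def by (rule box_finite_measure[OF t0])
  interpret N: finite_measure N by fact
  \<comment> \<open>Inside \<open>distr\<close> the measure \<open>?\<mu>\<close> merely supplies
    the sigma-algebra.\<close>
  have d: "?\<mu> = distr N ?\<mu> L" unfolding \<mu> by (rule embed_measure_eq_distr'[OF injL])
  have Lm: "L \<in> measurable N ?\<mu>" unfolding \<mu> by (rule measurable_embed_measure2'[OF injL])
  have f\<mu>: "finite_measure ?\<mu>" by (subst d) (rule N.finite_measure_distr[OF Lm])
  have cm: "(\<lambda>w. w i) \<in> borel_measurable N" if "i < d" for i
  proof -
    have "(\<lambda>w. w i) \<in> measurable N (restrict_space lborel {0..t i})"
      unfolding N_def using that by (intro measurable_component_singleton) auto
    then show ?thesis by (simp add: measurable_restrict_space2_iff)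
  qed
  have lm: "l i \<in> borel_measurable ?\<mu>" if "i < d" for i
  proof -
    have "(\<lambda>w. l i (L w)) \<in> borel_measurable N"
      using cm[OF that] by (subst measurable_cong[OF lL])
    then show ?thesis unfolding \<mu> by (rule measurable_embed_measure1)
  qed
  have sp: "space ?\<mu> = L ` space N" unfolding \<mu> by (rule space_embed_measure)
  define B where "B = (\<Sum>i<d. t i)"
  have bd: "\<bar>l i y\<bar> \<le> B" if "i < d" "y \<in> space ?\<mu>" for i y
  proof -
    obtain w where w: "w \<in> space N" "y = L w" using \<open>y \<in> space ?\<mu>\<close> sp by blast
    then have "0 \<le> w i" "w i \<le> t i" using that(1)
        by (auto simp: N_def space_PiM space_restrict_space dest!: PiE_mem)
    moreover have "t i \<le> B" unfolding B_def using that(1) t0 by (intro member_le_sum) auto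
    ultimately show ?thesis using lL[OF w(1)] w(2) by simp
  qed
  define \<rho> where "\<rho> i = structure_map M (a i)" for i
  have \<rho>: "\<rho> i \<in> carrier (End_C A M)" if "i < d" for i unfolding \<rho>_def
      by (rule structure_map_End_C[OF lM ac[OF that]])
  have ev: "E.lincomb d c \<rho> y = (\<Oplus>\<^bsub>M\<^esub>i\<in>{..<d}. sc (c i) \<odot>\<^bsub>M\<^esub> (a i \<odot>\<^bsub>M\<^esub> y))" if y: "y \<in> carrier M" for c y
  proof -
    have "(\<Oplus>\<^bsub>End_C A M\<^esub>i\<in>F. c i \<odot>\<^bsub>End_C A M\<^esub> \<rho> i) y = (\<Oplus>\<^bsub>M\<^esub>i\<in>F. sc (c i) \<odot>\<^bsub>M\<^esub> (a i \<odot>\<^bsub>M\<^esub> y))"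
      if "finite F" "F \<subseteq> {..<d}" for F
      using that
    proof (induction F rule: finite_induct)
      case empty
      show ?case using y by (simp add: End_C_simps)
    next
      case (insert i F)
      have cl: "c i \<odot>\<^bsub>End_C A M\<^esub> \<rho> i \<in> carrier (End_C A M)" if "i < d" for i using \<rho>[OF that]
          by (rule E.scale_closed)
      have cl': "sc (c i) \<odot>\<^bsub>M\<^esub> (a i \<odot>\<^bsub>M\<^esub> y) \<in> carrier M" if "i < d" for i using ac[OF that] y
          by (simp add: M.smult_closed)
      have "(\<Oplus>\<^bsub>End_C A M\<^esub>i\<in>insert i F. c i \<odot>\<^bsub>End_C A M\<^esub> \<rho> i) =
          c i \<odot>\<^bsub>End_C A M\<^esub> \<rho> i \<oplus>\<^bsub>End_C A M\<^esub> (\<Oplus>\<^bsub>End_C A M\<^esub>i\<in>F. c i \<odot>\<^bsub>End_C A M\<^esub> \<rho> i)"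
        using insert cl by (intro E.M.finsum_insert) auto
      moreover have "(\<Oplus>\<^bsub>M\<^esub>i\<in>insert i F. sc (c i) \<odot>\<^bsub>M\<^esub> (a i \<odot>\<^bsub>M\<^esub> y)) =
          sc (c i) \<odot>\<^bsub>M\<^esub> (a i \<odot>\<^bsub>M\<^esub> y) \<oplus>\<^bsub>M\<^esub> (\<Oplus>\<^bsub>M\<^esub>i\<in>F. sc (c i) \<odot>\<^bsub>M\<^esub> (a i \<odot>\<^bsub>M\<^esub> y))"
        using insert cl' by (intro M.M.finsum_insert) auto
      moreover have "(f \<oplus>\<^bsub>End_C A M\<^esub> g) y = f y \<oplus>\<^bsub>M\<^esub> g y" for f g using y by (simp add: End_C_simps(2))
      moreover have "(c i \<odot>\<^bsub>End_C A M\<^esub> \<rho> i) y = sc (c i) \<odot>\<^bsub>M\<^esub> (a i \<odot>\<^bsub>M\<^esub> y)"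
        using y by (simp add: End_C_simps(3) \<rho>_def structure_map_def)
      ultimately show ?case using insert by simp
    qed
    then show ?thesis unfolding E.lincomb_def by simp
  qed
  have f: "structure_map M y = E.lincomb d (\<lambda>i. complex_of_real (l i y)) \<rho>" if y: "y \<in> space ?\<mu>" for y
  proof -
    obtain w where w: "w \<in> space N" "y = L w" using y sp by blast
    have LA: "L w \<in> carrier A" unfolding L_def by (intro finsum_closed) (auto simp: ac csmult_closed)
    show ?thesis
    proof (rule extensionalityI[of _ "carrier M"])
      show "structure_map M y \<in> extensional (carrier M)" by (simp add: structure_map_def)
      show "E.lincomb d (\<lambda>i. complex_of_real (l i y)) \<rho> \<in> extensional (carrier M)"
        using E.lincomb_closed[OF \<rho>] unfolding End_C_carrier by (auto simp: PiE_def)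
      fix z assume z: "z \<in> carrier M"
      have "L w \<odot>\<^bsub>M\<^esub> z = (\<Oplus>\<^bsub>M\<^esub>i\<in>{..<d}. (complex_of_real (w i) \<odot> a i) \<odot>\<^bsub>M\<^esub> z)"
      proof -
        have "(\<Oplus>i\<in>F. complex_of_real (w i) \<odot> a i) \<odot>\<^bsub>M\<^esub> z = (\<Oplus>\<^bsub>M\<^esub>i\<in>F. (complex_of_real (w i) \<odot> a i) \<odot>\<^bsub>M\<^esub> z)"
          if "finite F" "F \<subseteq> {..<d}" for F
          using that
        proof (induction F rule: finite_induct)
          case empty then show ?case using z by (simp add: M.smult_zero_l)
        next
          case (insert i F)
          have cl: "complex_of_real (w i) \<odot> a i \<in> carrier A" if "i < d" for i using ac[OF that]
              by (rule csmult_closed)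
          have "(\<Oplus>i\<in>insert i F. complex_of_real (w i) \<odot> a i) =
              complex_of_real (w i) \<odot> a i \<oplus> (\<Oplus>i\<in>F. complex_of_real (w i) \<odot> a i)"
            using insert cl by (intro finsum_insert) auto
          moreover have "(\<Oplus>i\<in>F. complex_of_real (w i) \<odot> a i) \<in> carrier A"
            using insert cl by (intro finsum_closed) auto
          moreover have "(\<Oplus>\<^bsub>M\<^esub>i\<in>insert i F. (complex_of_real (w i) \<odot> a i) \<odot>\<^bsub>M\<^esub> z) =
            (complex_of_real (w i) \<odot> a i) \<odot>\<^bsub>M\<^esub> z \<oplus>\<^bsub>M\<^esub> (\<Oplus>\<^bsub>M\<^esub>i\<in>F. (complex_of_real (w i) \<odot> a i) \<odot>\<^bsub>M\<^esub> z)"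
            using insert cl z by (intro M.M.finsum_insert) (auto intro: M.smult_closed)
          ultimately show ?case using insert cl z by (simp add: M.smult_l_distr)
        qed
        then show ?thesis unfolding L_def by simp
      qed
      also have "\<dots> = (\<Oplus>\<^bsub>M\<^esub>i\<in>{..<d}. sc (complex_of_real (w i)) \<odot>\<^bsub>M\<^esub> (a i \<odot>\<^bsub>M\<^esub> z))"
      proof (rule M.M.finsum_cong')
        fix i assume "i \<in> {..<d}"
        then have ai: "a i \<in> carrier A" using ac by simp
        show "(complex_of_real (w i) \<odot> a i) \<odot>\<^bsub>M\<^esub> z = sc (complex_of_real (w i)) \<odot>\<^bsub>M\<^esub> (a i \<odot>\<^bsub>M\<^esub> z)"
          unfolding csmult_eq[OF ai] sc_def[symmetric] using ai z by (simp add: M.smult_assoc)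
      qed (auto simp: ac z intro!: M.smult_closed)
      finally show "structure_map M y z = E.lincomb d (\<lambda>i. complex_of_real (l i y)) \<rho> z"
        using z ev[OF z] lL[OF w(1)] w(2) by (simp add: structure_map_def)
    qed
  qed
  have int: "(\<integral>y. l i y \<partial>?\<mu>) = (t i)\<^sup>2 / 2 * (\<Prod>j\<in>{..<d} - {i}. t j)" if i: "i < d" for i
  proof -
    have "(\<integral>y. l i y \<partial>?\<mu>) = (\<integral>w. l i (L w) \<partial>N)"
      by (subst d) (rule integral_distr[OF Lm lm[OF i]])
    also have "\<dots> = (\<integral>w. w i \<partial>N)" by (rule Bochner_Integration.integral_cong[OF refl lL])
    finally show ?thesis unfolding N_def using box_integral(1)[of d t i] t0 i by simp
  qed
  have eq: "integral_profile A d a M t = E.lincomb d (\<lambda>i. complex_of_real (\<integral>y. l i y \<partial>?\<mu>)) \<rho>"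
    unfolding integral_profile_def using t E.bochner_integral_lincomb[OF f\<mu> \<rho> lm bd f] by simp
  show "integral_profile A d a M t \<in> carrier (End_C A M)" unfolding eq by (rule E.lincomb_closed[OF \<rho>])
  assume x: "x \<in> carrier M"
  from eq have "integral_profile A d a M t x =
      (\<Oplus>\<^bsub>M\<^esub>i\<in>{..<d}. sc (complex_of_real (\<integral>y. l i y \<partial>?\<mu>)) \<odot>\<^bsub>M\<^esub> (a i \<odot>\<^bsub>M\<^esub> x))"
    using ev[OF x] by simp
  also have "\<dots> = (\<Oplus>\<^bsub>M\<^esub>i\<in>{..<d}. sc (complex_of_real ((t i)\<^sup>2 / 2 * (\<Prod>j\<in>{..<d} - {i}. t j))) \<odot>\<^bsub>M\<^esub> (a i \<odot>\<^bsub>M\<^esub> x))"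
  proof (rule M.M.finsum_cong')
    fix i assume "i \<in> {..<d}"
    then show "sc (complex_of_real (\<integral>y. l i y \<partial>?\<mu>)) \<odot>\<^bsub>M\<^esub> (a i \<odot>\<^bsub>M\<^esub> x) =
        sc (complex_of_real ((t i)\<^sup>2 / 2 * (\<Prod>j\<in>{..<d} - {i}. t j))) \<odot>\<^bsub>M\<^esub> (a i \<odot>\<^bsub>M\<^esub> x)"
      by (simp only: int lessThan_iff)
  qed (use ac x in \<open>auto intro!: M.smult_closed\<close>)
  finally show "integral_profile A d a M t x =
      (\<Oplus>\<^bsub>M\<^esub>i\<in>{..<d}. sc (complex_of_real ((t i)\<^sup>2 / 2 * (\<Prod>j\<in>{..<d} - {i}. t j))) \<odot>\<^bsub>M\<^esub> (a i \<odot>\<^bsub>M\<^esub> x))" .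
qed

end

text \<open>A finite sum depends on carrier, addition and zero alone; this identifies sums in
  \<open>M\<close> with sums in its underlying vector space, which is a record with another scalar
  multiplication.\<close>

lemma finsum_cong_record:
  assumes "carrier G = carrier H" "add G = add H" "\<zero>\<^bsub>G\<^esub> = \<zero>\<^bsub>H\<^esub>"
  shows "finsum G = finsum H"
  using assms by (intro ext) (simp add: finsum_def finprod_def)

context complex_algebra
begin

lemma integral_profile_zero_iff:
  assumes M: "finite_dim_module A M" and basis: "is_basis A d a"
  shows "(\<forall>t\<in>orthant d. \<forall>x\<in>carrier M. integral_profile A d a M t x = \<zero>\<^bsub>M\<^esub>) \<longleftrightarrow> carrier M = {\<zero>\<^bsub>M\<^esub>}"
proof -
  have lM: "left_module A M" using M by (simp add: finite_dim_module_def)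
  interpret M: left_module A M by fact
  note pe = integral_profile_eq[OF M basis]
  have ac: "a i \<in> carrier A" if "i < d" for i using basis that by (simp add: is_basis_def)
  show ?thesis
  proof
    assume z: "carrier M = {\<zero>\<^bsub>M\<^esub>}"
    show "\<forall>t\<in>orthant d. \<forall>x\<in>carrier M. integral_profile A d a M t x = \<zero>\<^bsub>M\<^esub>"
    proof (intro ballI)
      fix t x assume "t \<in> orthant d" "x \<in> carrier M"
      then have "integral_profile A d a M t x \<in> carrier M" using pe(1)[of t] unfolding End_C_carrier by auto
      then show "integral_profile A d a M t x = \<zero>\<^bsub>M\<^esub>" using z by blast
    qed
  next
    assume zero: "\<forall>t\<in>orthant d. \<forall>x\<in>carrier M. integral_profile A d a M t x = \<zero>\<^bsub>M\<^esub>"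
    obtain \<Phi> where \<Phi>: "finite \<Phi>" "\<Phi> \<subseteq> lmod_hom complex_ring (vector_space_of M) (regular_module complex_ring)"
      "\<And>x. x \<in> carrier M \<Longrightarrow> (\<And>\<phi>. \<phi> \<in> \<Phi> \<Longrightarrow> \<phi> x = 0) \<Longrightarrow> x = \<zero>\<^bsub>M\<^esub>"
      by (rule finite_separating_functionals[OF M]) blast
    interpret F: functional_space "vector_space_of M" \<Phi>
      by (rule functional_space.intro[OF left_module_vector_space_of[OF lM]], unfold_locales) (use \<Phi> in auto)
    have fs: "finsum (vector_space_of M) = finsum M"
      by (rule finsum_cong_record) (simp_all add: vector_space_of_def)
    have ax: "a k \<odot>\<^bsub>M\<^esub> x = \<zero>\<^bsub>M\<^esub>" if x: "x \<in> carrier M" and k: "k < d" for x k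
    proof (rule \<Phi>(3))
      have axc: "a i \<odot>\<^bsub>M\<^esub> x \<in> carrier M" if "i < d" for i using x ac[OF that] by (simp add: M.smult_closed)
      show "a k \<odot>\<^bsub>M\<^esub> x \<in> carrier M" by (rule axc[OF k])
      fix \<phi> assume \<phi>: "\<phi> \<in> \<Phi>"
      have sum0: "(\<Sum>i<d. complex_of_real ((t i)\<^sup>2 / 2 * (\<Prod>j\<in>{..<d} - {i}. t j)) * \<phi> (a i \<odot>\<^bsub>M\<^esub> x)) = 0"
        if t: "t \<in> orthant d" for t
      proof -
        let ?c = "\<lambda>i. complex_of_real ((t i)\<^sup>2 / 2 * (\<Prod>j\<in>{..<d} - {i}. t j))"
        have "F.lincomb d ?c (\<lambda>i. a i \<odot>\<^bsub>M\<^esub> x) = \<zero>\<^bsub>M\<^esub>"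
          using pe(2)[OF t x] zero t x by (simp add: F.lincomb_def fs)
        then have "\<phi> (F.lincomb d ?c (\<lambda>i. a i \<odot>\<^bsub>M\<^esub> x)) = 0" using F.functional_zero[OF \<phi>] by simp
        then show ?thesis using F.functional_lincomb[OF \<phi>, of d "\<lambda>i. a i \<odot>\<^bsub>M\<^esub> x" ?c] axc by simp
      qed
      \<comment> \<open>At the all-ones point every coefficient is 1/2. Doubling the k-th entry
        makes the coefficient 2 at \<open>k\<close> and 1 elsewhere, so subtracting twice the first
        relation isolates the term at \<open>k\<close>.\<close>
      define t1 where "t1 = (\<lambda>i\<in>{..<d}. 1 :: real)"
      define t2 where "t2 = (\<lambda>i\<in>{..<d}. if i = k then 2 else 1 :: real)"
      have 1: "(\<Sum>i<d. \<phi> (a i \<odot>\<^bsub>M\<^esub> x) / 2) = 0"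
      proof -
        have "t1 \<in> orthant d" by (auto simp: t1_def orthant_def)
        from sum0[OF this] show ?thesis by (simp add: t1_def)
      qed
      have "t2 \<in> orthant d" by (auto simp: t2_def orthant_def)
      note sum0[OF this]
      also have "(\<Sum>i<d. complex_of_real ((t2 i)\<^sup>2 / 2 * (\<Prod>j\<in>{..<d} - {i}. t2 j)) * \<phi> (a i \<odot>\<^bsub>M\<^esub> x)) =
          (\<Sum>i<d. 2 * (\<phi> (a i \<odot>\<^bsub>M\<^esub> x) / 2) + (if i = k then \<phi> (a i \<odot>\<^bsub>M\<^esub> x) else 0))"
      proof (intro sum.cong refl)
        fix i assume i: "i \<in> {..<d}"
        have p: "(\<Prod>j\<in>{..<d} - {i}. t2 j) = (if i = k then 1 else 2)"
        proof (cases "i = k")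
          case True
          then show ?thesis by (simp add: t2_def)
        next
          case False
          have "(\<Prod>j\<in>{..<d} - {i}. t2 j) = (\<Prod>j\<in>{..<d} - {i}. if j = k then 2 else 1)"
            by (rule prod.cong) (auto simp: t2_def)
          then show ?thesis using False k by (simp add: prod.delta)
        qed
        show "complex_of_real ((t2 i)\<^sup>2 / 2 * (\<Prod>j\<in>{..<d} - {i}. t2 j)) * \<phi> (a i \<odot>\<^bsub>M\<^esub> x) =
          2 * (\<phi> (a i \<odot>\<^bsub>M\<^esub> x) / 2) + (if i = k then \<phi> (a i \<odot>\<^bsub>M\<^esub> x) else 0)"
          unfolding p using i by (simp add: t2_def)
      qed
      also have "\<dots> = 2 * (\<Sum>i<d. \<phi> (a i \<odot>\<^bsub>M\<^esub> x) / 2) + \<phi> (a k \<odot>\<^bsub>M\<^esub> x)"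
        using k by (simp add: sum.distrib sum_distrib_left)
      finally show "\<phi> (a k \<odot>\<^bsub>M\<^esub> x) = 0" using 1 by simp
    qed
    have "x = \<zero>\<^bsub>M\<^esub>" if x: "x \<in> carrier M" for x
    proof -
      obtain c :: "nat \<Rightarrow> complex" where c: "\<one> = (\<Oplus>i\<in>{..<d}. c i \<odot> a i)"
        using basis unfolding is_basis_def by blast
      have "(\<Oplus>i\<in>F. c i \<odot> a i) \<in> carrier A \<and> (\<Oplus>i\<in>F. c i \<odot> a i) \<odot>\<^bsub>M\<^esub> x = \<zero>\<^bsub>M\<^esub>" if "finite F" "F \<subseteq> {..<d}" for F
        using that
      proof (induction F rule: finite_induct)
        case empty then show ?case using x by (simp add: M.smult_zero_l)
      next
        case (insert i F)
        have cl: "c i \<odot> a i \<in> carrier A" if "i < d" for i using ac[OF that] by (rule csmult_closed)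
        have i: "i < d" using insert by auto
        have eq: "(\<Oplus>i\<in>insert i F. c i \<odot> a i) = c i \<odot> a i \<oplus> (\<Oplus>i\<in>F. c i \<odot> a i)"
          using insert cl by (intro finsum_insert) auto
        have "(c i \<odot> a i) \<odot>\<^bsub>M\<^esub> x = sc (c i) \<odot>\<^bsub>M\<^esub> (a i \<odot>\<^bsub>M\<^esub> x)"
          unfolding csmult_eq[OF ac[OF i]] sc_def[symmetric] using ac[OF i] x by (simp add: M.smult_assoc)
        then have "(c i \<odot> a i) \<odot>\<^bsub>M\<^esub> x = \<zero>\<^bsub>M\<^esub>" using ax[OF x i] by (simp add: M.smult_zero_r)
        then show ?case unfolding eq using insert cl[OF i] x by (simp add: M.smult_l_distr)
      qed
      then have "\<one> \<odot>\<^bsub>M\<^esub> x = \<zero>\<^bsub>M\<^esub>" unfolding c by blast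
      then show ?thesis using x by (simp add: M.smult_one)
    qed
    then show "carrier M = {\<zero>\<^bsub>M\<^esub>}" by blast
  qed
qed

section \<open>Degrees and polynomiality of total profiles\<close>

lemma total_profile_zero_iff:
  assumes M: "finite_dim_module A (X n)" and basis: "is_basis A d a"
  shows "total_profile A d a X n = \<zero>\<^bsub>map_algebra (orthant d) (End_C A (X n))\<^esub> \<longleftrightarrow> carrier (X n) = {\<zero>\<^bsub>X n\<^esub>}"
proof -
  have "total_profile A d a X n = \<zero>\<^bsub>map_algebra (orthant d) (End_C A (X n))\<^esub> \<longleftrightarrow>
      (\<forall>t\<in>orthant d. integral_profile A d a (X n) t = \<zero>\<^bsub>End_C A (X n)\<^esub>)"
    unfolding total_profile_def map_algebra_def
    by (auto simp: fun_eq_iff integral_profile_def restrict_def)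
  also have "\<dots> \<longleftrightarrow> (\<forall>t\<in>orthant d. \<forall>x\<in>carrier (X n). integral_profile A d a (X n) t x = \<zero>\<^bsub>X n\<^esub>)"
  proof (intro ball_cong refl)
    fix t assume "t \<in> orthant d"
    then have "integral_profile A d a (X n) t \<in> extensional (carrier (X n))"
      using integral_profile_eq(1)[OF M basis] unfolding End_C_carrier by (auto simp: PiE_def)
    then show "integral_profile A d a (X n) t = \<zero>\<^bsub>End_C A (X n)\<^esub> \<longleftrightarrow>
        (\<forall>x\<in>carrier (X n). integral_profile A d a (X n) t x = \<zero>\<^bsub>X n\<^esub>)"
      unfolding End_C_simps by (auto intro!: extensionalityI[of _ "carrier (X n)"])
  qed
  also have "\<dots> \<longleftrightarrow> carrier (X n) = {\<zero>\<^bsub>X n\<^esub>}" by (rule integral_profile_zero_iff[OF M basis])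
  finally show ?thesis .
qed

text \<open>Nonzero coefficients and nonzero terms have the same indices, so a common bound on the
  degrees is a common index past which all terms vanish.\<close>

lemma profile_degrees_finite_iff:
  assumes M: "\<And>v n. v \<in> S \<Longrightarrow> finite_dim_module A (X v n)" and basis: "is_basis A d a"
  shows "(SUP v\<in>S. profile_degree A d a (X v)) < \<infinity> \<longleftrightarrow> (\<exists>N. \<forall>v\<in>S. \<forall>k>N. carrier (X v k) = {\<zero>\<^bsub>X v k\<^esub>})"
proof
  assume "(SUP v\<in>S. profile_degree A d a (X v)) < \<infinity>"
  then obtain N where N: "(SUP v\<in>S. profile_degree A d a (X v)) = enat N" by auto
  have "carrier (X v k) = {\<zero>\<^bsub>X v k\<^esub>}" if v: "v \<in> S" and k: "k > N" for v k
  proof (rule ccontr)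
    assume "carrier (X v k) \<noteq> {\<zero>\<^bsub>X v k\<^esub>}"
    then have "enat k \<le> profile_degree A d a (X v)"
      unfolding profile_degree_def using total_profile_zero_iff[where X = "X v"
          and n = k, OF M[OF v] basis] by (intro SUP_upper) simp
    also have "\<dots> \<le> enat N" unfolding N[symmetric] using v by (intro SUP_upper)
    finally show False using k by simp
  qed
  then show "\<exists>N. \<forall>v\<in>S. \<forall>k>N. carrier (X v k) = {\<zero>\<^bsub>X v k\<^esub>}" by blast
next
  assume "\<exists>N. \<forall>v\<in>S. \<forall>k>N. carrier (X v k) = {\<zero>\<^bsub>X v k\<^esub>}"
  then obtain N where N: "\<And>v k. v \<in> S \<Longrightarrow> k > N \<Longrightarrow> carrier (X v k) = {\<zero>\<^bsub>X v k\<^esub>}" by blast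
  have "profile_degree A d a (X v) \<le> enat N" if v: "v \<in> S" for v
    unfolding profile_degree_def
  proof (rule SUP_least)
    fix n assume "n \<in> {n. total_profile A d a (X v) n \<noteq> \<zero>\<^bsub>map_algebra (orthant d) (End_C A (X v n))\<^esub>}"
    then have "carrier (X v n) \<noteq> {\<zero>\<^bsub>X v n\<^esub>}" using total_profile_zero_iff[where X = "X v"
        and n = n, OF M[OF v] basis] by simp
    then show "enat n \<le> enat N" using N[OF v, of n] by (cases "n > N") auto
  qed
  then have "(SUP v\<in>S. profile_degree A d a (X v)) \<le> enat N" by (rule SUP_least)
  then show "(SUP v\<in>S. profile_degree A d a (X v)) < \<infinity>" by (rule order_le_less_trans) simp
qed

lemma proj_inj_categoryI:
  fixes M :: "('a, 'u) module"
  assumes M: "finite_dim_module A M" and "projective_module A M \<or> injective_module A M"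
  shows "M \<in> proj_inj_category A"
proof -
  let ?f = "\<lambda>x. \<lambda>i\<in>{..<Suc 0}. x"
  have "?f \<in> lmod_iso A M (lmod_dsum {..<Suc 0} (\<lambda>_. M))"
    unfolding lmod_iso_def
  proof (intro CollectI conjI)
    show "?f \<in> lmod_hom A M (lmod_dsum {..<Suc 0} (\<lambda>_. M))"
      by (rule lmod_homI) (auto simp: lmod_dsum_def)
    show "bij_betw ?f (carrier M) (carrier (lmod_dsum {..<Suc 0} (\<lambda>_. M)))"
    proof (rule bij_betw_byWitness[where f' = "\<lambda>g. g 0"])
      show "\<forall>g\<in>carrier (lmod_dsum {..<Suc 0} (\<lambda>_. M)). ?f (g 0) = g"
      proof
        fix g assume "g \<in> carrier (lmod_dsum {..<Suc 0} (\<lambda>_. M))"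
        then have "g \<in> extensional {..<Suc 0}" by (auto simp: lmod_dsum_def PiE_def)
        then show "?f (g 0) = g" by (intro extensionalityI[of _ "{..<Suc 0}"]) auto
      qed
    qed (auto simp: lmod_dsum_def split: if_splits)
  qed
  then have "\<exists>k (N :: nat \<Rightarrow> ('a, 'u) module).
        (\<forall>i<k. finite_dim_module A (N i) \<and> (projective_module A (N i) \<or> injective_module A (N i))) \<and>
        lmod_iso A M (lmod_dsum {..<k} N) \<noteq> {}"
    using assms by (intro exI[of _ "Suc 0"] exI[of _ "\<lambda>_. M"]) blast
  then show ?thesis unfolding proj_inj_category_def using M by blast
qed

end

text \<open>\<open>\<sigma> M\<close> maps onto the product, so every element of \<open>M\<close>
  occurs as a first component and no part of the profile is lost. That \<open>\<sigma> M\<close>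
  preserves zero comes from the equation for zero acting on zero in \<open>Pi_N\<close>.\<close>

lemma Emb_zero_iff:
  fixes Q :: "('v, 'e) pre_digraph" and M :: "(('v, 'e) bq_elt, 'u) module"
  assumes alg: "complex_algebra (bound_quiver_algebra Q I)"
    and basis: "is_basis (bound_quiver_algebra Q I) d a"
        and M: "finite_dim_module (bound_quiver_algebra Q I) M"
            and C: "left_module (bound_quiver_algebra Q I) (C M)"
    and \<sigma>: "\<sigma> M \<in> lmod_iso (bound_quiver_algebra Q I) (Pi_N Q I) (lmod_prod M (C M))"
    and zero: "\<zero>\<^bsub>Pi_N Q I\<^esub> \<in> carrier (Pi_N Q I)" "\<zero>\<^bsub>bound_quiver_algebra Q I\<^esub> \<odot>\<^bsub>Pi_N Q I\<^esub> \<zero>\<^bsub>Pi_N Q I\<^esub> =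
        \<zero>\<^bsub>Pi_N Q I\<^esub>"
  shows "Emb Q I d C \<sigma> M (integral_profile (bound_quiver_algebra Q I) d a M) =
      (\<lambda>t\<in>orthant d. \<lambda>x\<in>carrier (Pi_N Q I). \<zero>\<^bsub>Pi_N Q I\<^esub>) \<longleftrightarrow>
    carrier M = {\<zero>\<^bsub>M\<^esub>}"
proof -
  let ?A = "bound_quiver_algebra Q I"
  interpret complex_algebra ?A by fact
  have lM: "left_module ?A M" using M by (simp add: finite_dim_module_def)
  interpret M: left_module ?A M by fact
  interpret C: left_module ?A "C M" by fact
  let ?Pi = "carrier (Pi_N Q I)" and ?z = "\<zero>\<^bsub>Pi_N Q I\<^esub>"
  have b: "bij_betw (\<sigma> M) ?Pi (carrier M \<times> carrier (C M))"
      and h: "\<sigma> M \<in> lmod_hom ?A (Pi_N Q I) (lmod_prod M (C M))"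
    using \<sigma> by (auto simp: lmod_iso_def lmod_prod_def)
  have \<sigma>c: "\<sigma> M x \<in> carrier M \<times> carrier (C M)" if "x \<in> ?Pi" for x
    using lmod_homD(1)[OF h that] by (simp add: lmod_prod_def)
  have \<sigma>0: "\<sigma> M ?z = (\<zero>\<^bsub>M\<^esub>, \<zero>\<^bsub>C M\<^esub>)"
  proof -
    have "\<sigma> M ?z = \<zero>\<^bsub>?A\<^esub> \<odot>\<^bsub>lmod_prod M (C M)\<^esub> \<sigma> M ?z"
      using lmod_homD(3)[OF h zero_closed zero(1)] zero(2) by simp
    then show ?thesis using \<sigma>c[OF zero(1)]
      by (cases "\<sigma> M ?z") (auto simp: lmod_prod_def M.smult_zero_l C.smult_zero_l)
  qed
  have inv: "inv_into ?Pi (\<sigma> M) (m, \<zero>\<^bsub>C M\<^esub>) = ?z \<longleftrightarrow> m = \<zero>\<^bsub>M\<^esub>" if "m \<in> carrier M" for m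
  proof
    assume "inv_into ?Pi (\<sigma> M) (m, \<zero>\<^bsub>C M\<^esub>) = ?z"
    then have "\<sigma> M (inv_into ?Pi (\<sigma> M) (m, \<zero>\<^bsub>C M\<^esub>)) = (\<zero>\<^bsub>M\<^esub>, \<zero>\<^bsub>C M\<^esub>)" using \<sigma>0 by simp
    then show "m = \<zero>\<^bsub>M\<^esub>" using bij_betw_inv_into_right[OF b, of "(m, \<zero>\<^bsub>C M\<^esub>)"] that by simp
  next
    assume "m = \<zero>\<^bsub>M\<^esub>"
    then show "inv_into ?Pi (\<sigma> M) (m, \<zero>\<^bsub>C M\<^esub>) = ?z"
      using bij_betw_inv_into_left[OF b zero(1)] \<sigma>0 by simp
  qed
  let ?p = "integral_profile ?A d a M"
  have pc: "?p t m \<in> carrier M" if "t \<in> orthant d" "m \<in> carrier M" for t m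
    using integral_profile_eq(1)[OF M basis that(1)] that(2) unfolding End_C_carrier by auto
  have "Emb Q I d C \<sigma> M ?p = (\<lambda>t\<in>orthant d. \<lambda>x\<in>?Pi. ?z) \<longleftrightarrow>
      (\<forall>t\<in>orthant d. \<forall>x\<in>?Pi. inv_into ?Pi (\<sigma> M) (?p t (fst (\<sigma> M x)), \<zero>\<^bsub>C M\<^esub>) = ?z)"
    unfolding Emb_def by (simp add: fun_eq_iff restrict_def) blast
  also have "\<dots> \<longleftrightarrow> (\<forall>t\<in>orthant d. \<forall>x\<in>?Pi. ?p t (fst (\<sigma> M x)) = \<zero>\<^bsub>M\<^esub>)"
    using inv pc \<sigma>c by (intro ball_cong refl) (auto simp: mem_Times_iff)
  also have "\<dots> \<longleftrightarrow> (\<forall>t\<in>orthant d. \<forall>m\<in>carrier M. ?p t m = \<zero>\<^bsub>M\<^esub>)"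
  proof (intro ball_cong refl iffI ballI)
    fix t m assume *: "\<forall>x\<in>?Pi. ?p t (fst (\<sigma> M x)) = \<zero>\<^bsub>M\<^esub>" and m: "m \<in> carrier M"
    have "(m, \<zero>\<^bsub>C M\<^esub>) \<in> \<sigma> M ` ?Pi" using b m by (simp add: bij_betw_def)
    then obtain x where "x \<in> ?Pi" "\<sigma> M x = (m, \<zero>\<^bsub>C M\<^esub>)" by auto
    then show "?p t m = \<zero>\<^bsub>M\<^esub>" using * by force
  next
    fix t x assume "\<forall>m\<in>carrier M. ?p t m = \<zero>\<^bsub>M\<^esub>" "x \<in> ?Pi"
    then show "?p t (fst (\<sigma> M x)) = \<zero>\<^bsub>M\<^esub>" using \<sigma>c[of x] by (auto simp: mem_Times_iff)
  qed
  also have "\<dots> \<longleftrightarrow> carrier M = {\<zero>\<^bsub>M\<^esub>}" by (rule integral_profile_zero_iff[OF M basis])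
  finally show ?thesis .
qed

text \<open>All coefficients lie in \<open>coefficient_ring\<close> from the start, because every
  term is projective or injective and so belongs to the category; membership in \<open>UP\<close>
  only adds that they are eventually zero.\<close>

lemma embedded_total_profile_polynomial_iff:
  fixes Q :: "('v, 'e) pre_digraph" and X :: "nat \<Rightarrow> (('v, 'e) bq_elt, 'u) module"
  assumes alg: "complex_algebra (bound_quiver_algebra Q I)"
    and basis: "is_basis (bound_quiver_algebra Q I) d a" and emb: "embedding_system Q I C \<sigma>"
    and X: "\<And>n. finite_dim_module (bound_quiver_algebra Q I) (X n)"
        "\<And>n. projective_module (bound_quiver_algebra Q I) (X n) \<or> injective_module (bound_quiver_algebra
            Q I) (X n)"
    and zero: "\<zero>\<^bsub>Pi_N Q I\<^esub> \<in> carrier (Pi_N Q I)" "\<zero>\<^bsub>bound_quiver_algebra Q I\<^esub> \<odot>\<^bsub>Pi_N Q I\<^esub> \<zero>\<^bsub>Pi_N Q I\<^esub> =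
        \<zero>\<^bsub>Pi_N Q I\<^esub>"
  shows "embedded_total_profile Q I d a C \<sigma> X \<in> carrier (UP (coefficient_ring Q I d a C \<sigma>)) \<longleftrightarrow>
    (\<exists>N. \<forall>k>N. carrier (X k) = {\<zero>\<^bsub>X k\<^esub>})"
proof -
  let ?A = "bound_quiver_algebra Q I"
  interpret complex_algebra ?A by fact
  have cat: "X n \<in> proj_inj_category ?A" for n by (rule proj_inj_categoryI[OF X])
  let ?R = "coefficient_ring Q I d a C \<sigma>"
  have z: "\<zero>\<^bsub>?R\<^esub> = (\<lambda>t\<in>orthant d. \<lambda>x\<in>carrier (Pi_N Q I). \<zero>\<^bsub>Pi_N Q I\<^esub>)"
    by (simp add: coefficient_ring_def Let_def map_algebra_def End_C_def)
  have mem: "embedded_total_profile Q I d a C \<sigma> X n \<in> carrier ?R" for n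
    unfolding coefficient_ring_def Let_def embedded_total_profile_def
    using cat[of n] by (auto intro!: generated_subalgebra.incl)
  have zi: "embedded_total_profile Q I d a C \<sigma> X n = \<zero>\<^bsub>?R\<^esub> \<longleftrightarrow> carrier (X n) = {\<zero>\<^bsub>X n\<^esub>}" for n
  proof -
    have "left_module ?A (C (X n))" "\<sigma> (X n) \<in> lmod_iso ?A (Pi_N Q I) (lmod_prod (X n) (C (X n)))"
      using emb cat[of n] by (auto simp: embedding_system_def Let_def)
    then show ?thesis
      unfolding z embedded_total_profile_def by (rule Emb_zero_iff[OF alg basis X(1) _ _ zero])
  qed
  have "embedded_total_profile Q I d a C \<sigma> X \<in> carrier (UP ?R) \<longleftrightarrow>
      (\<exists>N. bound \<zero>\<^bsub>?R\<^esub> N (embedded_total_profile Q I d a C \<sigma> X))"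
    using mem by (auto simp: UP_def up_def)
  also have "\<dots> \<longleftrightarrow> (\<exists>N. \<forall>k>N. embedded_total_profile Q I d a C \<sigma> X k = \<zero>\<^bsub>?R\<^esub>)"
    by (auto simp: bound_def)
  finally show ?thesis unfolding zi .
qed

section \<open>The radical of a bound quiver algebra\<close>

locale bound_quiver =
  fixes Q :: "('v, 'e) pre_digraph" and I :: "(('v, 'e) path \<Rightarrow> complex) set"
  assumes quiver: "fin_digraph Q" and admissible: "admissible_ideal Q I"
begin

abbreviation P where "P \<equiv> path_algebra Q"
abbreviation A where "A \<equiv> bound_quiver_algebra Q I"

sublocale I: ideal I P
  using admissible by (simp add: admissible_ideal_def)

interpretation Q: fin_digraph Q by (rule quiver)

lemma P_simps:
  "f \<in> carrier P \<longleftrightarrow> finite {p. f p \<noteq> 0} \<and> {p. f p \<noteq> 0} \<subseteq> paths Q"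
  "f \<oplus>\<^bsub>P\<^esub> g = (\<lambda>p. f p + g p)" "\<zero>\<^bsub>P\<^esub> = (\<lambda>p. 0)" "c \<odot>\<^bsub>P\<^esub> f = (\<lambda>p. c * f p)"
  "\<one>\<^bsub>P\<^esub> = (\<lambda>(u, p). if u \<in> verts Q \<and> p = [] then 1 else 0)"
  "f \<otimes>\<^bsub>P\<^esub> g = (\<lambda>(u, p). \<Sum>i\<le>length p. f (u, take i p) * g (last (Q.awalk_verts u (take i p)), drop i p))"
  by (auto simp: path_algebra_def)

lemma P_mult_apply:
  "(f \<otimes>\<^bsub>P\<^esub> g) (u, p) = (\<Sum>i\<le>length p. f (u, take i p) * g (last (Q.awalk_verts u (take i p)), drop i p))"
  by (simp add: P_simps)

lemma P_minus: "f \<in> carrier P \<Longrightarrow> g \<in> carrier P \<Longrightarrow> f \<ominus>\<^bsub>P\<^esub> g = (\<lambda>p. f p - g p)"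
proof -
  assume f: "f \<in> carrier P" and g: "g \<in> carrier P"
  have "{p. - g p \<noteq> 0} = {p. g p \<noteq> 0}" by auto
  then have ng: "(\<lambda>p. - g p) \<in> carrier P" using g by (simp add: P_simps)
  have "\<ominus>\<^bsub>P\<^esub> g = (\<lambda>p. - g p)" by (rule I.minus_equality[OF _ g ng]) (simp add: P_simps)
  then show ?thesis by (simp add: a_minus_def P_simps)
qed

lemma P_smult_closed: "f \<in> carrier P \<Longrightarrow> c \<odot>\<^bsub>P\<^esub> f \<in> carrier P"
  by (auto simp: P_simps intro: finite_subset[of _ "{p. f p \<noteq> 0}"])

lemma P_smult_mult: "(c \<odot>\<^bsub>P\<^esub> f) \<otimes>\<^bsub>P\<^esub> g = c \<odot>\<^bsub>P\<^esub> (f \<otimes>\<^bsub>P\<^esub> g)" "f \<otimes>\<^bsub>P\<^esub> (c \<odot>\<^bsub>P\<^esub> g) = c \<odot>\<^bsub>P\<^esub> (f \<otimes>\<^bsub>P\<^esub> g)"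
  by (auto simp: P_simps sum_distrib_left algebra_simps)

lemma P_smult_one: "f \<in> carrier P \<Longrightarrow> (c \<odot>\<^bsub>P\<^esub> \<one>\<^bsub>P\<^esub>) \<otimes>\<^bsub>P\<^esub> f = c \<odot>\<^bsub>P\<^esub> f" "f \<in> carrier P \<Longrightarrow>
    f \<otimes>\<^bsub>P\<^esub> (c \<odot>\<^bsub>P\<^esub> \<one>\<^bsub>P\<^esub>) = c \<odot>\<^bsub>P\<^esub> f"
  by (simp_all add: P_smult_mult)

lemma I_smult_closed: "f \<in> I \<Longrightarrow> c \<odot>\<^bsub>P\<^esub> f \<in> I"
  using I.I_l_closed[of f "c \<odot>\<^bsub>P\<^esub> \<one>\<^bsub>P\<^esub>"] P_smult_one(1)[of f c] P_smult_closed[of "\<one>\<^bsub>P\<^esub>" c] I.Icarr[of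
      f] by simp

text \<open>A trivial path can be cut in one way only, so taking the coefficient at it is
  multiplicative; this is the origin of the characters.\<close>

lemma P_mult_trivial: "(f \<otimes>\<^bsub>P\<^esub> g) (v, []) = f (v, []) * g (v, [])"
  by (simp add: P_mult_apply)

lemma trivial_path: "v \<in> verts Q \<Longrightarrow> (v, []) \<in> paths Q" "(v, []) \<in> paths Q \<Longrightarrow> v \<in> verts Q"
  by (auto simp: paths_def Q.awalk_Nil_iff)

lemma path_elt_closed: "p \<in> paths Q \<Longrightarrow> path_elt p \<in> carrier P"
  by (auto simp: P_simps path_elt_def)

lemma arrow_path: "e \<in> arcs Q \<Longrightarrow> (tail Q e, [e]) \<in> paths Q"
  by (auto simp: paths_def Q.awalk_Cons_iff Q.awalk_Nil_iff)

lemma path_elt_Cons: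
  assumes "(u, x # xs) \<in> paths Q"
  shows "path_elt (u, x # xs) = path_elt (tail Q x, [x]) \<otimes>\<^bsub>P\<^esub> path_elt (head Q x, xs)"
    "x \<in> arcs Q" "(head Q x, xs) \<in> paths Q"
proof -
  obtain v where "Q.awalk u (x # xs) v" using assms by (auto simp: paths_def)
  then have u: "u = tail Q x" and x: "x \<in> arcs Q" and w: "Q.awalk (head Q x) xs v"
      by (auto simp: Q.awalk_Cons_iff)
  show "x \<in> arcs Q" "(head Q x, xs) \<in> paths Q" using x w by (auto simp: paths_def)
  show "path_elt (u, x # xs) = path_elt (tail Q x, [x]) \<otimes>\<^bsub>P\<^esub> path_elt (head Q x, xs)"
  proof
    fix q :: "('v, 'e) path"
    obtain w r where q: "q = (w, r)" by (cases q)
    let ?t = "\<lambda>i. path_elt (tail Q x, [x]) (w, take i r) * path_elt (head Q x, xs) (last (Q.awalk_verts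
        w (take i r)), drop i r)"
    show "path_elt (u, x # xs) q = (path_elt (tail Q x, [x]) \<otimes>\<^bsub>P\<^esub> path_elt (head Q x, xs)) q"
    proof (cases "q = (u, x # xs)")
      case True
      then have w: "w = tail Q x" and r: "r = x # xs" using q u by auto
      \<comment> \<open>Among all ways to cut the path, only the cut after its first arrow matches
        both factors.\<close>
      have "?t i = (if i = Suc 0 then 1 else 0)" if "i \<le> length r" for i
      proof (cases i)
        case (Suc j)
        have "take j xs = [] \<longleftrightarrow> j = 0 \<or> xs = []" by simp
        then show ?thesis using that Suc w r by (cases "j = 0") (auto simp: path_elt_def)
      qed (simp add: path_elt_def)
      then have "(\<Sum>i\<le>length r. ?t i) = (\<Sum>i\<le>length r. if i = Suc 0 then 1 else 0)" by (intro sum.cong) auto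
      also have "\<dots> = (if Suc 0 \<in> {..length r} then 1 else 0)" by (rule sum.delta) simp
      also have "\<dots> = 1" using r by simp
      finally show ?thesis using True q by (simp add: P_mult_apply path_elt_def)
    next
      case False
      have "?t i = 0" if "i \<le> length r" for i
      proof (rule ccontr)
        assume "?t i \<noteq> 0"
        then have "w = tail Q x" "take i r = [x]" "drop i r = xs" by (auto simp: path_elt_def split: if_splits)
        then have "r = x # xs" using append_take_drop_id[of i r] by simp
        then show False using False q u \<open>w = tail Q x\<close> by simp
      qed
      then have "(\<Sum>i\<le>length r. ?t i) = 0" by (intro sum.neutral) auto
      then show ?thesis using False q by (simp add: P_mult_apply path_elt_def)
    qed
  qed
qed

text \<open>The combinations of nontrivial paths, to be identified with the arrow ideal.\<close>

definition Z where "Z = {f \<in> carrier P. \<forall>v. f (v, []) = 0}"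

lemma ideal_Z: "ideal Z P"
proof (rule idealI[OF I.ring_axioms])
  show "subgroup Z (add_monoid P)"
  proof (rule subgroup.intro)
    show "Z \<subseteq> carrier (add_monoid P)" by (auto simp: Z_def)
    show "x \<otimes>\<^bsub>add_monoid P\<^esub> y \<in> Z" if "x \<in> Z" "y \<in> Z" for x y
      using that I.a_closed[of x y] by (auto simp: Z_def P_simps(2))
    show "\<one>\<^bsub>add_monoid P\<^esub> \<in> Z" using I.zero_closed by (auto simp: Z_def P_simps(3))
    show "inv\<^bsub>add_monoid P\<^esub> x \<in> Z" if "x \<in> Z" for x
    proof -
      have x: "x \<in> carrier P" using that by (simp add: Z_def)
      have "\<ominus>\<^bsub>P\<^esub> x = \<zero>\<^bsub>P\<^esub> \<ominus>\<^bsub>P\<^esub> x" using x by (simp add: a_minus_def)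
      also have "\<dots> = (\<lambda>p. - x p)" using P_minus[OF I.zero_closed x] by (simp add: P_simps)
      finally have "\<ominus>\<^bsub>P\<^esub> x \<in> Z" using that I.a_inv_closed[OF x] by (simp add: Z_def)
      then show ?thesis by (simp add: a_inv_def)
    qed
  qed
  show "x \<otimes>\<^bsub>P\<^esub> a \<in> Z" "a \<otimes>\<^bsub>P\<^esub> x \<in> Z" if "a \<in> Z" "x \<in> carrier P" for a x
    using that by (auto simp: Z_def P_mult_trivial)
qed

text \<open>\<open>Z\<close> is an ideal containing the arrows, hence contains the ideal they
  generate. Conversely a nontrivial path starts with an arrow and so lies in that ideal; induction
  on the support handles combinations.\<close>

lemma arrow_ideal_eq: "arrow_ideal Q = Z"
proof
  let ?G = "{path_elt (tail Q e, [e]) | e. e \<in> arcs Q}"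
  have G: "?G \<subseteq> carrier P" using path_elt_closed[OF arrow_path] by auto
  have GZ: "?G \<subseteq> Z" using G by (auto simp: Z_def path_elt_def)
  show "arrow_ideal Q \<subseteq> Z" unfolding arrow_ideal_def by (rule I.genideal_minimal[OF ideal_Z GZ])
  interpret Idl: ideal "arrow_ideal Q" P unfolding arrow_ideal_def by (rule I.genideal_ideal[OF G])
  have smult: "c \<odot>\<^bsub>P\<^esub> f \<in> arrow_ideal Q" if "f \<in> arrow_ideal Q" for c f
    using Idl.I_l_closed[OF that, of "c \<odot>\<^bsub>P\<^esub> \<one>\<^bsub>P\<^esub>"] P_smult_one(1)[OF Idl.Icarr[OF that], of c]
        P_smult_closed[of "\<one>\<^bsub>P\<^esub>" c] by simp
  have pe: "path_elt p \<in> arrow_ideal Q" if pp: "p \<in> paths Q" and ne: "snd p \<noteq> []" for p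
  proof -
    obtain u x xs where p: "p = (u, x # xs)" using ne by (cases p; cases "snd p") auto
    note c = path_elt_Cons[of u x xs, OF pp[unfolded p]]
    have "path_elt (tail Q x, [x]) \<in> arrow_ideal Q"
      unfolding arrow_ideal_def using I.genideal_self[OF G] c(2) by blast
    from Idl.I_r_closed[OF this path_elt_closed[OF c(3)]] show ?thesis unfolding p c(1) .
  qed
  have "\<forall>f\<in>Z. {p. f p \<noteq> 0} \<subseteq> S \<longrightarrow> f \<in> arrow_ideal Q" if "finite S" for S
    using that
  proof (induction S rule: finite_induct)
    case empty
    have "f = \<zero>\<^bsub>P\<^esub>" if "{p. f p \<noteq> 0} \<subseteq> {}" for f using that by (auto simp: P_simps)
    then show ?case using Idl.zero_closed by metis
  next
    case (insert p S)
    show ?case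
    proof (intro ballI impI)
      fix f assume f: "f \<in> Z" and S: "{p. f p \<noteq> 0} \<subseteq> insert p S"
      show "f \<in> arrow_ideal Q"
      proof (cases "f p = 0")
        case True then show ?thesis using insert.IH f S by blast
      next
        case False
        have fP: "f \<in> carrier P" using f by (simp add: Z_def)
        have p: "p \<in> paths Q" "snd p \<noteq> []" using False f by (cases p; auto simp: Z_def P_simps)+
        let ?g = "f(p := 0)"
        have "{q. ?g q \<noteq> 0} \<subseteq> {q. f q \<noteq> 0}" by auto
        then have "finite {q. ?g q \<noteq> 0}" "{q. ?g q \<noteq> 0} \<subseteq> paths Q"
          using fP finite_subset unfolding P_simps by blast+
        then have "?g \<in> carrier P" unfolding P_simps by blast
        then have "?g \<in> Z" using f by (auto simp: Z_def)
        moreover have "{q. ?g q \<noteq> 0} \<subseteq> S" using S by auto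
        ultimately have "?g \<in> arrow_ideal Q" using insert.IH by blast
        moreover have "f = f p \<odot>\<^bsub>P\<^esub> path_elt p \<oplus>\<^bsub>P\<^esub> ?g" by (auto simp: P_simps path_elt_def)
        ultimately show ?thesis using Idl.a_closed[OF smult[OF pe[OF p], of "f p"]] by metis
      qed
    qed
  qed
  then show "Z \<subseteq> arrow_ideal Q" by (auto simp: Z_def P_simps)
qed

lemma power_carrier: "arrow_ideal_power Q n \<subseteq> carrier P"
proof (induction n)
  case (Suc n)
  have "x \<in> carrier P" if "x \<in> ideal_prod P (arrow_ideal_power Q n) (arrow_ideal Q)" for x
    using that
  proof (induction rule: ideal_prod.induct)
    case (prod i j)
    then show ?case using Suc by (auto simp: arrow_ideal_eq Z_def)
  qed simp
  then show ?case by auto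
qed simp

text \<open>Powers are built by new factors on the right, whereas the socle filtration of left
  modules multiplies on the left; this reconciles the two sides.\<close>

lemma power_mult: "f \<in> arrow_ideal_power Q n \<Longrightarrow> g \<in> arrow_ideal Q \<Longrightarrow> g \<otimes>\<^bsub>P\<^esub> f \<in> arrow_ideal_power Q (Suc n)"
proof (induction n arbitrary: f)
  case 0
  then have c: "g \<otimes>\<^bsub>P\<^esub> f \<in> Z" using ideal.I_r_closed[OF ideal_Z, of g f] by (simp add: arrow_ideal_eq)
  then have "\<one>\<^bsub>P\<^esub> \<otimes>\<^bsub>P\<^esub> (g \<otimes>\<^bsub>P\<^esub> f) \<in> ideal_prod P (carrier P) (arrow_ideal Q)"
    by (intro ideal_prod.prod) (auto simp: arrow_ideal_eq)
  then show ?case using c by (simp add: Z_def)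
next
  case (Suc n)
  have gP: "g \<in> carrier P" using Suc.prems(2) by (simp add: arrow_ideal_eq Z_def)
  from Suc.prems(1) have "f \<in> ideal_prod P (arrow_ideal_power Q n) (arrow_ideal Q)" by simp
  then have "f \<in> carrier P \<and> g \<otimes>\<^bsub>P\<^esub> f \<in> ideal_prod P (arrow_ideal_power Q (Suc n)) (arrow_ideal Q)"
  proof (induction rule: ideal_prod.induct)
    case (prod i j)
    have c: "i \<in> carrier P" "j \<in> carrier P" using prod power_carrier[of n] by (auto simp: arrow_ideal_eq Z_def)
    have "(g \<otimes>\<^bsub>P\<^esub> i) \<otimes>\<^bsub>P\<^esub> j \<in> ideal_prod P (arrow_ideal_power Q (Suc n)) (arrow_ideal Q)"
      by (rule ideal_prod.prod[OF Suc.IH[OF prod(1) Suc.prems(2)] prod(2)])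
    then show ?case using c gP by (simp add: I.m_assoc)
  next
    case (sum s t)
    then show ?case using gP by (simp add: I.r_distr ideal_prod.sum)
  qed
  then show ?case by simp
qed

lemma I_subset_Z: "I \<subseteq> Z"
proof -
  have "I \<subseteq> arrow_ideal_power Q 2" using admissible by (simp add: admissible_ideal_def)
  also have "\<dots> = ideal_prod P (arrow_ideal_power Q 1) (arrow_ideal Q)" by (simp add: numeral_2_eq_2)
  also have "\<dots> \<subseteq> Z"
  proof
    fix x assume "x \<in> ideal_prod P (arrow_ideal_power Q 1) (arrow_ideal Q)"
    then show "x \<in> Z"
    proof (induction rule: ideal_prod.induct)
      case (prod i j)
      then show ?case using ideal.I_l_closed[OF ideal_Z, of j i] power_carrier[of 1]
          by (auto simp: arrow_ideal_eq)
    next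
      case (sum s t)
      then show ?case using additive_subgroup.a_closed[OF ideal.axioms(1)[OF ideal_Z]] by blast
    qed
  qed
  finally show ?thesis .
qed

section \<open>The quotient algebra and its characters\<close>

definition q where "q f = I +>\<^bsub>P\<^esub> f"

lemma A_fields:
  "carrier A = carrier (P Quot I)" "mult A = mult (P Quot I)" "one A = one (P Quot I)" "zero A =
      zero (P Quot I)" "add A = add (P Quot I)"
  "c \<odot>\<^bsub>A\<^esub> X = (\<Union>f\<in>X. I +>\<^bsub>P\<^esub> (c \<odot>\<^bsub>P\<^esub> f))"
  by (simp_all add: bound_quiver_algebra_def ring.defs module.defs)

lemma carrier_A: "carrier A = q ` carrier P"
  by (auto simp: A_fields FactRing_def A_RCOSETS_def' q_def)

lemma q_simps:
  "f \<in> carrier P \<Longrightarrow> g \<in> carrier P \<Longrightarrow> q f \<otimes>\<^bsub>A\<^esub> q g = q (f \<otimes>\<^bsub>P\<^esub> g)"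
  "f \<in> carrier P \<Longrightarrow> g \<in> carrier P \<Longrightarrow> q f \<oplus>\<^bsub>A\<^esub> q g = q (f \<oplus>\<^bsub>P\<^esub> g)"
  "\<one>\<^bsub>A\<^esub> = q \<one>\<^bsub>P\<^esub>" "\<zero>\<^bsub>A\<^esub> = I"
  by (simp_all add: A_fields FactRing_def q_def I.rcoset_mult_add I.a_rcos_sum)

lemma q_eq_iff: "f \<in> carrier P \<Longrightarrow> g \<in> carrier P \<Longrightarrow> q f = q g \<longleftrightarrow> f \<ominus>\<^bsub>P\<^esub> g \<in> I"
  unfolding q_def by (rule I.quotient_eq_iff_same_a_r_cos[OF I.ideal_axioms, symmetric])

lemma q_mem_iff: "f \<in> carrier P \<Longrightarrow> g \<in> q f \<longleftrightarrow> (\<exists>i\<in>I. g = i \<oplus>\<^bsub>P\<^esub> f)"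
  by (auto simp: q_def a_r_coset_def' )

lemma q_smult: "f \<in> carrier P \<Longrightarrow> c \<odot>\<^bsub>A\<^esub> q f = q (c \<odot>\<^bsub>P\<^esub> f)"
proof -
  assume f: "f \<in> carrier P"
  have "I +>\<^bsub>P\<^esub> (c \<odot>\<^bsub>P\<^esub> g) = q (c \<odot>\<^bsub>P\<^esub> f)" if g: "g \<in> q f" for g
  proof -
    obtain i where i: "i \<in> I" "g = i \<oplus>\<^bsub>P\<^esub> f" using g q_mem_iff[OF f] by blast
    have iP: "i \<in> carrier P" by (rule I.Icarr[OF i(1)])
    have gP: "g \<in> carrier P" using iP f by (simp add: i)
    have "(c \<odot>\<^bsub>P\<^esub> g) \<ominus>\<^bsub>P\<^esub> (c \<odot>\<^bsub>P\<^esub> f) = c \<odot>\<^bsub>P\<^esub> i"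
      unfolding P_minus[OF P_smult_closed[OF gP] P_smult_closed[OF f]] by (simp add: i P_simps algebra_simps)
    then have "(c \<odot>\<^bsub>P\<^esub> g) \<ominus>\<^bsub>P\<^esub> (c \<odot>\<^bsub>P\<^esub> f) \<in> I" using I_smult_closed[OF i(1)] by simp
    then have "q (c \<odot>\<^bsub>P\<^esub> g) = q (c \<odot>\<^bsub>P\<^esub> f)" using q_eq_iff P_smult_closed gP f by blast
    then show ?thesis by (simp add: q_def)
  qed
  moreover have "q f \<noteq> {}" using q_mem_iff[OF f] I.zero_closed I.additive_subgroup_axioms
      additive_subgroup.zero_closed by blast
  ultimately show ?thesis unfolding A_fields by auto
qed

lemma ring_A: "ring A"
proof -
  interpret B: ring "P Quot I" by (rule I.quotient_is_ring)
  show ?thesis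
  proof (intro ringI abelian_groupI monoidI, unfold A_fields(1-5))
    show "\<exists>y\<in>carrier (P Quot I). y \<oplus>\<^bsub>P Quot I\<^esub> x = \<zero>\<^bsub>P Quot I\<^esub>" if "x \<in> carrier (P Quot I)" for x
      using that B.l_neg by blast
  qed (simp_all add: B.a_assoc B.m_assoc B.l_distr B.r_distr B.a_ac)
qed

lemma complex_algebra_A: "complex_algebra A"
proof -
  interpret A: ring A by (rule ring_A)
  note cl = P_smult_closed I.one_closed
  show ?thesis
  proof (unfold_locales)
    fix a c assume "a \<in> carrier A"
    then obtain f where f: "f \<in> carrier P" "a = q f" by (auto simp: carrier_A)
    show "c \<odot>\<^bsub>A\<^esub> a \<in> carrier A" using f by (auto simp: carrier_A q_smult cl)
    show "c \<odot>\<^bsub>A\<^esub> a = (c \<odot>\<^bsub>A\<^esub> \<one>\<^bsub>A\<^esub>) \<otimes>\<^bsub>A\<^esub> a" using f by (simp add: q_simps q_smult cl P_smult_one)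
    show "(c \<odot>\<^bsub>A\<^esub> \<one>\<^bsub>A\<^esub>) \<otimes>\<^bsub>A\<^esub> a = a \<otimes>\<^bsub>A\<^esub> (c \<odot>\<^bsub>A\<^esub> \<one>\<^bsub>A\<^esub>)" using f by (simp add: q_simps q_smult cl P_smult_one)
  next
    fix c c' :: complex
    show "(c + c') \<odot>\<^bsub>A\<^esub> \<one>\<^bsub>A\<^esub> = c \<odot>\<^bsub>A\<^esub> \<one>\<^bsub>A\<^esub> \<oplus>\<^bsub>A\<^esub> c' \<odot>\<^bsub>A\<^esub> \<one>\<^bsub>A\<^esub>"
      by (simp add: q_simps q_smult cl) (simp add: P_simps algebra_simps)
    show "(c * c') \<odot>\<^bsub>A\<^esub> \<one>\<^bsub>A\<^esub> = (c \<odot>\<^bsub>A\<^esub> \<one>\<^bsub>A\<^esub>) \<otimes>\<^bsub>A\<^esub> (c' \<odot>\<^bsub>A\<^esub> \<one>\<^bsub>A\<^esub>)"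
      by (simp add: q_simps q_smult cl P_smult_one) (simp add: P_simps algebra_simps)
    show "1 \<odot>\<^bsub>A\<^esub> \<one>\<^bsub>A\<^esub> = \<one>\<^bsub>A\<^esub>" by (simp add: q_simps q_smult cl) (simp add: P_simps)
  qed
qed

text \<open>The scalar by which a class acts in \<open>simple_module v\<close>, in the same form, so
  that the two descriptions of the simple modules agree by unfolding.\<close>

definition ch :: "'v \<Rightarrow> ('v, 'e) bq_elt \<Rightarrow> complex" where "ch v X = (THE c. \<forall>f\<in>X. f (v, []) = c)"

text \<open>Representatives of a class differ by an element of \<open>I\<close>, which lies in the
  arrow ideal and has no coefficient at trivial paths; so the description determines one
  number.\<close>

lemma ch_q: "f \<in> carrier P \<Longrightarrow> ch v (q f) = f (v, [])"
proof -
  assume f: "f \<in> carrier P"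
  have all: "\<forall>g\<in>q f. g (v, []) = f (v, [])"
    using subsetD[OF I_subset_Z] by (auto simp: q_mem_iff[OF f] P_simps(2) Z_def)
  have fq: "f \<in> q f"
    using q_mem_iff[OF f] additive_subgroup.zero_closed[OF I.additive_subgroup_axioms] f by force
  show ?thesis unfolding ch_def
  proof (rule the_equality)
    show "\<forall>g\<in>q f. g (v, []) = f (v, [])" by (rule all)
    fix c assume "\<forall>g\<in>q f. g (v, []) = c"
    from bspec[OF this fq] show "c = f (v, [])" by simp
  qed
qed

definition radJ where "radJ = {a \<in> carrier A. \<forall>v\<in>verts Q. ch v a = 0}"

text \<open>\<open>radJ\<close> tests vertices, \<open>Z\<close> all elements of the type; at a
  non-vertex the pair with the empty list is not a path, and the coefficient is zero anyway.\<close>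

lemma radJ_eq: "radJ = q ` Z"
proof
  show "radJ \<subseteq> q ` Z"
  proof
    fix a assume a: "a \<in> radJ"
    then obtain f where f: "f \<in> carrier P" "a = q f" by (auto simp: radJ_def carrier_A)
    have "f (v, []) = 0" for v
    proof (cases "v \<in> verts Q")
      case True then show ?thesis using a f ch_q[OF f(1)] by (simp add: radJ_def)
    next
      case False then show ?thesis using f(1) trivial_path(2)[of v] by (auto simp: P_simps)
    qed
    then show "a \<in> q ` Z" using f by (auto simp: Z_def)
  qed
  show "q ` Z \<subseteq> radJ" by (auto simp: radJ_def Z_def carrier_A ch_q)
qed

text \<open>Multiplication by the radical raises the power of the arrow ideal by one, and the m-th
  power is contained in \<open>I\<close>. Hence classes from the n-th power lie in the k-th socle
  when n + k = m; the case n = 0 covers the identity.\<close>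

lemma nilpotent_radJ: "\<exists>m. \<one>\<^bsub>A\<^esub> \<in> socle radJ (regular_module A) m"
proof -
  obtain m where m: "arrow_ideal_power Q m \<subseteq> I" using admissible by (auto simp: admissible_ideal_def)
  have "q f \<in> socle radJ (regular_module A) k" if "f \<in> arrow_ideal_power Q n" "n + k = m" for k n f
    using that
  proof (induction k arbitrary: n f)
    case 0
    then have "f \<in> I" using m by auto
    then have "q f = I" unfolding q_def by (rule I.a_rcos_zero[OF I.ideal_axioms])
    then show ?case by (simp add: regular_module_def q_simps)
  next
    case (Suc k)
    have fP: "f \<in> carrier P" using Suc.prems(1) power_carrier by blast
    have "j \<otimes>\<^bsub>A\<^esub> q f \<in> socle radJ (regular_module A) k" if j: "j \<in> radJ" for j
    proof -
      obtain g where g: "g \<in> Z" "j = q g" using j by (auto simp: radJ_eq)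
      have "g \<otimes>\<^bsub>P\<^esub> f \<in> arrow_ideal_power Q (Suc n)" using power_mult[OF Suc.prems(1)] g(1)
          by (simp add: arrow_ideal_eq)
      then have "q (g \<otimes>\<^bsub>P\<^esub> f) \<in> socle radJ (regular_module A) k" by (rule Suc.IH) (use Suc.prems(2) in simp)
      then show ?thesis using g fP by (simp add: q_simps Z_def)
    qed
    then show ?case using fP by (simp add: regular_module_def carrier_A)
  qed
  from this[of "\<one>\<^bsub>P\<^esub>" 0 m] show ?thesis by (auto simp: q_simps)
qed

lemma split_algebra_ex: "\<exists>m. split_algebra A (verts Q) (vertex_idem Q I) ch radJ m"
proof -
  interpret C: complex_algebra A by (rule complex_algebra_A)
  obtain m where m: "\<one>\<^bsub>A\<^esub> \<in> socle radJ (regular_module A) m" using nilpotent_radJ by blast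
  have vi: "vertex_idem Q I v = q (path_elt (v, []))" for v by (simp add: vertex_idem_def q_def)
  have pe: "path_elt (v, []) \<in> carrier P" if "v \<in> verts Q" for v
      using path_elt_closed trivial_path(1)[OF that] by blast
  have "split_algebra A (verts Q) (vertex_idem Q I) ch radJ m"
  proof (unfold_locales)
    show "finite (verts Q)" by simp
    show "vertex_idem Q I v \<in> carrier A" if "v \<in> verts Q" for v using pe[OF that] by (auto simp: vi carrier_A)
    fix v assume v: "v \<in> verts Q"
    show "ch v (c \<odot>\<^bsub>A\<^esub> \<one>\<^bsub>A\<^esub>) = c" for c
      using v by (simp add: q_simps q_smult ch_q P_smult_closed) (simp add: P_simps)
    show "ch v (vertex_idem Q I w) = (if v = w then 1 else 0)" if "w \<in> verts Q" for w
      using pe[OF that] by (simp add: vi ch_q path_elt_def)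
    fix a b assume "a \<in> carrier A" "b \<in> carrier A"
    then obtain f g where fg: "f \<in> carrier P" "g \<in> carrier P" "a = q f" "b = q g" by (auto simp: carrier_A)
    show "ch v (a \<oplus>\<^bsub>A\<^esub> b) = ch v a + ch v b" using fg by (simp add: q_simps ch_q) (simp add: P_simps(2))
    show "ch v (a \<otimes>\<^bsub>A\<^esub> b) = ch v a * ch v b" using fg by (simp add: q_simps ch_q P_mult_trivial)
  qed (use m in \<open>simp_all add: radJ_def\<close>)
  then show ?thesis by blast
qed

text \<open>The two facts from which \<open>Emb_zero_iff\<close> derives that
  \<open>\<sigma> M\<close> preserves zero, checked componentwise on the summands.\<close>

lemma Pi_N_zero:
  "\<zero>\<^bsub>Pi_N Q I\<^esub> \<in> carrier (Pi_N Q I)" "\<zero>\<^bsub>A\<^esub> \<odot>\<^bsub>Pi_N Q I\<^esub> \<zero>\<^bsub>Pi_N Q I\<^esub> = \<zero>\<^bsub>Pi_N Q I\<^esub>"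
proof -
  interpret C: complex_algebra A by (rule complex_algebra_A)
  have e: "vertex_idem Q I v \<in> carrier A" if "v \<in> verts Q" for v
    using path_elt_closed[OF trivial_path(1)[OF that]]
        by (auto simp: vertex_idem_def q_def[symmetric] carrier_A)
  have P0: "\<zero>\<^bsub>indec_projective Q I v\<^esub> \<in> carrier (indec_projective Q I v)" if "v \<in> verts Q" for v
    using e[OF that] by (auto simp: indec_projective_def Let_def intro!: exI[of _ "\<zero>\<^bsub>A\<^esub>"])
  have Ps: "\<zero>\<^bsub>A\<^esub> \<odot>\<^bsub>indec_projective Q I v\<^esub> \<zero>\<^bsub>indec_projective Q I v\<^esub> = \<zero>\<^bsub>indec_projective Q I v\<^esub>" for v
    by (simp add: indec_projective_def Let_def)
  have I0: "\<zero>\<^bsub>indec_injective Q I v\<^esub> \<in> carrier (indec_injective Q I v)" if v: "v \<in> verts Q" for v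
  proof -
    let ?eA = "{vertex_idem Q I v \<otimes>\<^bsub>A\<^esub> x | x. x \<in> carrier A}"
    have a: "x \<oplus>\<^bsub>A\<^esub> y \<in> ?eA" if "x \<in> ?eA" "y \<in> ?eA" for x y
    proof -
      obtain x' y' where "x = vertex_idem Q I v \<otimes>\<^bsub>A\<^esub> x'" "y =
          vertex_idem Q I v \<otimes>\<^bsub>A\<^esub> y'" "x' \<in> carrier A" "y' \<in> carrier A"
        using \<open>x \<in> ?eA\<close> \<open>y \<in> ?eA\<close> by auto
      then have "x \<oplus>\<^bsub>A\<^esub> y = vertex_idem Q I v \<otimes>\<^bsub>A\<^esub> (x' \<oplus>\<^bsub>A\<^esub> y')" "x' \<oplus>\<^bsub>A\<^esub> y' \<in> carrier A"
        using e[OF v] by (simp_all add: C.r_distr)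
      then show ?thesis by blast
    qed
    have s: "c \<odot>\<^bsub>A\<^esub> x \<in> ?eA" if "x \<in> ?eA" for c x
    proof -
      obtain x' where x': "x = vertex_idem Q I v \<otimes>\<^bsub>A\<^esub> x'" "x' \<in> carrier A" using \<open>x \<in> ?eA\<close> by auto
      have "c \<odot>\<^bsub>A\<^esub> x = C.sc c \<otimes>\<^bsub>A\<^esub> (vertex_idem Q I v \<otimes>\<^bsub>A\<^esub> x')"
        using C.csmult_eq[of x c] x' e[OF v] by (simp add: C.sc_def)
      also have "\<dots> = vertex_idem Q I v \<otimes>\<^bsub>A\<^esub> (C.sc c \<otimes>\<^bsub>A\<^esub> x')"
        using x'(2) e[OF v] C.sc_comm[OF e[OF v], of c] by (simp add: C.m_assoc[symmetric])
      finally show ?thesis using x'(2) by auto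
    qed
    show ?thesis unfolding indec_injective_def Let_def using a s by simp
  qed
  have Is: "\<zero>\<^bsub>A\<^esub> \<odot>\<^bsub>indec_injective Q I v\<^esub> \<zero>\<^bsub>indec_injective Q I v\<^esub> = \<zero>\<^bsub>indec_injective Q I v\<^esub>"
      if v: "v \<in> verts Q" for v
  proof -
    let ?eA = "{vertex_idem Q I v \<otimes>\<^bsub>A\<^esub> x | x. x \<in> carrier A}"
    have "x \<otimes>\<^bsub>A\<^esub> \<zero>\<^bsub>A\<^esub> \<in> ?eA" if "x \<in> ?eA" for x
    proof -
      have "x \<otimes>\<^bsub>A\<^esub> \<zero>\<^bsub>A\<^esub> = vertex_idem Q I v \<otimes>\<^bsub>A\<^esub> \<zero>\<^bsub>A\<^esub>" using that e[OF v] by auto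
      then show ?thesis by blast
    qed
    then have "(\<lambda>x\<in>?eA. (\<lambda>x\<in>?eA. 0 :: complex) (x \<otimes>\<^bsub>A\<^esub> \<zero>\<^bsub>A\<^esub>)) = (\<lambda>x\<in>?eA. 0)"
      by (intro restrict_ext) (simp only: restrict_apply if_True)
    then show ?thesis
      unfolding indec_injective_def Let_def by (simp only: module.simps ring.simps monoid.simps
          partial_object.simps)
  qed
  show "\<zero>\<^bsub>Pi_N Q I\<^esub> \<in> carrier (Pi_N Q I)"
    using P0 I0 by (auto simp: Pi_N_def Pi_module_def lmod_dsum_def lmod_prod_def)
  have "\<zero>\<^bsub>A\<^esub> \<odot>\<^bsub>Pi_module Q I\<^esub> \<zero>\<^bsub>Pi_module Q I\<^esub> = \<zero>\<^bsub>Pi_module Q I\<^esub>"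
    unfolding Pi_module_def lmod_dsum_def module.simps ring.simps
    by (rule restrict_ext) (simp add: lmod_prod_def Ps Is)
  then show "\<zero>\<^bsub>A\<^esub> \<odot>\<^bsub>Pi_N Q I\<^esub> \<zero>\<^bsub>Pi_N Q I\<^esub> = \<zero>\<^bsub>Pi_N Q I\<^esub>"
    unfolding Pi_N_def lmod_dsum_def module.simps ring.simps
    by (intro restrict_ext) (simp only: restrict_apply UNIV_I if_True)
qed

end

section \<open>The simple modules and the top\<close>

text \<open>The literal quotient by cosets, which underlies \<open>top_module\<close>. Its scalar
  multiplication is a union over representatives that collapses to a single coset.\<close>

lemma lmod_quot:
  assumes M: "left_module R M" and U: "submodule U R M"
  shows "left_module R (lmod_quot M U)"
    and "(\<lambda>x. U +>\<^bsub>M\<^esub> x) \<in> lmod_hom R M (lmod_quot M U)"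
    and "(\<lambda>x. U +>\<^bsub>M\<^esub> x) ` carrier M = carrier (lmod_quot M U)"
    and "\<And>x. x \<in> carrier M \<Longrightarrow> U +>\<^bsub>M\<^esub> x = \<zero>\<^bsub>lmod_quot M U\<^esub> \<longleftrightarrow> x \<in> U"
proof -
  interpret M: left_module R M by fact
  note UD = M.submoduleD[OF U]
  interpret U: additive_subgroup U M
    using submodule.axioms(1)[OF U] by (rule additive_subgroup.intro)
  interpret U: abelian_subgroup U M
    by (rule abelian_subgroupI3[OF U.additive_subgroup_axioms M.M.abelian_group_axioms])
  let ?q = "\<lambda>x. U +>\<^bsub>M\<^esub> x" and ?N = "lmod_quot M U"
  show c: "?q ` carrier M = carrier ?N" by (auto simp: lmod_quot_def A_RCOSETS_def')
  have add: "?q x \<oplus>\<^bsub>?N\<^esub> ?q y = ?q (x \<oplus>\<^bsub>M\<^esub> y)" if "x \<in> carrier M" "y \<in> carrier M" for x y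
    using U.a_rcos_sum[OF that] by (simp add: lmod_quot_def)
  have mem: "z \<in> ?q x \<longleftrightarrow> (\<exists>u\<in>U. z = u \<oplus>\<^bsub>M\<^esub> x)" for z x by (auto simp: a_r_coset_def')
  have self: "x \<in> ?q x" if "x \<in> carrier M" for x unfolding mem using that UD(2) by force
  have smult: "a \<odot>\<^bsub>?N\<^esub> ?q x = ?q (a \<odot>\<^bsub>M\<^esub> x)" if a: "a \<in> carrier R" and x: "x \<in> carrier M" for a x
  proof -
    have "?q (a \<odot>\<^bsub>M\<^esub> z) = ?q (a \<odot>\<^bsub>M\<^esub> x)" if z: "z \<in> ?q x" for z
    proof -
      obtain u where u: "u \<in> U" "z = u \<oplus>\<^bsub>M\<^esub> x" using z unfolding mem by blast
      have "a \<odot>\<^bsub>M\<^esub> z = a \<odot>\<^bsub>M\<^esub> u \<oplus>\<^bsub>M\<^esub> a \<odot>\<^bsub>M\<^esub> x" unfolding u(2) by (rule M.smult_r_distr[OF a UD(7)[OF u(1)] x])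
      then have "a \<odot>\<^bsub>M\<^esub> z \<in> ?q (a \<odot>\<^bsub>M\<^esub> x)" unfolding mem using UD(4)[OF a u(1)] by blast
      then show ?thesis by (rule U.a_repr_independence'[symmetric, OF _ M.smult_closed[OF a x]])
    qed
    then show ?thesis unfolding lmod_quot_def module.simps using self[OF x] by blast
  qed
  have zero: "\<zero>\<^bsub>?N\<^esub> = ?q \<zero>\<^bsub>M\<^esub>" using U.a_rcos_const[OF UD(2)] by (simp add: lmod_quot_def)
  have "\<forall>X\<in>carrier ?N. \<exists>x\<in>carrier M. X = ?q x" unfolding c[symmetric] by blast
  then have rep: thesis if "X \<in> carrier ?N" "\<And>x. x \<in> carrier M \<Longrightarrow> X = ?q x \<Longrightarrow> thesis" for X thesis
      using that by blast
  have qc: "?q x \<in> carrier ?N" if "x \<in> carrier M" for x using that c by blast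
  show "left_module R ?N"
  proof (rule left_moduleI)
    show "ring R" by (rule M.R.ring_axioms)
    show "\<zero>\<^bsub>?N\<^esub> \<in> carrier ?N" unfolding zero by (rule qc) simp
  next
    fix X Y assume "X \<in> carrier ?N" "Y \<in> carrier ?N"
    then obtain x y where xy: "x \<in> carrier M" "y \<in> carrier M" "X = ?q x" "Y = ?q y" using rep by metis
    show "X \<oplus>\<^bsub>?N\<^esub> Y \<in> carrier ?N" using xy by (simp add: add qc)
    show "X \<oplus>\<^bsub>?N\<^esub> Y = Y \<oplus>\<^bsub>?N\<^esub> X" using xy by (simp add: add M.M.a_comm)
    show "\<zero>\<^bsub>?N\<^esub> \<oplus>\<^bsub>?N\<^esub> X = X" "\<one>\<^bsub>R\<^esub> \<odot>\<^bsub>?N\<^esub> X = X" "\<zero>\<^bsub>R\<^esub> \<odot>\<^bsub>?N\<^esub> X = \<zero>\<^bsub>?N\<^esub>"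
      using xy(1) by (simp_all add: zero xy(3) add smult M.smult_one M.smult_zero_l)
    fix a assume a: "a \<in> carrier R"
    show "a \<odot>\<^bsub>?N\<^esub> X \<in> carrier ?N" using xy a by (simp add: smult qc M.smult_closed)
    show "a \<odot>\<^bsub>?N\<^esub> (X \<oplus>\<^bsub>?N\<^esub> Y) = a \<odot>\<^bsub>?N\<^esub> X \<oplus>\<^bsub>?N\<^esub> a \<odot>\<^bsub>?N\<^esub> Y"
      using xy a by (simp add: smult add M.smult_closed M.smult_r_distr)
    fix b assume b: "b \<in> carrier R"
    show "(a \<oplus>\<^bsub>R\<^esub> b) \<odot>\<^bsub>?N\<^esub> X = a \<odot>\<^bsub>?N\<^esub> X \<oplus>\<^bsub>?N\<^esub> b \<odot>\<^bsub>?N\<^esub> X"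
      "(a \<otimes>\<^bsub>R\<^esub> b) \<odot>\<^bsub>?N\<^esub> X = a \<odot>\<^bsub>?N\<^esub> (b \<odot>\<^bsub>?N\<^esub> X)"
      using xy a b by (simp_all add: smult add M.smult_closed M.smult_l_distr M.smult_assoc)
  next
    fix X Y Z assume "X \<in> carrier ?N" "Y \<in> carrier ?N" "Z \<in> carrier ?N"
    then obtain x y z where "x \<in> carrier M" "y \<in> carrier M" "z \<in> carrier M" "X = ?q x" "Y = ?q y" "Z = ?q z"
      using rep by metis
    then show "(X \<oplus>\<^bsub>?N\<^esub> Y) \<oplus>\<^bsub>?N\<^esub> Z = X \<oplus>\<^bsub>?N\<^esub> (Y \<oplus>\<^bsub>?N\<^esub> Z)" by (simp add: add M.M.a_assoc)
  qed
  show "?q \<in> lmod_hom R M ?N" by (rule lmod_homI) (simp_all add: qc add smult)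
  show "?q x = \<zero>\<^bsub>?N\<^esub> \<longleftrightarrow> x \<in> U" if x: "x \<in> carrier M" for x
    using self[OF x] U.a_rcos_const[of x] by (auto simp: lmod_quot_def)
qed

context split_algebra
begin

definition simple :: "'v \<Rightarrow> ('a, complex) module" where
  "simple v = \<lparr>carrier = UNIV, mult = undefined, one = undefined, zero = 0, add = (+),
     smult = (\<lambda>a z. ch v a * z)\<rparr>"

lemma simple_simps [simp]:
  "carrier (simple v) = UNIV" "\<zero>\<^bsub>simple v\<^esub> = 0" "z \<oplus>\<^bsub>simple v\<^esub> w = z + w" "a \<odot>\<^bsub>simple v\<^esub> z = ch v a * z"
  by (simp_all add: simple_def)

lemma left_module_simple: "v \<in> V \<Longrightarrow> left_module A (simple v)"
  by (rule left_moduleI) (simp_all add: ring_axioms ch_add ch_mult algebra_simps)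

lemma J_simple: "v \<in> V \<Longrightarrow> j \<in> J \<Longrightarrow> j \<odot>\<^bsub>simple v\<^esub> z = \<zero>\<^bsub>simple v\<^esub>"
  by (simp add: J_def)

text \<open>By \<open>e_action_module\<close>, \<open>a\<close> acts on a vector fixed by
  \<open>e v\<close> and killed by \<open>J\<close> as the scalar \<open>ch v a\<close>, which is
  its action on the simple module at \<open>v\<close>.\<close>

lemma hom_from_simple:
  assumes M: "left_module A M" and v: "v \<in> V" and y: "y \<in> carrier M"
    and Jy: "\<And>j. j \<in> J \<Longrightarrow> j \<odot>\<^bsub>M\<^esub> y = \<zero>\<^bsub>M\<^esub>" and ey: "e v \<odot>\<^bsub>M\<^esub> y = y"
  shows "(\<lambda>z. sc z \<odot>\<^bsub>M\<^esub> y) \<in> lmod_hom A (simple v) M"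
proof -
  interpret M: left_module A M by fact
  have act: "a \<odot>\<^bsub>M\<^esub> y = sc (ch v a) \<odot>\<^bsub>M\<^esub> y" if a: "a \<in> carrier A" for a
  proof -
    obtain j where "j \<in> J" "a \<odot>\<^bsub>M\<^esub> (e v \<odot>\<^bsub>M\<^esub> y) = sc (ch v a) \<odot>\<^bsub>M\<^esub> (e v \<odot>\<^bsub>M\<^esub> y) \<oplus>\<^bsub>M\<^esub> j \<odot>\<^bsub>M\<^esub> y"
      using e_action_module[OF M v a y] by blast
    then show ?thesis using Jy y by (simp add: ey M.smult_closed)
  qed
  show ?thesis
  proof (rule lmod_homI)
    show "sc (z \<oplus>\<^bsub>simple v\<^esub> w) \<odot>\<^bsub>M\<^esub> y = sc z \<odot>\<^bsub>M\<^esub> y \<oplus>\<^bsub>M\<^esub> sc w \<odot>\<^bsub>M\<^esub> y" for z w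
      using y by (simp add: sc_add M.smult_l_distr)
    show "sc (a \<odot>\<^bsub>simple v\<^esub> z) \<odot>\<^bsub>M\<^esub> y = a \<odot>\<^bsub>M\<^esub> (sc z \<odot>\<^bsub>M\<^esub> y)" if a: "a \<in> carrier A" for a z
    proof -
      have "sc (ch v a * z) \<odot>\<^bsub>M\<^esub> y = sc z \<odot>\<^bsub>M\<^esub> (sc (ch v a) \<odot>\<^bsub>M\<^esub> y)"
        using y by (simp add: sc_mult mult.commute[of "ch v a"] M.smult_assoc)
      also have "\<dots> = a \<odot>\<^bsub>M\<^esub> (sc z \<odot>\<^bsub>M\<^esub> y)" unfolding act[OF a, symmetric]
          by (rule smult_sc_comm[OF M a y, symmetric])
      finally show ?thesis by simp
    qed
  qed (use y in \<open>simp add: M.smult_closed\<close>)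
qed

lemma sc_smult_zero_iff:
  assumes M: "left_module A M" and y: "y \<in> carrier M" "y \<noteq> \<zero>\<^bsub>M\<^esub>"
  shows "sc z \<odot>\<^bsub>M\<^esub> y = \<zero>\<^bsub>M\<^esub> \<longleftrightarrow> z = 0"
proof -
  interpret M: left_module A M by fact
  have "y = \<zero>\<^bsub>M\<^esub>" if "z \<noteq> 0" and zy: "sc z \<odot>\<^bsub>M\<^esub> y = \<zero>\<^bsub>M\<^esub>"
  proof -
    have "y = sc (inverse z * z) \<odot>\<^bsub>M\<^esub> y" using y that(1) by (simp add: M.smult_one)
    also have "\<dots> = sc (inverse z) \<odot>\<^bsub>M\<^esub> (sc z \<odot>\<^bsub>M\<^esub> y)" using y by (simp add: sc_mult M.smult_assoc)
    also have "\<dots> = \<zero>\<^bsub>M\<^esub>" by (simp add: zy M.smult_zero_r)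
    finally show ?thesis .
  qed
  then show ?thesis using y by (auto simp: M.smult_zero_l)
qed

lemma e_idem_action:
  assumes M: "left_module A M" and v: "v \<in> V" and x: "x \<in> carrier M"
    and Jx: "\<And>j. j \<in> J \<Longrightarrow> j \<odot>\<^bsub>M\<^esub> x = \<zero>\<^bsub>M\<^esub>"
  shows "e v \<odot>\<^bsub>M\<^esub> (e v \<odot>\<^bsub>M\<^esub> x) = e v \<odot>\<^bsub>M\<^esub> x" "\<And>j. j \<in> J \<Longrightarrow> j \<odot>\<^bsub>M\<^esub> (e v \<odot>\<^bsub>M\<^esub> x) = \<zero>\<^bsub>M\<^esub>"
proof -
  interpret M: left_module A M by fact
  obtain j where "j \<in> J" "e v \<odot>\<^bsub>M\<^esub> (e v \<odot>\<^bsub>M\<^esub> x) = sc (ch v (e v)) \<odot>\<^bsub>M\<^esub> (e v \<odot>\<^bsub>M\<^esub> x) \<oplus>\<^bsub>M\<^esub> j \<odot>\<^bsub>M\<^esub> x"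
    using e_action_module[OF M v e_closed[OF v] x] by blast
  then show "e v \<odot>\<^bsub>M\<^esub> (e v \<odot>\<^bsub>M\<^esub> x) = e v \<odot>\<^bsub>M\<^esub> x"
    using Jx x v e_closed[OF v] by (simp add: ch_e M.smult_closed M.smult_one)
  show "j \<odot>\<^bsub>M\<^esub> (e v \<odot>\<^bsub>M\<^esub> x) = \<zero>\<^bsub>M\<^esub>" if "j \<in> J" for j
    using Jx[OF J_mult(1)[OF that e_closed[OF v]]] J_closed[OF that] e_closed[OF v] x
        by (simp add: M.smult_assoc)
qed

text \<open>Some \<open>e v\<close> does not kill \<open>x\<close>, since \<open>\<one>\<close> is
  congruent to the sum of the \<open>e v\<close>. The line spanned by the image is a copy of
  \<open>simple v\<close> and, as \<open>J\<close> kills \<open>X\<close>, a direct summand; the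
  projection onto it is the required map.\<close>

lemma simple_separates:
  assumes X: "left_module A X" and JX: "\<And>j y. j \<in> J \<Longrightarrow> y \<in> carrier X \<Longrightarrow> j \<odot>\<^bsub>X\<^esub> y = \<zero>\<^bsub>X\<^esub>"
    and x: "x \<in> carrier X" "x \<noteq> \<zero>\<^bsub>X\<^esub>"
  shows "\<exists>v\<in>V. \<exists>f\<in>lmod_hom A X (simple v). f x \<noteq> \<zero>\<^bsub>simple v\<^esub>"
proof -
  interpret X: left_module A X by fact
  have "\<exists>v\<in>V. e v \<odot>\<^bsub>X\<^esub> x \<noteq> \<zero>\<^bsub>X\<^esub>"
  proof (rule ccontr)
    assume "\<not> (\<exists>v\<in>V. e v \<odot>\<^bsub>X\<^esub> x \<noteq> \<zero>\<^bsub>X\<^esub>)"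
    then have "x \<in> {\<zero>\<^bsub>X\<^esub>}" using JX x(1) by (intro e_sum_action[OF X X.submodule_zero x(1)]) auto
    then show False using x(2) by simp
  qed
  then obtain v where v: "v \<in> V" and y0: "e v \<odot>\<^bsub>X\<^esub> x \<noteq> \<zero>\<^bsub>X\<^esub>" by blast
  let ?y = "e v \<odot>\<^bsub>X\<^esub> x" and ?S = "simple v"
  have y: "?y \<in> carrier X" by (rule X.smult_closed[OF e_closed[OF v] x(1)])
  note idem = e_idem_action[OF X v x(1) JX[OF _ x(1)]]
  have S: "left_module A ?S" by (rule left_module_simple[OF v])
  let ?i = "\<lambda>z. sc z \<odot>\<^bsub>X\<^esub> ?y"
  have i: "?i \<in> lmod_hom A ?S X" by (rule hom_from_simple[OF X v y idem(2) idem(1)])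
  let ?U = "?i ` carrier ?S"
  have U: "submodule ?U A X"
    by (rule submodule_image[OF S X i]) (rule left_module.submodule_carrier[OF S])
  have "inj_on ?i (carrier ?S)"
    using lmod_hom_inj_iff[OF S X i] sc_smult_zero_iff[OF X y y0] by simp
  then have "?i \<in> lmod_iso A ?S (X\<lparr>carrier := ?U\<rparr>)"
    using lmod_hom_codomain[OF i subset_refl] by (simp add: lmod_iso_def inj_on_imp_bij_betw)
  from lmod_iso_inv[OF S X.submodule_left_module[OF U] this]
  have inv: "inv_into (carrier ?S) ?i \<in> lmod_hom A (X\<lparr>carrier := ?U\<rparr>) ?S" by (simp add: lmod_iso_def)
  have JX': "j \<odot>\<^bsub>X\<^esub> y \<in> {\<zero>\<^bsub>X\<^esub>}" if "j \<in> J" "y \<in> carrier X" for j y using JX[OF that] by simp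
  obtain W where W: "submodule W A X" "{\<zero>\<^bsub>X\<^esub>} \<subseteq> W"
    "\<forall>x\<in>carrier X. \<exists>w\<in>W. \<exists>u\<in>?U. x = w \<oplus>\<^bsub>X\<^esub> u" "W \<inter> ?U \<subseteq> {\<zero>\<^bsub>X\<^esub>}"
    by (rule complement_ex[OF X U X.submodule_zero JX'])
  have inv0: "inv_into (carrier ?S) ?i u = \<zero>\<^bsub>?S\<^esub>" if u: "u \<in> W" "u \<in> ?U" for u
  proof -
    have "u = \<zero>\<^bsub>X\<^esub>" using W(4) u by blast
    then show ?thesis using lmod_hom_zero[OF X.submodule_left_module[OF U] S inv] by simp
  qed
  obtain h where h: "h \<in> lmod_hom A X ?S" "\<And>u. u \<in> ?U \<Longrightarrow> h u = inv_into (carrier ?S) ?i u"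
  proof (rule lmod_hom_extend[OF X S U W(1) bspec[OF W(3)] inv inv0])
    fix h
    assume h: "h \<in> lmod_hom A X ?S" "\<And>u. u \<in> ?U \<Longrightarrow> h u = inv_into (carrier ?S) ?i u"
    show thesis by (rule that[OF h])
  qed
  have yU: "?y \<in> ?U" using y by (intro image_eqI[of _ _ 1]) (simp_all add: X.smult_one)
  have "?i (h ?y) = ?y" unfolding h(2)[OF yU] by (rule f_inv_into_f[OF yU])
  then have "h ?y \<noteq> 0" using y0 y by (auto simp: X.smult_zero_l)
  \<comment> \<open>\<open>e v\<close> acts as 1 on \<open>simple v\<close>, so the map is nonzero
    at \<open>x\<close> and not only at \<open>?y\<close>.\<close>
  moreover have "h ?y = h x" using lmod_homD(3)[OF h(1) e_closed[OF v] x(1)] v by (simp add: ch_e)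
  ultimately show ?thesis using v h(1) by auto
qed

text \<open>The kernel of each character is a maximal left ideal, having codimension one.
  Conversely, if a maximal left ideal \<open>N\<close> missed some \<open>j\<close> in
  \<open>J\<close>, then N + J would be everything and 1 = n + i with \<open>i\<close> nilpotent,
  which forces \<open>\<one>\<close> into \<open>N\<close>.\<close>

lemma jacobson_radical_eq: "jacobson_radical A = J"
proof
  let ?R = "regular_module A"
  interpret R: left_module A ?R by (rule left_module_regular)
  have Rs: "carrier ?R = carrier A" "a \<odot>\<^bsub>?R\<^esub> b = a \<otimes> b" "a \<oplus>\<^bsub>?R\<^esub> b = a \<oplus> b" "\<zero>\<^bsub>?R\<^esub> = \<zero>" for a b
    by (simp_all add: regular_module_def)
  have "x \<in> {a \<in> carrier A. ch v a = 0}" if x: "x \<in> jacobson_radical A" and v: "v \<in> V" for x v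
  proof -
    let ?M = "{a \<in> carrier A. ch v a = 0}"
    have sub: "submodule ?M A ?R"
      by (rule R.submoduleI') (use v in \<open>auto simp: Rs ch_add ch_mult\<close>)
    have "\<one> \<notin> ?M" using v by simp
    then have ne: "?M \<noteq> carrier A" using one_closed by metis
    have "K = carrier A" if K: "submodule K A ?R" and MK: "?M \<subseteq> K" and "K \<noteq> ?M" for K
    proof -
      note KD = R.submoduleD[OF K, unfolded Rs]
      obtain k where k: "k \<in> K" "ch v k \<noteq> 0" using MK \<open>K \<noteq> ?M\<close> KD(1) by auto
      have kA: "k \<in> carrier A" using k KD(1) by blast
      have "a \<in> K" if a: "a \<in> carrier A" for a
      proof -
        \<comment> \<open>A multiple of \<open>k\<close> with the same character value as
          \<open>a\<close>; the difference then lies in the kernel.\<close>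
        let ?b = "sc (ch v a / ch v k) \<otimes> k"
        have b: "?b \<in> K" by (rule KD(4)[OF sc_closed k(1)])
        have bA: "?b \<in> carrier A" using kA by simp
        have "ch v (a \<ominus> ?b) = ch v a - ch v ?b" by (rule ch_minus[OF v a bA])
        also have "ch v ?b = ch v a" using k(2) kA v by (simp add: ch_mult)
        finally have "a \<ominus> ?b \<in> K" using MK a bA by auto
        then have "(a \<ominus> ?b) \<oplus> ?b \<in> K" by (rule KD(3)[OF _ b])
        then show ?thesis using a bA by (simp add: a_minus_def a_assoc l_neg)
      qed
      then show ?thesis using KD(1) by blast
    qed
    then have "maximal_left_ideal ?M A" using sub ne unfolding maximal_left_ideal_def by blast
    then show ?thesis using x unfolding jacobson_radical_def by blast
  qed
  then show "jacobson_radical A \<subseteq> J" by (auto simp: J_def jacobson_radical_def)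
  show "J \<subseteq> jacobson_radical A"
  proof
    fix j assume j: "j \<in> J"
    have "j \<in> N" if N: "maximal_left_ideal N A" for N
    proof (rule ccontr)
      assume jN: "j \<notin> N"
      have subN: "submodule N A ?R" and neN: "N \<noteq> carrier A"
        and maxN: "\<And>K. submodule K A ?R \<Longrightarrow> N \<subseteq> K \<Longrightarrow> K = N \<or> K = carrier A"
        using N unfolding maximal_left_ideal_def by blast+
      note ND = R.submoduleD[OF subN, unfolded Rs]
      have NA: "n \<in> carrier A" if "n \<in> N" for n using that ND(1) by blast
      let ?K = "{n \<oplus> i | n i. n \<in> N \<and> i \<in> J}"
      have Jadd: "i \<oplus> i' \<in> J" if "i \<in> J" "i' \<in> J" for i i' using that by (auto simp: J_def ch_add)
      have J0: "\<zero> \<in> J" by (auto simp: J_def)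
      have "submodule ?K A ?R"
      proof (rule R.submoduleI')
        show "?K \<subseteq> carrier ?R" using NA J_closed by (auto simp: Rs)
        have "\<zero> = \<zero> \<oplus> \<zero>" by simp
        then show "\<zero>\<^bsub>?R\<^esub> \<in> ?K" unfolding Rs using ND(2) J0 by blast
        show "x \<oplus>\<^bsub>?R\<^esub> y \<in> ?K" if xy: "x \<in> ?K" "y \<in> ?K" for x y
        proof -
          obtain n i n' i' where *: "n \<in> N" "i \<in> J" "n' \<in> N" "i' \<in> J" "x = n \<oplus> i" "y = n' \<oplus> i'" using xy
              by blast
          have "x \<oplus> y = (n \<oplus> n') \<oplus> (i \<oplus> i')" using * NA J_closed by (simp add: a_ac)
          then show ?thesis unfolding Rs using ND(3)[OF *(1,3)] Jadd[OF *(2,4)] by blast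
        qed
        show "a \<odot>\<^bsub>?R\<^esub> x \<in> ?K" if a: "a \<in> carrier A" and x: "x \<in> ?K" for a x
        proof -
          obtain n i where *: "n \<in> N" "i \<in> J" "x = n \<oplus> i" using x by blast
          have "a \<otimes> x = a \<otimes> n \<oplus> a \<otimes> i" using * NA J_closed a by (simp add: r_distr)
          then show ?thesis unfolding Rs using ND(4)[OF a *(1)] J_mult(2)[OF *(2) a] by blast
        qed
      qed
      moreover have "N \<subseteq> ?K"
      proof
        fix n assume n: "n \<in> N"
        then have "n = n \<oplus> \<zero>" using NA by simp
        then show "n \<in> ?K" using n J0 by blast
      qed
      moreover have "?K \<noteq> N"
      proof -
        have "j = \<zero> \<oplus> j" using J_closed[OF j] by simp
        then have "j \<in> ?K" using ND(2) j by blast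
        then show ?thesis using jN by blast
      qed
      ultimately have "?K = carrier A" using maxN by blast
      then obtain n i where ni: "n \<in> N" "i \<in> J" "\<one> = n \<oplus> i" using one_closed by blast
      have iA: "i \<in> carrier A" by (rule J_closed[OF ni(2)])
      \<comment> \<open>\<open>x\<close> runs through the powers of \<open>i\<close>, starting from
        \<open>\<one>\<close> with \<open>n'\<close> zero: multiplying 1 = n + i by \<open>x\<close>
        and substituting replaces \<open>x\<close> by i x, one socle layer lower. Commutation with
        \<open>i\<close> is carried along because the substitution produces x i.\<close>
      have "\<one> \<in> N" if "x \<in> socle J ?R k" "x \<otimes> i = i \<otimes> x" "x \<in> carrier A" "\<one> = n' \<oplus> x" "n' \<in> N" for k x n'
        using that
      proof (induction k arbitrary: x n')
        case 0
        then have "\<one> = n'" using NA by (simp add: Rs)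
        then show ?case using 0(5) by simp
      next
        case (Suc k)
        have "x \<otimes> \<one> = x \<otimes> n \<oplus> x \<otimes> i" unfolding ni(3) by (rule r_distr[OF NA[OF ni(1)] iA Suc.prems(3)])
        then have "n' \<oplus> x = (n' \<oplus> x \<otimes> n) \<oplus> i \<otimes> x"
          using Suc.prems(2,3,5) NA[OF ni(1)] NA[OF Suc.prems(5)] iA by (simp add: a_assoc)
        then have one: "\<one> = (n' \<oplus> x \<otimes> n) \<oplus> i \<otimes> x" using Suc.prems(4) by simp
        show ?case
        proof (rule Suc.IH[OF _ _ _ one])
          show "i \<otimes> x \<in> socle J ?R k" using Suc.prems(1) ni(2) by (auto simp: Rs)
          show "(i \<otimes> x) \<otimes> i = i \<otimes> (i \<otimes> x)" using iA Suc.prems(2,3) by (simp add: m_assoc)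
          show "n' \<oplus> x \<otimes> n \<in> N" by (rule ND(3)[OF Suc.prems(5) ND(4)[OF Suc.prems(3) ni(1)]])
          show "i \<otimes> x \<in> carrier A" using iA Suc.prems(3) by simp
        qed
      qed
      from this[OF nilpotent, of \<zero>] have "\<one> \<in> N" using iA ND(2) by simp
      then have "a \<in> N" if "a \<in> carrier A" for a using ND(4)[OF that, of \<one>] that by simp
      then show False using neN ND(1) by blast
    qed
    then show "j \<in> jacobson_radical A" using J_closed[OF j] by (auto simp: jacobson_radical_def)
  qed
qed

text \<open>The top is generated by the class of \<open>\<one>\<close>, so an element killed by
  \<open>J\<close> determines a map out of it; the class of \<open>e v\<close> spans in it a copy of
  the simple module at \<open>v\<close>, nonzero because \<open>ch v (e v) = 1\<close>.\<close>

lemma top_module_facts: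
  shows left_module_top: "left_module A (top_module A)"
    and J_top: "j \<in> J \<Longrightarrow> t \<in> carrier (top_module A) \<Longrightarrow> j \<odot>\<^bsub>top_module A\<^esub> t = \<zero>\<^bsub>top_module A\<^esub>"
    and top_hom: "left_module A C \<Longrightarrow> c \<in> carrier C \<Longrightarrow> (\<And>j. j \<in> J \<Longrightarrow> j \<odot>\<^bsub>C\<^esub> c = \<zero>\<^bsub>C\<^esub>) \<Longrightarrow>
      \<exists>f\<in>lmod_hom A (top_module A) C. \<exists>t\<in>carrier (top_module A). f t = c"
    and simple_into_top: "v \<in> V \<Longrightarrow> \<exists>g\<in>lmod_hom A (simple v) (top_module A). \<forall>z. g z = \<zero>\<^bsub>top_module A\<^esub> \<longrightarrow> z = 0"
proof -
  let ?R = "regular_module A"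
  interpret R: left_module A ?R by (rule left_module_regular)
  have Rs: "carrier ?R = carrier A" "a \<odot>\<^bsub>?R\<^esub> b = a \<otimes> b" "a \<oplus>\<^bsub>?R\<^esub> b = a \<oplus> b" "\<zero>\<^bsub>?R\<^esub> = \<zero>" for a b
    by (simp_all add: regular_module_def)
  have J: "submodule J A ?R"
    by (rule R.submoduleI') (auto simp: Rs J_def ch_add ch_mult)
  note T = lmod_quot[OF R.left_module_axioms J, unfolded jacobson_radical_eq[symmetric], folded top_module_def,
      unfolded jacobson_radical_eq Rs(1)]
  let ?T = "top_module A" and ?p = "\<lambda>x. J +>\<^bsub>?R\<^esub> x"
  interpret T: left_module A ?T by (rule T(1))
  show "left_module A ?T" by (rule T(1))
  have p: "a \<odot>\<^bsub>?T\<^esub> ?p b = ?p (a \<otimes> b)" if "a \<in> carrier A" "b \<in> carrier A" for a b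
    using lmod_homD(3)[OF T(2) that(1), of b] that(2) by (simp add: Rs)
  have JT: "j \<odot>\<^bsub>?T\<^esub> t = \<zero>\<^bsub>?T\<^esub>" if j: "j \<in> J" and t: "t \<in> carrier ?T" for j t
  proof -
    obtain b where b: "b \<in> carrier A" "t = ?p b" using t unfolding T(3)[symmetric] by blast
    have "j \<otimes> b \<in> J" by (rule J_mult(1)[OF j b(1)])
    then show ?thesis using T(4)[of "j \<otimes> b"] p[OF J_closed[OF j] b(1)] J_closed b(2) by simp
  qed
  then show "j \<in> J \<Longrightarrow> t \<in> carrier ?T \<Longrightarrow> j \<odot>\<^bsub>?T\<^esub> t = \<zero>\<^bsub>?T\<^esub>" .
  have p1: "?p \<one> \<in> carrier ?T" using T(3) by blast
  show "\<exists>f\<in>lmod_hom A ?T C. \<exists>t\<in>carrier ?T. f t = c"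
    if C: "left_module A C" and c: "c \<in> carrier C" and Jc: "\<And>j. j \<in> J \<Longrightarrow> j \<odot>\<^bsub>C\<^esub> c = \<zero>\<^bsub>C\<^esub>"
  proof -
    interpret C: left_module A C by fact
    have T3: "?p ` carrier ?R = carrier ?T" using T(3) by (simp add: Rs)
    have ker: "x \<odot>\<^bsub>C\<^esub> c = \<zero>\<^bsub>C\<^esub>" if "x \<in> carrier ?R" "?p x = \<zero>\<^bsub>?T\<^esub>" for x
      using Jc T(4)[of x] that by (simp add: Rs)
    obtain h where h: "h \<in> lmod_hom A ?T C" "\<And>x. x \<in> carrier ?R \<Longrightarrow> h (?p x) = x \<odot>\<^bsub>C\<^esub> c"
      using lmod_hom_factor[OF R.left_module_axioms T(1) C T(2) T3 hom_from_regular[OF C c] ker] by blast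
    have "h (?p \<one>) = c" using h(2)[of \<one>] c by (simp add: Rs C.smult_one)
    then show ?thesis using h(1) p1 by blast
  qed
  show "\<exists>g\<in>lmod_hom A (simple v) ?T. \<forall>z. g z = \<zero>\<^bsub>?T\<^esub> \<longrightarrow> z = 0" if v: "v \<in> V"
  proof -
    let ?y = "e v \<odot>\<^bsub>?T\<^esub> ?p \<one>"
    have y: "?y \<in> carrier ?T" by (rule T.smult_closed[OF e_closed[OF v] p1])
    have "?y = ?p (e v)" using p[OF e_closed[OF v] one_closed] e_closed[OF v] by simp
    moreover have "e v \<notin> J" using v by (auto simp: J_def ch_e)
    ultimately have y0: "?y \<noteq> \<zero>\<^bsub>?T\<^esub>" using T(4)[OF e_closed[OF v]] by simp
    note idem = e_idem_action[OF T(1) v p1 JT[OF _ p1]]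
    show ?thesis
      by (rule bexI[OF _ hom_from_simple[OF T(1) v y idem(2) idem(1)]]) (simp add: sc_smult_zero_iff[OF
          T(1) y y0])
  qed
qed

text \<open>A separating map to a simple module is followed by an embedding of that module into the
  top.\<close>

lemma top_separates:
  assumes X: "left_module A X" and JX: "\<And>j y. j \<in> J \<Longrightarrow> y \<in> carrier X \<Longrightarrow> j \<odot>\<^bsub>X\<^esub> y = \<zero>\<^bsub>X\<^esub>"
    and x: "x \<in> carrier X" "x \<noteq> \<zero>\<^bsub>X\<^esub>"
  shows "\<exists>f\<in>lmod_hom A X (top_module A). f x \<noteq> \<zero>\<^bsub>top_module A\<^esub>"
proof -
  obtain v f where v: "v \<in> V" and f: "f \<in> lmod_hom A X (simple v)" "f x \<noteq> 0"
    using simple_separates[OF X JX x] by auto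
  obtain g where g: "g \<in> lmod_hom A (simple v) (top_module A)" "\<forall>z. g z = \<zero>\<^bsub>top_module A\<^esub> \<longrightarrow> z = 0"
    using simple_into_top[OF v] by blast
  have "g (f x) \<noteq> \<zero>\<^bsub>top_module A\<^esub>" using g(2) f(2) by auto
  then show ?thesis by (rule bexI[OF _ lmod_hom_comp[OF f(1) g(1)]])
qed

end

theorem theorem6:
  fixes Q :: "('v, 'e) pre_digraph"
    and I :: "(('v, 'e) path \<Rightarrow> complex) set"
    and A :: "(complex, ('v, 'e) bq_elt) module"
    and d :: nat and a :: "nat \<Rightarrow> ('v, 'e) bq_elt"
    and C :: "(('v, 'e) bq_elt, 'u) module \<Rightarrow> (('v, 'e) bq_elt, 'u) module"
    and \<sigma> :: "(('v, 'e) bq_elt, 'u) module \<Rightarrow> ('v, 'e) Pi_elt \<Rightarrow> 'u \<times> 'u"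
    and PS IS :: "'v \<Rightarrow> nat \<Rightarrow> (('v, 'e) bq_elt, 'u) module"
    and \<epsilon>S :: "'v \<Rightarrow> 'u \<Rightarrow> complex" and \<eta>S :: "'v \<Rightarrow> complex \<Rightarrow> 'u"
    and DS \<delta>S :: "'v \<Rightarrow> nat \<Rightarrow> 'u \<Rightarrow> 'u"
    and PT IT :: "nat \<Rightarrow> (('v, 'e) bq_elt, 'u) module"
    and \<epsilon>T :: "'u \<Rightarrow> ('v, 'e) bq_elt set" and \<eta>T :: "('v, 'e) bq_elt set \<Rightarrow> 'u"
    and DT \<delta>T :: "nat \<Rightarrow> 'u \<Rightarrow> 'u"
  assumes universe: "\<exists>j :: complex \<Rightarrow> 'u. inj j"
    and quiver: "fin_digraph Q"
    and admissible: "admissible_ideal Q I"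
    and A: "A = bound_quiver_algebra Q I"
    and basis: "is_basis A d a"
    and embedding: "embedding_system Q I C \<sigma>"
    and proj_simple: "\<And>v. v \<in> verts Q \<Longrightarrow>
      minimal_projective_resolution A (simple_module v) (PS v) (\<epsilon>S v) (DS v)"
    and inj_simple: "\<And>v. v \<in> verts Q \<Longrightarrow>
      minimal_injective_coresolution A (simple_module v) (IS v) (\<eta>S v) (\<delta>S v)"
    and proj_top: "minimal_projective_resolution A (top_module A) PT \<epsilon>T DT"
    and inj_top: "minimal_injective_coresolution A (top_module A) IT \<eta>T \<delta>T"
  shows "(gl_dim TYPE('u) A < \<infinity>
            \<longleftrightarrow> (SUP v\<in>verts Q. profile_degree A d a (PS v)) < \<infinity>)
       \<and> (gl_dim TYPE('u) A < \<infinity>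
            \<longleftrightarrow> embedded_total_profile Q I d a C \<sigma> PT \<in> carrier (UP (coefficient_ring Q I d a C \<sigma>)))
       \<and> (gl_dim TYPE('u) A < \<infinity>
            \<longleftrightarrow> (SUP v\<in>verts Q. profile_degree A d a (IS v)) < \<infinity>)
       \<and> (gl_dim TYPE('u) A < \<infinity>
            \<longleftrightarrow> embedded_total_profile Q I d a C \<sigma> IT \<in> carrier (UP (coefficient_ring Q I d a C \<sigma>)))"
proof -
  interpret bq: bound_quiver Q I by (rule bound_quiver.intro[OF quiver admissible])
  obtain m where m: "split_algebra A (verts Q) (vertex_idem Q I) bq.ch bq.radJ m"
    using bq.split_algebra_ex unfolding A by blast
  interpret S: split_algebra A "verts Q" "vertex_idem Q I" bq.ch bq.radJ m by (rule m)
  obtain j :: "complex \<Rightarrow> 'u" where "inj j" using universe by blast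
  from S.enough_modules[OF this basis] have en: "enough_modules TYPE('u) A" .
  let ?S = "simple_module :: 'v \<Rightarrow> (('v, 'e) bq_elt, complex) module"
  have simple: "?S v = S.simple v" for v :: 'v
    by (simp add: simple_module_def S.simple_def bq.ch_def)
  \<comment> \<open>The simple module at \<open>v\<close> maps onto the line through
    \<open>c\<close>, with 1 going to \<open>c\<close>.\<close>
  have gen: "\<exists>v\<in>verts Q. \<exists>f\<in>lmod_hom A (?S v) X. \<exists>t\<in>carrier (?S v). f t = c"
    if "left_module A X" "v \<in> verts Q" "c \<in> carrier X"
      "\<And>j. j \<in> bq.radJ \<Longrightarrow> j \<odot>\<^bsub>X\<^esub> c = \<zero>\<^bsub>X\<^esub>" "vertex_idem Q I v \<odot>\<^bsub>X\<^esub> c = c"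
    for X :: "(('v, 'e) bq_elt, 'u) module" and v c
  proof (intro bexI)
    show "S.sc 1 \<odot>\<^bsub>X\<^esub> c = c" using left_module.smult_one[OF that(1,3)] by simp
    show "(\<lambda>z. S.sc z \<odot>\<^bsub>X\<^esub> c) \<in> lmod_hom A (?S v) X"
      unfolding simple by (rule S.hom_from_simple[OF that(1,2,3,4,5)])
    show "v \<in> verts Q" by (rule that(2))
  qed (simp add: simple)
  have simpleM: "left_module A (?S v)" if "v \<in> verts Q" for v
    unfolding simple by (rule S.left_module_simple[OF that])
  have Jsimple: "j \<odot>\<^bsub>?S v\<^esub> t = \<zero>\<^bsub>?S v\<^esub>" if "v \<in> verts Q" "j \<in> bq.radJ" for v j t
    unfolding simple by (rule S.J_simple[OF that])
  have sep: "\<exists>v\<in>verts Q. \<exists>f\<in>lmod_hom A X (?S v). f x \<noteq> \<zero>\<^bsub>?S v\<^esub>"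
    if "left_module A X" "\<And>j y. j \<in> bq.radJ \<Longrightarrow> y \<in> carrier X \<Longrightarrow> j \<odot>\<^bsub>X\<^esub> y = \<zero>\<^bsub>X\<^esub>" "x \<in> carrier X" "x \<noteq> \<zero>\<^bsub>X\<^esub>"
    for X :: "(('v, 'e) bq_elt, 'u) module" and x
    unfolding simple by (rule S.simple_separates[OF that])
  note simples = S.gl_dim_finite_iff[where Ind = "verts Q" and T = ?S,
      OF en simpleM Jsimple gen sep proj_simple inj_simple]
  have tgen: "\<exists>i\<in>{()}. \<exists>f\<in>lmod_hom A (top_module A) X. \<exists>t\<in>carrier (top_module A). f t = c"
    if "left_module A X" "v \<in> verts Q" "c \<in> carrier X"
      "\<And>j. j \<in> bq.radJ \<Longrightarrow> j \<odot>\<^bsub>X\<^esub> c = \<zero>\<^bsub>X\<^esub>" "vertex_idem Q I v \<odot>\<^bsub>X\<^esub> c = c"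
    for X :: "(('v, 'e) bq_elt, 'u) module" and v c
    using S.top_hom[OF that(1,3,4)] by simp
  have tsep: "\<exists>i\<in>{()}. \<exists>f\<in>lmod_hom A X (top_module A). f x \<noteq> \<zero>\<^bsub>top_module A\<^esub>"
    if "left_module A X" "\<And>j y. j \<in> bq.radJ \<Longrightarrow> y \<in> carrier X \<Longrightarrow> j \<odot>\<^bsub>X\<^esub> y = \<zero>\<^bsub>X\<^esub>" "x \<in> carrier X" "x \<noteq> \<zero>\<^bsub>X\<^esub>"
    for X :: "(('v, 'e) bq_elt, 'u) module" and x
    using S.top_separates[OF that] by simp
  \<comment> \<open>A family with one member; the final unfolding removes the quantifiers over its
    index.\<close>
  note top = S.gl_dim_finite_iff[where Ind = "{()}" and T = "\<lambda>_. top_module A" and P = "\<lambda>_. PT" and E = "\<lambda>_. IT",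
      OF en S.left_module_top S.J_top tgen tsep proj_top inj_top, unfolded ball_simps simp_thms]
  have PS: "finite_dim_module A (PS v n)" and IS: "finite_dim_module A (IS v n)" if "v \<in> verts Q" for v n
    using proj_simple[OF that] inj_simple[OF that]
    unfolding minimal_projective_resolution_def minimal_injective_coresolution_def by blast+
  have PT: "finite_dim_module A (PT n)" and IT: "finite_dim_module A (IT n)" for n
    using proj_top inj_top unfolding minimal_projective_resolution_def minimal_injective_coresolution_def by blast+
  have "projective_resolution A (top_module A) PT \<epsilon>T DT"
    using proj_top unfolding minimal_projective_resolution_def by (rule conjunct1)
  then have "projective_module A (PT n)" for n unfolding projective_resolution_def by blast
  then have PT': "projective_module A (PT n) \<or> injective_module A (PT n)" for n by (rule disjI1)
  have "injective_coresolution A (top_module A) IT \<eta>T \<delta>T"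
    using inj_top unfolding minimal_injective_coresolution_def by (rule conjunct1)
  then have "injective_module A (IT n)" for n unfolding injective_coresolution_def by blast
  then have IT': "projective_module A (IT n) \<or> injective_module A (IT n)" for n by (rule disjI2)
  note alg = S.complex_algebra_axioms
  note emb = embedded_total_profile_polynomial_iff[OF alg[unfolded A] basis[unfolded A] embedding _ _ bq.Pi_N_zero, folded A]
  have degP: "(SUP v\<in>verts Q. profile_degree A d a (PS v)) < \<infinity> \<longleftrightarrow>
      (\<exists>N. \<forall>v\<in>verts Q. \<forall>k>N. carrier (PS v k) = {\<zero>\<^bsub>PS v k\<^esub>})"
    by (rule S.profile_degrees_finite_iff[OF PS basis])
  have degI: "(SUP v\<in>verts Q. profile_degree A d a (IS v)) < \<infinity> \<longleftrightarrow>
      (\<exists>N. \<forall>v\<in>verts Q. \<forall>k>N. carrier (IS v k) = {\<zero>\<^bsub>IS v k\<^esub>})"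
    by (rule S.profile_degrees_finite_iff[OF IS basis])
  show ?thesis
    unfolding degP degI emb[OF PT PT'] emb[OF IT IT']
    by (intro conjI simples top)
qed

end
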